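(* Let $n\ge2$ and suppose that the nontrivial monomial polyhedron $\mathcal U_B\subset\mathbb C^n$ satisfies the condition $m=1$. Let $p_*=\max_j\frac{2\,\mathbf 1a_j}{\mathbf 1a_j+1}$ and let $q_*$ be the Hölder conjugate of $p_*$. Then both operators $P^+_{\mathcal U_B}$ and $P_{\mathcal U_B}$ are (with respect to Lebesgue measure on $\mathcal U_B$) (1) of restricted type $(p_*,p_* )$; (2) of strong type $(p,p)$ for each $p_*<p<q_*$; (3) of weak type $(q_*,q_* )$.
   Context: Monomial polyhedron: for an integer matrix $B\in\mathbb Z^{n\times n}$ with entry $b^j_k$ in row $j$, column $k$, set $\mathcal U_B=\{z\in\mathbb C^n:\ \prod_{k=1}^n|z_k|^{b^j_k}<1\text{ for }1\le j\le n\}$ (a point is in the set only if all the powers are defined; $0^0=1$). It is called a monomial polyhedron if it is a bounded domain (connected open set) in $\mathbb C^n$, $n\ge2$. It is nontrivial if it is not the unit polydisc $\mathbb D^n$. The rows of $B$ are ordered so that $\det B>0$ (permuting rows does not change $\mathcal U_B$). Associated quantities: let $\Delta=\operatorname{adj}B=(\det B)B^{-1}$ (an integer matrix with nonnegative entries and nonzero determinant), with columns $\delta_1,\dots,\delta_n$. Let $a_j=\delta_j/\gcd(\delta_j)$, where $\gcd(\delta_j)$ is the gcd of the entries of $\delta_j$. Let $\mathbf 1=(1,\dots,1)\in\mathbb Z^{1\times n}$, so $\mathbf 1a_j$ is the sum of the entries of $a_j$. Define $m=\#\{j:\mathbf 1a_j=\max_{k}\mathbf 1a_k\}$. Bergman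 operators: for a domain $\Omega\subset\mathbb C^n$, $K_\Omega$ is the Bergman kernel (the reproducing kernel of the space of square-integrable holomorphic functions on $\Omega$), $P_\Omega f(z)=\int_\Omega K_\Omega(z,\zeta)f(\zeta)\,dV(\zeta)$ is the Bergman projection, and $P^+_\Omega f(z)=\int_\Omega|K_\Omega(z,\zeta)|f(\zeta)\,dV(\zeta)$ is the positive Bergman operator, whenever the integrals converge ($dV$ is Lebesgue measure). Types: a linear operator $T$ is of restricted type $(p,p)$ if there is $C>0$ with $\|T(1_E)\|_{L^p}\le C\|1_E\|_{L^p}$ for all measurable $E$ of finite measure; of strong type $(p,p)$ if it is bounded on $L^p$; of weak type $(p,p)$ if there is $C>0$ with $|\{|Tf|>y\}|\le (C\|f\|_{L^p}/y)^p$ for all $f\in L^p$ and $y>0$. *)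

theory Defs
  imports "HOL-Analysis.Analysis"
begin

section \<open>Monomial polyhedra\<close>

text \<open>An integer matrix \<open>B\<close> of type \<^typ>\<open>int^'n^'n\<close> has entry \<open>B $ j $ k\<close> in row \<open>j\<close> and
  column \<open>k\<close>. Since \<open>0 powi (-1) = 0\<close> in HOL, the requirement that all powers be defined is
  a separate conjunct; \<open>0 powi 0 = 1\<close> agrees with the convention for monomials.\<close>

definition monomial_set :: "int^'n^'n \<Rightarrow> (complex^'n) set" where
  "monomial_set B = {z. \<forall>j. (\<forall>k. z $ k = 0 \<longrightarrow> 0 \<le> B $ j $ k) \<and>
                            (\<Prod>k\<in>UNIV. cmod (z $ k) powi (B $ j $ k)) < 1}"

definition is_monomial_polyhedron :: "int^'n^'n \<Rightarrow> bool" where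
  "is_monomial_polyhedron B \<longleftrightarrow> 2 \<le> CARD('n) \<and>
     open (monomial_set B) \<and> connected (monomial_set B) \<and> bounded (monomial_set B)"

definition unit_polydisc :: "(complex^'n) set" where
  "unit_polydisc = {z. \<forall>k. cmod (z $ k) < 1}"

text \<open>The entry in row \<open>k\<close> and column \<open>j\<close> of the adjugate is the cofactor of \<open>B\<close> at \<open>(j, k)\<close>,
  written here as the determinant of \<open>B\<close> with row \<open>j\<close> replaced by the \<open>k\<close>-th unit vector.\<close>

definition adjugate :: "'a::comm_ring_1^'n^'n \<Rightarrow> 'a^'n^'n" where
  "adjugate B = (\<chi> k j. det (\<chi> i. if i = j then axis k 1 else B $ i))"

lemma matrix_mult_adjugate:
  fixes B :: "'a::comm_ring_1^'n^'n"
  shows "B ** adjugate B = mat (det B)"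
proof -
  have "(\<Sum>k\<in>UNIV. B $ i $ k * det (\<chi> r. if r = j then axis k 1 else B $ r))
      = (if i = j then det B else 0)" for i j
  proof -
    have unit_sum: "(\<Sum>k\<in>UNIV. B $ i $ k *s axis k 1) = B $ i"
      by (rule basis_expansion)
    have "(\<Sum>k\<in>UNIV. B $ i $ k * det (\<chi> r. if r = j then axis k 1 else B $ r))
        = (\<Sum>k\<in>UNIV. det (\<chi> r. if r = j then B $ i $ k *s axis k 1 else B $ r))"
      by (simp add: det_row_mul)
    also have "\<dots> = det (\<chi> r. if r = j then (\<Sum>k\<in>UNIV. B $ i $ k *s axis k 1) else B $ r)"
      by (simp add: det_linear_row_sum)
    also have "\<dots> = det (\<chi> r. if r = j then B $ i else B $ r)"
      by (simp only: unit_sum)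
    also have "\<dots> = (if i = j then det B else 0)"
    proof (cases "i = j")
      case True
      then have "(\<chi> r. if r = j then B $ i else B $ r) = B"
        by (simp add: vec_eq_iff)
      then show ?thesis using True by simp
    next
      case False
      have "det (\<chi> r. if r = j then B $ i else B $ r) = 0"
        by (rule det_identical_rows[OF False]) (use False in \<open>simp add: row_def vec_eq_iff\<close>)
      then show ?thesis using False by simp
    qed
    finally show ?thesis .
  qed
  then show ?thesis
    by (simp add: adjugate_def matrix_matrix_mult_def mat_def vec_eq_iff)
qed

text \<open>The primitive column vector \<open>a\<^sub>j\<close> and its coordinate sum.\<close>

definition primitive_column :: "int^'n^'n \<Rightarrow> 'n \<Rightarrow> int^'n" where
  "primitive_column B j =
     (let \<delta> = column j (adjugate B) in (\<chi> i. \<delta> $ i div Gcd (range (\<lambda>k. \<delta> $ k))))"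

definition primitive_column_sum :: "int^'n^'n \<Rightarrow> 'n \<Rightarrow> int" where
  "primitive_column_sum B j = (\<Sum>i\<in>UNIV. primitive_column B j $ i)"

definition max_multiplicity :: "int^'n^'n \<Rightarrow> nat" where
  "max_multiplicity B =
     card {j. primitive_column_sum B j = Max (range (primitive_column_sum B))}"

definition p_star :: "int^'n^'n \<Rightarrow> real" where
  "p_star B = Max (range (\<lambda>j. 2 * real_of_int (primitive_column_sum B j) /
                              (real_of_int (primitive_column_sum B j) + 1)))"

definition hoelder_conjugate :: "real \<Rightarrow> real" where
  "hoelder_conjugate p = p / (p - 1)"

definition q_star :: "int^'n^'n \<Rightarrow> real" where
  "q_star B = hoelder_conjugate (p_star B)"

section \<open>\<open>L\<^sup>p\<close> spaces and types of operators\<close>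

definition Lp_space :: "'a measure \<Rightarrow> real \<Rightarrow> ('a \<Rightarrow> complex) set" where
  "Lp_space M p = {f \<in> borel_measurable M. integrable M (\<lambda>x. cmod (f x) powr p)}"

definition Lp_norm :: "'a measure \<Rightarrow> real \<Rightarrow> ('a \<Rightarrow> complex) \<Rightarrow> real" where
  "Lp_norm M p f = (\<integral>x. cmod (f x) powr p \<partial>M) powr (1 / p)"

text \<open>An operator given by an integral need not be defined everywhere: \<open>T f x = None\<close> means that
  the integral defining \<open>T f\<close> does not converge at the point \<open>x\<close>. The boundedness
  properties below include that \<open>T f\<close> is defined almost everywhere.\<close>

type_synonym 'a partial_operator = "('a \<Rightarrow> complex) \<Rightarrow> 'a \<Rightarrow> complex option"

definition kernel_operator :: "'a measure \<Rightarrow> ('a \<Rightarrow> 'a \<Rightarrow> complex) \<Rightarrow> 'a partial_operator" where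
  "kernel_operator M k f x =
     (if integrable M (\<lambda>y. k x y * f y) then Some (\<integral>y. k x y * f y \<partial>M) else None)"

definition restricted_type :: "'a measure \<Rightarrow> 'a partial_operator \<Rightarrow> real \<Rightarrow> bool" where
  "restricted_type M T p \<longleftrightarrow>
     (\<exists>C>0. \<forall>E\<in>sets M. emeasure M E < \<infinity> \<longrightarrow>
        (AE x in M. T (indicator E) x \<noteq> None) \<and>
        (\<lambda>x. the (T (indicator E) x)) \<in> Lp_space M p \<and>
        Lp_norm M p (\<lambda>x. the (T (indicator E) x)) \<le> C * Lp_norm M p (indicator E))"

definition strong_type :: "'a measure \<Rightarrow> 'a partial_operator \<Rightarrow> real \<Rightarrow> bool" where
  "strong_type M T p \<longleftrightarrow>
     (\<exists>C>0. \<forall>f\<in>Lp_space M p.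
        (AE x in M. T f x \<noteq> None) \<and>
        (\<lambda>x. the (T f x)) \<in> Lp_space M p \<and>
        Lp_norm M p (\<lambda>x. the (T f x)) \<le> C * Lp_norm M p f)"

definition weak_type :: "'a measure \<Rightarrow> 'a partial_operator \<Rightarrow> real \<Rightarrow> bool" where
  "weak_type M T p \<longleftrightarrow>
     (\<exists>C>0. \<forall>f\<in>Lp_space M p.
        (AE x in M. T f x \<noteq> None) \<and>
        (\<lambda>x. the (T f x)) \<in> borel_measurable M \<and>
        (\<forall>y>0. emeasure M {x\<in>space M. cmod (the (T f x)) > y}
                 \<le> ennreal ((C * Lp_norm M p f / y) powr p)))"

section \<open>Bergman operators\<close>

definition holomorphic_several :: "(complex^'n \<Rightarrow> complex) \<Rightarrow> (complex^'n) set \<Rightarrow> bool" where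
  "holomorphic_several f \<Omega> \<longleftrightarrow>
     (\<forall>z\<in>\<Omega>. \<exists>D. (f has_derivative D) (at z) \<and> (\<forall>c v. D (c *s v) = c * D v))"

definition bergman_space :: "(complex^'n) set \<Rightarrow> (complex^'n \<Rightarrow> complex) set" where
  "bergman_space \<Omega> = {f \<in> Lp_space (lebesgue_on \<Omega>) 2. holomorphic_several f \<Omega>}"

text \<open>The reproducing property determines \<open>K\<close> on \<open>\<Omega> \<times> \<Omega>\<close>; the value \<open>0\<close> elsewhere makes
  it unique as a total function.\<close>

definition is_bergman_kernel ::
    "(complex^'n) set \<Rightarrow> (complex^'n \<Rightarrow> complex^'n \<Rightarrow> complex) \<Rightarrow> bool" where
  "is_bergman_kernel \<Omega> K \<longleftrightarrow>
     (\<forall>w\<in>\<Omega>. (\<lambda>z. K z w) \<in> bergman_space \<Omega>) \<and>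
     (\<forall>f\<in>bergman_space \<Omega>. \<forall>w\<in>\<Omega>. f w = (\<integral>z. f z * cnj (K z w) \<partial>lebesgue_on \<Omega>)) \<and>
     (\<forall>z w. (z, w) \<notin> \<Omega> \<times> \<Omega> \<longrightarrow> K z w = 0)"

definition bergman_kernel ::
    "(complex^'n) set \<Rightarrow> complex^'n \<Rightarrow> complex^'n \<Rightarrow> complex" where
  "bergman_kernel \<Omega> = (THE K. is_bergman_kernel \<Omega> K)"

definition bergman_projection :: "(complex^'n) set \<Rightarrow> (complex^'n) partial_operator" where
  "bergman_projection \<Omega> = kernel_operator (lebesgue_on \<Omega>) (bergman_kernel \<Omega>)"

definition positive_bergman :: "(complex^'n) set \<Rightarrow> (complex^'n) partial_operator" where
  "positive_bergman \<Omega> =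
     kernel_operator (lebesgue_on \<Omega>) (\<lambda>z \<zeta>. complex_of_real (cmod (bergman_kernel \<Omega> z \<zeta>)))"

end

theory Submission
  imports Defs "HOL-Complex_Analysis.Conformal_Mappings"
begin

text \<open>
  Let \<open>A\<close> be the nonnegative integer matrix whose columns are the primitive vectors \<open>a\<^sub>j\<close>, and put
  \<open>\<kappa>\<^sub>j = 1 a\<^sub>j\<close>. Since \<open>B A\<close> is a diagonal matrix with positive entries \<open>e\<^sub>j\<close>, the monomial map
  \<open>\<Phi>(x)\<^sub>k = \<Prod>\<^sub>j x\<^sub>j^A\<^sub>k\<^sub>j\<close> sends a point with nonzero coordinates into the polyhedron exactly when
  the point lies in the unit polydisc, and every point with nonzero coordinates has a preimage. So
  operators on the polyhedron can be studied on the polydisc, where Lebesgue measure of the polyhedron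
  becomes, up to a constant, the product of the weighted measures \<open>|x\<^sub>j|^(2\<kappa>\<^sub>j - 2) dV\<close> (the squared modulus
  of the Jacobian \<open>J(x) = \<Prod>\<^sub>j x\<^sub>j^(\<kappa>\<^sub>j - 1)\<close>, up to a constant). This is \<open>pushforward\<close>; it follows from the
  uniqueness of the Haar measure of the multiplicative group, as \<open>\<Phi>\<close> is a homomorphism.

  If \<open>f\<close> is square integrable and holomorphic on the polyhedron, then \<open>(f \<circ> \<Phi>) J\<close> is square integrable
  on the polydisc and holomorphic in each variable off the coordinate hyperplanes, so it is reproduced
  by the polydisc kernel \<open>\<Prod>\<^sub>j 1 / (1 - x\<^sub>j cnj y\<^sub>j)\<^sup>2\<close>. Sort the power series of this kernel by the residues of the
  exponents modulo the \<open>e\<^sub>j\<close>. The residue classes that are not exponents of monomials on the polyhedron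
  integrate to zero against \<open>(f \<circ> \<Phi>) J\<close>, because \<open>\<Phi>\<close> is invariant under the finite group of rotations
  in its kernel (\<open>off_lattice_vanish\<close>); the remaining ones descend to the polyhedron. This gives a
  finite formula for the Bergman kernel (\<open>bergman_kernel_\<Omega>\<close>), and with it the bound
  \<open>|K(\<Phi>(x), \<Phi>(y))| \<le> C \<Prod>\<^sub>j |x\<^sub>j|^(1 - \<kappa>\<^sub>j) |y\<^sub>j|^(1 - \<kappa>\<^sub>j) / |1 - (x\<^sub>j cnj y\<^sub>j)^e\<^sub>j|\<^sup>2\<close>.

  Both operators are therefore controlled by a tensor product of positive operators on weighted
  discs. A single factor is at most a constant times the sum of \<open>1 / |1 - (x cnj y)^e|\<^sup>2\<close>, which the Schur test
  shows to be bounded on \<open>L\<^sup>p\<close> for all \<open>1 < p < \<infinity>\<close>, and the rank-one kernel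
  \<open>|x|^(1 - \<kappa>) |y|^(1 - \<kappa>)\<close>. For the latter everything can be read off the function \<open>|x|^(1 - \<kappa>)\<close>, which
  lies in \<open>L\<^sup>s\<close> of the weighted disc exactly when \<open>(\<kappa> - 1) s < 2 \<kappa>\<close>, and in weak \<open>L\<^sup>s\<close> at the endpoint. Hence the
  factor is of strong type for \<open>2\<kappa> / (\<kappa> + 1) < p < 2\<kappa> / (\<kappa> - 1)\<close>, of restricted type at the left end and of weak
  type at the right end (\<open>model_kernel_strong\<close>, \<open>model_kernel_restricted\<close>, \<open>model_kernel_weak\<close>).

  These ranges shrink as \<open>\<kappa>\<close> grows. When \<open>m = 1\<close>, a single index attains the largest \<open>\<kappa>\<^sub>j\<close>, so at
  \<open>p\<^sub>*\<close> and \<open>q\<^sub>*\<close> all other factors are still of strong type. By Fubini's theorem the tensor product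
  of one operator of restricted (weak) type with operators of strong type is again of restricted
  (weak) type, which yields the endpoint statements.
\<close>

section \<open>Positive integral operators\<close>

text \<open>Real powers of extended nonnegative numbers, with \<open>\<infinity>\<close> going to \<open>\<infinity>\<close>: positive operators are studied with
  values in \<open>[0, \<infinity>]\<close>, so that no convergence has to be discussed before the estimates are proved.\<close>

definition epow :: "ennreal \<Rightarrow> real \<Rightarrow> ennreal" where
  "epow x p = (if x = \<infinity> then \<infinity> else ennreal (enn2real x powr p))"

lemma epow_zero [simp]: "epow 0 p = 0"
  by (simp add: epow_def)

lemma epow_top [simp]: "epow \<infinity> p = \<infinity>" "epow top p = \<infinity>"
  by (simp_all add: epow_def)

lemma epow_ennreal: "0 \<le> r \<Longrightarrow> epow (ennreal r) p = ennreal (r powr p)"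
  by (simp add: epow_def)

lemma epow_less_top: "x < \<infinity> \<Longrightarrow> epow x p < \<infinity>"
  by (simp add: epow_def)

lemma epow_mono: assumes "x \<le> y" "0 \<le> p" shows "epow x p \<le> epow y p"
proof (cases "y = \<infinity>")
  case False
  then have "x \<noteq> \<infinity>" "enn2real x \<le> enn2real y" using assms(1)
    by (auto simp: top.not_eq_extremum top.extremum_unique intro!: enn2real_mono)
  then show ?thesis using False assms(2) by (auto simp: epow_def intro!: ennreal_leI powr_mono2)
qed simp

lemma epow_mult: "epow (x * y) p = epow x p * epow y p"
proof (cases "x = 0 \<or> y = 0")
  case False
  then show ?thesis
    by (cases x; cases y)
       (auto simp: epow_def ennreal_mult_top ennreal_top_mult powr_mult
         simp flip: ennreal_mult split: if_splits)
qed auto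

lemma measurable_epow [measurable]: "(\<lambda>x. epow x p) \<in> borel_measurable borel"
  unfolding epow_def by measurable

lemma epow_add_le: assumes "0 \<le> p"
  shows "epow (x + y) p \<le> ennreal (2 powr p) * (epow x p + epow y p)"
proof -
  define m where "m = max x y"
  have "x + y \<le> 2 * m" unfolding m_def mult_2 by (intro add_mono) auto
  then have "epow (x + y) p \<le> epow (ennreal 2 * m) p"
    using assms by (intro epow_mono) auto
  also have "\<dots> = ennreal (2 powr p) * epow m p"
    by (simp add: epow_mult epow_ennreal del: ennreal_numeral)
  also have "epow m p \<le> epow x p + epow y p"
    by (cases "x \<le> y") (auto simp: m_def max_def)
  finally show ?thesis by (simp add: mult_left_mono)
qed

text \<open>The graph of \<open>t \<mapsto> t powr p\<close> lies above its tangent at \<open>a\<close>. Integrated against a finite measure, with \<open>a\<close>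
  equal to the mean, this inequality turns into Jensen's.\<close>

lemma powr_tangent_le:
  fixes t a p :: real assumes "1 < p" "0 \<le> t" "0 < a"
  shows "p * a powr (p - 1) * t \<le> t powr p + (p - 1) * a powr p"
proof (cases "t = 0")
  case False
  then have t: "t > 0" using assms by simp
  define q where "q = p / (p - 1)"
  have q: "q > 0" using assms by (simp add: q_def)
  have pq: "1/p + 1/q = 1" using assms by (simp add: q_def field_simps)
  have q1: "q > 1" using assms by (simp add: q_def field_simps)
  have "t * a powr (p - 1) \<le> t powr p / p + (a powr (p - 1)) powr q / q"
    using Youngs_inequality[of p q t "a powr (p-1)"] assms q1 pq t by simp
  also have "(a powr (p - 1)) powr q = a powr p" using assms by (simp add: powr_powr q_def)
  finally have "p * (t * a powr (p - 1)) \<le> p * (t powr p / p + a powr p / q)"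
    using assms by (intro mult_left_mono) auto
  also have "\<dots> = t powr p + (p - 1) * a powr p" using assms by (simp add: q_def field_simps)
  finally show ?thesis by (simp add: mult_ac)
qed (use assms in auto)

lemma Jensen_epow:
  assumes p: "1 < p" and [measurable]: "f \<in> borel_measurable M"
    and fin: "emeasure M (space M) < \<infinity>"
  shows "epow (\<integral>\<^sup>+x. f x \<partial>M) p \<le> epow (emeasure M (space M)) (p - 1) * (\<integral>\<^sup>+x. epow (f x) p \<partial>M)"
proof (cases "emeasure M (space M) = 0")
  case True
  have "AE x in M. f x = 0"
    by (rule AE_I[of _ _ "space M"]) (use True in auto)
  then have "(\<integral>\<^sup>+x. f x \<partial>M) = 0"
    by (simp add: nn_integral_0_iff_AE)
  then show ?thesis by simp
next
  case False
  define m where "m = enn2real (emeasure M (space M))"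
  have m: "emeasure M (space M) = ennreal m" "m > 0" using fin False
    by (auto simp: m_def enn2real_positive_iff less_top zero_less_iff_neq_zero)
  have tang: "ennreal (p * a powr (p - 1)) * t \<le> epow t p + ennreal ((p - 1) * a powr p)"
    if "a > 0" for a t
  proof (cases t)
    case (real r)
    then show ?thesis using powr_tangent_le[OF p, of r a] p that
      by (simp add: epow_ennreal ennreal_leI flip: ennreal_mult ennreal_plus)
  qed simp
  have int_tang: "ennreal (p * a powr (p - 1)) * (\<integral>\<^sup>+x. f x \<partial>M) \<le> (\<integral>\<^sup>+x. epow (f x) p \<partial>M) + ennreal ((p - 1) * a powr p) * ennreal m"
    if "a > 0" for a
  proof -
    have "(\<integral>\<^sup>+x. ennreal (p * a powr (p - 1)) * f x \<partial>M) \<le> (\<integral>\<^sup>+x. epow (f x) p + ennreal ((p - 1) * a powr p) \<partial>M)"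
      by (intro nn_integral_mono tang that)
    then show ?thesis by (simp add: nn_integral_cmult nn_integral_add m)
  qed
  show ?thesis
  proof (cases "(\<integral>\<^sup>+x. epow (f x) p \<partial>M) = \<infinity>")
    case True
    have "0 < m powr (p-1)" using m by simp
    then show ?thesis using True m by (simp add: epow_ennreal ennreal_mult_top)
  next
    case False
    then obtain J where J: "(\<integral>\<^sup>+x. epow (f x) p \<partial>M) = ennreal J" "J \<ge> 0"
      by (cases "\<integral>\<^sup>+x. epow (f x) p \<partial>M") auto
    have "ennreal p * (\<integral>\<^sup>+x. f x \<partial>M) < \<infinity>"
    proof (rule le_less_trans)
      show "ennreal p * (\<integral>\<^sup>+x. f x \<partial>M) \<le> ennreal J + ennreal (p - 1) * ennreal m"
        using int_tang[of 1] J by simp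
    qed (simp add: ennreal_mult_less_top)
    then have "(\<integral>\<^sup>+x. f x \<partial>M) < \<infinity>"
      using p by (cases "\<integral>\<^sup>+x. f x \<partial>M") (auto simp: ennreal_mult_top)
    then obtain i where i: "(\<integral>\<^sup>+x. f x \<partial>M) = ennreal i" "i \<ge> 0"
      by (cases "\<integral>\<^sup>+x. f x \<partial>M") auto
    show ?thesis
    proof (cases "i = 0")
      case False
      \<comment> \<open>the mean of \<open>f\<close>, where the tangent inequality is sharp\<close>
      define a where "a = i / m"
      have a: "a > 0" "i = a * m" using False i m by (auto simp: a_def)
      have "p * a powr (p - 1) * i \<le> J + (p - 1) * a powr p * m"
        using int_tang[OF a(1)] p i J m by (simp flip: ennreal_mult ennreal_plus)
      also have "p * a powr (p - 1) * i = p * a powr p * m"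
        using a(1) by (simp add: a(2) powr_diff)
      finally have "a powr p * m \<le> J" by (simp add: algebra_simps)
      then have "m powr (p - 1) * (a powr p * m) \<le> m powr (p - 1) * J"
        by (intro mult_left_mono) auto
      also have "m powr (p - 1) * (a powr p * m) = i powr p"
        using a m by (simp add: powr_diff powr_mult)
      finally show ?thesis using m i J p
        by (simp add: epow_ennreal ennreal_leI flip: ennreal_mult)
    qed (use i in simp)
  qed
qed

text \<open>Hoelder's inequality in the form needed for the Schur test: apply Jensen's inequality to
  \<open>g / u\<close> on the measure with density \<open>k u\<close>, for an arbitrary positive weight \<open>u\<close>.\<close>

lemma Jensen_weighted:
  assumes p: "1 < p" and [measurable]: "g \<in> borel_measurable M" "k \<in> borel_measurable M" "u \<in> borel_measurable M"
    and u: "\<And>x. 0 < u x" and fin: "(\<integral>\<^sup>+x. k x * ennreal (u x) \<partial>M) < \<infinity>"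
  shows "epow (\<integral>\<^sup>+x. k x * g x \<partial>M) p \<le> epow (\<integral>\<^sup>+x. k x * ennreal (u x) \<partial>M) (p - 1) *
           (\<integral>\<^sup>+x. k x * (ennreal (u x powr (1 - p)) * epow (g x) p) \<partial>M)"
proof -
  let ?N = "density M (\<lambda>x. k x * ennreal (u x))"
  have mass: "emeasure ?N (space ?N) = (\<integral>\<^sup>+x. k x * ennreal (u x) \<partial>M)"
    by (simp add: emeasure_density cong: nn_integral_cong)
  have e1: "k x * ennreal (u x) * (ennreal (1 / u x) * g x) = k x * g x" for x
  proof -
    have "ennreal (u x) * ennreal (1 / u x) = 1" using u[of x] by (simp flip: ennreal_mult)
    then show ?thesis by (metis mult.assoc mult.right_neutral)
  qed
  have e2: "k x * ennreal (u x) * epow (ennreal (1 / u x) * g x) p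
      = k x * (ennreal (u x powr (1 - p)) * epow (g x) p)" for x
  proof -
    have "ennreal (u x) * ennreal ((1 / u x) powr p) = ennreal (u x powr (1 - p))"
      using u[of x] by (simp add: powr_diff powr_divide flip: ennreal_mult)
    then show ?thesis using u[of x] by (simp add: epow_mult epow_ennreal mult.assoc less_imp_le) (metis mult.assoc)
  qed
  have "epow (\<integral>\<^sup>+x. (ennreal (1 / u x) * g x) \<partial>?N) p
      \<le> epow (emeasure ?N (space ?N)) (p - 1) * (\<integral>\<^sup>+x. epow (ennreal (1 / u x) * g x) p \<partial>?N)"
    by (rule Jensen_epow[OF p]) (use fin in \<open>simp_all only: mass\<close>, measurable)
  then show ?thesis by (simp only: mass) (simp add: nn_integral_density e1 e2)
qed

definition pos_op :: "'a measure \<Rightarrow> ('a \<Rightarrow> 'a \<Rightarrow> ennreal) \<Rightarrow> ('a \<Rightarrow> ennreal) \<Rightarrow> 'a \<Rightarrow> ennreal" where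
  "pos_op M k g x = (\<integral>\<^sup>+y. k x y * g y \<partial>M)"

text \<open>The class \<open>G\<close> of admissible inputs makes strong and restricted type two instances of one notion, so that
  sums, transfer and tensor products need to be treated only once.\<close>

definition pos_bounded_on :: "('a \<Rightarrow> ennreal) set \<Rightarrow> 'a measure \<Rightarrow> ('a \<Rightarrow> 'a \<Rightarrow> ennreal) \<Rightarrow> real \<Rightarrow> bool" where
  "pos_bounded_on G M k p \<longleftrightarrow> (\<exists>C<\<infinity>. \<forall>g\<in>G \<inter> borel_measurable M.
      (\<integral>\<^sup>+x. epow (pos_op M k g x) p \<partial>M) \<le> C * (\<integral>\<^sup>+x. epow (g x) p \<partial>M))"

abbreviation pos_strong :: "'a measure \<Rightarrow> ('a \<Rightarrow> 'a \<Rightarrow> ennreal) \<Rightarrow> real \<Rightarrow> bool" where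
  "pos_strong \<equiv> pos_bounded_on UNIV"

abbreviation pos_restricted :: "'a measure \<Rightarrow> ('a \<Rightarrow> 'a \<Rightarrow> ennreal) \<Rightarrow> real \<Rightarrow> bool" where
  "pos_restricted \<equiv> pos_bounded_on (range indicator)"

definition pos_weak :: "'a measure \<Rightarrow> ('a \<Rightarrow> 'a \<Rightarrow> ennreal) \<Rightarrow> real \<Rightarrow> bool" where
  "pos_weak M k p \<longleftrightarrow> (\<exists>C<\<infinity>. \<forall>g\<in>borel_measurable M. \<forall>t>0.
      ennreal (t powr p) * emeasure M {x\<in>space M. ennreal t < pos_op M k g x} \<le> C * (\<integral>\<^sup>+x. epow (g x) p \<partial>M))"

lemma measurable_pos_op:
  assumes "sigma_finite_measure N" "case_prod k \<in> borel_measurable (M \<Otimes>\<^sub>M N)" "g \<in> borel_measurable N"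
  shows "(\<lambda>x. \<integral>\<^sup>+y. k x y * g y \<partial>N) \<in> borel_measurable M"
proof -
  interpret sigma_finite_measure N by fact
  note [measurable] = assms(2,3)
  show ?thesis by measurable
qed

text \<open>The test function is \<open>w powr (-1 / (p q))\<close> with \<open>1/p + 1/q = 1\<close>, written through its \<open>p\<close>-th and \<open>q\<close>-th powers: the first
  hypothesis controls the mass in the weighted Jensen inequality, and the second one controls the integral
  in the other variable after Fubini's theorem. By symmetry of the kernel both can be stated as
  integrals in the second variable.\<close>

lemma Schur_test:
  assumes p: "1 < p" and sf: "sigma_finite_measure M"
    and km [measurable]: "case_prod k \<in> borel_measurable (M \<Otimes>\<^sub>M M)"
    and sym: "\<And>x y. k x y = k y x"
    and wm [measurable]: "w \<in> borel_measurable M" and w: "\<And>x. 0 < w x"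
    and C: "0 \<le> C"
    and 1: "\<And>x. x \<in> space M \<Longrightarrow> (\<integral>\<^sup>+y. k x y * ennreal (w y powr - (1 / p)) \<partial>M) \<le> ennreal (C * w x powr - (1 / p))"
    and 2: "\<And>x. x \<in> space M \<Longrightarrow> (\<integral>\<^sup>+y. k x y * ennreal (w y powr - (1 - 1 / p)) \<partial>M) \<le> ennreal (C * w x powr - (1 - 1 / p))"
  shows "pos_strong M k p"
proof -
  interpret sigma_finite_measure M by fact
  interpret P: pair_sigma_finite M M by unfold_locales
  let ?b = "1 - 1 / p"
  have w0: "w x \<noteq> 0" for x using w[of x] by simp
  have main: "(\<integral>\<^sup>+x. epow (pos_op M k g x) p \<partial>M) \<le> ennreal (C powr (p - 1) * C) * (\<integral>\<^sup>+x. epow (g x) p \<partial>M)"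
    if g [measurable]: "g \<in> borel_measurable M" for g
  proof -
    have pw: "epow (pos_op M k g x) p \<le>
       (\<integral>\<^sup>+y. ennreal (C powr (p - 1) * w x powr - ?b) * (k x y * (ennreal (w y powr ?b) * epow (g y) p)) \<partial>M)"
      if x [measurable]: "x \<in> space M" for x
    proof -
      let ?I = "\<integral>\<^sup>+y. k x y * ennreal (w y powr - (1 / p)) \<partial>M"
      have km' [measurable]: "k x \<in> borel_measurable M"
        using measurable_Pair2[OF km x] by simp
      have "epow (pos_op M k g x) p \<le> epow ?I (p - 1) *
          (\<integral>\<^sup>+y. k x y * (ennreal ((w y powr - (1 / p)) powr (1 - p)) * epow (g y) p) \<partial>M)"
        unfolding pos_op_def
        by (rule Jensen_weighted[OF p]) (simp_all add: w0 le_less_trans[OF 1[OF x]])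
      also have "epow ?I (p - 1) \<le> epow (ennreal (C * w x powr - (1 / p))) (p - 1)"
        using p 1[OF x] by (intro epow_mono) auto
      also have "epow (ennreal (C * w x powr - (1 / p))) (p - 1) = ennreal (C powr (p - 1) * w x powr - ?b)"
      proof -
        have "- (1 / p) * (p - 1) = - ?b" using p by (simp add: field_simps)
        then show ?thesis using C w[of x] by (simp add: epow_ennreal powr_mult powr_powr)
      qed
      also have "(\<lambda>y. (w y powr - (1 / p)) powr (1 - p)) = (\<lambda>y. w y powr ?b)"
      proof -
        have "- (1 / p) * (1 - p) = ?b" using p by (simp add: field_simps)
        then show ?thesis by (simp add: powr_powr)
      qed
      finally show ?thesis
        by (subst nn_integral_cmult) (simp_all add: mult_right_mono)
    qed
    have "(\<integral>\<^sup>+x. epow (pos_op M k g x) p \<partial>M) \<le>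
       (\<integral>\<^sup>+x. (\<integral>\<^sup>+y. ennreal (C powr (p - 1) * w x powr - ?b) * (k x y * (ennreal (w y powr ?b) * epow (g y) p)) \<partial>M) \<partial>M)"
      by (rule nn_integral_mono) (rule pw)
    also have "\<dots> = (\<integral>\<^sup>+y. (\<integral>\<^sup>+x. ennreal (C powr (p - 1) * w x powr - ?b) * (k x y * (ennreal (w y powr ?b) * epow (g y) p)) \<partial>M) \<partial>M)"
      by (rule P.Fubini'[symmetric]) measurable
    also have "\<dots> = (\<integral>\<^sup>+y. ennreal (C powr (p - 1)) * (ennreal (w y powr ?b) * epow (g y) p) * (\<integral>\<^sup>+x. k y x * ennreal (w x powr - ?b) \<partial>M) \<partial>M)"
    proof (rule nn_integral_cong)
      fix y assume y: "y \<in> space M"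
      have km' [measurable]: "k y \<in> borel_measurable M"
        using measurable_Pair2[OF km y] by simp
      show "(\<integral>\<^sup>+x. ennreal (C powr (p - 1) * w x powr - ?b) * (k x y * (ennreal (w y powr ?b) * epow (g y) p)) \<partial>M) =
         ennreal (C powr (p - 1)) * (ennreal (w y powr ?b) * epow (g y) p) * (\<integral>\<^sup>+x. k y x * ennreal (w x powr - ?b) \<partial>M)"
        by (subst nn_integral_cmult[symmetric])
           (auto simp: sym[of _ y] ennreal_mult mult_ac intro!: nn_integral_cong)
    qed
    also have "\<dots> \<le> (\<integral>\<^sup>+y. ennreal (C powr (p - 1)) * (ennreal (w y powr ?b) * epow (g y) p) * ennreal (C * w y powr - ?b) \<partial>M)"
      by (intro nn_integral_mono mult_left_mono 2) auto
    also have "\<dots> = (\<integral>\<^sup>+y. ennreal (C powr (p - 1) * C) * epow (g y) p \<partial>M)"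
    proof (rule nn_integral_cong)
      fix y
      have "ennreal (w y powr ?b) * ennreal (w y powr - ?b) = 1"
        using w[of y] by (simp add: powr_minus flip: ennreal_mult powr_add)
      then show "ennreal (C powr (p - 1)) * (ennreal (w y powr ?b) * epow (g y) p) * ennreal (C * w y powr - ?b)
         = ennreal (C powr (p - 1) * C) * epow (g y) p"
        using C by (simp add: ennreal_mult mult_ac)
    qed
    finally show ?thesis by (simp add: nn_integral_cmult)
  qed
  show ?thesis unfolding pos_bounded_on_def
    by (rule exI[of _ "ennreal (C powr (p - 1) * C)"]) (auto intro: main)
qed

lemma pos_op_le_sum:
  assumes [measurable]: "case_prod k1 \<in> borel_measurable (M \<Otimes>\<^sub>M M)" "case_prod k2 \<in> borel_measurable (M \<Otimes>\<^sub>M M)"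
    and [measurable]: "g \<in> borel_measurable M" and x: "x \<in> space M"
    and dom: "\<And>y. y \<in> space M \<Longrightarrow> k x y \<le> C * (k1 x y + k2 x y)"
  shows "pos_op M k g x \<le> C * (pos_op M k1 g x + pos_op M k2 g x)"
proof -
  have [measurable]: "k1 x \<in> borel_measurable M" "k2 x \<in> borel_measurable M"
    using measurable_Pair2[OF assms(1) x] measurable_Pair2[OF assms(2) x] by simp_all
  have "pos_op M k g x \<le> (\<integral>\<^sup>+y. C * (k1 x y * g y + k2 x y * g y) \<partial>M)"
    unfolding pos_op_def
    by (intro nn_integral_mono) (metis dom distrib_right mult.assoc mult_right_mono zero_le)
  then show ?thesis by (simp add: pos_op_def nn_integral_cmult nn_integral_add)
qed

lemma pos_op_measurable [measurable]:
  assumes "sigma_finite_measure M" "case_prod k \<in> borel_measurable (M \<Otimes>\<^sub>M M)" "g \<in> borel_measurable M"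
  shows "pos_op M k g \<in> borel_measurable M"
  using measurable_pos_op[OF assms] by (simp add: pos_op_def[abs_def])

lemma pos_bounded_on_sum:
  assumes sf: "sigma_finite_measure M"
    and km: "case_prod k1 \<in> borel_measurable (M \<Otimes>\<^sub>M M)" "case_prod k2 \<in> borel_measurable (M \<Otimes>\<^sub>M M)"
    and dom: "\<And>x y. x \<in> space M \<Longrightarrow> y \<in> space M \<Longrightarrow> k x y \<le> C * (k1 x y + k2 x y)"
    and C: "C < \<infinity>" and p: "0 \<le> p"
    and 1: "pos_bounded_on G M k1 p" and 2: "pos_bounded_on G M k2 p"
  shows "pos_bounded_on G M k p"
proof -
  obtain C1 where C1: "C1 < \<infinity>" "\<And>g. g \<in> G \<Longrightarrow> g \<in> borel_measurable M \<Longrightarrow>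
      (\<integral>\<^sup>+x. epow (pos_op M k1 g x) p \<partial>M) \<le> C1 * (\<integral>\<^sup>+x. epow (g x) p \<partial>M)"
    using 1 by (auto simp: pos_bounded_on_def)
  obtain C2 where C2: "C2 < \<infinity>" "\<And>g. g \<in> G \<Longrightarrow> g \<in> borel_measurable M \<Longrightarrow>
      (\<integral>\<^sup>+x. epow (pos_op M k2 g x) p \<partial>M) \<le> C2 * (\<integral>\<^sup>+x. epow (g x) p \<partial>M)"
    using 2 by (auto simp: pos_bounded_on_def)
  let ?D = "epow C p * ennreal (2 powr p)"
  have "(\<integral>\<^sup>+x. epow (pos_op M k g x) p \<partial>M) \<le> ?D * (C1 + C2) * (\<integral>\<^sup>+x. epow (g x) p \<partial>M)"
    if gG: "g \<in> G" and g [measurable]: "g \<in> borel_measurable M" for g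
  proof -
    have [measurable]: "pos_op M k1 g \<in> borel_measurable M" "pos_op M k2 g \<in> borel_measurable M"
      by (intro pos_op_measurable sf km g)+
    have "(\<integral>\<^sup>+x. epow (pos_op M k g x) p \<partial>M) \<le>
        (\<integral>\<^sup>+x. ?D * (epow (pos_op M k1 g x) p + epow (pos_op M k2 g x) p) \<partial>M)"
    proof (rule nn_integral_mono)
      fix x assume x: "x \<in> space M"
      have "epow (pos_op M k g x) p \<le> epow (C * (pos_op M k1 g x + pos_op M k2 g x)) p"
        by (intro epow_mono pos_op_le_sum km g x dom p)
      also have "\<dots> \<le> ?D * (epow (pos_op M k1 g x) p + epow (pos_op M k2 g x) p)"
        by (simp add: epow_mult mult.assoc mult_left_mono epow_add_le p)
      finally show "epow (pos_op M k g x) p \<le> ?D * (epow (pos_op M k1 g x) p + epow (pos_op M k2 g x) p)" .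
    qed
    also have "\<dots> = ?D * ((\<integral>\<^sup>+x. epow (pos_op M k1 g x) p \<partial>M) + (\<integral>\<^sup>+x. epow (pos_op M k2 g x) p \<partial>M))"
      by (simp add: nn_integral_cmult nn_integral_add)
    also have "\<dots> \<le> ?D * (C1 * (\<integral>\<^sup>+x. epow (g x) p \<partial>M) + C2 * (\<integral>\<^sup>+x. epow (g x) p \<partial>M))"
      by (intro mult_left_mono add_mono C1 C2 gG g) auto
    finally show ?thesis by (simp add: distrib_right mult.assoc)
  qed
  moreover have "?D * (C1 + C2) < \<infinity>"
    using C C1(1) C2(1) epow_less_top[OF C, of p] by (simp add: ennreal_mult_less_top)
  ultimately show ?thesis unfolding pos_bounded_on_def by blast
qed

lemma pos_strong_imp_weak:
  assumes sf: "sigma_finite_measure M" and km: "case_prod k \<in> borel_measurable (M \<Otimes>\<^sub>M M)"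
    and p: "0 < p" and s: "pos_strong M k p"
  shows "pos_weak M k p"
proof -
  obtain C where C: "C < \<infinity>" "\<And>g. g \<in> borel_measurable M \<Longrightarrow>
      (\<integral>\<^sup>+x. epow (pos_op M k g x) p \<partial>M) \<le> C * (\<integral>\<^sup>+x. epow (g x) p \<partial>M)"
    using s by (auto simp: pos_bounded_on_def)
  have "ennreal (t powr p) * emeasure M {x\<in>space M. ennreal t < pos_op M k g x} \<le> C * (\<integral>\<^sup>+x. epow (g x) p \<partial>M)"
    if g [measurable]: "g \<in> borel_measurable M" and t: "t > 0" for g t
  proof -
    have [measurable]: "pos_op M k g \<in> borel_measurable M"
      by (intro pos_op_measurable sf km g)
    have "ennreal (t powr p) * emeasure M {x\<in>space M. ennreal t < pos_op M k g x}
        = (\<integral>\<^sup>+x. ennreal (t powr p) * indicator {x\<in>space M. ennreal t < pos_op M k g x} x \<partial>M)"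
      by (subst nn_integral_cmult_indicator) auto
    also have "\<dots> \<le> (\<integral>\<^sup>+x. epow (pos_op M k g x) p \<partial>M)"
    proof (rule nn_integral_mono)
      fix x
      show "ennreal (t powr p) * indicator {x\<in>space M. ennreal t < pos_op M k g x} x \<le> epow (pos_op M k g x) p"
        using epow_mono[of "ennreal t" "pos_op M k g x" p] t p
        by (auto simp: indicator_def epow_ennreal)
    qed
    also have "\<dots> \<le> C * (\<integral>\<^sup>+x. epow (g x) p \<partial>M)" by (rule C(2)[OF g])
    finally show ?thesis .
  qed
  then show ?thesis using C(1) unfolding pos_weak_def by blast
qed

text \<open>Weak type survives a sum because the level set at height \<open>t\<close> is covered by the two level sets at
  height \<open>t / (2 C)\<close>.\<close>

lemma pos_weak_sum:
  assumes sf: "sigma_finite_measure M"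
    and km: "case_prod k1 \<in> borel_measurable (M \<Otimes>\<^sub>M M)" "case_prod k2 \<in> borel_measurable (M \<Otimes>\<^sub>M M)"
    and dom: "\<And>x y. x \<in> space M \<Longrightarrow> y \<in> space M \<Longrightarrow> k x y \<le> ennreal C * (k1 x y + k2 x y)"
    and C: "0 < C" and p: "0 < p"
    and 1: "pos_weak M k1 p" and 2: "pos_weak M k2 p"
  shows "pos_weak M k p"
proof -
  obtain C1 where C1: "C1 < \<infinity>" "\<And>g t. g \<in> borel_measurable M \<Longrightarrow> t > 0 \<Longrightarrow>
      ennreal (t powr p) * emeasure M {x\<in>space M. ennreal t < pos_op M k1 g x} \<le> C1 * (\<integral>\<^sup>+x. epow (g x) p \<partial>M)"
    using 1 unfolding pos_weak_def by blast
  obtain C2 where C2: "C2 < \<infinity>" "\<And>g t. g \<in> borel_measurable M \<Longrightarrow> t > 0 \<Longrightarrow>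
      ennreal (t powr p) * emeasure M {x\<in>space M. ennreal t < pos_op M k2 g x} \<le> C2 * (\<integral>\<^sup>+x. epow (g x) p \<partial>M)"
    using 2 unfolding pos_weak_def by blast
  let ?D = "ennreal ((2 * C) powr p)"
  have "ennreal (t powr p) * emeasure M {x\<in>space M. ennreal t < pos_op M k g x} \<le> ?D * (C1 + C2) * (\<integral>\<^sup>+x. epow (g x) p \<partial>M)"
    if g [measurable]: "g \<in> borel_measurable M" and t: "t > 0" for g t
  proof -
    have [measurable]: "pos_op M k1 g \<in> borel_measurable M" "pos_op M k2 g \<in> borel_measurable M"
      by (intro pos_op_measurable sf km g)+
    define s where "s = t / (2 * C)"
    have s: "s > 0" "t = 2 * C * s" using t C by (auto simp: s_def)
    let ?S = "\<lambda>k. {x\<in>space M. ennreal s < pos_op M k g x}"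
    have sub: "{x\<in>space M. ennreal t < pos_op M k g x} \<subseteq> ?S k1 \<union> ?S k2"
    proof safe
      fix x assume x: "x \<in> space M" and lt: "ennreal t < pos_op M k g x" and n2: "\<not> ennreal s < pos_op M k2 g x"
      show "ennreal s < pos_op M k1 g x"
      proof (rule ccontr)
        assume n1: "\<not> ennreal s < pos_op M k1 g x"
        have "pos_op M k g x \<le> ennreal C * (pos_op M k1 g x + pos_op M k2 g x)"
          by (intro pos_op_le_sum km g x dom)
        also have "\<dots> \<le> ennreal C * (ennreal s + ennreal s)"
          using n1 n2 by (intro mult_left_mono add_mono) auto
        also have "\<dots> = ennreal t" using s C by (simp add: mult.assoc flip: ennreal_plus ennreal_mult)
        finally show False using lt by simp
      qed
    qed
    have "emeasure M {x\<in>space M. ennreal t < pos_op M k g x} \<le> emeasure M (?S k1 \<union> ?S k2)"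
      by (rule emeasure_mono[OF sub]) measurable
    also have "\<dots> \<le> emeasure M (?S k1) + emeasure M (?S k2)"
      by (rule emeasure_subadditive) measurable
    finally have "ennreal (t powr p) * emeasure M {x\<in>space M. ennreal t < pos_op M k g x}
       \<le> ennreal (t powr p) * (emeasure M (?S k1) + emeasure M (?S k2))" by (simp add: mult_left_mono)
    also have "\<dots> = ?D * (ennreal (s powr p) * emeasure M (?S k1) + ennreal (s powr p) * emeasure M (?S k2))"
      using s C by (simp add: s(2) powr_mult ennreal_mult distrib_left mult.assoc)
    also have "\<dots> \<le> ?D * (C1 * (\<integral>\<^sup>+x. epow (g x) p \<partial>M) + C2 * (\<integral>\<^sup>+x. epow (g x) p \<partial>M))"
      by (intro mult_left_mono add_mono C1 C2 s g) auto
    finally show ?thesis by (simp add: distrib_right mult.assoc)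
  qed
  moreover have "?D * (C1 + C2) < \<infinity>"
    using C1(1) C2(1) by (simp add: ennreal_mult_less_top)
  ultimately show ?thesis unfolding pos_weak_def by blast
qed

section \<open>Transfer along a change of variables\<close>

text \<open>Here \<open>T\<close> carries a multiple of \<open>M\<close> to \<open>N\<close>, and the kernel on \<open>N\<close> pulls back to one dominated by the kernel on \<open>M\<close>.
  All estimates on \<open>M\<close> are then inherited by \<open>N\<close>.\<close>

lemma pos_op_transfer:
  assumes T [measurable]: "T \<in> M \<rightarrow>\<^sub>M N"
    and int: "\<And>f. f \<in> borel_measurable N \<Longrightarrow> (\<integral>\<^sup>+x. f x \<partial>N) = ennreal c * (\<integral>\<^sup>+x. f (T x) \<partial>M)"
    and dom: "AE x in M. AE y in M. kN (T x) (T y) \<le> ennreal D * kM x y"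
    and kN [measurable]: "case_prod kN \<in> borel_measurable (N \<Otimes>\<^sub>M N)"
    and kM: "case_prod kM \<in> borel_measurable (M \<Otimes>\<^sub>M M)"
    and g [measurable]: "g \<in> borel_measurable N"
  shows "AE x in M. pos_op N kN g (T x) \<le> ennreal c * ennreal D * pos_op M kM (\<lambda>x. g (T x)) x"
  using dom AE_space
proof eventually_elim
  fix x assume x: "AE y in M. kN (T x) (T y) \<le> ennreal D * kM x y" "x \<in> space M"
  have Tx: "T x \<in> space N" using measurable_space[OF T x(2)] .
  have [measurable]: "kN (T x) \<in> borel_measurable N" "kM x \<in> borel_measurable M"
    using measurable_Pair2[OF kN Tx] measurable_Pair2[OF kM x(2)] by simp_all
  have "pos_op N kN g (T x) = ennreal c * (\<integral>\<^sup>+y. kN (T x) (T y) * g (T y) \<partial>M)"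
    unfolding pos_op_def by (rule int) measurable
  also have "(\<integral>\<^sup>+y. kN (T x) (T y) * g (T y) \<partial>M) \<le> (\<integral>\<^sup>+y. ennreal D * (kM x y * g (T y)) \<partial>M)"
    by (rule nn_integral_mono_AE) (use x(1) in eventually_elim, simp add: mult.assoc[symmetric] mult_right_mono)
  also have "\<dots> = ennreal D * pos_op M kM (\<lambda>x. g (T x)) x"
    unfolding pos_op_def by (rule nn_integral_cmult) measurable
  finally show "pos_op N kN g (T x) \<le> ennreal c * ennreal D * pos_op M kM (\<lambda>x. g (T x)) x"
    by (simp add: mult.assoc mult_left_mono)
qed

lemma pos_bounded_on_transfer:
  assumes sfN: "sigma_finite_measure N" and sfM: "sigma_finite_measure M"
    and T [measurable]: "T \<in> M \<rightarrow>\<^sub>M N"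
    and int: "\<And>f. f \<in> borel_measurable N \<Longrightarrow> (\<integral>\<^sup>+x. f x \<partial>N) = ennreal c * (\<integral>\<^sup>+x. f (T x) \<partial>M)"
    and dom: "AE x in M. AE y in M. kN (T x) (T y) \<le> ennreal D * kM x y"
    and kN: "case_prod kN \<in> borel_measurable (N \<Otimes>\<^sub>M N)"
    and kM: "case_prod kM \<in> borel_measurable (M \<Otimes>\<^sub>M M)"
    and p: "0 \<le> p"
    and G: "\<And>g. g \<in> GN \<Longrightarrow> (\<lambda>x. g (T x)) \<in> GM"
    and b: "pos_bounded_on GM M kM p"
  shows "pos_bounded_on GN N kN p"
proof -
  obtain C where C: "C < \<infinity>" "\<And>g. g \<in> GM \<Longrightarrow> g \<in> borel_measurable M \<Longrightarrow>
      (\<integral>\<^sup>+x. epow (pos_op M kM g x) p \<partial>M) \<le> C * (\<integral>\<^sup>+x. epow (g x) p \<partial>M)"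
    using b by (auto simp: pos_bounded_on_def)
  let ?E = "epow (ennreal c * ennreal D) p"
  have "(\<integral>\<^sup>+x. epow (pos_op N kN g x) p \<partial>N) \<le> ?E * C * (\<integral>\<^sup>+x. epow (g x) p \<partial>N)"
    if gG: "g \<in> GN" and g [measurable]: "g \<in> borel_measurable N" for g
  proof -
    have [measurable]: "pos_op N kN g \<in> borel_measurable N"
      by (intro pos_op_measurable sfN kN g)
    have gT [measurable]: "(\<lambda>x. g (T x)) \<in> borel_measurable M" by measurable
    have [measurable]: "pos_op M kM (\<lambda>x. g (T x)) \<in> borel_measurable M"
      by (intro pos_op_measurable sfM kM gT)
    have tr: "AE x in M. pos_op N kN g (T x) \<le> ennreal c * ennreal D * pos_op M kM (\<lambda>x. g (T x)) x"
      by (rule pos_op_transfer[OF T _ dom kN kM g]) (rule int)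
    have "(\<integral>\<^sup>+x. epow (pos_op N kN g x) p \<partial>N) = ennreal c * (\<integral>\<^sup>+x. epow (pos_op N kN g (T x)) p \<partial>M)"
      by (rule int) measurable
    also have "(\<integral>\<^sup>+x. epow (pos_op N kN g (T x)) p \<partial>M) \<le> (\<integral>\<^sup>+x. ?E * epow (pos_op M kM (\<lambda>x. g (T x)) x) p \<partial>M)"
      by (rule nn_integral_mono_AE, use tr in eventually_elim)
         (use epow_mono[OF _ p] in \<open>fastforce simp flip: epow_mult\<close>)
    also have "\<dots> = ?E * (\<integral>\<^sup>+x. epow (pos_op M kM (\<lambda>x. g (T x)) x) p \<partial>M)"
      by (rule nn_integral_cmult) measurable
    also have "(\<integral>\<^sup>+x. epow (pos_op M kM (\<lambda>x. g (T x)) x) p \<partial>M) \<le> C * (\<integral>\<^sup>+x. epow (g (T x)) p \<partial>M)"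
      by (rule C(2)[OF G[OF gG] gT])
    also have "ennreal c * (?E * (C * (\<integral>\<^sup>+x. epow (g (T x)) p \<partial>M))) = ?E * C * (ennreal c * (\<integral>\<^sup>+x. epow (g (T x)) p \<partial>M))"
      by (simp add: mult_ac)
    also have "ennreal c * (\<integral>\<^sup>+x. epow (g (T x)) p \<partial>M) = (\<integral>\<^sup>+x. epow (g x) p \<partial>N)"
      by (rule int[symmetric]) measurable
    finally show ?thesis by (simp add: mult_left_mono)
  qed
  moreover have "?E * C < \<infinity>"
    using C(1) epow_less_top[of "ennreal c * ennreal D" p] by (simp add: ennreal_mult_less_top)
  ultimately show ?thesis unfolding pos_bounded_on_def by blast
qed

lemma pos_weak_transfer:
  assumes sfN: "sigma_finite_measure N" and sfM: "sigma_finite_measure M"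
    and T [measurable]: "T \<in> M \<rightarrow>\<^sub>M N"
    and int: "\<And>f. f \<in> borel_measurable N \<Longrightarrow> (\<integral>\<^sup>+x. f x \<partial>N) = ennreal c * (\<integral>\<^sup>+x. f (T x) \<partial>M)"
    and c: "0 < c" "0 < D"
    and dom: "AE x in M. AE y in M. kN (T x) (T y) \<le> ennreal D * kM x y"
    and kN: "case_prod kN \<in> borel_measurable (N \<Otimes>\<^sub>M N)"
    and kM: "case_prod kM \<in> borel_measurable (M \<Otimes>\<^sub>M M)"
    and p: "0 \<le> p"
    and b: "pos_weak M kM p"
  shows "pos_weak N kN p"
proof -
  obtain C where C: "C < \<infinity>" "\<And>g t. g \<in> borel_measurable M \<Longrightarrow> t > 0 \<Longrightarrow>
      ennreal (t powr p) * emeasure M {x\<in>space M. ennreal t < pos_op M kM g x} \<le> C * (\<integral>\<^sup>+x. epow (g x) p \<partial>M)"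
    using b unfolding pos_weak_def by blast
  let ?E = "ennreal ((c * D) powr p)"
  have "ennreal (t powr p) * emeasure N {x\<in>space N. ennreal t < pos_op N kN g x} \<le> ?E * C * (\<integral>\<^sup>+x. epow (g x) p \<partial>N)"
    if g [measurable]: "g \<in> borel_measurable N" and t: "t > 0" for g t
  proof -
    have [measurable]: "pos_op N kN g \<in> borel_measurable N"
      by (intro pos_op_measurable sfN kN g)
    have gT [measurable]: "(\<lambda>x. g (T x)) \<in> borel_measurable M" by measurable
    have [measurable]: "pos_op M kM (\<lambda>x. g (T x)) \<in> borel_measurable M"
      by (intro pos_op_measurable sfM kM gT)
    have tr: "AE x in M. pos_op N kN g (T x) \<le> ennreal c * ennreal D * pos_op M kM (\<lambda>x. g (T x)) x"
      by (rule pos_op_transfer[OF T _ dom kN kM g]) (rule int)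
    define s where "s = t / (c * D)"
    have s: "s > 0" "t = c * D * s" using t c by (auto simp: s_def)
    have "emeasure N {x\<in>space N. ennreal t < pos_op N kN g x} = (\<integral>\<^sup>+x. indicator {x\<in>space N. ennreal t < pos_op N kN g x} x \<partial>N)"
      by simp
    also have "\<dots> = ennreal c * (\<integral>\<^sup>+x. indicator {x\<in>space N. ennreal t < pos_op N kN g x} (T x) \<partial>M)"
      by (rule int) measurable
    also have "(\<integral>\<^sup>+x. indicator {x\<in>space N. ennreal t < pos_op N kN g x} (T x) \<partial>M)
       \<le> (\<integral>\<^sup>+x. indicator {x\<in>space M. ennreal s < pos_op M kM (\<lambda>x. g (T x)) x} x \<partial>M)"
    proof (rule nn_integral_mono_AE, use tr AE_space in eventually_elim)
      fix x assume x: "pos_op N kN g (T x) \<le> ennreal c * ennreal D * pos_op M kM (\<lambda>x. g (T x)) x" "x \<in> space M"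
      have "ennreal s < pos_op M kM (\<lambda>x. g (T x)) x" if lt: "ennreal t < pos_op N kN g (T x)"
      proof (rule ccontr)
        assume "\<not> ?thesis"
        then have "ennreal c * ennreal D * pos_op M kM (\<lambda>x. g (T x)) x \<le> ennreal c * ennreal D * ennreal s"
          by (intro mult_left_mono) auto
        also have "\<dots> = ennreal t" using s c by (simp flip: ennreal_mult)
        finally show False using lt x(1) by simp
      qed
      then show "indicator {x\<in>space N. ennreal t < pos_op N kN g x} (T x) \<le>
         (indicator {x\<in>space M. ennreal s < pos_op M kM (\<lambda>x. g (T x)) x} x :: ennreal)"
        using x(2) by (auto simp: indicator_def)
    qed
    also have "\<dots> = emeasure M {x\<in>space M. ennreal s < pos_op M kM (\<lambda>x. g (T x)) x}" (is "_ = ?m") by simp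
    finally have "ennreal (t powr p) * emeasure N {x\<in>space N. ennreal t < pos_op N kN g x} \<le> ennreal (t powr p) * (ennreal c * ?m)"
      by (simp add: mult_left_mono)
    also have "\<dots> = ?E * ennreal c * (ennreal (s powr p) * ?m)"
      using s c by (simp add: s(2) powr_mult ennreal_mult mult_ac)
    also have "\<dots> \<le> ?E * ennreal c * (C * (\<integral>\<^sup>+x. epow (g (T x)) p \<partial>M))"
      by (intro mult_left_mono C(2) gT s) auto
    also have "\<dots> = ?E * C * (ennreal c * (\<integral>\<^sup>+x. epow (g (T x)) p \<partial>M))"
      by (simp add: mult_ac)
    also have "ennreal c * (\<integral>\<^sup>+x. epow (g (T x)) p \<partial>M) = (\<integral>\<^sup>+x. epow (g x) p \<partial>N)"
      by (rule int[symmetric]) measurable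
    finally show ?thesis .
  qed
  moreover have "?E * C < \<infinity>"
    using C(1) by (simp add: ennreal_mult_less_top)
  ultimately show ?thesis unfolding pos_weak_def by blast
qed

section \<open>Tensor products of kernels\<close>

definition tensor_kernel :: "('a \<Rightarrow> 'a \<Rightarrow> ennreal) \<Rightarrow> ('b \<Rightarrow> 'b \<Rightarrow> ennreal) \<Rightarrow> 'a \<times> 'b \<Rightarrow> 'a \<times> 'b \<Rightarrow> ennreal" where
  "tensor_kernel k1 k2 x y = k1 (fst x) (fst y) * k2 (snd x) (snd y)"

context
  fixes M1 :: "'a measure" and M2 :: "'b measure"
    and k1 :: "'a \<Rightarrow> 'a \<Rightarrow> ennreal" and k2 :: "'b \<Rightarrow> 'b \<Rightarrow> ennreal"
  assumes sf1: "sigma_finite_measure M1" and sf2: "sigma_finite_measure M2"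
    and k1 [measurable]: "case_prod k1 \<in> borel_measurable (M1 \<Otimes>\<^sub>M M1)"
    and k2 [measurable]: "case_prod k2 \<in> borel_measurable (M2 \<Otimes>\<^sub>M M2)"
begin

interpretation M1: sigma_finite_measure M1 by (rule sf1)
interpretation M2: sigma_finite_measure M2 by (rule sf2)
interpretation P: pair_sigma_finite M1 M2 by unfold_locales
interpretation M12: sigma_finite_measure "M1 \<Otimes>\<^sub>M M2" by (rule P.sigma_finite_measure_axioms)

lemma measurable_tensor_kernel:
  "case_prod (tensor_kernel k1 k2) \<in> borel_measurable ((M1 \<Otimes>\<^sub>M M2) \<Otimes>\<^sub>M (M1 \<Otimes>\<^sub>M M2))"
  unfolding tensor_kernel_def by measurable

lemma pos_op_tensor:
  assumes g [measurable]: "g \<in> borel_measurable (M1 \<Otimes>\<^sub>M M2)" and x: "x1 \<in> space M1" "x2 \<in> space M2"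
  shows "pos_op (M1 \<Otimes>\<^sub>M M2) (tensor_kernel k1 k2) g (x1, x2)
           = pos_op M2 k2 (\<lambda>y2. pos_op M1 k1 (\<lambda>y1. g (y1, y2)) x1) x2"
    and "pos_op (M1 \<Otimes>\<^sub>M M2) (tensor_kernel k1 k2) g (x1, x2)
           = pos_op M1 k1 (\<lambda>y1. pos_op M2 k2 (\<lambda>y2. g (y1, y2)) x2) x1"
proof -
  have [measurable]: "k1 x1 \<in> borel_measurable M1" "k2 x2 \<in> borel_measurable M2"
    using measurable_Pair2[OF k1 x(1)] measurable_Pair2[OF k2 x(2)] by simp_all
  have "pos_op (M1 \<Otimes>\<^sub>M M2) (tensor_kernel k1 k2) g (x1, x2) = (\<integral>\<^sup>+y2. \<integral>\<^sup>+y1. k1 x1 y1 * k2 x2 y2 * g (y1, y2) \<partial>M1 \<partial>M2)"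
    unfolding pos_op_def tensor_kernel_def by (subst P.nn_integral_snd[symmetric]) auto
  also have "\<dots> = (\<integral>\<^sup>+y2. k2 x2 y2 * (\<integral>\<^sup>+y1. k1 x1 y1 * g (y1, y2) \<partial>M1) \<partial>M2)"
    by (intro nn_integral_cong, subst nn_integral_cmult[symmetric]) (auto simp: mult_ac)
  finally show "pos_op (M1 \<Otimes>\<^sub>M M2) (tensor_kernel k1 k2) g (x1, x2)
           = pos_op M2 k2 (\<lambda>y2. pos_op M1 k1 (\<lambda>y1. g (y1, y2)) x1) x2" by (simp add: pos_op_def)
  have "pos_op (M1 \<Otimes>\<^sub>M M2) (tensor_kernel k1 k2) g (x1, x2) = (\<integral>\<^sup>+y1. \<integral>\<^sup>+y2. k1 x1 y1 * k2 x2 y2 * g (y1, y2) \<partial>M2 \<partial>M1)"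
    unfolding pos_op_def tensor_kernel_def by (subst M2.nn_integral_fst[symmetric]) auto
  also have "\<dots> = (\<integral>\<^sup>+y1. k1 x1 y1 * (\<integral>\<^sup>+y2. k2 x2 y2 * g (y1, y2) \<partial>M2) \<partial>M1)"
    by (intro nn_integral_cong, subst nn_integral_cmult[symmetric]) (auto simp: mult_ac)
  finally show "pos_op (M1 \<Otimes>\<^sub>M M2) (tensor_kernel k1 k2) g (x1, x2)
           = pos_op M1 k1 (\<lambda>y1. pos_op M2 k2 (\<lambda>y2. g (y1, y2)) x2) x1" by (simp add: pos_op_def)
qed

lemma measurable_partial_op1:
  assumes g [measurable]: "g \<in> borel_measurable (M1 \<Otimes>\<^sub>M M2)"
  shows "(\<lambda>(x1, y2). pos_op M1 k1 (\<lambda>y1. g (y1, y2)) x1) \<in> borel_measurable (M1 \<Otimes>\<^sub>M M2)"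
  unfolding pos_op_def by measurable

lemma measurable_partial_op2:
  assumes g [measurable]: "g \<in> borel_measurable (M1 \<Otimes>\<^sub>M M2)"
  shows "(\<lambda>(y1, x2). pos_op M2 k2 (\<lambda>y2. g (y1, y2)) x2) \<in> borel_measurable (M1 \<Otimes>\<^sub>M M2)"
  unfolding pos_op_def by measurable

text \<open>Freeze the first variable and use the strong bound in the second one; then freeze the second
  variable. Only the inner operator is applied to slices of \<open>g\<close> itself, so only the first factor needs its bound on
  the restricted class, while the second one acts on an arbitrary nonnegative function.\<close>

lemma pos_bounded_on_tensor:
  assumes b1: "pos_bounded_on G1 M1 k1 p" and b2: "pos_strong M2 k2 p"
    and G: "\<And>g x2. g \<in> G \<Longrightarrow> (\<lambda>x1. g (x1, x2)) \<in> G1"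
  shows "pos_bounded_on G (M1 \<Otimes>\<^sub>M M2) (tensor_kernel k1 k2) p"
proof -
  obtain C1 where C1: "C1 < \<infinity>" "\<And>g. g \<in> G1 \<Longrightarrow> g \<in> borel_measurable M1 \<Longrightarrow>
      (\<integral>\<^sup>+x. epow (pos_op M1 k1 g x) p \<partial>M1) \<le> C1 * (\<integral>\<^sup>+x. epow (g x) p \<partial>M1)"
    using b1 by (auto simp: pos_bounded_on_def)
  obtain C2 where C2: "C2 < \<infinity>" "\<And>g. g \<in> borel_measurable M2 \<Longrightarrow>
      (\<integral>\<^sup>+x. epow (pos_op M2 k2 g x) p \<partial>M2) \<le> C2 * (\<integral>\<^sup>+x. epow (g x) p \<partial>M2)"
    using b2 by (auto simp: pos_bounded_on_def)
  let ?M = "M1 \<Otimes>\<^sub>M M2" and ?k = "tensor_kernel k1 k2"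
  have "(\<integral>\<^sup>+x. epow (pos_op ?M ?k g x) p \<partial>?M) \<le> C2 * C1 * (\<integral>\<^sup>+x. epow (g x) p \<partial>?M)"
    if gG: "g \<in> G" and g [measurable]: "g \<in> borel_measurable ?M" for g
  proof -
    have [measurable]: "pos_op ?M ?k g \<in> borel_measurable ?M"
      by (intro pos_op_measurable measurable_tensor_kernel g) unfold_locales
    note m1 [measurable] = measurable_partial_op1[OF g]
    have "(\<integral>\<^sup>+x. epow (pos_op ?M ?k g x) p \<partial>?M) = (\<integral>\<^sup>+x1. \<integral>\<^sup>+x2. epow (pos_op ?M ?k g (x1, x2)) p \<partial>M2 \<partial>M1)"
      by (subst M2.nn_integral_fst[symmetric]) auto
    also have "\<dots> = (\<integral>\<^sup>+x1. \<integral>\<^sup>+x2. epow (pos_op M2 k2 (\<lambda>y2. pos_op M1 k1 (\<lambda>y1. g (y1, y2)) x1) x2) p \<partial>M2 \<partial>M1)"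
      by (intro nn_integral_cong) (simp add: pos_op_tensor(1)[OF g])
    also have "\<dots> \<le> (\<integral>\<^sup>+x1. C2 * (\<integral>\<^sup>+y2. epow (pos_op M1 k1 (\<lambda>y1. g (y1, y2)) x1) p \<partial>M2) \<partial>M1)"
    proof (rule nn_integral_mono)
      fix x1 assume "x1 \<in> space M1"
      then have "(\<lambda>y2. pos_op M1 k1 (\<lambda>y1. g (y1, y2)) x1) \<in> borel_measurable M2"
        using measurable_Pair2[OF m1] by simp
      then show "(\<integral>\<^sup>+x2. epow (pos_op M2 k2 (\<lambda>y2. pos_op M1 k1 (\<lambda>y1. g (y1, y2)) x1) x2) p \<partial>M2)
          \<le> C2 * (\<integral>\<^sup>+y2. epow (pos_op M1 k1 (\<lambda>y1. g (y1, y2)) x1) p \<partial>M2)"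
        by (rule C2)
    qed
    also have "\<dots> = C2 * (\<integral>\<^sup>+x1. \<integral>\<^sup>+y2. epow (pos_op M1 k1 (\<lambda>y1. g (y1, y2)) x1) p \<partial>M2 \<partial>M1)"
      by (rule nn_integral_cmult) measurable
    also have "(\<integral>\<^sup>+x1. \<integral>\<^sup>+y2. epow (pos_op M1 k1 (\<lambda>y1. g (y1, y2)) x1) p \<partial>M2 \<partial>M1)
        = (\<integral>\<^sup>+y2. \<integral>\<^sup>+x1. epow (pos_op M1 k1 (\<lambda>y1. g (y1, y2)) x1) p \<partial>M1 \<partial>M2)"
      by (rule P.Fubini'[symmetric]) measurable
    also have "\<dots> \<le> (\<integral>\<^sup>+y2. C1 * (\<integral>\<^sup>+x1. epow (g (x1, y2)) p \<partial>M1) \<partial>M2)"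
      by (rule nn_integral_mono, rule C1(2)[OF G[OF gG]]) measurable
    also have "\<dots> = C1 * (\<integral>\<^sup>+y2. \<integral>\<^sup>+x1. epow (g (x1, y2)) p \<partial>M1 \<partial>M2)"
      by (rule nn_integral_cmult) measurable
    also have "(\<integral>\<^sup>+y2. \<integral>\<^sup>+x1. epow (g (x1, y2)) p \<partial>M1 \<partial>M2) = (\<integral>\<^sup>+x. epow (g x) p \<partial>?M)"
      by (subst P.nn_integral_snd[symmetric]) auto
    finally show ?thesis by (simp add: mult_left_mono mult.assoc)
  qed
  moreover have "C2 * C1 < \<infinity>" using C1(1) C2(1) by (simp add: ennreal_mult_less_top)
  ultimately show ?thesis unfolding pos_bounded_on_def by blast
qed

text \<open>Slice the level set by the second variable: for fixed \<open>x\<^sub>2\<close> the weak bound of the first factor applies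
  to the function obtained from \<open>g\<close> by the second operator, and the strong bound removes that operator.\<close>

lemma pos_weak_tensor:
  assumes b1: "pos_weak M1 k1 p" and b2: "pos_strong M2 k2 p"
  shows "pos_weak (M1 \<Otimes>\<^sub>M M2) (tensor_kernel k1 k2) p"
proof -
  obtain C1 where C1: "C1 < \<infinity>" "\<And>g t. g \<in> borel_measurable M1 \<Longrightarrow> t > 0 \<Longrightarrow>
      ennreal (t powr p) * emeasure M1 {x\<in>space M1. ennreal t < pos_op M1 k1 g x} \<le> C1 * (\<integral>\<^sup>+x. epow (g x) p \<partial>M1)"
    using b1 unfolding pos_weak_def by blast
  obtain C2 where C2: "C2 < \<infinity>" "\<And>g. g \<in> borel_measurable M2 \<Longrightarrow>
      (\<integral>\<^sup>+x. epow (pos_op M2 k2 g x) p \<partial>M2) \<le> C2 * (\<integral>\<^sup>+x. epow (g x) p \<partial>M2)"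
    using b2 by (auto simp: pos_bounded_on_def)
  let ?M = "M1 \<Otimes>\<^sub>M M2" and ?k = "tensor_kernel k1 k2"
  have "ennreal (t powr p) * emeasure ?M {x\<in>space ?M. ennreal t < pos_op ?M ?k g x} \<le> C1 * C2 * (\<integral>\<^sup>+x. epow (g x) p \<partial>?M)"
    if g [measurable]: "g \<in> borel_measurable ?M" and t: "t > 0" for g t
  proof -
    have pm [measurable]: "pos_op ?M ?k g \<in> borel_measurable ?M"
      by (intro pos_op_measurable measurable_tensor_kernel g) unfold_locales
    note m2 [measurable] = measurable_partial_op2[OF g]
    let ?S = "{x\<in>space ?M. ennreal t < pos_op ?M ?k g x}"
    have [measurable]: "?S \<in> sets ?M" by measurable
    have "ennreal (t powr p) * emeasure ?M ?S = ennreal (t powr p) * (\<integral>\<^sup>+x2. emeasure M1 ((\<lambda>x1. (x1, x2)) -` ?S) \<partial>M2)"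
      by (subst P.emeasure_pair_measure_alt2) auto
    also have "\<dots> = (\<integral>\<^sup>+x2. ennreal (t powr p) * emeasure M1 ((\<lambda>x1. (x1, x2)) -` ?S) \<partial>M2)"
      by (rule nn_integral_cmult[symmetric]) (rule P.measurable_emeasure_Pair2, measurable)
    also have "\<dots> \<le> (\<integral>\<^sup>+x2. C1 * (\<integral>\<^sup>+y1. epow (pos_op M2 k2 (\<lambda>y2. g (y1, y2)) x2) p \<partial>M1) \<partial>M2)"
    proof (rule nn_integral_mono)
      fix x2 assume x2: "x2 \<in> space M2"
      then have m: "(\<lambda>y1. pos_op M2 k2 (\<lambda>y2. g (y1, y2)) x2) \<in> borel_measurable M1"
        using measurable_Pair1[OF m2] by simp
      have "(\<lambda>x1. (x1, x2)) -` ?S = {x1\<in>space M1. ennreal t < pos_op M1 k1 (\<lambda>y1. pos_op M2 k2 (\<lambda>y2. g (y1, y2)) x2) x1}"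
        using x2 by (auto simp: space_pair_measure pos_op_tensor(2)[OF g])
      then show "ennreal (t powr p) * emeasure M1 ((\<lambda>x1. (x1, x2)) -` ?S)
          \<le> C1 * (\<integral>\<^sup>+y1. epow (pos_op M2 k2 (\<lambda>y2. g (y1, y2)) x2) p \<partial>M1)"
        using C1(2)[OF m t] by simp
    qed
    also have "\<dots> = C1 * (\<integral>\<^sup>+x2. \<integral>\<^sup>+y1. epow (pos_op M2 k2 (\<lambda>y2. g (y1, y2)) x2) p \<partial>M1 \<partial>M2)"
      by (rule nn_integral_cmult) measurable
    also have "(\<integral>\<^sup>+x2. \<integral>\<^sup>+y1. epow (pos_op M2 k2 (\<lambda>y2. g (y1, y2)) x2) p \<partial>M1 \<partial>M2)
        = (\<integral>\<^sup>+y1. \<integral>\<^sup>+x2. epow (pos_op M2 k2 (\<lambda>y2. g (y1, y2)) x2) p \<partial>M2 \<partial>M1)"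
      by (rule P.Fubini') measurable
    also have "\<dots> \<le> (\<integral>\<^sup>+y1. C2 * (\<integral>\<^sup>+x2. epow (g (y1, x2)) p \<partial>M2) \<partial>M1)"
      by (rule nn_integral_mono, rule C2(2)) measurable
    also have "\<dots> = C2 * (\<integral>\<^sup>+y1. \<integral>\<^sup>+x2. epow (g (y1, x2)) p \<partial>M2 \<partial>M1)"
      by (rule nn_integral_cmult) measurable
    also have "(\<integral>\<^sup>+y1. \<integral>\<^sup>+x2. epow (g (y1, x2)) p \<partial>M2 \<partial>M1) = (\<integral>\<^sup>+x. epow (g x) p \<partial>?M)"
      by (subst M2.nn_integral_fst[symmetric]) auto
    finally show ?thesis by (simp add: mult_left_mono mult.assoc)
  qed
  moreover have "C1 * C2 < \<infinity>" using C1(1) C2(1) by (simp add: ennreal_mult_less_top)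
  ultimately show ?thesis unfolding pos_weak_def by blast
qed

end

definition prod_kernel :: "'i set \<Rightarrow> ('i \<Rightarrow> 'a \<Rightarrow> 'a \<Rightarrow> ennreal) \<Rightarrow> ('i \<Rightarrow> 'a) \<Rightarrow> ('i \<Rightarrow> 'a) \<Rightarrow> ennreal" where
  "prod_kernel I k x y = (\<Prod>i\<in>I. k i (x i) (y i))"

context product_sigma_finite
begin

lemma measurable_prod_kernel:
  assumes "\<And>i. i \<in> I \<Longrightarrow> case_prod (k i) \<in> borel_measurable (M i \<Otimes>\<^sub>M M i)"
  shows "case_prod (prod_kernel I k) \<in> borel_measurable (PiM I M \<Otimes>\<^sub>M PiM I M)"
proof -
  have "(\<lambda>z. k i (fst z i) (snd z i)) \<in> borel_measurable (PiM I M \<Otimes>\<^sub>M PiM I M)" if "i \<in> I" for i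
    using measurable_compose[OF _ assms[OF that], of "\<lambda>z. (fst z i, snd z i)"] that by simp
  then show ?thesis
    unfolding prod_kernel_def split_beta by (intro borel_measurable_prod_ennreal) auto
qed

lemma prod_kernel_insert:
  assumes "finite I" "i \<notin> I"
  shows "prod_kernel (insert i I) k (x(i := s)) (y(i := t)) = tensor_kernel (k i) (prod_kernel I k) (s, x) (t, y)"
proof -
  have "(\<Prod>j\<in>I. k j ((x(i := s)) j) ((y(i := t)) j)) = (\<Prod>j\<in>I. k j (x j) (y j))"
    by (rule prod.cong) (use assms in auto)
  then show ?thesis using assms by (simp add: prod_kernel_def tensor_kernel_def)
qed

lemma nn_integral_insert_pair:
  assumes "finite I" "i \<notin> I" and f [measurable]: "f \<in> borel_measurable (PiM (insert i I) M)"
  shows "integral\<^sup>N (PiM (insert i I) M) f = (\<integral>\<^sup>+z. f ((snd z)(i := fst z)) \<partial>(M i \<Otimes>\<^sub>M PiM I M))"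
proof -
  interpret I: sigma_finite_measure "PiM I M" by (rule sigma_finite[OF assms(1)])
  interpret P: pair_sigma_finite "M i" "PiM I M" by unfold_locales
  show ?thesis
    by (subst product_nn_integral_insert[OF assms], subst P.nn_integral_snd[symmetric]) (auto split: prod.split)
qed

lemma pos_bounded_on_PiM_insert:
  assumes I: "finite I" "i \<notin> I"
    and k: "\<And>j. j \<in> insert i I \<Longrightarrow> case_prod (k j) \<in> borel_measurable (M j \<Otimes>\<^sub>M M j)"
    and p: "0 \<le> p"
    and b1: "pos_bounded_on G1 (M i) (k i) p" and b2: "pos_strong (PiM I M) (prod_kernel I k) p"
    and G: "\<And>g x. g \<in> G \<Longrightarrow> (\<lambda>t. g (x(i := t))) \<in> G1"
  shows "pos_bounded_on G (PiM (insert i I) M) (prod_kernel (insert i I) k) p"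
proof -
  interpret I: sigma_finite_measure "PiM I M" by (rule sigma_finite[OF I(1)])
  interpret P: pair_sigma_finite "M i" "PiM I M" by unfold_locales
  have kI: "case_prod (prod_kernel I k) \<in> borel_measurable (PiM I M \<Otimes>\<^sub>M PiM I M)"
    using k by (intro measurable_prod_kernel) auto
  let ?T = "\<lambda>z. (snd z)(i := fst z)"
  let ?G = "{h. \<forall>x. (\<lambda>t. h (t, x)) \<in> G1}"
  have "pos_bounded_on ?G (M i \<Otimes>\<^sub>M PiM I M) (tensor_kernel (k i) (prod_kernel I k)) p"
    by (rule pos_bounded_on_tensor[OF _ _ _ kI b1 b2]) (use k in \<open>auto intro: sigma_finite_measures I.sigma_finite_measure_axioms\<close>)
  then show ?thesis
  proof (rule pos_bounded_on_transfer[where T = ?T and c = 1 and D = 1, rotated -1])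
    show "sigma_finite_measure (PiM (insert i I) M)" by (rule sigma_finite) (use I in simp)
    show "sigma_finite_measure (M i \<Otimes>\<^sub>M PiM I M)" by (rule P.sigma_finite_measure_axioms)
    show "?T \<in> M i \<Otimes>\<^sub>M PiM I M \<rightarrow>\<^sub>M PiM (insert i I) M" by measurable
    show "case_prod (prod_kernel (insert i I) k) \<in> borel_measurable (PiM (insert i I) M \<Otimes>\<^sub>M PiM (insert i I) M)"
      by (intro measurable_prod_kernel k)
    show "case_prod (tensor_kernel (k i) (prod_kernel I k)) \<in> borel_measurable ((M i \<Otimes>\<^sub>M PiM I M) \<Otimes>\<^sub>M (M i \<Otimes>\<^sub>M PiM I M))"
      by (rule measurable_tensor_kernel[OF _ _ _ kI]) (use k in \<open>auto intro: sigma_finite_measures I.sigma_finite_measure_axioms\<close>)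
  qed (use p G I in \<open>auto simp: nn_integral_insert_pair prod_kernel_insert\<close>)
qed

lemma pos_weak_PiM_insert:
  assumes I: "finite I" "i \<notin> I"
    and k: "\<And>j. j \<in> insert i I \<Longrightarrow> case_prod (k j) \<in> borel_measurable (M j \<Otimes>\<^sub>M M j)"
    and p: "0 \<le> p"
    and b1: "pos_weak (M i) (k i) p" and b2: "pos_strong (PiM I M) (prod_kernel I k) p"
  shows "pos_weak (PiM (insert i I) M) (prod_kernel (insert i I) k) p"
proof -
  interpret I: sigma_finite_measure "PiM I M" by (rule sigma_finite[OF I(1)])
  interpret P: pair_sigma_finite "M i" "PiM I M" by unfold_locales
  have kI: "case_prod (prod_kernel I k) \<in> borel_measurable (PiM I M \<Otimes>\<^sub>M PiM I M)"
    using k by (intro measurable_prod_kernel) auto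
  let ?T = "\<lambda>z. (snd z)(i := fst z)"
  have "pos_weak (M i \<Otimes>\<^sub>M PiM I M) (tensor_kernel (k i) (prod_kernel I k)) p"
    by (rule pos_weak_tensor[OF _ _ _ kI b1 b2]) (use k in \<open>auto intro: sigma_finite_measures I.sigma_finite_measure_axioms\<close>)
  then show ?thesis
  proof (rule pos_weak_transfer[where T = ?T and c = 1 and D = 1, rotated -1])
    show "sigma_finite_measure (PiM (insert i I) M)" by (rule sigma_finite) (use I in simp)
    show "sigma_finite_measure (M i \<Otimes>\<^sub>M PiM I M)" by (rule P.sigma_finite_measure_axioms)
    show "?T \<in> M i \<Otimes>\<^sub>M PiM I M \<rightarrow>\<^sub>M PiM (insert i I) M" by measurable
    show "case_prod (prod_kernel (insert i I) k) \<in> borel_measurable (PiM (insert i I) M \<Otimes>\<^sub>M PiM (insert i I) M)"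
      by (intro measurable_prod_kernel k)
    show "case_prod (tensor_kernel (k i) (prod_kernel I k)) \<in> borel_measurable ((M i \<Otimes>\<^sub>M PiM I M) \<Otimes>\<^sub>M (M i \<Otimes>\<^sub>M PiM I M))"
      by (rule measurable_tensor_kernel[OF _ _ _ kI]) (use k in \<open>auto intro: sigma_finite_measures I.sigma_finite_measure_axioms\<close>)
  qed (use p I in \<open>auto simp: nn_integral_insert_pair prod_kernel_insert\<close>)
qed

lemma pos_strong_PiM:
  assumes "finite I"
    and "\<And>j. j \<in> I \<Longrightarrow> case_prod (k j) \<in> borel_measurable (M j \<Otimes>\<^sub>M M j)"
    and p: "0 \<le> p"
    and "\<And>j. j \<in> I \<Longrightarrow> pos_strong (M j) (k j) p"
  shows "pos_strong (PiM I M) (prod_kernel I k) p"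
  using assms(1,2,4)
proof (induction I rule: finite_induct)
  case empty
  show ?case unfolding pos_bounded_on_def
    by (rule exI[of _ 1]) (auto simp: nn_integral_empty pos_op_def prod_kernel_def simp del: nn_integral_const)
next
  case (insert i I)
  show ?case
    by (rule pos_bounded_on_PiM_insert[OF insert(1,2) insert.prems(1) p insert.prems(2) insert.IH])
       (use insert.prems in auto)
qed

end

section \<open>Lebesgue measure on the unit disc\<close>

lemma measurable_cis [measurable]: "cis \<in> borel_measurable borel"
  and measurable_cnj [measurable]: "cnj \<in> borel_measurable borel"
  by (intro borel_measurable_continuous_onI continuous_intros)+

lemma lborel_complex_eq_distr:
  "lborel = distr (lborel \<Otimes>\<^sub>M lborel) borel (\<lambda>(x, y). Complex x y)"
proof (rule lborel_eqI)
  have [measurable]: "(\<lambda>(x, y). Complex x y) \<in> borel_measurable (lborel \<Otimes>\<^sub>M lborel)"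
    unfolding Complex_eq by (simp add: split_beta)
  fix l u :: complex assume le: "\<And>b. b \<in> Basis \<Longrightarrow> l \<bullet> b \<le> u \<bullet> b"
  have le': "Re l \<le> Re u" "Im l \<le> Im u"
    using le[of 1] le[of \<i>] by (auto simp: Basis_complex_def)
  have "(\<lambda>(x, y). Complex x y) -` box l u \<inter> space (lborel \<Otimes>\<^sub>M lborel) = {Re l<..<Re u} \<times> {Im l<..<Im u}"
    by (auto simp: box_def Basis_complex_def space_pair_measure)
  then have "emeasure (distr (lborel \<Otimes>\<^sub>M lborel) borel (\<lambda>(x, y). Complex x y)) (box l u)
      = emeasure (lborel \<Otimes>\<^sub>M lborel) ({Re l<..<Re u} \<times> {Im l<..<Im u})"
    by (simp add: emeasure_distr)
  also have "\<dots> = ennreal (\<Prod>b\<in>Basis. (u - l) \<bullet> b)"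
    using le' by (simp add: lborel.emeasure_pair_measure_Times Basis_complex_def ennreal_mult)
  finally show "emeasure (distr (lborel \<Otimes>\<^sub>M lborel) borel (\<lambda>(x, y). Complex x y)) (box l u)
      = ennreal (\<Prod>b\<in>Basis. (u - l) \<bullet> b)" .
qed simp

lemma measurable_Complex [measurable (raw)]:
  assumes "f \<in> borel_measurable M" "g \<in> borel_measurable M"
  shows "(\<lambda>x. Complex (f x) (g x)) \<in> borel_measurable M"
  unfolding Complex_eq using assms by measurable

lemma nn_integral_lborel_complex:
  fixes f :: "complex \<Rightarrow> ennreal"
  assumes [measurable]: "f \<in> borel_measurable borel"
  shows "(\<integral>\<^sup>+z. f z \<partial>lborel) = (\<integral>\<^sup>+x. \<integral>\<^sup>+y. f (Complex x y) \<partial>lborel \<partial>lborel)"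
  by (subst lborel_complex_eq_distr, subst nn_integral_distr)
     (auto simp: split_beta simp flip: lborel.nn_integral_fst)

text \<open>Multiplication by \<open>a + i b\<close> is the composition of two shears with one-dimensional scalings by \<open>a\<close> and by
  \<open>(a\<^sup>2 + b\<^sup>2) / a\<close>, whose product is the squared modulus. This needs \<open>a \<noteq> 0\<close>.\<close>

lemma nn_integral_complex_mult_aux:
  fixes f :: "complex \<Rightarrow> ennreal"
  assumes [measurable]: "f \<in> borel_measurable borel" and c: "Re c \<noteq> 0"
  shows "(\<integral>\<^sup>+z. f z \<partial>lborel) = ennreal ((cmod c)\<^sup>2) * (\<integral>\<^sup>+z. f (c * z) \<partial>lborel)"
proof -
  define a b where "a = Re c" and "b = Im c"
  have a: "a \<noteq> 0" using c by (simp add: a_def)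
  define s where "s = (a\<^sup>2 + b\<^sup>2) / a"
  have s: "s \<noteq> 0" using a by (simp add: s_def sum_power2_eq_zero_iff)
  have cs: "(cmod c)\<^sup>2 = \<bar>a\<bar> * \<bar>s\<bar>"
    using a by (simp add: s_def a_def b_def cmod_power2 abs_mult[symmetric])
  have cm: "c * Complex x y = Complex (a * x - b * y) (b * x + a * y)" for x y
    by (simp add: a_def b_def complex_eq_iff)
  have "(\<integral>\<^sup>+z. f z \<partial>lborel) = (\<integral>\<^sup>+u. \<integral>\<^sup>+v. f (Complex u v) \<partial>lborel \<partial>lborel)"
    by (rule nn_integral_lborel_complex) measurable
  also have "\<dots> = (\<integral>\<^sup>+u. ennreal \<bar>s\<bar> * (\<integral>\<^sup>+y. f (Complex u (b / a * u + s * y)) \<partial>lborel) \<partial>lborel)"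
    by (intro nn_integral_cong nn_integral_real_affine[OF _ s]) measurable
  also have "\<dots> = ennreal \<bar>s\<bar> * (\<integral>\<^sup>+u. \<integral>\<^sup>+y. f (Complex u (b / a * u + s * y)) \<partial>lborel \<partial>lborel)"
    by (rule nn_integral_cmult) measurable
  also have "(\<integral>\<^sup>+u. \<integral>\<^sup>+y. f (Complex u (b / a * u + s * y)) \<partial>lborel \<partial>lborel)
      = (\<integral>\<^sup>+y. \<integral>\<^sup>+u. f (Complex u (b / a * u + s * y)) \<partial>lborel \<partial>lborel)"
    by (rule lborel_pair.Fubini'[symmetric]) measurable
  also have "\<dots> = (\<integral>\<^sup>+y. ennreal \<bar>a\<bar> * (\<integral>\<^sup>+x. f (Complex (- b * y + a * x) (b / a * (- b * y + a * x) + s * y)) \<partial>lborel) \<partial>lborel)"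
    by (intro nn_integral_cong nn_integral_real_affine[OF _ a]) measurable
  also have "\<dots> = (\<integral>\<^sup>+y. ennreal \<bar>a\<bar> * (\<integral>\<^sup>+x. f (c * Complex x y) \<partial>lborel) \<partial>lborel)"
  proof -
    have "Complex (- b * y + a * x) (b / a * (- b * y + a * x) + s * y) = c * Complex x y" for x y
      using a by (simp add: cm s_def field_simps power2_eq_square)
    then show ?thesis by simp
  qed
  also have "\<dots> = ennreal \<bar>a\<bar> * (\<integral>\<^sup>+y. \<integral>\<^sup>+x. f (c * Complex x y) \<partial>lborel \<partial>lborel)"
    by (rule nn_integral_cmult) measurable
  also have "(\<integral>\<^sup>+y. \<integral>\<^sup>+x. f (c * Complex x y) \<partial>lborel \<partial>lborel) = (\<integral>\<^sup>+x. \<integral>\<^sup>+y. f (c * Complex x y) \<partial>lborel \<partial>lborel)"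
    by (rule lborel_pair.Fubini') measurable
  also have "\<dots> = (\<integral>\<^sup>+z. f (c * z) \<partial>lborel)"
    by (rule nn_integral_lborel_complex[symmetric]) measurable
  finally show ?thesis by (simp add: cs ennreal_mult mult_ac)
qed

lemma nn_integral_complex_mult:
  fixes f :: "complex \<Rightarrow> ennreal"
  assumes f [measurable]: "f \<in> borel_measurable borel" and c: "c \<noteq> 0"
  shows "(\<integral>\<^sup>+z. f z \<partial>lborel) = ennreal ((cmod c)\<^sup>2) * (\<integral>\<^sup>+z. f (c * z) \<partial>lborel)"
proof (cases "Re c = 0")
  case False
  then show ?thesis by (rule nn_integral_complex_mult_aux[OF f])
next
  case True
  \<comment> \<open>a purely imaginary factor is split into two factors with nonzero real part\<close>
  define d where "d = c / (1 + \<i>)"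
  have i0: "1 + \<i> \<noteq> 0" by (simp add: complex_eq_iff)
  have d: "Re d \<noteq> 0" "c = (1 + \<i>) * d"
    using True c i0 by (auto simp: d_def Re_divide complex_eq_iff power2_eq_square)
  have "(\<integral>\<^sup>+z. f z \<partial>lborel) = ennreal ((cmod (1 + \<i>))\<^sup>2) * (\<integral>\<^sup>+z. f ((1 + \<i>) * z) \<partial>lborel)"
    by (rule nn_integral_complex_mult_aux) auto
  also have "(\<integral>\<^sup>+z. f ((1 + \<i>) * z) \<partial>lborel) = ennreal ((cmod d)\<^sup>2) * (\<integral>\<^sup>+z. f ((1 + \<i>) * (d * z)) \<partial>lborel)"
    by (rule nn_integral_complex_mult_aux) (use d in auto)
  finally show ?thesis
    by (simp add: d(2) norm_mult power_mult_distrib ennreal_mult mult.assoc)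
qed

lemma measurable_indicator_unit_ball [measurable]:
  "(indicator (ball 0 1) :: complex \<Rightarrow> ennreal) \<in> borel_measurable borel"
  by (rule borel_measurable_indicator) simp

definition disc :: "complex measure" where
  "disc = density lborel (indicator (ball 0 1))"

lemma sets_disc [simp, measurable_cong]: "sets disc = sets borel" and space_disc [simp]: "space disc = UNIV"
  by (simp_all add: disc_def)

lemma nn_integral_disc:
  "f \<in> borel_measurable borel \<Longrightarrow> (\<integral>\<^sup>+z. f z \<partial>disc) = (\<integral>\<^sup>+z. indicator (ball 0 1) z * f z \<partial>lborel)"
  unfolding disc_def by (subst nn_integral_density) auto

lemma emeasure_ball_complex: "0 \<le> r \<Longrightarrow> emeasure lborel (ball (a::complex) r) = ennreal (pi * r\<^sup>2)"
  by (simp add: emeasure_ball unit_ball_vol_2)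

lemma emeasure_cball_complex: "0 \<le> r \<Longrightarrow> emeasure lborel (cball (a::complex) r) = ennreal (pi * r\<^sup>2)"
  by (simp add: emeasure_cball unit_ball_vol_2)

lemma finite_measure_disc: "finite_measure disc"
proof
  have "emeasure disc UNIV = emeasure lborel (ball (0::complex) 1)"
    unfolding disc_def by (subst emeasure_density) auto
  then show "emeasure disc (space disc) \<noteq> \<infinity>" by (simp add: emeasure_ball_complex)
qed

lemma sigma_finite_disc: "sigma_finite_measure disc"
  using finite_measure_disc by (simp add: finite_measure_def)

lemma AE_disc: "AE z in disc. z \<noteq> 0 \<and> cmod z < 1"
proof -
  have "AE z in lborel. z \<in> ball (0::complex) 1 \<longrightarrow> z \<noteq> 0 \<and> cmod z < 1"
    using AE_lborel_singleton[of "0::complex"] by eventually_elim (auto simp: dist_norm)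
  then show ?thesis unfolding disc_def by (subst AE_density) (auto simp: indicator_def)
qed

lemma disc_rotate:
  assumes c: "cmod c = 1"
  shows "distr disc borel (\<lambda>z. c * z) = disc"
proof (rule measure_eqI)
  fix A assume "A \<in> sets (distr disc borel (\<lambda>z. c * z))"
  then have [measurable]: "A \<in> sets borel" by simp
  have c0: "c \<noteq> 0" using c by auto
  have "emeasure (distr disc borel (\<lambda>z. c * z)) A = (\<integral>\<^sup>+z. indicator A z \<partial>distr disc borel (\<lambda>z. c * z))"
    by simp
  also have "\<dots> = (\<integral>\<^sup>+z. indicator A (c * z) \<partial>disc)"
    by (rule nn_integral_distr) auto
  also have "\<dots> = (\<integral>\<^sup>+z. indicator (ball 0 1) z * indicator A (c * z) \<partial>lborel)"
    by (rule nn_integral_disc) measurable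
  also have "\<dots> = (\<integral>\<^sup>+z. indicator (ball 0 1) (c * z) * indicator A (c * z) \<partial>lborel)"
    by (rule nn_integral_cong) (simp add: indicator_def dist_norm norm_mult c)
  also have "\<dots> = (\<integral>\<^sup>+z. indicator (ball 0 1) z * indicator A z \<partial>lborel)"
  proof -
    have "(\<integral>\<^sup>+z. indicator (ball 0 1) z * indicator A z \<partial>lborel)
      = ennreal ((cmod c)\<^sup>2) * (\<integral>\<^sup>+z. indicator (ball 0 1) (c * z) * indicator A (c * z) \<partial>lborel)"
      by (rule nn_integral_complex_mult[OF _ c0]) measurable
    then show ?thesis by (simp only: c) simp
  qed
  also have "\<dots> = (\<integral>\<^sup>+z. indicator A z \<partial>disc)"
    by (rule nn_integral_disc[symmetric]) measurable
  also have "\<dots> = emeasure disc A" by simp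
  finally show "emeasure (distr disc borel (\<lambda>z. c * z)) A = emeasure disc A" .
qed simp

text \<open>The disc \<open>{|z|\<^sup>2 < t}\<close> has area \<open>\<pi> t\<close>: in the variable \<open>|z|\<^sup>2\<close> the measure of the disc is uniform.\<close>

lemma disc_radial:
  "distr disc borel (\<lambda>z. (cmod z)\<^sup>2) = density lborel (\<lambda>t. ennreal pi * indicator {0<..<1} t)"
proof (rule measure_eqI_lessThan)
  have lhs: "emeasure (distr disc borel (\<lambda>z. (cmod z)\<^sup>2)) {t<..} = ennreal (pi * (1 - min 1 (max 0 t)))" for t
  proof -
    have "emeasure (distr disc borel (\<lambda>z. (cmod z)\<^sup>2)) {t<..} = emeasure disc {z. t < (cmod z)\<^sup>2}"
      by (subst emeasure_distr) (auto simp: vimage_def)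
    also have "\<dots> = emeasure lborel (ball 0 1 \<inter> {z::complex. t < (cmod z)\<^sup>2})"
    proof -
      have "emeasure disc {z. t < (cmod z)\<^sup>2} = (\<integral>\<^sup>+z. indicator (ball 0 1) z * indicator {z. t < (cmod z)\<^sup>2} z \<partial>lborel)"
        unfolding disc_def by (rule emeasure_density) auto
      also have "\<dots> = (\<integral>\<^sup>+z. indicator (ball 0 1 \<inter> {z. t < (cmod z)\<^sup>2}) z \<partial>lborel)"
        by (intro nn_integral_cong) (simp add: indicator_def)
      also have "\<dots> = emeasure lborel (ball 0 1 \<inter> {z::complex. t < (cmod z)\<^sup>2})"
        by (rule nn_integral_indicator) measurable
      finally show ?thesis .
    qed
    also have "\<dots> = ennreal (pi * (1 - min 1 (max 0 t)))"
    proof (cases "t < 0")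
      case True
      then have "ball 0 1 \<inter> {z::complex. t < (cmod z)\<^sup>2} = ball 0 1"
        by (auto intro: less_le_trans)
      then show ?thesis using True by (simp add: emeasure_ball_complex)
    next
      case False
      show ?thesis
      proof (cases "t < 1")
        case True
        have eq: "ball 0 1 \<inter> {z::complex. t < (cmod z)\<^sup>2} = ball 0 1 - cball 0 (sqrt t)"
          using False by (auto simp: dist_norm not_le real_sqrt_less_iff
              intro: real_less_lsqrt dest: real_le_lsqrt) (metis norm_ge_zero not_le real_le_lsqrt real_le_rsqrt real_sqrt_less_iff real_sqrt_unique)+
        have "cmod x < 1" if "cmod x \<le> sqrt t" for x
          using that True real_sqrt_less_iff[of t 1] by (metis le_less_trans real_sqrt_one)
        then have "emeasure lborel (ball 0 1 - cball 0 (sqrt t) :: complex set)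
          = emeasure lborel (ball (0::complex) 1) - emeasure lborel (cball (0::complex) (sqrt t))"
          using False by (intro emeasure_Diff) (auto simp: emeasure_cball_complex)
        also have "\<dots> = ennreal (pi * (1 - t))"
          using False True by (simp add: emeasure_cball_complex emeasure_ball_complex ennreal_minus right_diff_distrib)
        finally show ?thesis using False True by (simp add: eq)
      next
        case False
        then have "ball 0 1 \<inter> {z::complex. t < (cmod z)\<^sup>2} = {}"
          by (auto simp: abs_square_less_1 not_less dest: power_le_one[of "cmod _" 2])
             (smt (verit) norm_ge_zero power_le_one)
        then show ?thesis using False by simp
      qed
    qed
    finally show ?thesis .
  qed
  show "emeasure (distr disc borel (\<lambda>z. (cmod z)\<^sup>2)) {t<..} < \<infinity>" for t by (simp add: lhs)
  show "emeasure (distr disc borel (\<lambda>z. (cmod z)\<^sup>2)) {t<..}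
      = emeasure (density lborel (\<lambda>t. ennreal pi * indicator {0<..<1} t)) {t<..}" for t
  proof -
    have "emeasure (density lborel (\<lambda>t. ennreal pi * indicator {0<..<1} t)) {t<..}
        = (\<integral>\<^sup>+x. ennreal pi * indicator {max 0 t<..<1} x \<partial>lborel)"
      by (subst emeasure_density) (auto simp: indicator_def intro!: nn_integral_cong)
    also have "\<dots> = ennreal pi * emeasure lborel {max 0 t<..<1}"
      by (subst nn_integral_cmult_indicator) auto
    also have "emeasure lborel {max 0 t<..<1} = ennreal (1 - min 1 (max 0 t))"
      by (cases "max 0 t \<le> 1") (auto simp: min_def)
    finally show ?thesis by (simp add: lhs ennreal_mult)
  qed
qed simp_all

lemma nn_integral_disc_radial:
  assumes [measurable]: "f \<in> borel_measurable borel"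
  shows "(\<integral>\<^sup>+z. f ((cmod z)\<^sup>2) \<partial>disc) = ennreal pi * (\<integral>\<^sup>+t. indicator {0<..<1} t * f t \<partial>lborel)"
proof -
  have "(\<integral>\<^sup>+z. f ((cmod z)\<^sup>2) \<partial>disc) = (\<integral>\<^sup>+t. f t \<partial>distr disc borel (\<lambda>z. (cmod z)\<^sup>2))"
    by (rule nn_integral_distr[symmetric]) auto
  also have "\<dots> = (\<integral>\<^sup>+t. ennreal pi * indicator {0<..<1} t * f t \<partial>lborel)"
    unfolding disc_radial by (rule nn_integral_density) auto
  also have "\<dots> = ennreal pi * (\<integral>\<^sup>+t. indicator {0<..<1} t * f t \<partial>lborel)"
    unfolding mult.assoc by (rule nn_integral_cmult) auto
  finally show ?thesis .
qed

text \<open>The speed \<open>\<alpha>\<close> is free because the kernels below depend on \<open>z^e\<close>, which makes \<open>\<alpha> = 1/e\<close> the convenient choice.\<close>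

lemma nn_integral_disc_rotation_average:
  fixes f :: "complex \<Rightarrow> ennreal" and \<alpha> :: real
  assumes [measurable]: "f \<in> borel_measurable borel"
  shows "ennreal (2 * pi) * (\<integral>\<^sup>+z. f z \<partial>disc) = (\<integral>\<^sup>+z. (\<integral>\<^sup>+\<theta>. indicator {0..2*pi} \<theta> * f (cis (\<alpha> * \<theta>) * z) \<partial>lborel) \<partial>disc)"
proof -
  interpret D: sigma_finite_measure disc by (rule sigma_finite_disc)
  interpret P: pair_sigma_finite "lborel :: real measure" disc by unfold_locales
  have "(\<integral>\<^sup>+z. (\<integral>\<^sup>+\<theta>. indicator {0..2*pi} \<theta> * f (cis (\<alpha> * \<theta>) * z) \<partial>lborel) \<partial>disc)
     = (\<integral>\<^sup>+\<theta>. (\<integral>\<^sup>+z. indicator {0..2*pi} \<theta> * f (cis (\<alpha> * \<theta>) * z) \<partial>disc) \<partial>lborel)"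
    by (rule P.Fubini') measurable
  also have "\<dots> = (\<integral>\<^sup>+\<theta>. (\<integral>\<^sup>+z. f z \<partial>disc) * indicator {0..2*pi} \<theta> \<partial>lborel)"
  proof (rule nn_integral_cong)
    fix \<theta> :: real
    have "(\<integral>\<^sup>+z. f (cis (\<alpha> * \<theta>) * z) \<partial>disc) = (\<integral>\<^sup>+z. f z \<partial>distr disc borel (\<lambda>z. cis (\<alpha> * \<theta>) * z))"
      by (rule nn_integral_distr[symmetric]) auto
    also have "\<dots> = (\<integral>\<^sup>+z. f z \<partial>disc)" by (simp add: disc_rotate)
    finally show "(\<integral>\<^sup>+z. indicator {0..2*pi} \<theta> * f (cis (\<alpha> * \<theta>) * z) \<partial>disc) = (\<integral>\<^sup>+z. f z \<partial>disc) * indicator {0..2*pi} \<theta>"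
      by (subst nn_integral_cmult) (auto simp: mult.commute)
  qed
  also have "\<dots> = (\<integral>\<^sup>+z. f z \<partial>disc) * ennreal (2 * pi)"
    by (subst nn_integral_cmult_indicator) auto
  finally show ?thesis by (simp add: mult.commute)
qed

section \<open>Integrals of the kernel of the disc\<close>

lemma circlepath_unit_has_integral:
  assumes "(f has_contour_integral (2 * of_real pi * \<i> * I)) (circlepath 0 1)"
  shows "((\<lambda>t. f (cis t) * cis t) has_integral (2 * of_real pi * I)) {0..2*pi}"
proof -
  have "((\<lambda>t. f (0 + 1 * cis t) * 1 * \<i> * cis t) has_integral (2 * of_real pi * \<i> * I)) {0..2*pi}"
    using assms has_contour_integral_part_circlepath_iff[of 0 "2*pi" f "2 * of_real pi * \<i> * I" 0 1]
    by (simp add: circlepath_def)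
  from has_integral_mult_right[OF this, of "- \<i>"] show ?thesis
    by (simp add: mult_ac)
qed

text \<open>On the unit circle \<open>cnj u = 1 / u\<close>, so \<open>1 / |1 - b u|\<^sup>2\<close> becomes the Cauchy kernel at \<open>cnj b\<close> applied to
  \<open>u \<mapsto> 1 / (1 - b u)\<close>.\<close>

lemma Poisson_kernel_integral:
  assumes b: "cmod b < 1"
  shows "((\<lambda>t. 1 / (cmod (1 - b * cis t))\<^sup>2) has_integral (2 * pi / (1 - (cmod b)\<^sup>2))) {0..2*pi}"
proof -
  let ?g = "\<lambda>u. 1 / (1 - b * u)"
  have nz: "1 - b * u \<noteq> 0" if "cmod u \<le> 1" for u
  proof
    assume "1 - b * u = 0"
    then have "cmod b * cmod u = 1" by (metis eq_iff_diff_eq_0 norm_mult norm_one)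
    moreover have "cmod b * cmod u \<le> cmod b" using that by (simp add: mult_left_le)
    ultimately show False using b by simp
  qed
  have hol: "?g holomorphic_on cball 0 1"
    by (intro holomorphic_intros) (use nz in \<open>auto simp: dist_norm\<close>)
  have "((\<lambda>u. ?g u / (u - cnj b)) has_contour_integral (2 * of_real pi * \<i> * ?g (cnj b))) (circlepath 0 1)"
    by (rule Cauchy_integral_circlepath_simple[OF hol]) (use b in simp)
  from circlepath_unit_has_integral[OF this]
  have "((\<lambda>t. ?g (cis t) / (cis t - cnj b) * cis t) has_integral (2 * of_real pi * ?g (cnj b))) {0..2*pi}" .
  moreover have "?g (cis t) / (cis t - cnj b) * cis t = of_real (1 / (cmod (1 - b * cis t))\<^sup>2)" for t
  proof -
    have "cis t - cnj b = cis t * cnj (1 - b * cis t)"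
      by (simp add: algebra_simps cis_cnj cis_mult)
    then have "?g (cis t) / (cis t - cnj b) * cis t = 1 / ((1 - b * cis t) * cnj (1 - b * cis t))"
      by (simp add: divide_simps)
    then show ?thesis by (simp only: complex_norm_square[symmetric]) simp
  qed
  moreover have "2 * of_real pi * ?g (cnj b) = complex_of_real (2 * pi / (1 - (cmod b)\<^sup>2))"
    using complex_norm_square[of b] by simp
  ultimately have "((\<lambda>t. complex_of_real (1 / (cmod (1 - b * cis t))\<^sup>2)) has_integral complex_of_real (2 * pi / (1 - (cmod b)\<^sup>2))) {0..2*pi}"
    by (simp only:)
  from has_integral_Re[OF this] show ?thesis by simp
qed

lemma nn_integral_Poisson_kernel:
  assumes b: "cmod b < 1"
  shows "(\<integral>\<^sup>+t. indicator {0..2*pi} t * ennreal (1 / (cmod (1 - b * cis t))\<^sup>2) \<partial>lborel) = ennreal (2 * pi / (1 - (cmod b)\<^sup>2))"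
  using nn_integral_has_integral_lebesgue'[OF _ Poisson_kernel_integral[OF b]] by (simp add: mult.commute)

lemma power_less_one_norm: "cmod x < 1 \<Longrightarrow> 0 < e \<Longrightarrow> cmod x ^ e < 1"
  by (simp add: power_less_one_iff)

text \<open>Average over rotations: the angular integral is the Poisson integral at \<open>(x cnj z)^e\<close>, and what remains
  depends on \<open>|z|\<^sup>2\<close> only.\<close>

lemma nn_integral_disc_kernel:
  fixes \<phi> :: "real \<Rightarrow> ennreal"
  assumes [measurable]: "\<phi> \<in> borel_measurable borel" and x: "cmod x < 1" and e: "0 < e"
  shows "(\<integral>\<^sup>+z. \<phi> ((cmod z)\<^sup>2) * ennreal (1 / (cmod (1 - (x * cnj z) ^ e))\<^sup>2) \<partial>disc)
       = (\<integral>\<^sup>+z. \<phi> ((cmod z)\<^sup>2) * ennreal (1 / (1 - ((cmod x)\<^sup>2 * (cmod z)\<^sup>2) ^ e)) \<partial>disc)"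
proof -
  let ?I = "\<integral>\<^sup>+z. \<phi> ((cmod z)\<^sup>2) * ennreal (1 / (cmod (1 - (x * cnj z) ^ e))\<^sup>2) \<partial>disc"
  let ?J = "\<integral>\<^sup>+z. \<phi> ((cmod z)\<^sup>2) * ennreal (1 / (1 - ((cmod x)\<^sup>2 * (cmod z)\<^sup>2) ^ e)) \<partial>disc"
  have "ennreal (2 * pi) * ?I = (\<integral>\<^sup>+z. (\<integral>\<^sup>+\<theta>. indicator {0..2*pi} \<theta> * (\<phi> ((cmod (cis (1 / e * \<theta>) * z))\<^sup>2) *
      ennreal (1 / (cmod (1 - (x * cnj (cis (1 / e * \<theta>) * z)) ^ e))\<^sup>2)) \<partial>lborel) \<partial>disc)"
    by (rule nn_integral_disc_rotation_average) measurable
  also have "\<dots> = (\<integral>\<^sup>+z. ennreal (2 * pi) * (\<phi> ((cmod z)\<^sup>2) * ennreal (1 / (1 - ((cmod x)\<^sup>2 * (cmod z)\<^sup>2) ^ e))) \<partial>disc)"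
  proof (rule nn_integral_cong_AE, use AE_disc in eventually_elim)
    fix z assume z: "z \<noteq> 0 \<and> cmod z < 1"
    let ?b = "cnj ((x * cnj z) ^ e)"
    have "cmod x * cmod z < 1 * 1" using x z by (intro mult_strict_mono) auto
    then have "cmod (x * cnj z) < 1" by (simp add: norm_mult)
    then have "cmod (x * cnj z) ^ e < 1" using e by (rule power_less_one_norm)
    then have b: "cmod ?b < 1" by (simp only: complex_mod_cnj norm_power)
    have "cmod (1 - (x * cnj (cis (1 / e * \<theta>) * z)) ^ e) = cmod (1 - ?b * cis \<theta>)" for \<theta>
    proof -
      have "(x * cnj (cis (1 / e * \<theta>) * z)) ^ e = cnj (?b * cis \<theta>)"
        using e by (simp add: power_mult_distrib Complex.DeMoivre cis_cnj)
      then show ?thesis by (metis complex_cnj_diff complex_cnj_one complex_mod_cnj)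
    qed
    then have "(\<integral>\<^sup>+\<theta>. indicator {0..2*pi} \<theta> * (\<phi> ((cmod (cis (1 / e * \<theta>) * z))\<^sup>2) *
        ennreal (1 / (cmod (1 - (x * cnj (cis (1 / e * \<theta>) * z)) ^ e))\<^sup>2)) \<partial>lborel)
      = (\<integral>\<^sup>+\<theta>. \<phi> ((cmod z)\<^sup>2) * (indicator {0..2*pi} \<theta> * ennreal (1 / (cmod (1 - ?b * cis \<theta>))\<^sup>2)) \<partial>lborel)"
      by (simp add: norm_mult mult_ac)
    also have "\<dots> = \<phi> ((cmod z)\<^sup>2) * (\<integral>\<^sup>+\<theta>. indicator {0..2*pi} \<theta> * ennreal (1 / (cmod (1 - ?b * cis \<theta>))\<^sup>2) \<partial>lborel)"
      by (rule nn_integral_cmult) measurable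
    also have "\<dots> = \<phi> ((cmod z)\<^sup>2) * ennreal (2 * pi / (1 - (cmod ?b)\<^sup>2))"
      by (simp only: nn_integral_Poisson_kernel[OF b])
    also have "(cmod ?b)\<^sup>2 = ((cmod x)\<^sup>2 * (cmod z)\<^sup>2) ^ e"
      by (simp add: norm_power norm_mult power_mult_distrib mult.commute flip: power_mult)
    also have "ennreal (2 * pi / (1 - ((cmod x)\<^sup>2 * (cmod z)\<^sup>2) ^ e)) = ennreal (2 * pi) * ennreal (1 / (1 - ((cmod x)\<^sup>2 * (cmod z)\<^sup>2) ^ e))"
    proof -
      have "((cmod x)\<^sup>2 * (cmod z)\<^sup>2) ^ e \<le> 1"
        using x z by (intro power_le_one mult_le_one) (auto simp: power_le_one)
      then show ?thesis by (simp flip: ennreal_mult)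
    qed
    finally show "(\<integral>\<^sup>+\<theta>. indicator {0..2*pi} \<theta> * (\<phi> ((cmod (cis (1 / e * \<theta>) * z))\<^sup>2) *
        ennreal (1 / (cmod (1 - (x * cnj (cis (1 / e * \<theta>) * z)) ^ e))\<^sup>2)) \<partial>lborel)
      = ennreal (2 * pi) * (\<phi> ((cmod z)\<^sup>2) * ennreal (1 / (1 - ((cmod x)\<^sup>2 * (cmod z)\<^sup>2) ^ e)))"
      by (simp add: mult_ac)
  qed
  also have "\<dots> = ennreal (2 * pi) * ?J"
    by (rule nn_integral_cmult) measurable
  finally show ?thesis by (simp add: ennreal_mult_cancel_left)
qed

text \<open>The estimate that feeds the Schur test. After the angular integration and the substitution \<open>t = 1 - |z|\<^sup>2\<close>
  the integrand is at most \<open>t powr -b / max \<delta> t\<close> with \<open>\<delta> = 1 - |x|\<^sup>2\<close>. The two terms in the constant come from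
  \<open>t \<le> \<delta>\<close> and \<open>t \<ge> \<delta>\<close>.\<close>

lemma disc_kernel_test_bound:
  assumes x: "cmod x < 1" and e: "0 < e" and b: "0 < b" "b < 1"
  shows "(\<integral>\<^sup>+z. ennreal ((1 - (cmod z)\<^sup>2) powr - b) * ennreal (1 / (cmod (1 - (x * cnj z) ^ e))\<^sup>2) \<partial>disc)
       \<le> ennreal (pi * (1 / (1 - b) + 1 / b) * (1 - (cmod x)\<^sup>2) powr - b)"
proof -
  define R where "R = (cmod x)\<^sup>2"
  define \<delta> where "\<delta> = 1 - R"
  have R: "0 \<le> R" "R < 1" using x by (auto simp: R_def abs_square_less_1)
  have \<delta>: "0 < \<delta>" "\<delta> \<le> 1" using R by (auto simp: \<delta>_def)
  have "(\<integral>\<^sup>+t. indicator {0<..<1} t * (ennreal ((1 - t) powr - b) * ennreal (1 / (1 - (R * t) ^ e))) \<partial>lborel)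
     = (\<integral>\<^sup>+t. indicator {0<..<1} (1 - t) * (ennreal (t powr - b) * ennreal (1 / (1 - (R * (1 - t)) ^ e))) \<partial>lborel)"
    by (subst nn_integral_real_affine[of _ "-1" 1]) auto
  also have "\<dots> \<le> (\<integral>\<^sup>+t. ennreal (1 / \<delta> * t powr - b) * indicator {0..\<delta>} t + ennreal (t powr (- b - 1)) * indicator {\<delta>..} t \<partial>lborel)"
  proof (rule nn_integral_mono)
    fix t :: real
    show "indicator {0<..<1} (1 - t) * (ennreal (t powr - b) * ennreal (1 / (1 - (R * (1 - t)) ^ e)))
       \<le> ennreal (1 / \<delta> * t powr - b) * indicator {0..\<delta>} t + ennreal (t powr (- b - 1)) * indicator {\<delta>..} t"
    proof (cases "0 < t \<and> t < 1")
      case True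
      have Rt: "0 \<le> R * (1 - t)" "R * (1 - t) \<le> 1" using R True by (auto intro!: mult_le_one)
      have pe: "(R * (1 - t)) ^ e \<le> R * (1 - t)"
        using power_decreasing[of 1 e "R * (1 - t)"] e Rt by simp
      have "t * (1 - R) \<le> 1 - R" using R True by (simp add: mult_left_le_one_le)
      then have l: "\<delta> \<le> 1 - R * (1 - t)" "t \<le> 1 - R * (1 - t)"
        using R True by (auto simp: \<delta>_def algebra_simps)
      have "1 / (1 - (R * (1 - t)) ^ e) \<le> (if t \<le> \<delta> then 1 / \<delta> else 1 / t)"
        using l pe True \<delta> by (auto intro!: divide_left_mono mult_pos_pos)
      then have "t powr - b * (1 / (1 - (R * (1 - t)) ^ e)) \<le> (if t \<le> \<delta> then 1 / \<delta> * t powr - b else t powr (- b - 1))"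
        using mult_left_mono[of "1 / (1 - (R * (1 - t)) ^ e)" "if t \<le> \<delta> then 1 / \<delta> else 1 / t" "t powr - b"] True
        by (auto simp: powr_diff mult.commute split: if_splits)
      moreover have "0 \<le> 1 / (1 - (R * (1 - t)) ^ e)" using pe Rt by simp
      ultimately have "ennreal (t powr - b) * ennreal (1 / (1 - (R * (1 - t)) ^ e))
          \<le> ennreal (if t \<le> \<delta> then 1 / \<delta> * t powr - b else t powr (- b - 1))"
        by (simp add: ennreal_leI flip: ennreal_mult)
      also have "\<dots> \<le> ennreal (1 / \<delta> * t powr - b) * indicator {0..\<delta>} t + ennreal (t powr (- b - 1)) * indicator {\<delta>..} t"
        using True by (cases "t \<le> \<delta>") (simp_all add: indicator_def)
      finally show ?thesis using True by (simp add: indicator_def)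
    qed (auto simp: indicator_def)
  qed
  also have "\<dots> = (\<integral>\<^sup>+t. ennreal (1 / \<delta> * t powr - b) * indicator {0..\<delta>} t \<partial>lborel) + (\<integral>\<^sup>+t. ennreal (t powr (- b - 1)) * indicator {\<delta>..} t \<partial>lborel)"
    by (rule nn_integral_add) measurable
  also have "(\<integral>\<^sup>+t. ennreal (1 / \<delta> * t powr - b) * indicator {0..\<delta>} t \<partial>lborel) = ennreal (1 / \<delta> * (\<delta> powr (- b + 1) / (- b + 1)))"
    by (rule nn_integral_has_integral_lebesgue', use \<delta> in simp, rule has_integral_mult_right, rule has_integral_powr_from_0) (use b \<delta> in auto)
  also have "1 / \<delta> * (\<delta> powr (- b + 1) / (- b + 1)) = \<delta> powr - b / (1 - b)"
    using \<delta> powr_add[of \<delta> "- b" 1] by simp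
  also have "(\<integral>\<^sup>+t. ennreal (t powr (- b - 1)) * indicator {\<delta>..} t \<partial>lborel) = ennreal (- (\<delta> powr (- b - 1 + 1)) / (- b - 1 + 1))"
    by (rule nn_integral_has_integral_lebesgue', simp, rule has_integral_powr_to_inf) (use b \<delta> in auto)
  also have "- (\<delta> powr (- b - 1 + 1)) / (- b - 1 + 1) = \<delta> powr - b / b" by simp
  also have "ennreal (\<delta> powr - b / (1 - b)) + ennreal (\<delta> powr - b / b) = ennreal ((1 / (1 - b) + 1 / b) * \<delta> powr - b)"
    using b by (simp add: distrib_right flip: ennreal_plus)
  finally have inner: "(\<integral>\<^sup>+t. indicator {0<..<1} t * (ennreal ((1 - t) powr - b) * ennreal (1 / (1 - (R * t) ^ e))) \<partial>lborel)
     \<le> ennreal ((1 / (1 - b) + 1 / b) * \<delta> powr - b)" .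
  have "(\<integral>\<^sup>+z. ennreal ((1 - (cmod z)\<^sup>2) powr - b) * ennreal (1 / (cmod (1 - (x * cnj z) ^ e))\<^sup>2) \<partial>disc)
     = (\<integral>\<^sup>+z. ennreal ((1 - (cmod z)\<^sup>2) powr - b) * ennreal (1 / (1 - (R * (cmod z)\<^sup>2) ^ e)) \<partial>disc)"
    unfolding R_def
    by (rule nn_integral_disc_kernel[of "\<lambda>t. ennreal ((1 - t) powr - b)", OF _ x e]) measurable
  also have "\<dots> = ennreal pi * (\<integral>\<^sup>+t. indicator {0<..<1} t * (ennreal ((1 - t) powr - b) * ennreal (1 / (1 - (R * t) ^ e))) \<partial>lborel)"
    by (rule nn_integral_disc_radial[of "\<lambda>t. ennreal ((1 - t) powr - b) * ennreal (1 / (1 - (R * t) ^ e))"]) measurable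
  also have "\<dots> \<le> ennreal pi * ennreal ((1 / (1 - b) + 1 / b) * \<delta> powr - b)"
    by (rule mult_left_mono[OF inner]) simp
  also have "ennreal pi * ennreal ((1 / (1 - b) + 1 / b) * \<delta> powr - b) = ennreal (pi * (1 / (1 - b) + 1 / b) * \<delta> powr - b)"
    using b by (simp add: mult.assoc ennreal_mult)
  finally show ?thesis by (simp only: \<delta>_def R_def)
qed

lemma nn_integral_disc_powr_le:
  assumes s: "-2 < s" and R: "0 \<le> R"
  shows "(\<integral>\<^sup>+z. indicator {z. cmod z < R} z * ennreal (cmod z powr s) \<partial>disc) \<le> ennreal (pi * (R powr (s + 2) / (s / 2 + 1)))"
proof -
  have "(\<integral>\<^sup>+z. indicator {z. cmod z < R} z * ennreal (cmod z powr s) \<partial>disc)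
      \<le> (\<integral>\<^sup>+z. indicator {0..R\<^sup>2} ((cmod z)\<^sup>2) * ennreal (((cmod z)\<^sup>2) powr (s / 2)) \<partial>disc)"
  proof (rule nn_integral_mono)
    fix z
    have "((cmod z)\<^sup>2) powr (s / 2) = cmod z powr s"
      by (simp add: powr_powr[of _ 2, simplified] flip: powr_numeral)
    then show "indicator {z. cmod z < R} z * ennreal (cmod z powr s) \<le> indicator {0..R\<^sup>2} ((cmod z)\<^sup>2) * ennreal (((cmod z)\<^sup>2) powr (s / 2))"
      by (auto simp: indicator_def power_mono)
  qed
  also have "\<dots> = ennreal pi * (\<integral>\<^sup>+t. indicator {0<..<1} t * (indicator {0..R\<^sup>2} t * ennreal (t powr (s / 2))) \<partial>lborel)"
    by (rule nn_integral_disc_radial[of "\<lambda>t. indicator {0..R\<^sup>2} t * ennreal (t powr (s / 2))"]) measurable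
  also have "(\<integral>\<^sup>+t. indicator {0<..<1} t * (indicator {0..R\<^sup>2} t * ennreal (t powr (s / 2))) \<partial>lborel)
      \<le> (\<integral>\<^sup>+t. ennreal (t powr (s / 2)) * indicator {0..R\<^sup>2} t \<partial>lborel)"
    by (rule nn_integral_mono) (auto simp: indicator_def)
  also have "(\<integral>\<^sup>+t. ennreal (t powr (s / 2)) * indicator {0..R\<^sup>2} t \<partial>lborel) = ennreal ((R\<^sup>2) powr (s / 2 + 1) / (s / 2 + 1))"
    by (rule nn_integral_has_integral_lebesgue', simp, rule has_integral_powr_from_0) (use s in auto)
  also have "(R\<^sup>2) powr (s / 2 + 1) = R powr (s + 2)"
    using R by (simp add: powr_powr distrib_left flip: powr_numeral)
  finally show ?thesis using s by (simp add: mult_left_mono flip: ennreal_mult)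
qed

section \<open>Kernels of rank one\<close>

lemma rank_one_pos_op:
  assumes [measurable]: "v \<in> borel_measurable M" "g \<in> borel_measurable M"
  shows "pos_op M (\<lambda>x y. v x * v y) g x = v x * (\<integral>\<^sup>+y. v y * g y \<partial>M)"
  unfolding pos_op_def mult.assoc by (rule nn_integral_cmult) measurable

text \<open>Hoelder's inequality for \<open>v g\<close>, obtained from the weighted Jensen inequality with the weight
  \<open>v powr (1 / (p - 1))\<close>, for which the product of kernel and weight is \<open>v\<close> to the conjugate exponent.\<close>

lemma Hoelder_rank_one:
  fixes v :: "'a \<Rightarrow> real"
  assumes p: "1 < p" and [measurable]: "v \<in> borel_measurable M" "g \<in> borel_measurable M"
    and v: "\<And>x. 0 < v x"
    and fin: "(\<integral>\<^sup>+x. ennreal (v x powr (p / (p - 1))) \<partial>M) < \<infinity>"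
  shows "epow (\<integral>\<^sup>+y. ennreal (v y) * g y \<partial>M) p
     \<le> epow (\<integral>\<^sup>+x. ennreal (v x powr (p / (p - 1))) \<partial>M) (p - 1) * (\<integral>\<^sup>+x. epow (g x) p \<partial>M)"
proof -
  let ?u = "\<lambda>x. v x powr (1 / (p - 1))"
  have e1: "ennreal (v x) * ennreal (?u x) = ennreal (v x powr (p / (p - 1)))" for x
  proof -
    have "v x powr 1 * v x powr (1 / (p - 1)) = v x powr (p / (p - 1))"
    proof -
      have "1 + 1 / (p - 1) = p / (p - 1)" using p by (simp add: field_simps)
      then show ?thesis by (metis powr_add)
    qed
    then show ?thesis using v[of x] by (simp flip: ennreal_mult)
  qed
  have e2: "ennreal (v x) * (ennreal (?u x powr (1 - p)) * a) = a" for x a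
  proof -
    have "1 / (p - 1) * (1 - p) = -1" using p by (simp add: field_simps)
    then have "?u x powr (1 - p) = 1 / v x" using v[of x] by (simp add: powr_powr powr_minus_divide)
    then have "ennreal (v x) * ennreal (?u x powr (1 - p)) = 1" using v[of x] by (simp flip: ennreal_mult)
    then show ?thesis by (simp flip: mult.assoc)
  qed
  have vn: "v x \<noteq> 0" for x using v[of x] by simp
  have "epow (\<integral>\<^sup>+y. ennreal (v y) * g y \<partial>M) p \<le> epow (\<integral>\<^sup>+x. ennreal (v x) * ennreal (?u x) \<partial>M) (p - 1) *
           (\<integral>\<^sup>+x. ennreal (v x) * (ennreal (?u x powr (1 - p)) * epow (g x) p) \<partial>M)"
    by (rule Jensen_weighted[OF p]) (use fin in \<open>simp_all add: vn e1\<close>)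
  then show ?thesis by (simp only: e1 e2)
qed

lemma rank_one_strong:
  fixes v :: "'a \<Rightarrow> real"
  assumes p: "1 < p" and [measurable]: "v \<in> borel_measurable M" and v: "\<And>x. 0 < v x"
    and fin1: "(\<integral>\<^sup>+x. ennreal (v x powr (p / (p - 1))) \<partial>M) < \<infinity>"
    and fin2: "(\<integral>\<^sup>+x. ennreal (v x powr p) \<partial>M) < \<infinity>"
  shows "pos_strong M (\<lambda>x y. ennreal (v x) * ennreal (v y)) p"
proof -
  let ?A = "epow (\<integral>\<^sup>+x. ennreal (v x powr (p / (p - 1))) \<partial>M) (p - 1)" and ?B = "\<integral>\<^sup>+x. ennreal (v x powr p) \<partial>M"
  have "(\<integral>\<^sup>+x. epow (pos_op M (\<lambda>x y. ennreal (v x) * ennreal (v y)) g x) p \<partial>M) \<le> ?B * ?A * (\<integral>\<^sup>+x. epow (g x) p \<partial>M)"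
    if g [measurable]: "g \<in> borel_measurable M" for g
  proof -
    have "(\<integral>\<^sup>+x. epow (pos_op M (\<lambda>x y. ennreal (v x) * ennreal (v y)) g x) p \<partial>M)
      = (\<integral>\<^sup>+x. ennreal (v x powr p) * epow (\<integral>\<^sup>+y. ennreal (v y) * g y \<partial>M) p \<partial>M)"
      using v by (simp add: rank_one_pos_op[of "\<lambda>x. ennreal (v x)"] epow_mult epow_ennreal less_imp_le)
    also have "\<dots> = ?B * epow (\<integral>\<^sup>+y. ennreal (v y) * g y \<partial>M) p"
      by (rule nn_integral_multc) measurable
    also have "\<dots> \<le> ?B * (?A * (\<integral>\<^sup>+x. epow (g x) p \<partial>M))"
      by (intro mult_left_mono Hoelder_rank_one p v fin1) auto
    finally show ?thesis by (simp add: mult.assoc)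
  qed
  moreover have "?B * ?A < \<infinity>"
    using fin2 epow_less_top[OF fin1, of "p - 1"] by (simp add: ennreal_mult_less_top)
  ultimately show ?thesis unfolding pos_bounded_on_def by blast
qed

text \<open>The output is a multiple of \<open>v\<close>, so weak type asks for \<open>v\<close> in weak \<open>L\<^sup>p\<close> and, to pair with the input, in \<open>L\<^sup>q\<close> for
  the conjugate exponent \<open>q\<close>.\<close>

lemma rank_one_weak:
  fixes v :: "'a \<Rightarrow> real"
  assumes p: "1 < p" and [measurable]: "v \<in> borel_measurable M" and v: "\<And>x. 0 < v x"
    and fin1: "(\<integral>\<^sup>+x. ennreal (v x powr (p / (p - 1))) \<partial>M) < \<infinity>"
    and weak: "\<And>t. 0 < t \<Longrightarrow> ennreal (t powr p) * emeasure M {x\<in>space M. t < v x} \<le> D" and D: "D < \<infinity>"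
  shows "pos_weak M (\<lambda>x y. ennreal (v x) * ennreal (v y)) p"
proof -
  let ?A = "epow (\<integral>\<^sup>+x. ennreal (v x powr (p / (p - 1))) \<partial>M) (p - 1)"
  \<comment> \<open>\<open>D + 1\<close> instead of \<open>D\<close>, so that an infinite right-hand side stays infinite when \<open>D = 0\<close>\<close>
  have AD: "(D + 1) * ?A < \<infinity>"
    using D epow_less_top[OF fin1, of "p - 1"] by (simp add: ennreal_mult_less_top)
  have "ennreal (t powr p) * emeasure M {x\<in>space M. ennreal t < pos_op M (\<lambda>x y. ennreal (v x) * ennreal (v y)) g x}
       \<le> (D + 1) * ?A * (\<integral>\<^sup>+x. epow (g x) p \<partial>M)"
    if g [measurable]: "g \<in> borel_measurable M" and t: "t > 0" for g t
  proof -
    let ?I = "\<integral>\<^sup>+y. ennreal (v y) * g y \<partial>M"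
    have H: "epow ?I p \<le> ?A * (\<integral>\<^sup>+x. epow (g x) p \<partial>M)"
      by (intro Hoelder_rank_one p v fin1) auto
    have op: "pos_op M (\<lambda>x y. ennreal (v x) * ennreal (v y)) g x = ennreal (v x) * ?I" for x
      by (rule rank_one_pos_op[of "\<lambda>x. ennreal (v x)"]) measurable
    show ?thesis
    proof (cases "?I = \<infinity>")
      case True
      then have "?A * (\<integral>\<^sup>+x. epow (g x) p \<partial>M) = \<infinity>" using H by (simp add: top.extremum_unique)
      then show ?thesis by (simp add: mult.assoc ennreal_mult_top)
    next
      case False
      then obtain i where i: "?I = ennreal i" "i \<ge> 0" by (cases ?I) auto
      show ?thesis
      proof (cases "i = 0")
        case True
        then show ?thesis by (simp add: op i)
      next
        case False
        then have i0: "i > 0" using i by simp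
        have set: "{x\<in>space M. ennreal t < ennreal (v x) * ?I} = {x\<in>space M. t / i < v x}"
          using v t i0 by (auto simp: i divide_less_eq ennreal_less_iff less_imp_le simp flip: ennreal_mult)
        have "ennreal (t powr p) = ennreal (i powr p) * ennreal ((t / i) powr p)"
          using i0 t by (simp add: powr_divide flip: ennreal_mult)
        then have "ennreal (t powr p) * emeasure M {x\<in>space M. ennreal t < ennreal (v x) * ?I}
          = ennreal (i powr p) * (ennreal ((t / i) powr p) * emeasure M {x\<in>space M. t / i < v x})"
          by (simp only: set mult.assoc)
        also have "\<dots> \<le> ennreal (i powr p) * D"
          using t i0 by (intro mult_left_mono weak) auto
        also have "\<dots> \<le> (?A * (\<integral>\<^sup>+x. epow (g x) p \<partial>M)) * (D + 1)"
          using H i by (intro mult_mono) (auto simp: epow_ennreal)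
        finally show ?thesis by (simp add: op mult_ac)
      qed
    qed
  qed
  then show ?thesis using AD unfolding pos_weak_def by blast
qed

text \<open>The output is a multiple of \<open>v \<in> L\<^sup>p\<close>; only the coefficient \<open>\<integral>\<^sub>E v\<close> has to be compared with the measure of \<open>E\<close>.\<close>

lemma rank_one_restricted:
  fixes v :: "'a \<Rightarrow> real"
  assumes p: "1 < p" and [measurable]: "v \<in> borel_measurable M" and v: "\<And>x. 0 < v x"
    and fin2: "(\<integral>\<^sup>+x. ennreal (v x powr p) \<partial>M) < \<infinity>"
    and restr: "\<And>E. E \<in> sets M \<Longrightarrow> epow (\<integral>\<^sup>+x. ennreal (v x) * indicator E x \<partial>M) p \<le> D * emeasure M E" and D: "D < \<infinity>"
  shows "pos_restricted M (\<lambda>x y. ennreal (v x) * ennreal (v y)) p"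
proof -
  let ?B = "\<integral>\<^sup>+x. ennreal (v x powr p) \<partial>M"
  have "(\<integral>\<^sup>+x. epow (pos_op M (\<lambda>x y. ennreal (v x) * ennreal (v y)) g x) p \<partial>M) \<le> ?B * D * (\<integral>\<^sup>+x. epow (g x) p \<partial>M)"
    if g [measurable]: "g \<in> borel_measurable M" and gr: "g \<in> range indicator" for g
  proof -
    obtain E' where E': "g = indicator E'" using gr by auto
    define E where "E = E' \<inter> space M"
    have "{x\<in>space M. g x = 1} \<in> sets M" by measurable
    moreover have "{x\<in>space M. g x = 1} = E" by (auto simp: E_def E' indicator_def split: if_splits)
    ultimately have E [measurable]: "E \<in> sets M" by simp
    have gE: "g x = indicator E x" if "x \<in> space M" for x using that by (simp add: E_def E' indicator_def)
    have "(\<integral>\<^sup>+x. epow (pos_op M (\<lambda>x y. ennreal (v x) * ennreal (v y)) g x) p \<partial>M)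
      = (\<integral>\<^sup>+x. ennreal (v x powr p) * epow (\<integral>\<^sup>+y. ennreal (v y) * g y \<partial>M) p \<partial>M)"
      using v by (simp add: rank_one_pos_op[of "\<lambda>x. ennreal (v x)"] epow_mult epow_ennreal less_imp_le)
    also have "\<dots> = ?B * epow (\<integral>\<^sup>+y. ennreal (v y) * g y \<partial>M) p"
      by (rule nn_integral_multc) measurable
    also have "(\<integral>\<^sup>+y. ennreal (v y) * g y \<partial>M) = (\<integral>\<^sup>+y. ennreal (v y) * indicator E y \<partial>M)"
      by (intro nn_integral_cong) (simp add: gE)
    also have "?B * epow (\<integral>\<^sup>+y. ennreal (v y) * indicator E y \<partial>M) p \<le> ?B * (D * emeasure M E)"
      by (intro mult_left_mono restr) auto
    also have "emeasure M E = (\<integral>\<^sup>+x. epow (g x) p \<partial>M)"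
    proof -
      have "(\<integral>\<^sup>+x. epow (g x) p \<partial>M) = (\<integral>\<^sup>+x. indicator E x \<partial>M)"
        using epow_ennreal[of 1 p] by (intro nn_integral_cong) (auto simp: gE indicator_def)
      then show ?thesis by simp
    qed
    finally show ?thesis by (simp add: mult.assoc)
  qed
  moreover have "?B * D < \<infinity>"
    using fin2 D by (simp add: ennreal_mult_less_top)
  ultimately show ?thesis unfolding pos_bounded_on_def by blast
qed

section \<open>The model kernel on the weighted disc\<close>

text \<open>One factor of the measure that the polyhedron induces on the polydisc.\<close>

definition wdisc :: "nat \<Rightarrow> complex measure" where
  "wdisc \<kappa> = density disc (\<lambda>z. ennreal (cmod z ^ (2 * \<kappa> - 2)))"

lemma sets_wdisc [simp, measurable_cong]: "sets (wdisc \<kappa>) = sets borel" and space_wdisc [simp]: "space (wdisc \<kappa>) = UNIV"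
  by (simp_all add: wdisc_def)

lemma nn_integral_wdisc:
  "f \<in> borel_measurable borel \<Longrightarrow> (\<integral>\<^sup>+z. f z \<partial>wdisc \<kappa>) = (\<integral>\<^sup>+z. ennreal (cmod z ^ (2 * \<kappa> - 2)) * f z \<partial>disc)"
  unfolding wdisc_def by (subst nn_integral_density) auto

lemma nn_integral_wdisc_le:
  assumes [measurable]: "f \<in> borel_measurable borel"
  shows "(\<integral>\<^sup>+z. f z \<partial>wdisc \<kappa>) \<le> (\<integral>\<^sup>+z. f z \<partial>disc)"
proof -
  have "(\<integral>\<^sup>+z. ennreal (cmod z ^ (2 * \<kappa> - 2)) * f z \<partial>disc) \<le> (\<integral>\<^sup>+z. f z \<partial>disc)"
  proof (rule nn_integral_mono_AE, use AE_disc in eventually_elim)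
    fix z assume "z \<noteq> 0 \<and> cmod z < 1"
    then have "ennreal (cmod z ^ (2 * \<kappa> - 2)) \<le> 1" by (simp add: power_le_one ennreal_le_1)
    from mult_right_mono[OF this] show "ennreal (cmod z ^ (2 * \<kappa> - 2)) * f z \<le> f z" by simp
  qed
  then show ?thesis by (simp add: nn_integral_wdisc)
qed

lemma AE_wdisc: "AE z in wdisc \<kappa>. z \<noteq> 0 \<and> cmod z < 1"
  unfolding wdisc_def by (subst AE_density) (use AE_disc in auto)

lemma finite_measure_wdisc: "finite_measure (wdisc \<kappa>)"
proof
  have "emeasure (wdisc \<kappa>) UNIV = (\<integral>\<^sup>+z. 1 \<partial>wdisc \<kappa>)" by simp
  also have "\<dots> \<le> (\<integral>\<^sup>+z. 1 \<partial>disc)" by (rule nn_integral_wdisc_le) measurable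
  also have "\<dots> < \<infinity>" using finite_measure.emeasure_finite[OF finite_measure_disc, of UNIV] by (simp add: top.not_eq_extremum)
  finally show "emeasure (wdisc \<kappa>) (space (wdisc \<kappa>)) \<noteq> \<infinity>" by simp
qed

lemma sigma_finite_wdisc: "sigma_finite_measure (wdisc \<kappa>)"
  using finite_measure_wdisc by (simp add: finite_measure_def)

definition disc_kernel :: "nat \<Rightarrow> complex \<Rightarrow> complex \<Rightarrow> real" where
  "disc_kernel e x y = (if cmod x < 1 \<and> cmod y < 1 then 1 / (cmod (1 - (x * cnj y) ^ e))\<^sup>2 else 0)"

lemma disc_kernel_commute: "disc_kernel e x y = disc_kernel e y x"
proof -
  have "1 - (x * cnj y) ^ e = cnj (1 - (y * cnj x) ^ e)" by (simp add: mult.commute)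
  then have "cmod (1 - (x * cnj y) ^ e) = cmod (1 - (y * cnj x) ^ e)" by (metis complex_mod_cnj)
  then show ?thesis by (simp add: disc_kernel_def)
qed

lemma disc_kernel_nonneg: "0 \<le> disc_kernel e x y"
  by (simp add: disc_kernel_def)

lemma measurable_disc_kernel [measurable]:
  "case_prod (disc_kernel e) \<in> borel_measurable (borel \<Otimes>\<^sub>M borel)"
  unfolding disc_kernel_def by measurable

lemma measurable_disc_kernel' [measurable (raw)]:
  assumes [measurable]: "f \<in> borel_measurable M" "g \<in> borel_measurable M"
  shows "(\<lambda>x. disc_kernel e (f x) (g x)) \<in> borel_measurable M"
  unfolding disc_kernel_def by measurable

text \<open>The Schur test with powers of \<open>1 - |x|\<^sup>2\<close> as test functions. The constant is symmetric under
  \<open>b \<mapsto> 1 - b\<close>, so the two conditions of the test have the same constant; the weight of the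
  measure is at most one and only helps.\<close>

lemma disc_kernel_strong:
  assumes p: "1 < p" and e: "0 < e"
  shows "pos_strong (wdisc \<kappa>) (\<lambda>x y. ennreal (disc_kernel e x y)) p"
proof -
  define w :: "complex \<Rightarrow> real" where "w x = (if cmod x < 1 then 1 - (cmod x)\<^sup>2 else 1)" for x
  have [measurable]: "w \<in> borel_measurable borel" unfolding w_def by measurable
  have wpos: "0 < w x" for x by (auto simp: w_def abs_square_less_1)
  define C where "C = pi * (1 / (1 - 1 / p) + 1 / (1 / p))"
  have C: "C \<ge> 0" using p by (simp add: C_def)
  have bound: "(\<integral>\<^sup>+y. ennreal (disc_kernel e x y) * ennreal (w y powr - b) \<partial>wdisc \<kappa>) \<le> ennreal (C * w x powr - b)"
    if b: "0 < b" "b < 1" "1 / (1 - b) + 1 / b = 1 / (1 - 1 / p) + 1 / (1 / p)" for b x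
  proof (cases "cmod x < 1")
    case True
    have "(\<integral>\<^sup>+y. ennreal (disc_kernel e x y) * ennreal (w y powr - b) \<partial>wdisc \<kappa>)
        \<le> (\<integral>\<^sup>+y. ennreal (disc_kernel e x y) * ennreal (w y powr - b) \<partial>disc)"
      by (rule nn_integral_wdisc_le) measurable
    also have "\<dots> = (\<integral>\<^sup>+z. ennreal ((1 - (cmod z)\<^sup>2) powr - b) * ennreal (1 / (cmod (1 - (x * cnj z) ^ e))\<^sup>2) \<partial>disc)"
      by (rule nn_integral_cong_AE, use AE_disc in eventually_elim) (use True in \<open>simp add: disc_kernel_def w_def mult.commute\<close>)
    also have "\<dots> \<le> ennreal (pi * (1 / (1 - b) + 1 / b) * (1 - (cmod x)\<^sup>2) powr - b)"
      by (rule disc_kernel_test_bound[OF True e b(1,2)])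
    finally show ?thesis using True b(3) by (simp add: C_def w_def)
  qed (simp add: disc_kernel_def)
  show ?thesis
  proof (rule Schur_test[OF p sigma_finite_wdisc _ _ _ wpos C])
    show "(\<lambda>(x, y). ennreal (disc_kernel e x y)) \<in> borel_measurable (wdisc \<kappa> \<Otimes>\<^sub>M wdisc \<kappa>)" by measurable
    show "w \<in> borel_measurable (wdisc \<kappa>)" by measurable
    show "ennreal (disc_kernel e x y) = ennreal (disc_kernel e y x)" for x y by (simp add: disc_kernel_commute)
    show "(\<integral>\<^sup>+y. ennreal (disc_kernel e x y) * ennreal (w y powr - (1 / p)) \<partial>wdisc \<kappa>) \<le> ennreal (C * w x powr - (1 / p))" for x
      by (rule bound) (use p in auto)
    show "(\<integral>\<^sup>+y. ennreal (disc_kernel e x y) * ennreal (w y powr - (1 - 1 / p)) \<partial>wdisc \<kappa>) \<le> ennreal (C * w x powr - (1 - 1 / p))" for x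
      by (rule bound) (use p in auto)
  qed
qed

text \<open>One factor of the reciprocal of the Jacobian. The value at the origin, a null set, only keeps the function positive everywhere.\<close>

definition sing :: "nat \<Rightarrow> complex \<Rightarrow> real" where
  "sing \<kappa> x = (if x = 0 then 1 else 1 / cmod x ^ (\<kappa> - 1))"

lemma sing_pos: "0 < sing \<kappa> x" by (simp add: sing_def)

lemma measurable_sing [measurable]: "sing \<kappa> \<in> borel_measurable borel"
  unfolding sing_def[abs_def] by measurable

lemma sing_powr: assumes "x \<noteq> 0" "1 \<le> \<kappa>" shows "sing \<kappa> x powr s = cmod x powr (- (real \<kappa> - 1) * s)"
proof -
  have "sing \<kappa> x = cmod x powr (- (real \<kappa> - 1))"
    using assms powr_realpow[of "cmod x" "\<kappa> - 1"] by (simp add: sing_def powr_minus_divide of_nat_diff del: powr_diff minus_diff_eq)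
  then show ?thesis by (simp add: powr_powr)
qed

lemma weight_powr: assumes "x \<noteq> 0" "1 \<le> \<kappa>" shows "cmod x ^ (2 * \<kappa> - 2) = cmod x powr (2 * real \<kappa> - 2)"
  using assms powr_realpow[of "cmod x" "2 * \<kappa> - 2"] by (simp add: of_nat_diff)

text \<open>The radial integral \<open>\<integral> r powr (2\<kappa> - 2 - (\<kappa> - 1) s) \<cdot> r dr\<close> converges at the origin precisely under the assumption on
  \<open>s\<close>. The radius \<open>R\<close> is kept for the endpoint estimates.\<close>

lemma sing_integral_le:
  assumes \<kappa>: "1 \<le> \<kappa>" and R: "0 \<le> R" and s: "(real \<kappa> - 1) * s < 2 * real \<kappa>"
  shows "(\<integral>\<^sup>+x. ennreal (sing \<kappa> x powr s) * indicator {x. cmod x < R} x \<partial>wdisc \<kappa>)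
     \<le> ennreal (pi * (R powr (2 * real \<kappa> - (real \<kappa> - 1) * s) / (real \<kappa> - (real \<kappa> - 1) * s / 2)))"
proof -
  have "(\<integral>\<^sup>+x. ennreal (sing \<kappa> x powr s) * indicator {x. cmod x < R} x \<partial>wdisc \<kappa>)
     = (\<integral>\<^sup>+x. ennreal (cmod x ^ (2 * \<kappa> - 2)) * (ennreal (sing \<kappa> x powr s) * indicator {x. cmod x < R} x) \<partial>disc)"
    by (rule nn_integral_wdisc) measurable
  also have "\<dots> = (\<integral>\<^sup>+x. indicator {x. cmod x < R} x * ennreal (cmod x powr (2 * real \<kappa> - 2 - (real \<kappa> - 1) * s)) \<partial>disc)"
  proof (rule nn_integral_cong_AE, use AE_disc in eventually_elim)
    fix x :: complex assume "x \<noteq> 0 \<and> cmod x < 1"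
    then have "cmod x ^ (2 * \<kappa> - 2) * sing \<kappa> x powr s = cmod x powr (2 * real \<kappa> - 2 - (real \<kappa> - 1) * s)"
    proof -
      have "cmod x powr (2 * real \<kappa> - 2) * cmod x powr (- (real \<kappa> - 1) * s) = cmod x powr ((2 * real \<kappa> - 2) + (- (real \<kappa> - 1) * s))"
        by (rule powr_add[symmetric])
      also have "(2 * real \<kappa> - 2) + (- (real \<kappa> - 1) * s) = 2 * real \<kappa> - 2 - (real \<kappa> - 1) * s"
        by (simp add: algebra_simps)
      finally show ?thesis using \<open>x \<noteq> 0 \<and> cmod x < 1\<close> by (simp only: sing_powr[OF _ \<kappa>] weight_powr[OF _ \<kappa>] not_False_eq_True)
    qed
    then have "ennreal (cmod x ^ (2 * \<kappa> - 2)) * ennreal (sing \<kappa> x powr s) = ennreal (cmod x powr (2 * real \<kappa> - 2 - (real \<kappa> - 1) * s))"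
      by (subst ennreal_mult[symmetric]) auto
    then show "ennreal (cmod x ^ (2 * \<kappa> - 2)) * (ennreal (sing \<kappa> x powr s) * indicator {x. cmod x < R} x) =
        indicator {x. cmod x < R} x * ennreal (cmod x powr (2 * real \<kappa> - 2 - (real \<kappa> - 1) * s))"
      by (simp only: mult.assoc[symmetric]) (rule mult.commute)
  qed
  also have "\<dots> \<le> ennreal (pi * (R powr (2 * real \<kappa> - 2 - (real \<kappa> - 1) * s + 2) / ((2 * real \<kappa> - 2 - (real \<kappa> - 1) * s) / 2 + 1)))"
    by (rule nn_integral_disc_powr_le) (use s R in auto)
  also have "(2 * real \<kappa> - 2 - (real \<kappa> - 1) * s) / 2 + 1 = real \<kappa> - (real \<kappa> - 1) * s / 2"
    by (simp add: field_simps)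
  also have "2 * real \<kappa> - 2 - (real \<kappa> - 1) * s + 2 = 2 * real \<kappa> - (real \<kappa> - 1) * s" by simp
  finally show ?thesis .
qed

lemma sing_integral_finite:
  assumes \<kappa>: "1 \<le> \<kappa>" and s: "(real \<kappa> - 1) * s < 2 * real \<kappa>"
  shows "(\<integral>\<^sup>+x. ennreal (sing \<kappa> x powr s) \<partial>wdisc \<kappa>) < \<infinity>"
proof -
  have "(\<integral>\<^sup>+x. ennreal (sing \<kappa> x powr s) \<partial>wdisc \<kappa>) = (\<integral>\<^sup>+x. ennreal (sing \<kappa> x powr s) * indicator {x. cmod x < 1} x \<partial>wdisc \<kappa>)"
    by (rule nn_integral_cong_AE, use AE_wdisc in eventually_elim) simp
  also have "\<dots> < \<infinity>" using sing_integral_le[OF \<kappa> _ s, of 1] by (rule le_less_trans) simp_all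
  finally show ?thesis .
qed

definition model_kernel :: "nat \<Rightarrow> nat \<Rightarrow> complex \<Rightarrow> complex \<Rightarrow> ennreal" where
  "model_kernel \<kappa> e x y = ennreal (sing \<kappa> x * sing \<kappa> y * disc_kernel e x y)"

lemma measurable_model_kernel [measurable]:
  "case_prod (model_kernel \<kappa> e) \<in> borel_measurable (wdisc \<kappa> \<Otimes>\<^sub>M wdisc \<kappa>)"
  unfolding model_kernel_def by measurable

text \<open>The two singularities of the model kernel do not interact. If both points are at distance at least
  \<open>1/2\<close> from the origin, then \<open>sing\<close> is bounded; otherwise \<open>|x cnj y| \<le> 1/2\<close> and the disc kernel is bounded by \<open>4\<close>.\<close>

lemma model_kernel_le:
  assumes e: "0 < e"
  shows "model_kernel \<kappa> e x y \<le> ennreal (4 ^ \<kappa> * 4) * (ennreal (disc_kernel e x y) + ennreal (sing \<kappa> x) * ennreal (sing \<kappa> y))"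
proof -
  have "sing \<kappa> x * sing \<kappa> y * disc_kernel e x y \<le> 4 ^ \<kappa> * 4 * (disc_kernel e x y + sing \<kappa> x * sing \<kappa> y)"
  proof (cases "1 / 2 \<le> cmod x \<and> 1 / 2 \<le> cmod y")
    case True
    have s: "sing \<kappa> z \<le> 2 ^ \<kappa>" if "1 / 2 \<le> cmod z" for z
    proof -
      have "sing \<kappa> z = (1 / cmod z) ^ (\<kappa> - 1)" using that by (auto simp: sing_def power_one_over)
      also have "\<dots> \<le> 2 ^ (\<kappa> - 1)" using that by (intro power_mono) (auto simp: divide_simps)
      also have "\<dots> \<le> 2 ^ \<kappa>" by (intro power_increasing) auto
      finally show ?thesis .
    qed
    have "sing \<kappa> x * sing \<kappa> y \<le> 2 ^ \<kappa> * 2 ^ \<kappa>"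
      using True by (intro mult_mono s) (auto intro: less_imp_le[OF sing_pos])
    also have "\<dots> = 4 ^ \<kappa>" by (simp flip: power_mult_distrib)
    finally have "sing \<kappa> x * sing \<kappa> y * disc_kernel e x y \<le> 4 ^ \<kappa> * disc_kernel e x y"
      by (intro mult_right_mono disc_kernel_nonneg)
    also have "\<dots> \<le> 4 ^ \<kappa> * 4 * (disc_kernel e x y + sing \<kappa> x * sing \<kappa> y)"
      unfolding mult.assoc
      using disc_kernel_nonneg[of e x y] sing_pos[of \<kappa> x] sing_pos[of \<kappa> y]
      by (intro mult_left_mono) (auto intro: add_increasing2)
    finally show ?thesis .
  next
    case False
    have "disc_kernel e x y \<le> 4"
    proof (cases "cmod x < 1 \<and> cmod y < 1")
      case True
      have "cmod x * cmod y \<le> 1 / 2"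
      proof (cases "cmod x < 1 / 2")
        case t: True
        have "cmod x * cmod y \<le> 1 / 2 * 1" using t True by (intro mult_mono) auto
        then show ?thesis by simp
      next
        case f: False
        have "cmod x * cmod y \<le> 1 * (1 / 2)" using f False True by (intro mult_mono) auto
        then show ?thesis by simp
      qed
      moreover have "(cmod x * cmod y) ^ e \<le> cmod x * cmod y"
        using power_decreasing[of 1 e "cmod x * cmod y"] e True by (simp add: mult_le_one)
      ultimately have "cmod ((x * cnj y) ^ e) \<le> 1 / 2" by (simp add: norm_power norm_mult)
      then have "1 / 2 \<le> cmod (1 - (x * cnj y) ^ e)"
        using norm_triangle_ineq2[of 1 "(x * cnj y) ^ e"] by simp
      then have "(1 / 2)\<^sup>2 \<le> (cmod (1 - (x * cnj y) ^ e))\<^sup>2" by (intro power_mono) auto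
      then have "1 / (cmod (1 - (x * cnj y) ^ e))\<^sup>2 \<le> 1 / (1 / 2)\<^sup>2" by (intro divide_left_mono) (auto simp: zero_less_mult_iff)
      then show ?thesis by (simp add: disc_kernel_def power2_eq_square)
    qed (auto simp: disc_kernel_def)
    then have "sing \<kappa> x * sing \<kappa> y * disc_kernel e x y \<le> sing \<kappa> x * sing \<kappa> y * 4"
      using sing_pos[of \<kappa> x] sing_pos[of \<kappa> y] by (intro mult_left_mono) auto
    also have "\<dots> \<le> 4 ^ \<kappa> * (4 * (disc_kernel e x y + sing \<kappa> x * sing \<kappa> y))"
    proof -
      have "1 * (4 * (sing \<kappa> x * sing \<kappa> y)) \<le> 4 ^ \<kappa> * (4 * (disc_kernel e x y + sing \<kappa> x * sing \<kappa> y))"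
        using disc_kernel_nonneg[of e x y] sing_pos[of \<kappa> x] sing_pos[of \<kappa> y]
        by (intro mult_mono) auto
      then show ?thesis by (simp add: mult_ac)
    qed
    finally show ?thesis by (simp only: mult.assoc)
  qed
  then show ?thesis
    using disc_kernel_nonneg[of e x y] sing_pos[of \<kappa> x] sing_pos[of \<kappa> y] unfolding model_kernel_def
    by (simp add: ennreal_leI less_imp_le flip: ennreal_mult ennreal_plus)
qed

text \<open>The two bounds on \<open>p\<close> say that \<open>sing \<kappa>\<close> lies in \<open>L\<^sup>q\<close>, for the conjugate exponent \<open>q\<close>, and in \<open>L\<^sup>p\<close>.\<close>

lemma model_kernel_strong:
  assumes \<kappa>: "1 \<le> \<kappa>" and e: "0 < e" and p: "2 * real \<kappa> / (real \<kappa> + 1) < p" "p * (real \<kappa> - 1) < 2 * real \<kappa>"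
  shows "pos_strong (wdisc \<kappa>) (model_kernel \<kappa> e) p"
proof (rule pos_bounded_on_sum[OF sigma_finite_wdisc _ _ model_kernel_le[OF e]])
  have "1 \<le> 2 * real \<kappa> / (real \<kappa> + 1)" using \<kappa> by simp
  then have p1: "1 < p" using p(1) by (rule le_less_trans)
  then show "pos_strong (wdisc \<kappa>) (\<lambda>x y. ennreal (disc_kernel e x y)) p"
    by (intro disc_kernel_strong e)
  show "pos_strong (wdisc \<kappa>) (\<lambda>x y. ennreal (sing \<kappa> x) * ennreal (sing \<kappa> y)) p"
  proof (rule rank_one_strong[OF p1 _ sing_pos])
    have "2 * real \<kappa> < p * (real \<kappa> + 1)" using p(1) by (simp add: divide_less_eq)
    then have "(real \<kappa> - 1) * (p / (p - 1)) < 2 * real \<kappa>" using p1 by (simp add: divide_less_eq algebra_simps)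
    then show "(\<integral>\<^sup>+x. ennreal (sing \<kappa> x powr (p / (p - 1))) \<partial>wdisc \<kappa>) < \<infinity>" by (rule sing_integral_finite[OF \<kappa>])
    show "(\<integral>\<^sup>+x. ennreal (sing \<kappa> x powr p) \<partial>wdisc \<kappa>) < \<infinity>"
      by (rule sing_integral_finite[OF \<kappa>]) (use p in \<open>simp add: mult.commute\<close>)
  qed measurable
  show "0 \<le> p" using p1 by simp
qed (simp, measurable)

text \<open>At the right endpoint \<open>sing \<kappa>\<close> just fails to lie in \<open>L\<^sup>q\<close>, but it lies in weak \<open>L\<^sup>q\<close>: the set \<open>{sing > t}\<close> is a
  disc whose measure is \<open>\<pi> / \<kappa> \<cdot> t powr -q\<close> if it is contained in the unit disc.\<close>

lemma model_kernel_weak: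
  assumes \<kappa>: "2 \<le> \<kappa>" and e: "0 < e"
  shows "pos_weak (wdisc \<kappa>) (model_kernel \<kappa> e) (2 * real \<kappa> / (real \<kappa> - 1))"
proof -
  define q where "q = 2 * real \<kappa> / (real \<kappa> - 1)"
  have k1: "1 \<le> \<kappa>" using \<kappa> by simp
  have q1: "1 < q" using \<kappa> by (simp add: q_def)
  have rk: "real \<kappa> - 1 > 0" using \<kappa> by simp
  have "pos_weak (wdisc \<kappa>) (\<lambda>x y. ennreal (sing \<kappa> x) * ennreal (sing \<kappa> y)) q"
  proof (rule rank_one_weak[OF q1 _ sing_pos])
    have "q - 1 = (real \<kappa> + 1) / (real \<kappa> - 1)" using rk by (simp add: q_def field_simps)
    then have "q / (q - 1) = 2 * real \<kappa> / (real \<kappa> + 1)" using rk by (simp add: q_def)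
    moreover have "(real \<kappa> - 1) * (2 * real \<kappa> / (real \<kappa> + 1)) < 2 * real \<kappa>" using rk by (simp add: divide_less_eq algebra_simps)
    ultimately show "(\<integral>\<^sup>+x. ennreal (sing \<kappa> x powr (q / (q - 1))) \<partial>wdisc \<kappa>) < \<infinity>"
      by (simp only:) (rule sing_integral_finite[OF k1])
    show "ennreal (t powr q) * emeasure (wdisc \<kappa>) {x\<in>space (wdisc \<kappa>). t < sing \<kappa> x} \<le> ennreal (pi / real \<kappa>)" if t: "0 < t" for t
    proof -
      define R where "R = t powr (- 1 / (real \<kappa> - 1))"
      have R: "R > 0" using t by (simp add: R_def)
      have "emeasure (wdisc \<kappa>) {x\<in>space (wdisc \<kappa>). t < sing \<kappa> x} = (\<integral>\<^sup>+x. indicator {x. t < sing \<kappa> x} x \<partial>wdisc \<kappa>)"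
        by (subst nn_integral_indicator) auto
      also have "\<dots> \<le> (\<integral>\<^sup>+x. ennreal (sing \<kappa> x powr 0) * indicator {x. cmod x < R} x \<partial>wdisc \<kappa>)"
      proof (rule nn_integral_mono_AE, use AE_wdisc in eventually_elim)
        fix x :: complex assume x: "x \<noteq> 0 \<and> cmod x < 1"
        have "cmod x < R" if "t < sing \<kappa> x"
        proof -
          have "sing \<kappa> x powr (- 1 / (real \<kappa> - 1)) < t powr (- 1 / (real \<kappa> - 1))"
            using that t rk by (intro powr_less_mono2_neg) auto
          moreover have "- (real \<kappa> - 1) * (- 1 / (real \<kappa> - 1)) = 1" using rk by (simp add: field_simps)
          ultimately show ?thesis
            using x k1 by (simp only: R_def sing_powr not_False_eq_True powr_one norm_ge_zero)
                qed
        then show "indicator {x. t < sing \<kappa> x} x \<le> ennreal (sing \<kappa> x powr 0) * indicator {x. cmod x < R} x"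
          using sing_pos[of \<kappa> x] by (auto simp: indicator_def)
      qed
      also have "\<dots> \<le> ennreal (pi * (R powr (2 * real \<kappa> - (real \<kappa> - 1) * 0) / (real \<kappa> - (real \<kappa> - 1) * 0 / 2)))"
        by (rule sing_integral_le[OF k1]) (use R k1 in auto)
      also have "R powr (2 * real \<kappa> - (real \<kappa> - 1) * 0) = t powr (- q)"
        using rk by (simp add: R_def powr_powr q_def)
      finally have "ennreal (t powr q) * emeasure (wdisc \<kappa>) {x\<in>space (wdisc \<kappa>). t < sing \<kappa> x}
          \<le> ennreal (t powr q) * ennreal (pi * (t powr (- q) / (real \<kappa> - (real \<kappa> - 1) * 0 / 2)))"
        by (rule mult_left_mono) simp
      also have "\<dots> = ennreal (pi / real \<kappa>)"
        using t by (simp add: powr_minus_divide flip: ennreal_mult)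
      finally show ?thesis .
    qed
  qed auto
  moreover have "pos_weak (wdisc \<kappa>) (\<lambda>x y. ennreal (disc_kernel e x y)) q"
    by (rule pos_strong_imp_weak[OF sigma_finite_wdisc _ _ disc_kernel_strong[OF q1 e]]) (use q1 in \<open>auto, measurable\<close>)
  ultimately have "pos_weak (wdisc \<kappa>) (model_kernel \<kappa> e) q"
    by (intro pos_weak_sum[OF sigma_finite_wdisc _ _ model_kernel_le[OF e]]) (use q1 in \<open>auto, measurable\<close>)
  then show ?thesis by (simp add: q_def)
qed

text \<open>At the left endpoint the conjugate exponent is critical. Let \<open>R\<close> be such that \<open>R powr (2\<kappa>)\<close> is the
  measure of \<open>E\<close>, so that the disc of radius \<open>R\<close> and \<open>E\<close> have comparable measures; integrate \<open>sing\<close> exactly over this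
  disc and bound it by its value at radius \<open>R\<close> on the rest of \<open>E\<close>.\<close>

lemma model_kernel_restricted:
  assumes \<kappa>: "2 \<le> \<kappa>" and e: "0 < e"
  shows "pos_restricted (wdisc \<kappa>) (model_kernel \<kappa> e) (2 * real \<kappa> / (real \<kappa> + 1))"
proof -
  define p where "p = 2 * real \<kappa> / (real \<kappa> + 1)"
  have k1: "1 \<le> \<kappa>" using \<kappa> by simp
  have p1: "1 < p" using \<kappa> by (simp add: p_def)
  have rk: "real \<kappa> - 1 > 0" using \<kappa> by simp
  have "pos_restricted (wdisc \<kappa>) (\<lambda>x y. ennreal (sing \<kappa> x) * ennreal (sing \<kappa> y)) p"
  proof (rule rank_one_restricted[OF p1 _ sing_pos])
    have "(real \<kappa> - 1) * p < 2 * real \<kappa>" using rk by (simp add: p_def divide_less_eq algebra_simps)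
    then show "(\<integral>\<^sup>+x. ennreal (sing \<kappa> x powr p) \<partial>wdisc \<kappa>) < \<infinity>"
      by (rule sing_integral_finite[OF k1])
    show "epow (\<integral>\<^sup>+x. ennreal (sing \<kappa> x) * indicator E x \<partial>wdisc \<kappa>) p \<le> ennreal ((1 + pi) powr p) * emeasure (wdisc \<kappa>) E"
      if "E \<in> sets (wdisc \<kappa>)" for E
    proof (cases "emeasure (wdisc \<kappa>) E = 0")
      case True
      then have "AE x in wdisc \<kappa>. ennreal (sing \<kappa> x) * indicator E x = 0"
        using that by (intro AE_I[of _ _ E]) (auto simp: indicator_def)
      then have "(\<integral>\<^sup>+x. ennreal (sing \<kappa> x) * indicator E x \<partial>wdisc \<kappa>) = (\<integral>\<^sup>+x. 0 \<partial>wdisc \<kappa>)"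
        by (rule nn_integral_cong_AE)
      then show ?thesis by simp
    next
      case False
      have [measurable]: "E \<in> sets borel" using that by simp
      obtain m where m: "emeasure (wdisc \<kappa>) E = ennreal m" "m \<ge> 0"
        using finite_measure.emeasure_finite[OF finite_measure_wdisc, of \<kappa> E] by (cases "emeasure (wdisc \<kappa>) E") auto
      have m0: "m > 0" using False m by (cases "m = 0") auto
      define R where "R = m powr (1 / (2 * real \<kappa>))"
      have R: "R > 0" using m0 by (simp add: R_def)
      define S where "S = m powr ((real \<kappa> + 1) / (2 * real \<kappa>))"
      have S: "S \<ge> 0" by (simp add: S_def)
      have RS: "R powr (real \<kappa> + 1) = S" by (simp add: R_def S_def powr_powr)
      have RS2: "R powr (- (real \<kappa> - 1)) * m = S"
      proof -
        have "R powr (- (real \<kappa> - 1)) * m = m powr (- (real \<kappa> - 1) / (2 * real \<kappa>)) * m powr 1"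
          using m0 by (simp add: R_def powr_powr)
        also have "\<dots> = m powr (- (real \<kappa> - 1) / (2 * real \<kappa>) + 1)" by (simp only: powr_add)
        also have "- (real \<kappa> - 1) / (2 * real \<kappa>) + 1 = (real \<kappa> + 1) / (2 * real \<kappa>)"
          using k1 by (simp add: field_simps)
        finally show ?thesis by (simp add: S_def)
      qed
      have "(\<integral>\<^sup>+x. ennreal (sing \<kappa> x) * indicator E x \<partial>wdisc \<kappa>)
         \<le> (\<integral>\<^sup>+x. ennreal (sing \<kappa> x powr 1) * indicator {x. cmod x < R} x + ennreal (R powr (- (real \<kappa> - 1))) * indicator E x \<partial>wdisc \<kappa>)"
      proof (rule nn_integral_mono_AE, use AE_wdisc in eventually_elim)
        fix x :: complex assume x: "x \<noteq> 0 \<and> cmod x < 1"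
        have s1: "sing \<kappa> x powr 1 = sing \<kappa> x" using sing_pos[of \<kappa> x] by simp
        show "ennreal (sing \<kappa> x) * indicator E x \<le> ennreal (sing \<kappa> x powr 1) * indicator {x. cmod x < R} x + ennreal (R powr (- (real \<kappa> - 1))) * indicator E x"
        proof (cases "cmod x < R")
          case True
          then show ?thesis by (simp add: abs_of_pos[OF sing_pos] indicator_def)
        next
          case False
          have "sing \<kappa> x = cmod x powr (- (real \<kappa> - 1))" using sing_powr[of x \<kappa> 1] x k1 s1 by simp
          also have "\<dots> \<le> R powr (- (real \<kappa> - 1))" using False R rk by (intro powr_mono2') auto
          finally show ?thesis using False by (simp add: indicator_def ennreal_leI)
        qed
      qed
      also have "\<dots> = (\<integral>\<^sup>+x. ennreal (sing \<kappa> x powr 1) * indicator {x. cmod x < R} x \<partial>wdisc \<kappa>) + ennreal (R powr (- (real \<kappa> - 1))) * emeasure (wdisc \<kappa>) E"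
        by (subst nn_integral_add) (auto simp: nn_integral_cmult_indicator)
      also have "\<dots> \<le> ennreal (pi * (R powr (2 * real \<kappa> - (real \<kappa> - 1) * 1) / (real \<kappa> - (real \<kappa> - 1) * 1 / 2))) + ennreal (R powr (- (real \<kappa> - 1))) * ennreal m"
        unfolding m by (intro add_mono sing_integral_le[OF k1]) (use R rk in auto)
      also have "\<dots> \<le> ennreal ((1 + pi) * S)"
      proof -
        have "2 * real \<kappa> - (real \<kappa> - 1) * 1 = real \<kappa> + 1" "real \<kappa> - (real \<kappa> - 1) * 1 / 2 = (real \<kappa> + 1) / 2" by (auto simp: field_simps)
        then have "pi * (R powr (2 * real \<kappa> - (real \<kappa> - 1) * 1) / (real \<kappa> - (real \<kappa> - 1) * 1 / 2)) = pi * (S / ((real \<kappa> + 1) / 2))"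
          by (simp only: RS)
        also have "\<dots> \<le> pi * S" using S rk by (intro mult_left_mono) (auto simp: divide_le_eq intro!: mult_left_mono)
        finally have "pi * (R powr (2 * real \<kappa> - (real \<kappa> - 1) * 1) / (real \<kappa> - (real \<kappa> - 1) * 1 / 2)) + R powr (- (real \<kappa> - 1)) * m \<le> (1 + pi) * S"
          unfolding RS2 by (simp add: algebra_simps)
        then show ?thesis using m0 rk by (simp add: ennreal_leI flip: ennreal_mult ennreal_plus)
      qed
      finally have "epow (\<integral>\<^sup>+x. ennreal (sing \<kappa> x) * indicator E x \<partial>wdisc \<kappa>) p \<le> epow (ennreal ((1 + pi) * S)) p"
        using p1 by (intro epow_mono) auto
      also have "\<dots> = ennreal ((1 + pi) powr p * S powr p)" using S pi_ge_zero by (simp add: epow_ennreal powr_mult)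
      also have "S powr p = m" using m0 k1 by (simp add: S_def powr_powr p_def)
      finally show ?thesis using m by (simp add: ennreal_mult)
    qed
  qed auto
  moreover have "pos_restricted (wdisc \<kappa>) (\<lambda>x y. ennreal (disc_kernel e x y)) p"
    using disc_kernel_strong[OF p1 e, of \<kappa>] unfolding pos_bounded_on_def by blast
  ultimately have "pos_restricted (wdisc \<kappa>) (model_kernel \<kappa> e) p"
    by (intro pos_bounded_on_sum[OF sigma_finite_wdisc _ _ model_kernel_le[OF e]]) (use p1 in \<open>auto, measurable\<close>)
  then show ?thesis by (simp add: p_def)
qed

section \<open>The reproducing formula on the disc\<close>

text \<open>On the circle of radius \<open>|y|\<close> the conjugate of \<open>cis \<theta> y\<close> is a rational function of \<open>cis \<theta>\<close>, and Cauchy's formula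
  for the first derivative of \<open>w \<mapsto> w H(y w)\<close> evaluates the integral. The result is the derivative of
  \<open>s \<mapsto> s H(x s)\<close> at \<open>s = |y|\<^sup>2\<close>, which makes the remaining radial integral elementary.\<close>

lemma circle_reproducing:
  assumes H: "H holomorphic_on ball 0 1" and x: "cmod x < 1" and y: "cmod y < 1"
  defines "t \<equiv> complex_of_real ((cmod y)\<^sup>2)"
  shows "((\<lambda>\<theta>. H (cis \<theta> * y) / (1 - x * cnj (cis \<theta> * y))\<^sup>2) has_integral
            (2 * of_real pi * (H (x * t) + x * t * deriv H (x * t)))) {0..2*pi}"
proof -
  define w0 where "w0 = x * cnj y"
  have "cmod x * cmod y < 1 * 1" using x y by (intro mult_strict_mono) auto
  then have w0: "cmod w0 < 1" by (simp add: w0_def norm_mult)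
  have yw0: "y * w0 = x * t" using complex_norm_square[of y] by (simp add: w0_def t_def mult_ac)
  have inb: "y * w \<in> ball 0 1" if "w \<in> cball 0 1" for w
  proof -
    have "cmod y * cmod w \<le> cmod y" using that by (simp add: mult_left_le)
    then show ?thesis using y by (simp add: norm_mult)
  qed
  let ?f = "\<lambda>w. w * H (y * w)"
  have "(H \<circ> (\<lambda>w. y * w)) holomorphic_on cball 0 1"
    by (rule holomorphic_on_compose_gen[OF _ H]) (use inb in \<open>auto intro!: holomorphic_intros\<close>)
  then have holf: "?f holomorphic_on cball 0 1"
    by (intro holomorphic_intros) (simp add: o_def)
  have cont: "continuous_on (cball 0 1) ?f" by (rule holomorphic_on_imp_continuous_on[OF holf])
  have holb: "?f holomorphic_on ball 0 1" by (rule holomorphic_on_subset[OF holf ball_subset_cball])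
  have w0b: "w0 \<in> ball 0 1" using w0 by simp
  note C = Cauchy_derivative_integral_circlepath[OF cont holb w0b]
  have xt: "x * t \<in> ball 0 1" using inb[of w0] w0 yw0 by simp
  have "(H has_field_derivative deriv H (x * t)) (at (x * t))"
    by (rule holomorphic_derivI[OF H _ xt]) simp
  then have "(H has_field_derivative deriv H (x * t)) (at (y * w0))" by (simp only: yw0)
  then have "((\<lambda>w. H (y * w)) has_field_derivative (deriv H (x * t) * y)) (at w0)"
    by (rule DERIV_chain2) (auto intro!: derivative_eq_intros)
  then have "(?f has_field_derivative (H (x * t) + x * t * deriv H (x * t))) (at w0)"
  proof -
    assume *: "((\<lambda>w. H (y * w)) has_field_derivative (deriv H (x * t) * y)) (at w0)"
    have **: "deriv H (x * t) * y * w0 = x * t * deriv H (x * t)"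
      by (simp only: mult.assoc yw0) (simp only: mult_ac)
    then show ?thesis using DERIV_mult[OF DERIV_ident *] by (simp only: ** yw0 mult_1)
  qed
  from DERIV_unique[OF this C(2)]
  have "contour_integral (circlepath 0 1) (\<lambda>u. ?f u / (u - w0)\<^sup>2) = 2 * of_real pi * \<i> * (H (x * t) + x * t * deriv H (x * t))"
    by simp
  then have "((\<lambda>u. ?f u / (u - w0)\<^sup>2) has_contour_integral (2 * of_real pi * \<i> * (H (x * t) + x * t * deriv H (x * t)))) (circlepath 0 1)"
    using has_contour_integral_integral[OF C(1)] by simp
  from circlepath_unit_has_integral[OF this]
  have "((\<lambda>\<theta>. cis \<theta> * H (y * cis \<theta>) / (cis \<theta> - w0)\<^sup>2 * cis \<theta>) has_integral (2 * of_real pi * (H (x * t) + x * t * deriv H (x * t)))) {0..2*pi}" .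
  moreover have "cis \<theta> * H (y * cis \<theta>) / (cis \<theta> - w0)\<^sup>2 * cis \<theta> = H (cis \<theta> * y) / (1 - x * cnj (cis \<theta> * y))\<^sup>2" for \<theta>
  proof -
    have e: "cis \<theta> - w0 = cis \<theta> * (1 - x * cnj (cis \<theta> * y))"
    proof -
      have "cis \<theta> * cnj (cis \<theta>) = 1" by (simp add: cis_cnj cis_mult)
      then have "cis \<theta> * (x * (cnj (cis \<theta>) * cnj y)) = x * cnj y" by (metis mult.assoc mult.commute mult_1)
      then show ?thesis by (simp only: w0_def right_diff_distrib complex_cnj_mult mult_1_right)
    qed
    have "c * H (y * c) / (c * d)\<^sup>2 * c = H (c * y) / d\<^sup>2" if "c \<noteq> 0" for c d
      using that by (simp add: power2_eq_square mult.commute[of y])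
    then show ?thesis unfolding e by simp
  qed
  ultimately show ?thesis by simp
qed

lemma disc_norm_ge:
  assumes "cmod x < 1" "cmod y < 1"
  shows "1 - cmod x \<le> cmod (1 - x * cnj y)"
proof -
  have "cmod x * cmod y \<le> cmod x" using assms by (simp add: mult_left_le)
  then show ?thesis using norm_triangle_ineq2[of 1 "x * cnj y"] by (simp add: norm_mult)
qed

lemma integrable_disc_kernel:
  assumes H: "integrable disc H" and x: "cmod x < 1"
  shows "integrable disc (\<lambda>y. H y / (1 - x * cnj y)\<^sup>2)"
proof (rule Bochner_Integration.integrable_bound)
  have [measurable]: "H \<in> borel_measurable borel" using borel_measurable_integrable[OF H] by simp
  show "integrable disc (\<lambda>y. cmod (H y) / (1 - cmod x)\<^sup>2)" using H by auto
  show "(\<lambda>y. H y / (1 - x * cnj y)\<^sup>2) \<in> borel_measurable disc" by measurable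
  show "AE y in disc. norm (H y / (1 - x * cnj y)\<^sup>2) \<le> norm (cmod (H y) / (1 - cmod x)\<^sup>2)"
    using AE_disc
  proof eventually_elim
    fix y assume y: "y \<noteq> 0 \<and> cmod y < 1"
    have "(1 - cmod x)\<^sup>2 \<le> (cmod (1 - x * cnj y))\<^sup>2"
      using disc_norm_ge[OF x] y x by (intro power_mono) auto
    moreover have "0 < (1 - cmod x)\<^sup>2" using x by simp
    ultimately have "cmod (H y) / (cmod (1 - x * cnj y))\<^sup>2 \<le> cmod (H y) / (1 - cmod x)\<^sup>2"
      by (intro divide_left_mono mult_pos_pos) (simp_all only: norm_ge_zero, linarith?)
    then show "norm (H y / (1 - x * cnj y)\<^sup>2) \<le> norm (cmod (H y) / (1 - cmod x)\<^sup>2)"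
      by (simp add: norm_divide norm_power)
  qed
qed

text \<open>Integrate over circles first; in the variable \<open>t = |y|\<^sup>2\<close> the radial integral is that of the derivative of
  \<open>t H(x t)\<close> over \<open>[0, 1]\<close>.\<close>

lemma disc_reproducing:
  assumes H: "H holomorphic_on ball 0 1" and int: "integrable disc H" and x: "cmod x < 1"
  shows "(\<integral>y. H y / (1 - x * cnj y)\<^sup>2 \<partial>disc) = of_real pi * H x"
proof -
  have Hm [measurable]: "H \<in> borel_measurable borel" using borel_measurable_integrable[OF int] by simp
  interpret D: sigma_finite_measure disc by (rule sigma_finite_disc)
  interpret P: pair_sigma_finite "lborel :: real measure" disc by unfold_locales
  define F where "F y = H y / (1 - x * cnj y)\<^sup>2" for y
  have Fm [measurable]: "F \<in> borel_measurable borel" unfolding F_def by measurable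
  have Fi: "integrable disc F" unfolding F_def by (rule integrable_disc_kernel[OF int x])
  let ?K = "\<lambda>\<theta> y. indicator {0..2*pi} \<theta> *\<^sub>R F (cis \<theta> * y)"
  have Ki: "integrable (lborel \<Otimes>\<^sub>M disc) (case_prod ?K)"
    unfolding integrable_iff_bounded
  proof
    show "case_prod ?K \<in> borel_measurable (lborel \<Otimes>\<^sub>M disc)" by measurable
    have "(\<integral>\<^sup>+z. ennreal (norm (case_prod ?K z)) \<partial>(lborel \<Otimes>\<^sub>M disc))
      = (\<integral>\<^sup>+y. \<integral>\<^sup>+\<theta>. ennreal (norm (?K \<theta> y)) \<partial>lborel \<partial>disc)"
      by (subst P.nn_integral_snd[symmetric]) auto
    also have "\<dots> = (\<integral>\<^sup>+y. (\<integral>\<^sup>+\<theta>. indicator {0..2*pi} \<theta> * ennreal (norm (F (cis (1 * \<theta>) * y))) \<partial>lborel) \<partial>disc)"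
      by (intro nn_integral_cong) (auto simp: indicator_def)
    also have "\<dots> = ennreal (2 * pi) * (\<integral>\<^sup>+y. ennreal (norm (F y)) \<partial>disc)"
      by (rule nn_integral_disc_rotation_average[symmetric]) measurable
    also have "\<dots> < \<infinity>" using Fi by (auto simp: integrable_iff_bounded ennreal_mult_less_top)
    finally show "(\<integral>\<^sup>+z. ennreal (norm (case_prod ?K z)) \<partial>(lborel \<Otimes>\<^sub>M disc)) < \<infinity>" .
  qed
  define G where "G t = H (x * of_real t) + x * of_real t * deriv H (x * of_real t)" for t :: real
  have rot: "(\<integral>y. F (cis \<theta> * y) \<partial>disc) = (\<integral>y. F y \<partial>disc)" for \<theta>
  proof -
    have "(\<integral>y. F (cis \<theta> * y) \<partial>disc) = (\<integral>y. F y \<partial>distr disc borel (\<lambda>y. cis \<theta> * y))"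
      by (rule integral_distr[symmetric]) auto
    then show ?thesis by (simp add: disc_rotate)
  qed
  have "(\<integral>\<theta>. (\<integral>y. ?K \<theta> y \<partial>disc) \<partial>lborel) = (\<integral>\<theta>. indicator {0..2*pi} \<theta> *\<^sub>R (\<integral>y. F y \<partial>disc) \<partial>lborel)"
    by (simp add: rot)
  also have "\<dots> = (2 * pi) *\<^sub>R (\<integral>y. F y \<partial>disc)"
    by (subst integral_scaleR_left) (auto simp: integrable_indicator_iff)
  finally have lhs: "(\<integral>\<theta>. (\<integral>y. ?K \<theta> y \<partial>disc) \<partial>lborel) = (2 * pi) *\<^sub>R (\<integral>y. F y \<partial>disc)" .
  let ?t = "\<lambda>y. (cmod y)\<^sup>2"
  have xt: "x * of_real t \<in> ball 0 1" if "t \<in> {0..1}" for t :: real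
  proof -
    have "cmod x * t \<le> cmod x" using that by (simp add: mult_left_le)
    then show ?thesis using x that by (simp add: norm_mult)
  qed
  have dH: "(H has_field_derivative deriv H (x * of_real t)) (at (x * of_real t))" if "t \<in> {0..1}" for t :: real
    by (rule holomorphic_derivI[OF H _ xt[OF that]]) simp
  have contH: "continuous_on {0..1} (\<lambda>t. H (x * complex_of_real t))"
    by (rule continuous_on_compose2[OF holomorphic_on_imp_continuous_on[OF H]]) (use xt in \<open>auto intro!: continuous_intros\<close>)
  have dhol: "deriv H holomorphic_on ball 0 1" by (rule holomorphic_deriv[OF H]) simp
  have contdH: "continuous_on {0..1} (\<lambda>t. deriv H (x * complex_of_real t))"
    by (rule continuous_on_compose2[OF holomorphic_on_imp_continuous_on[OF dhol]]) (use xt in \<open>auto intro!: continuous_intros\<close>)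
  have contG: "continuous_on {0..1} G"
    unfolding G_def by (intro continuous_intros contH contdH)
  have Gm [measurable]: "(\<lambda>t. indicator {0..1} t *\<^sub>R G t) \<in> borel_measurable borel"
    by (rule borel_measurable_continuous_on_indicator[OF _ contG]) simp
  have "(\<integral>y. (\<integral>\<theta>. ?K \<theta> y \<partial>lborel) \<partial>disc) = (\<integral>y. 2 * of_real pi * (indicator {0..1} (?t y) *\<^sub>R G (?t y)) \<partial>disc)"
  proof (rule integral_cong_AE)
    show "AE y in disc. (\<integral>\<theta>. ?K \<theta> y \<partial>lborel) = 2 * of_real pi * (indicator {0..1} (?t y) *\<^sub>R G (?t y))"
      using AE_disc P.AE_integrable_snd[OF Ki]
    proof eventually_elim
      fix y assume y: "y \<noteq> 0 \<and> cmod y < 1" and i: "integrable lborel (\<lambda>\<theta>. ?K \<theta> y)"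
      have "((\<lambda>\<theta>. F (cis \<theta> * y)) has_integral (2 * of_real pi * G (?t y))) {0..2*pi}"
        unfolding F_def G_def using circle_reproducing[OF H x, of y] y by simp
      moreover have "(\<lambda>\<theta>. ?K \<theta> y) = (\<lambda>\<theta>. if \<theta> \<in> {0..2*pi} then F (cis \<theta> * y) else 0)"
        by (auto simp: fun_eq_iff indicator_def)
      ultimately have "((\<lambda>\<theta>. ?K \<theta> y) has_integral (2 * of_real pi * G (?t y))) UNIV"
        by (simp only: has_integral_restrict_UNIV)
      then have "(\<integral>\<theta>. ?K \<theta> y \<partial>lborel) = 2 * of_real pi * G (?t y)"
        using has_integral_integral_lborel[OF i] has_integral_unique by blast
      then show "(\<integral>\<theta>. ?K \<theta> y \<partial>lborel) = 2 * of_real pi * (indicator {0..1} (?t y) *\<^sub>R G (?t y))"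
        using y by (simp add: indicator_def power_le_one)
    qed
    show "(\<lambda>y. 2 * of_real pi * (indicator {0..1} (?t y) *\<^sub>R G (?t y))) \<in> borel_measurable disc"
    proof -
      have "(\<lambda>y. indicator {0..1} (?t y) *\<^sub>R G (?t y)) \<in> borel_measurable disc"
        by (rule measurable_compose[OF _ Gm]) measurable
      then show ?thesis by (intro borel_measurable_times borel_measurable_const)
    qed
  qed measurable
  also have "\<dots> = 2 * of_real pi * (\<integral>y. indicator {0..1} (?t y) *\<^sub>R G (?t y) \<partial>disc)"
    by (rule integral_mult_right_zero)
  also have "(\<integral>y. indicator {0..1} (?t y) *\<^sub>R G (?t y) \<partial>disc) = (\<integral>t. indicator {0..1} t *\<^sub>R G t \<partial>distr disc borel ?t)"
    by (rule integral_distr[symmetric]) auto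
  also have "\<dots> = (\<integral>t. indicator {0..1} t *\<^sub>R G t \<partial>density lborel (\<lambda>t. ennreal (pi * indicator {0<..<1} t)))"
    unfolding disc_radial by (simp add: ennreal_mult ennreal_indicator)
  also have "\<dots> = (\<integral>t. (pi * indicator {0<..<1} t) *\<^sub>R (indicator {0..1} t *\<^sub>R G t) \<partial>lborel)"
    by (rule integral_density) auto
  also have "\<dots> = (\<integral>t. pi *\<^sub>R (indicator {0..1} t *\<^sub>R G t) \<partial>lborel)"
  proof (rule integral_cong_AE)
    show "AE t in lborel. (pi * indicator {0<..<1} t) *\<^sub>R (indicator {0..1} t *\<^sub>R G t) = pi *\<^sub>R (indicator {0..1} t *\<^sub>R G t)"
      using AE_lborel_singleton[of "0::real"] AE_lborel_singleton[of "1::real"]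
      by eventually_elim (auto simp: indicator_def)
    have Gm': "(\<lambda>t. indicator {0..1} t *\<^sub>R G t) \<in> borel_measurable lborel" using Gm by simp
    show "(\<lambda>t. (pi * indicator {0<..<1} t) *\<^sub>R (indicator {0..1} t *\<^sub>R G t)) \<in> borel_measurable lborel"
      by (rule borel_measurable_scaleR[OF _ Gm']) measurable
    show "(\<lambda>t. pi *\<^sub>R (indicator {0..1} t *\<^sub>R G t)) \<in> borel_measurable lborel"
      by (rule borel_measurable_scaleR[OF _ Gm']) measurable
  qed
  also have "\<dots> = pi *\<^sub>R (\<integral>t. indicator {0..1} t *\<^sub>R G t \<partial>lborel)"
    by (rule integral_scaleR_right)
  also have "(\<integral>t. indicator {0..1} t *\<^sub>R G t \<partial>lborel) = of_real 1 * H (x * of_real 1) - of_real 0 * H (x * of_real 0)"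
  proof (rule integral_FTC_atLeastAtMost[OF _ _ contG])
    fix t :: real assume t: "0 \<le> t" "t \<le> 1"
    have "((\<lambda>u. H (x * u)) has_field_derivative (deriv H (x * of_real t) * x)) (at (of_real t))"
      by (rule DERIV_chain2[of H _ "\<lambda>u. x * u"], rule dH) (use t in \<open>auto intro!: derivative_eq_intros\<close>)
    then have "((\<lambda>u. u * H (x * u)) has_field_derivative G t) (at (of_real t))"
      by (auto intro!: derivative_eq_intros simp: G_def)
    from has_vector_derivative_real_field[OF this]
    show "((\<lambda>t. of_real t * H (x * of_real t)) has_vector_derivative G t) (at t within {0..1})" .
  qed simp
  finally have rhs: "(\<integral>y. (\<integral>\<theta>. ?K \<theta> y \<partial>lborel) \<partial>disc) = 2 * of_real pi * (pi *\<^sub>R H x)"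
    by simp
  have "(\<integral>y. (\<integral>\<theta>. ?K \<theta> y \<partial>lborel) \<partial>disc) = (\<integral>\<theta>. (\<integral>y. ?K \<theta> y \<partial>disc) \<partial>lborel)"
    by (rule P.Fubini_integral[OF Ki])
  then have "(2 * pi) *\<^sub>R (\<integral>y. F y \<partial>disc) = 2 * of_real pi * (pi *\<^sub>R H x)" using lhs rhs by simp
  then show ?thesis unfolding F_def by (simp add: scaleR_conv_of_real)
qed

lemma integrable_of_square_integrable:
  fixes h :: "'a \<Rightarrow> complex"
  assumes M: "finite_measure M" and [measurable]: "h \<in> borel_measurable M"
    and L2: "(\<integral>\<^sup>+z. ennreal ((cmod (h z))\<^sup>2) \<partial>M) < \<infinity>"
  shows "integrable M h"
  unfolding integrable_iff_bounded
proof
  have "(\<integral>\<^sup>+z. ennreal (norm (h z)) \<partial>M) \<le> (\<integral>\<^sup>+z. 1 + ennreal ((cmod (h z))\<^sup>2) \<partial>M)"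
  proof (rule nn_integral_mono)
    fix z
    have "cmod (h z) \<le> 1 + (cmod (h z))\<^sup>2"
      using sum_squares_bound[of 1 "cmod (h z)"] norm_ge_zero[of "h z"] by (simp del: norm_ge_zero)
    then have "ennreal (norm (h z)) \<le> ennreal (1 + (cmod (h z))\<^sup>2)" by (rule ennreal_leI)
    then show "ennreal (norm (h z)) \<le> 1 + ennreal ((cmod (h z))\<^sup>2)" by (simp flip: ennreal_1)
  qed
  also have "\<dots> = (\<integral>\<^sup>+z. 1 \<partial>M) + (\<integral>\<^sup>+z. ennreal ((cmod (h z))\<^sup>2) \<partial>M)"
    by (rule nn_integral_add) auto
  also have "\<dots> < \<infinity>"
    using L2 finite_measure.emeasure_finite[OF M, of "space M"] by (simp add: top.not_eq_extremum)
  finally show "(\<integral>\<^sup>+z. ennreal (norm (h z)) \<partial>M) < \<infinity>" .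
qed simp

text \<open>The mean value property on the disc of radius \<open>|z|/2\<close> about \<open>z\<close>, together with \<open>2 a b \<le> a\<^sup>2 / d + d b\<^sup>2\<close>, bounds
  \<open>|z h(z)|\<close> by \<open>\<integral> |h|\<^sup>2 / d\<close> over a small disc about the origin plus a multiple of \<open>d\<close>. Hence \<open>z h(z)\<close> tends to zero, and
  Riemann's theorem applies.\<close>

lemma L2_removable_singularity:
  fixes h :: "complex \<Rightarrow> complex"
  assumes h: "h holomorphic_on ball 0 1 - {0}" and hm [measurable]: "h \<in> borel_measurable borel"
    and L2: "(\<integral>\<^sup>+z. ennreal ((cmod (h z))\<^sup>2) \<partial>disc) < \<infinity>"
  shows "\<exists>H. H holomorphic_on ball 0 1 \<and> (\<forall>z\<in>ball 0 1 - {0}. H z = h z)"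
proof -
  define \<mu> where "\<mu> = density disc (\<lambda>z. ennreal ((cmod (h z))\<^sup>2))"
  have [simp]: "sets \<mu> = sets borel" "space \<mu> = UNIV" by (simp_all add: \<mu>_def)
  define J where "J n = emeasure \<mu> (ball 0 (1 / real (Suc n)))" for n
  have fin: "emeasure \<mu> A < \<infinity>" if "A \<in> sets borel" for A
  proof -
    have "emeasure \<mu> A \<le> emeasure \<mu> (space \<mu>)" by (rule emeasure_space)
    also have "\<dots> = (\<integral>\<^sup>+z. ennreal ((cmod (h z))\<^sup>2) \<partial>disc)"
      unfolding \<mu>_def by (subst emeasure_density) auto
    finally show ?thesis using L2 by (rule le_less_trans)
  qed
  have "J \<longlonglongrightarrow> emeasure \<mu> (\<Inter>n. ball 0 (1 / real (Suc n)))"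
    unfolding J_def
  proof (rule Lim_emeasure_decseq)
    show "decseq (\<lambda>n. ball (0::complex) (1 / real (Suc n)))"
      by (intro decseq_SucI subset_ball) (simp add: frac_le)
    show "emeasure \<mu> (ball 0 (1 / real (Suc n))) \<noteq> \<infinity>" for n
      using fin[of "ball 0 (1 / real (Suc n))"] by simp
  qed auto
  also have "(\<Inter>n. ball (0::complex) (1 / real (Suc n))) = {0}"
  proof -
    have "z = 0" if "\<And>n. cmod z < 1 / real (Suc n)" for z :: complex
    proof (rule ccontr)
      assume "z \<noteq> 0"
      then obtain n where "inverse (real (Suc n)) < cmod z" using reals_Archimedean[of "cmod z"] by auto
      then show False using that[of n] by (simp add: inverse_eq_divide)
    qed
    then show ?thesis by auto
  qed
  also have "emeasure \<mu> {0} = 0"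
  proof -
    have "emeasure \<mu> {0} = (\<integral>\<^sup>+z. ennreal ((cmod (h z))\<^sup>2) * indicator {0} z \<partial>disc)"
      unfolding \<mu>_def by (rule emeasure_density) auto
    also have "\<dots> = (\<integral>\<^sup>+z. 0 \<partial>disc)"
      by (rule nn_integral_cong_AE, use AE_disc in eventually_elim) auto
    finally show ?thesis by simp
  qed
  finally have J0: "J \<longlonglongrightarrow> 0" .
  have key: "ennreal (pi * (cmod z * cmod (h z))) \<le> ennreal (1 / d) * J n + ennreal (d * pi)"
    if z: "z \<noteq> 0" "2 * cmod z < 1 / real (Suc n)" and d: "0 < d" for z n d
  proof -
    define \<rho> where "\<rho> = cmod z / 2"
    have \<rho>: "\<rho> > 0" using z by (simp add: \<rho>_def)
    have half: "1 / real (Suc n) \<le> 1" by simp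
    have z1: "2 * cmod z < 1" using z(2) half by (rule less_le_trans)
    have inA: "z + \<rho> * w \<in> ball 0 (1 / real (Suc n)) - {0}" "z + \<rho> * w \<in> ball 0 1 - {0}" if "cmod w < 1" for w :: complex
    proof -
      have "\<rho> * cmod w < \<rho>" using that \<rho> by simp
      then have "cmod (\<rho> * w) < cmod z / 2" using \<rho> by (simp add: norm_mult \<rho>_def)
      moreover have "cmod (z + \<rho> * w) \<le> cmod z + cmod (\<rho> * w)" "cmod z - cmod (\<rho> * w) \<le> cmod (z + \<rho> * w)"
        using norm_triangle_ineq norm_diff_ineq by blast+
      ultimately have "cmod (z + \<rho> * w) < 2 * cmod z" "0 < cmod (z + \<rho> * w)" using z(1) by linarith+
      then show "z + \<rho> * w \<in> ball 0 (1 / real (Suc n)) - {0}" "z + \<rho> * w \<in> ball 0 1 - {0}"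
        using z(2) z1 by auto
    qed
    define g where "g w = h (z + \<rho> * w)" for w :: complex
    have gm [measurable]: "g \<in> borel_measurable borel" unfolding g_def by measurable
    have "(h \<circ> (\<lambda>w. z + \<rho> * w)) holomorphic_on ball 0 1"
      by (rule holomorphic_on_compose_gen[OF _ h]) (use inA in \<open>auto intro!: holomorphic_intros\<close>)
    then have gh: "g holomorphic_on ball 0 1" by (simp add: g_def[abs_def] o_def)
    \<comment> \<open>the change of variables \<open>y = z + \<rho> w\<close>\<close>
    have cov: "ennreal (\<rho>\<^sup>2) * (\<integral>\<^sup>+w. ennreal ((cmod (g w))\<^sup>2) \<partial>disc) \<le> J n"
    proof -
      let ?f = "\<lambda>y. indicator (ball 0 (1 / real (Suc n))) y * (indicator (ball 0 1) y * ennreal ((cmod (h y))\<^sup>2))"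
      have 2: "(\<lambda>y. indicator (ball 0 1) y * ennreal ((cmod (h y))\<^sup>2)) \<in> borel_measurable borel"
        by measurable
      have 1: "(indicator (ball 0 (1 / real (Suc n))) :: complex \<Rightarrow> ennreal) \<in> borel_measurable borel"
        by (rule borel_measurable_indicator) simp
      have fm: "?f \<in> borel_measurable borel" using 1 2 by (rule borel_measurable_times_ennreal)
      have "ennreal (\<rho>\<^sup>2) * (\<integral>\<^sup>+w. ennreal ((cmod (g w))\<^sup>2) \<partial>disc)
          = ennreal (\<rho>\<^sup>2) * (\<integral>\<^sup>+w. indicator (ball 0 1) w * ennreal ((cmod (g w))\<^sup>2) \<partial>lborel)"
        by (subst nn_integral_disc) auto
      also have "\<dots> \<le> ennreal (\<rho>\<^sup>2) * (\<integral>\<^sup>+w. ?f (z + \<rho> * (w::complex)) \<partial>lborel)"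
        by (intro mult_left_mono nn_integral_mono) (use inA in \<open>auto simp: indicator_def g_def\<close>)
      also have "\<dots> = (\<integral>\<^sup>+y. ?f (z + y) \<partial>lborel)"
      proof -
        have "(\<lambda>y. ?f (z + y)) \<in> borel_measurable borel"
          by (rule measurable_compose[OF _ fm]) measurable
        from nn_integral_complex_mult[OF this, of \<rho>] show ?thesis using \<rho> by simp
      qed
      also have "\<dots> = (\<integral>\<^sup>+y. ?f y \<partial>distr lborel borel ((+) z))"
        by (rule nn_integral_distr[symmetric]) (simp, use fm in \<open>simp only: measurable_distr_eq1 measurable_lborel1\<close>)
      also have "\<dots> = (\<integral>\<^sup>+y. ?f y \<partial>lborel)" by (simp add: lborel_distr_plus)
      also have "\<dots> = (\<integral>\<^sup>+y. indicator (ball 0 1) y * (ennreal ((cmod (h y))\<^sup>2) * indicator (ball 0 (1 / real (Suc n))) y) \<partial>lborel)"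
        by (simp add: mult_ac)
      also have "\<dots> = (\<integral>\<^sup>+y. ennreal ((cmod (h y))\<^sup>2) * indicator (ball 0 (1 / real (Suc n))) y \<partial>disc)"
        by (rule nn_integral_disc[symmetric], rule borel_measurable_times_ennreal[OF _ 1]) measurable
      also have "\<dots> = J n" unfolding J_def \<mu>_def by (rule emeasure_density[symmetric]) auto
      finally show ?thesis .
    qed
    have Jfin: "J n < \<infinity>" unfolding J_def by (rule fin) simp
    have "ennreal (\<rho>\<^sup>2) * (\<integral>\<^sup>+w. ennreal ((cmod (g w))\<^sup>2) \<partial>disc) < \<infinity>"
      using cov Jfin by (rule le_less_trans)
    then have gL2: "(\<integral>\<^sup>+w. ennreal ((cmod (g w))\<^sup>2) \<partial>disc) < \<infinity>"
      using \<rho> by (cases "\<integral>\<^sup>+w. ennreal ((cmod (g w))\<^sup>2) \<partial>disc") (auto simp: ennreal_mult_top)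
    have gi: "integrable disc g" by (rule integrable_of_square_integrable[OF finite_measure_disc _ gL2]) (use gm in simp)
    have "(\<integral>w. g w \<partial>disc) = of_real pi * g 0" using disc_reproducing[OF gh gi, of 0] by simp
    then have "pi * cmod (h z) = cmod (\<integral>w. g w \<partial>disc)" by (simp add: norm_mult g_def)
    then have "ennreal (pi * cmod (h z)) \<le> (\<integral>\<^sup>+w. ennreal (cmod (g w)) \<partial>disc)"
      using integral_norm_bound_ennreal[OF gi] by simp
    then have "ennreal (2 * \<rho>) * ennreal (pi * cmod (h z)) \<le> ennreal (2 * \<rho>) * (\<integral>\<^sup>+w. ennreal (cmod (g w)) \<partial>disc)"
      by (rule mult_left_mono) simp
    also have "\<dots> = (\<integral>\<^sup>+w. ennreal (2 * \<rho>) * ennreal (cmod (g w)) \<partial>disc)"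
      by (rule nn_integral_cmult[symmetric]) auto
    also have "\<dots> \<le> (\<integral>\<^sup>+w. ennreal (\<rho>\<^sup>2 / d) * ennreal ((cmod (g w))\<^sup>2) + ennreal d \<partial>disc)"
    proof (rule nn_integral_mono)
      fix w
      have "0 \<le> (\<rho> * cmod (g w) - d)\<^sup>2" by simp
      then have "2 * \<rho> * cmod (g w) * d \<le> (\<rho> * cmod (g w))\<^sup>2 + d\<^sup>2" by (simp add: power2_diff mult_ac)
      then have "2 * \<rho> * cmod (g w) \<le> ((\<rho> * cmod (g w))\<^sup>2 + d\<^sup>2) / d" using d by (simp add: le_divide_eq)
      also have "\<dots> = \<rho>\<^sup>2 / d * (cmod (g w))\<^sup>2 + d" using d by (simp add: field_simps power2_eq_square)
      finally show "ennreal (2 * \<rho>) * ennreal (cmod (g w)) \<le> ennreal (\<rho>\<^sup>2 / d) * ennreal ((cmod (g w))\<^sup>2) + ennreal d"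
        using \<rho> d by (simp add: ennreal_leI flip: ennreal_mult ennreal_plus)
    qed
    also have "\<dots> = ennreal (\<rho>\<^sup>2 / d) * (\<integral>\<^sup>+w. ennreal ((cmod (g w))\<^sup>2) \<partial>disc) + ennreal d * emeasure disc UNIV"
      by (subst nn_integral_add) (auto simp: nn_integral_cmult)
    also have "emeasure disc UNIV = ennreal pi"
    proof -
      have "emeasure disc UNIV = emeasure lborel (ball (0::complex) 1)"
        unfolding disc_def by (subst emeasure_density) auto
      then show ?thesis by (simp add: emeasure_ball_complex)
    qed
    also have "ennreal (\<rho>\<^sup>2 / d) = ennreal (1 / d) * ennreal (\<rho>\<^sup>2)" using d by (simp flip: ennreal_mult)
    also have "ennreal (1 / d) * ennreal (\<rho>\<^sup>2) * (\<integral>\<^sup>+w. ennreal ((cmod (g w))\<^sup>2) \<partial>disc) + ennreal d * ennreal pi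
        \<le> ennreal (1 / d) * J n + ennreal d * ennreal pi"
      unfolding mult.assoc by (intro add_right_mono mult_left_mono cov) simp
    finally show ?thesis using d \<rho> by (simp add: \<rho>_def mult_ac flip: ennreal_mult)
  qed
  have lim: "((\<lambda>z. (z - 0) * h z) \<longlongrightarrow> 0) (at 0)"
  proof (rule tendstoI)
    fix \<epsilon> :: real assume \<epsilon>: "\<epsilon> > 0"
    define d where "d = \<epsilon> / 2"
    have d: "d > 0" using \<epsilon> by (simp add: d_def)
    have "(\<lambda>n. ennreal (1 / d) * J n) \<longlonglongrightarrow> ennreal (1 / d) * 0"
      by (intro ennreal_tendsto_cmult J0) simp
    then have "eventually (\<lambda>n. ennreal (1 / d) * J n < ennreal (d * pi)) sequentially"
      using d by (intro order_tendstoD(2)[where y = 0]) auto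
    then obtain n where n: "ennreal (1 / d) * J n < ennreal (d * pi)"
      by (auto simp: eventually_sequentially)
    have "eventually (\<lambda>z. z \<noteq> 0 \<and> cmod z < 1 / (2 * real (Suc n))) (at (0::complex))"
      unfolding eventually_at by (rule exI[of _ "1 / (2 * real (Suc n))"]) auto
    then show "eventually (\<lambda>z. dist ((z - 0) * h z) 0 < \<epsilon>) (at 0)"
    proof eventually_elim
      fix z :: complex assume z: "z \<noteq> 0 \<and> cmod z < 1 / (2 * real (Suc n))"
      then have "2 * cmod z < 1 / real (Suc n)" by (simp add: field_simps)
      from key[OF _ this d] z
      have "ennreal (pi * (cmod z * cmod (h z))) \<le> ennreal (1 / d) * J n + ennreal (d * pi)" by simp
      also have "\<dots> < ennreal (d * pi) + ennreal (d * pi)"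
        unfolding add.commute[of "ennreal (1 / d) * J n"] ennreal_add_left_cancel_less using n by simp
      also have "\<dots> = ennreal (pi * \<epsilon>)" using d by (simp add: d_def flip: ennreal_plus)
      finally have "pi * (cmod z * cmod (h z)) < pi * \<epsilon>" by (simp add: ennreal_less_iff)
      then show "dist ((z - 0) * h z) 0 < \<epsilon>" by (simp add: norm_mult)
    qed
  qed
  have "(\<exists>g. g holomorphic_on ball 0 1 \<and> (\<forall>z \<in> ball 0 1 - {0}. g z = h z))"
    by (subst holomorphic_on_extend_lim[OF h]) (use lim in auto)
  then show ?thesis .
qed

lemma punctured_disc_reproducing:
  fixes h :: "complex \<Rightarrow> complex"
  assumes h: "h holomorphic_on ball 0 1 - {0}" and hm [measurable]: "h \<in> borel_measurable borel"
    and L2: "(\<integral>\<^sup>+z. ennreal ((cmod (h z))\<^sup>2) \<partial>disc) < \<infinity>" and x: "x \<in> ball 0 1 - {0}"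
  shows "(\<integral>y. h y / (1 - x * cnj y)\<^sup>2 \<partial>disc) = of_real pi * h x"
proof -
  obtain H0 where H0: "H0 holomorphic_on ball 0 1" "\<And>z. z \<in> ball 0 1 - {0} \<Longrightarrow> H0 z = h z"
    using L2_removable_singularity[OF h hm L2] by blast
  \<comment> \<open>patched only at the origin, so that it remains Borel measurable on the whole plane\<close>
  define H where "H z = (if z = 0 then H0 0 else h z)" for z
  have [measurable]: "H \<in> borel_measurable borel" unfolding H_def by measurable
  have "H z = H0 z" if "z \<in> ball 0 1" for z using H0(2)[of z] that by (simp add: H_def)
  then have Hh: "H holomorphic_on ball 0 1" using H0(1) holomorphic_cong by blast
  have ae: "AE z in disc. H z = h z" using AE_disc by eventually_elim (simp add: H_def)
  have "integrable disc H \<longleftrightarrow> integrable disc h"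
    by (rule integrable_cong_AE) (use ae in auto)
  moreover have "integrable disc h" by (rule integrable_of_square_integrable[OF finite_measure_disc _ L2]) (use hm in simp)
  ultimately have Hi: "integrable disc H" by simp
  have "(\<integral>y. h y / (1 - x * cnj y)\<^sup>2 \<partial>disc) = (\<integral>y. H y / (1 - x * cnj y)\<^sup>2 \<partial>disc)"
    by (rule integral_cong_AE) (use ae in auto)
  also have "\<dots> = of_real pi * H x" using disc_reproducing[OF Hh Hi, of x] x by simp
  finally show ?thesis using x by (simp add: H_def)
qed

section \<open>The reproducing formula on the polydisc\<close>

context product_sigma_finite
begin

lemma AE_PiM_coordinate:
  assumes I: "finite I" "i \<in> I" and P: "AE t in M i. P t"
  shows "AE x in PiM I M. P (x i)"
proof -
  obtain N where N: "{t\<in>space (M i). \<not> P t} \<subseteq> N" "emeasure (M i) N = 0" "N \<in> sets (M i)"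
    using P by (rule AE_E)
  let ?A = "\<lambda>j. if j = i then N else space (M j)"
  have A: "?A j \<in> sets (M j)" for j using N by auto
  have "emeasure (PiM I M) (PiE I ?A) = (\<Prod>j\<in>I. emeasure (M j) (?A j))"
    by (rule emeasure_PiM) (use I A in auto)
  also have "\<dots> = 0" using I N by (auto simp: prod_zero_iff)
  finally have "PiE I ?A \<in> null_sets (PiM I M)"
    using A I by (intro null_setsI) (auto intro!: sets_PiM_I_finite)
  moreover have "{x\<in>space (PiM I M). \<not> P (x i)} \<subseteq> PiE I ?A"
    using N(1) I by (auto simp: space_PiM PiE_iff extensional_def)
  ultimately show ?thesis by (rule AE_I')
qed

lemma AE_PiM_insertI:
  assumes I: "finite I" "i \<notin> I"
    and m [measurable]: "{x\<in>space (PiM (insert i I) M). P x} \<in> sets (PiM (insert i I) M)"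
    and ae: "AE s in M i. AE x in PiM I M. P (x(i := s))"
  shows "AE x in PiM (insert i I) M. P x"
proof -
  let ?B = "{x\<in>space (PiM (insert i I) M). \<not> P x}"
  have [measurable]: "Measurable.pred (PiM (insert i I) M) P" using m by (simp add: pred_def)
  have Bm: "?B \<in> sets (PiM (insert i I) M)" by measurable
  have "emeasure (PiM (insert i I) M) ?B = (\<integral>\<^sup>+x. indicator ?B x \<partial>PiM (insert i I) M)" using Bm by simp
  also have "\<dots> = (\<integral>\<^sup>+s. (\<integral>\<^sup>+x. indicator ?B (x(i := s)) \<partial>PiM I M) \<partial>M i)"
    by (rule product_nn_integral_insert_rev[OF I]) (use Bm in simp)
  also have "\<dots> = (\<integral>\<^sup>+s. 0 \<partial>M i)"
  proof (rule nn_integral_cong_AE, use ae in eventually_elim)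
    fix s assume s: "AE x in PiM I M. P (x(i := s))"
    have "(\<integral>\<^sup>+x. indicator ?B (x(i := s)) \<partial>PiM I M) = (\<integral>\<^sup>+x. 0 \<partial>PiM I M)"
      by (rule nn_integral_cong_AE, use s in eventually_elim) auto
    then show "(\<integral>\<^sup>+x. indicator ?B (x(i := s)) \<partial>PiM I M) = 0" by simp
  qed
  finally show ?thesis using Bm by (intro AE_I[of _ _ ?B]) auto
qed

end

interpretation discs: product_sigma_finite "\<lambda>_::'i. disc"
  by (simp add: product_sigma_finite_def sigma_finite_disc)

abbreviation polydisc :: "'i set \<Rightarrow> ('i \<Rightarrow> complex) measure" where
  "polydisc I \<equiv> PiM I (\<lambda>_. disc)"

definition polydisc_kernel :: "'i set \<Rightarrow> ('i \<Rightarrow> complex) \<Rightarrow> ('i \<Rightarrow> complex) \<Rightarrow> complex" where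
  "polydisc_kernel I x y = (\<Prod>i\<in>I. 1 / (1 - x i * cnj (y i))\<^sup>2)"

lemma measurable_polydisc_kernel [measurable]:
  "case_prod (polydisc_kernel I) \<in> borel_measurable (polydisc I \<Otimes>\<^sub>M polydisc I)"
proof -
  have "(\<lambda>z. fst z i) \<in> polydisc I \<Otimes>\<^sub>M polydisc I \<rightarrow>\<^sub>M disc" "(\<lambda>z. snd z i) \<in> polydisc I \<Otimes>\<^sub>M polydisc I \<rightarrow>\<^sub>M disc"
    if "i \<in> I" for i
    using measurable_compose[OF measurable_fst measurable_component_singleton[OF that]]
      measurable_compose[OF measurable_snd measurable_component_singleton[OF that]] by blast+
  then have [measurable]: "(\<lambda>z. fst z i) \<in> borel_measurable (polydisc I \<Otimes>\<^sub>M polydisc I)" "(\<lambda>z. snd z i) \<in> borel_measurable (polydisc I \<Otimes>\<^sub>M polydisc I)"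
    if "i \<in> I" for i
    using that by (simp_all only: measurable_cong_sets[OF refl sets_disc])
  show ?thesis unfolding polydisc_kernel_def split_beta
    by (intro borel_measurable_prod) measurable
qed

lemma finite_measure_polydisc: "finite I \<Longrightarrow> finite_measure (polydisc I)"
proof
  assume I: "finite I"
  have "emeasure (polydisc I) (PiE I (\<lambda>_. UNIV)) = (\<Prod>i\<in>I. emeasure disc UNIV)"
    by (rule discs.emeasure_PiM) (use I in auto)
  also have "\<dots> \<noteq> \<infinity>"
    using finite_measure.emeasure_finite[OF finite_measure_disc, of UNIV] by (simp add: ennreal_prod_eq_top power_eq_top_ennreal)
  finally show "emeasure (polydisc I) (space (polydisc I)) \<noteq> \<infinity>" by (simp add: space_PiM)
qed

lemma AE_polydisc: "finite I \<Longrightarrow> AE x in polydisc I. \<forall>i\<in>I. x i \<noteq> 0 \<and> cmod (x i) < 1"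
  by (intro AE_finite_allI discs.AE_PiM_coordinate AE_disc)

lemma integrable_polydisc_kernel:
  fixes F :: "('i \<Rightarrow> complex) \<Rightarrow> complex"
  assumes I: "finite I" and F: "integrable (polydisc I) F" and x: "x \<in> space (polydisc I)" "\<And>i. i \<in> I \<Longrightarrow> cmod (x i) < 1"
  shows "integrable (polydisc I) (\<lambda>y. F y * polydisc_kernel I x y)"
proof (rule Bochner_Integration.integrable_bound)
  have [measurable]: "F \<in> borel_measurable (polydisc I)" using borel_measurable_integrable[OF F] by simp
  have [measurable]: "polydisc_kernel I x \<in> borel_measurable (polydisc I)"
    using measurable_Pair2[OF measurable_polydisc_kernel x(1)] by simp
  let ?C = "\<Prod>i\<in>I. 1 / (1 - cmod (x i))\<^sup>2"
  show "integrable (polydisc I) (\<lambda>y. ?C * cmod (F y))" using F by auto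
  show "(\<lambda>y. F y * polydisc_kernel I x y) \<in> borel_measurable (polydisc I)" by measurable
  show "AE y in polydisc I. norm (F y * polydisc_kernel I x y) \<le> norm (?C * cmod (F y))"
    using AE_polydisc[OF I]
  proof eventually_elim
    fix y :: "'i \<Rightarrow> complex" assume y: "\<forall>i\<in>I. y i \<noteq> 0 \<and> cmod (y i) < 1"
    have "cmod (polydisc_kernel I x y) = (\<Prod>i\<in>I. 1 / (cmod (1 - x i * cnj (y i)))\<^sup>2)"
      by (simp add: polydisc_kernel_def norm_divide norm_power flip: prod_norm)
    also have "\<dots> \<le> ?C"
    proof (rule prod_mono)
      fix i assume i: "i \<in> I"
      have "0 < (1 - cmod (x i))\<^sup>2" using x(2)[OF i] by simp
      moreover have "(1 - cmod (x i))\<^sup>2 \<le> (cmod (1 - x i * cnj (y i)))\<^sup>2"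
        using disc_norm_ge[OF x(2)[OF i]] y i x(2)[OF i] by (intro power_mono) auto
      ultimately show "0 \<le> 1 / (cmod (1 - x i * cnj (y i)))\<^sup>2 \<and> 1 / (cmod (1 - x i * cnj (y i)))\<^sup>2 \<le> 1 / (1 - cmod (x i))\<^sup>2"
        by (auto intro!: frac_le)
    qed
    finally have "cmod (F y) * cmod (polydisc_kernel I x y) \<le> cmod (F y) * ?C" by (intro mult_left_mono) auto
    also have "\<dots> \<le> norm (?C * cmod (F y))"
      unfolding real_norm_def by (subst mult.commute) (rule abs_ge_self)
    finally show "norm (F y * polydisc_kernel I x y) \<le> norm (?C * cmod (F y))" by (simp add: norm_mult)
  qed
qed

text \<open>Induction on the number of variables, using the one-variable formula in the new coordinate.
  Slices of a square integrable function are square integrable for almost all values of the other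
  coordinates only, hence the formula holds almost everywhere.\<close>

lemma polydisc_reproducing_AE:
  fixes F :: "('i \<Rightarrow> complex) \<Rightarrow> complex"
  assumes "finite I" and "F \<in> borel_measurable (polydisc I)"
    and "(\<integral>\<^sup>+z. ennreal ((cmod (F z))\<^sup>2) \<partial>polydisc I) < \<infinity>"
    and "\<And>x i. x \<in> PiE I (\<lambda>_. ball 0 1 - {0}) \<Longrightarrow> i \<in> I \<Longrightarrow> (\<lambda>t. F (x(i := t))) holomorphic_on ball 0 1 - {0}"
  shows "AE x in polydisc I. (\<integral>y. F y * polydisc_kernel I x y \<partial>polydisc I) = of_real pi ^ card I * F x"
  using assms
proof (induction I arbitrary: F rule: finite_induct)
  case empty
  interpret finite_measure "polydisc ({} :: 'i set)" by (rule finite_measure_polydisc) simp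
  have "measure (polydisc ({} :: 'i set)) (space (polydisc {})) = 1"
    by (simp add: PiM_empty)
  then show ?case
    by (auto simp: polydisc_kernel_def PiM_empty lebesgue_integral_count_space_finite)
next
  case (insert i I)
  note I = insert.hyps
  have Fm [measurable]: "F \<in> borel_measurable (polydisc (insert i I))" by (rule insert.prems(1))
  note L2 = insert.prems(2) and hol = insert.prems(3)
  have Fi: "integrable (polydisc (insert i I)) F"
    by (rule integrable_of_square_integrable[OF finite_measure_polydisc]) (use I Fm L2 in auto)
  interpret I: sigma_finite_measure "polydisc I" by (rule discs.sigma_finite[OF I(1)])
  interpret J: sigma_finite_measure "polydisc (insert i I)" by (rule discs.sigma_finite) (use I in simp)
  let ?J = "insert i I"
  have upd: "x(i := s) \<in> PiE ?J (\<lambda>_. ball 0 1 - {0})"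
    if "x \<in> space (polydisc I)" "\<forall>j\<in>I. x j \<noteq> 0 \<and> cmod (x j) < 1" "s \<noteq> 0" "cmod s < 1" for x s
    using that by (auto simp: space_PiM PiE_iff extensional_def)
  have updm [measurable]: "(\<lambda>(x, s). x(i := s)) \<in> polydisc I \<Otimes>\<^sub>M disc \<rightarrow>\<^sub>M polydisc ?J"
    by measurable
  have sl: "(\<lambda>y. F (y(i := s))) \<in> borel_measurable (polydisc I)" for s
    by measurable
  have slt: "(\<lambda>t. F (y(i := t))) \<in> borel_measurable borel" if "y \<in> space (polydisc I)" for y
  proof -
    have "(\<lambda>t. F (y(i := t))) \<in> borel_measurable disc"
      using measurable_compose[OF measurable_component_update[OF that I(2)] Fm] by simp
    then show ?thesis by simp
  qed
  have L2s: "AE s in disc. (\<integral>\<^sup>+y. ennreal ((cmod (F (y(i := s))))\<^sup>2) \<partial>polydisc I) < \<infinity>"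
  proof -
    have "(\<integral>\<^sup>+s. (\<integral>\<^sup>+y. ennreal ((cmod (F (y(i := s))))\<^sup>2) \<partial>polydisc I) \<partial>disc) < \<infinity>"
      using L2 discs.product_nn_integral_insert_rev[OF I, of "\<lambda>z. ennreal ((cmod (F z))\<^sup>2)"] by simp
    then have "AE s in disc. (\<integral>\<^sup>+y. ennreal ((cmod (F (y(i := s))))\<^sup>2) \<partial>polydisc I) \<noteq> \<infinity>"
      by (intro nn_integral_noteq_infinite) auto
    then show ?thesis by (simp add: top.not_eq_extremum)
  qed
  have L2t: "AE y in polydisc I. (\<integral>\<^sup>+t. ennreal ((cmod (F (y(i := t))))\<^sup>2) \<partial>disc) < \<infinity>"
  proof -
    interpret D: sigma_finite_measure disc by (rule sigma_finite_disc)
    have "(\<integral>\<^sup>+y. (\<integral>\<^sup>+t. ennreal ((cmod (F (y(i := t))))\<^sup>2) \<partial>disc) \<partial>polydisc I) < \<infinity>"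
      using L2 discs.product_nn_integral_insert[OF I, of "\<lambda>z. ennreal ((cmod (F z))\<^sup>2)"] by simp
    then have "AE y in polydisc I. (\<integral>\<^sup>+t. ennreal ((cmod (F (y(i := t))))\<^sup>2) \<partial>disc) \<noteq> \<infinity>"
      by (intro nn_integral_noteq_infinite) auto
    then show ?thesis by (simp add: top.not_eq_extremum)
  qed
  have step: "AE s in disc. AE x in polydisc I.
      (\<integral>y. F y * polydisc_kernel ?J (x(i := s)) y \<partial>polydisc ?J) = of_real pi ^ card ?J * F (x(i := s))"
    using L2s AE_disc
  proof eventually_elim
    fix s assume L2s: "(\<integral>\<^sup>+y. ennreal ((cmod (F (y(i := s))))\<^sup>2) \<partial>polydisc I) < \<infinity>" and s: "s \<noteq> 0 \<and> cmod s < 1"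
    have "AE x in polydisc I. (\<integral>y. F (y(i := s)) * polydisc_kernel I x y \<partial>polydisc I) = of_real pi ^ card I * F (x(i := s))"
    proof (rule insert.IH[OF sl L2s])
      fix x :: "'i \<Rightarrow> complex" and j assume x: "x \<in> PiE I (\<lambda>_. ball 0 1 - {0})" and j: "j \<in> I"
      have "x(i := s) \<in> PiE ?J (\<lambda>_. ball 0 1 - {0})"
        using x s by (auto simp: PiE_iff extensional_def)
      moreover have "(x(j := t))(i := s) = (x(i := s))(j := t)" for t
        using j I(2) by (intro fun_upd_twist) auto
      ultimately show "(\<lambda>t. F ((x(j := t))(i := s))) holomorphic_on ball 0 1 - {0}"
        using hol[of "x(i := s)" j] j by (simp only: insertI2)
    qed
    then show "AE x in polydisc I.
      (\<integral>y. F y * polydisc_kernel ?J (x(i := s)) y \<partial>polydisc ?J) = of_real pi ^ card ?J * F (x(i := s))"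
      using AE_polydisc[OF I(1)] AE_space
    proof eventually_elim
      fix x assume IH: "(\<integral>y. F (y(i := s)) * polydisc_kernel I x y \<partial>polydisc I) = of_real pi ^ card I * F (x(i := s))"
        and x: "\<forall>i\<in>I. x i \<noteq> 0 \<and> cmod (x i) < 1" and xs: "x \<in> space (polydisc I)"
      have xis: "x(i := s) \<in> space (polydisc ?J)" using xs by (auto simp: space_PiM PiE_iff extensional_def)
      have km [measurable]: "polydisc_kernel ?J (x(i := s)) \<in> borel_measurable (polydisc ?J)"
        using measurable_Pair2[OF measurable_polydisc_kernel xis] by simp
      have kmI [measurable]: "polydisc_kernel I x \<in> borel_measurable (polydisc I)"
        using measurable_Pair2[OF measurable_polydisc_kernel xs] by simp
      have "(\<integral>y. F y * polydisc_kernel ?J (x(i := s)) y \<partial>polydisc ?J)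
        = (\<integral>y. (\<integral>t. F (y(i := t)) * polydisc_kernel ?J (x(i := s)) (y(i := t)) \<partial>disc) \<partial>polydisc I)"
        by (rule discs.product_integral_insert[OF I], rule integrable_polydisc_kernel[OF _ Fi xis])
           (use I x s in auto)
      also have "\<dots> = (\<integral>y. of_real pi * (F (y(i := s)) * polydisc_kernel I x y) \<partial>polydisc I)"
      proof (rule integral_cong_AE)
        interpret D: sigma_finite_measure disc by (rule sigma_finite_disc)
        show "(\<lambda>y. \<integral>t. F (y(i := t)) * polydisc_kernel ?J (x(i := s)) (y(i := t)) \<partial>disc) \<in> borel_measurable (polydisc I)"
          by measurable
        show "(\<lambda>y. of_real pi * (F (y(i := s)) * polydisc_kernel I x y)) \<in> borel_measurable (polydisc I)"
          using sl by measurable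
        show "AE y in polydisc I. (\<integral>t. F (y(i := t)) * polydisc_kernel ?J (x(i := s)) (y(i := t)) \<partial>disc)
            = of_real pi * (F (y(i := s)) * polydisc_kernel I x y)"
          using L2t AE_polydisc[OF I(1)] AE_space
        proof eventually_elim
          fix y assume L2t: "(\<integral>\<^sup>+t. ennreal ((cmod (F (y(i := t))))\<^sup>2) \<partial>disc) < \<infinity>"
            and y: "\<forall>i\<in>I. y i \<noteq> 0 \<and> cmod (y i) < 1" and ys: "y \<in> space (polydisc I)"
          have ker: "polydisc_kernel ?J (x(i := s)) (y(i := t)) = polydisc_kernel I x y / (1 - s * cnj t)\<^sup>2" for t
          proof -
            have "(\<Prod>j\<in>I. 1 / (1 - (x(i := s)) j * cnj ((y(i := t)) j))\<^sup>2) = polydisc_kernel I x y"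
              unfolding polydisc_kernel_def by (rule prod.cong) (use I in auto)
            then show ?thesis using I by (simp add: polydisc_kernel_def)
          qed
          have "(\<lambda>t. F ((y(i := s))(i := t))) holomorphic_on ball 0 1 - {0}"
            by (rule hol[OF upd[OF ys y]]) (use s in auto)
          then have "(\<integral>t. F (y(i := t)) / (1 - s * cnj t)\<^sup>2 \<partial>disc) = of_real pi * F (y(i := s))"
            using punctured_disc_reproducing[OF _ slt[OF ys] L2t, of s] s by simp
          moreover have "(\<integral>t. F (y(i := t)) * polydisc_kernel ?J (x(i := s)) (y(i := t)) \<partial>disc)
              = (\<integral>t. (F (y(i := t)) / (1 - s * cnj t)\<^sup>2) * polydisc_kernel I x y \<partial>disc)"
            unfolding ker by (simp add: field_simps)
          moreover have "\<dots> = (\<integral>t. F (y(i := t)) / (1 - s * cnj t)\<^sup>2 \<partial>disc) * polydisc_kernel I x y"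
            by (rule integral_mult_left_zero)
          ultimately show "(\<integral>t. F (y(i := t)) * polydisc_kernel ?J (x(i := s)) (y(i := t)) \<partial>disc)
            = of_real pi * (F (y(i := s)) * polydisc_kernel I x y)" by (simp only: mult.assoc)
        qed
      qed
      also have "\<dots> = of_real pi * (of_real pi ^ card I * F (x(i := s)))" by (simp add: IH)
      also have "\<dots> = of_real pi ^ card ?J * F (x(i := s))" using I by simp
      finally show "(\<integral>y. F y * polydisc_kernel ?J (x(i := s)) y \<partial>polydisc ?J) = of_real pi ^ card ?J * F (x(i := s))" .
    qed
  qed
  show ?case
    by (rule discs.AE_PiM_insertI[OF I _ step]) measurable
qed

section \<open>Products of measures and coordinates\<close>

lemma power_int_prod_distrib: "(\<Prod>i\<in>I. f i) powi n = (\<Prod>i\<in>I. f i powi n)" for f :: "'a \<Rightarrow> 'b::field"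
  by (induction I rule: infinite_finite_induct) (simp_all add: power_int_mult_distrib)

lemma power_int_sum_exponent: "x \<noteq> 0 \<Longrightarrow> x powi (\<Sum>i\<in>I. f i) = (\<Prod>i\<in>I. x powi f i)" for x :: "'b::field"
  by (induction I rule: infinite_finite_induct) (simp_all add: power_int_add)

lemma sigma_finite_density_real:
  assumes "sigma_finite_measure M" "h \<in> borel_measurable M"
  shows "sigma_finite_measure (density M (\<lambda>x. ennreal (h x)))"
  using assms sigma_finite_measure.sigma_finite_iff_density_finite[OF assms(1), of "\<lambda>x. ennreal (h x)"] by simp

lemma PiM_density:
  fixes M :: "'i \<Rightarrow> 'a measure"
  assumes I: "finite I" and M: "product_sigma_finite M"
    and D: "product_sigma_finite (\<lambda>i. density (M i) (h i))"
    and h [measurable]: "\<And>i. h i \<in> borel_measurable (M i)"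
  shows "PiM I (\<lambda>i. density (M i) (h i)) = density (PiM I M) (\<lambda>x. \<Prod>i\<in>I. h i (x i))"
proof -
  interpret M: product_sigma_finite M by (rule M)
  interpret D: product_sigma_finite "\<lambda>i. density (M i) (h i)" by (rule D)
  have "(\<lambda>x. h i (x i)) \<in> borel_measurable (PiM I M)" if "i \<in> I" for i
    using that by measurable
  then have hp [measurable]: "(\<lambda>x. \<Prod>i\<in>I. h i (x i)) \<in> borel_measurable (PiM I M)"
    by (intro borel_measurable_prod_ennreal)
  show ?thesis
  proof (rule D.PiM_eqI[symmetric, OF I])
    show "sets (density (PiM I M) (\<lambda>x. \<Prod>i\<in>I. h i (x i))) = sets (PiM I (\<lambda>i. density (M i) (h i)))"
      by (simp cong: sets_PiM_cong)
    fix A assume "\<And>i. i \<in> I \<Longrightarrow> A i \<in> sets (density (M i) (h i))"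
    then have A [measurable]: "\<And>i. i \<in> I \<Longrightarrow> A i \<in> sets (M i)" by simp
    have [measurable]: "PiE I A \<in> sets (PiM I M)" by (rule sets_PiM_I_finite[OF I A])
    have "emeasure (density (PiM I M) (\<lambda>x. \<Prod>i\<in>I. h i (x i))) (PiE I A)
        = (\<integral>\<^sup>+x. (\<Prod>i\<in>I. h i (x i)) * indicator (PiE I A) x \<partial>PiM I M)"
      by (rule emeasure_density) measurable
    also have "\<dots> = (\<integral>\<^sup>+x. (\<Prod>i\<in>I. h i (x i) * indicator (A i) (x i)) \<partial>PiM I M)"
    proof (rule nn_integral_cong)
      fix x assume x: "x \<in> space (PiM I M)"
      have "(\<Prod>i\<in>I. indicator (A i) (x i)) = (indicator (PiE I A) x :: ennreal)"
        using x I by (auto simp: indicator_def PiE_iff space_PiM prod_zero_iff)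
      then show "(\<Prod>i\<in>I. h i (x i)) * indicator (PiE I A) x = (\<Prod>i\<in>I. h i (x i) * indicator (A i) (x i))"
        by (simp add: prod.distrib)
    qed
    also have "\<dots> = (\<Prod>i\<in>I. \<integral>\<^sup>+t. h i t * indicator (A i) t \<partial>M i)"
      by (rule M.product_nn_integral_prod[OF I]) measurable
    also have "\<dots> = (\<Prod>i\<in>I. emeasure (density (M i) (h i)) (A i))"
      by (rule prod.cong[OF refl], rule emeasure_density[symmetric]) (use A in auto)
    finally show "emeasure (density (PiM I M) (\<lambda>x. \<Prod>i\<in>I. h i (x i))) (PiE I A) = (\<Prod>i\<in>I. emeasure (density (M i) (h i)) (A i))" .
  qed
qed

lemma measurable_vec_lambda_complex:
  "(vec_lambda :: ('n \<Rightarrow> complex) \<Rightarrow> complex^'n) \<in> PiM UNIV (\<lambda>_. borel) \<rightarrow>\<^sub>M borel"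
proof (subst borel_measurable_euclidean_space, intro ballI)
  fix b :: "complex^'n" assume "b \<in> Basis"
  then obtain i u where b: "b = axis i u" by (auto simp: Basis_vec_def)
  have "(\<lambda>x :: 'n \<Rightarrow> complex. x i \<bullet> u) \<in> borel_measurable (PiM UNIV (\<lambda>_. borel))"
    by measurable
  then show "(\<lambda>x. vec_lambda x \<bullet> b) \<in> borel_measurable (PiM UNIV (\<lambda>_. borel))"
    by (simp add: b inner_axis)
qed

lemma measurable_vec_nth_complex [measurable]: "(\<lambda>z :: complex^'n. z $ i) \<in> borel_measurable borel"
  by (intro borel_measurable_continuous_onI continuous_intros)

lemma lborel_vec_eq_distr:
  "lborel = distr (PiM UNIV (\<lambda>_::'n. lborel :: complex measure)) borel (vec_lambda :: ('n \<Rightarrow> complex) \<Rightarrow> complex^'n)"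
proof (rule lborel_eqI)
  interpret product_sigma_finite "\<lambda>_::'n. lborel :: complex measure"
    by (simp add: product_sigma_finite_def lborel.sigma_finite_measure_axioms)
  have m [measurable]: "(vec_lambda :: ('n \<Rightarrow> complex) \<Rightarrow> complex^'n) \<in> PiM UNIV (\<lambda>_. lborel) \<rightarrow>\<^sub>M borel"
    using measurable_vec_lambda_complex by (simp cong: measurable_cong_sets sets_PiM_cong)
  fix l u :: "complex^'n" assume le: "\<And>b. b \<in> Basis \<Longrightarrow> l \<bullet> b \<le> u \<bullet> b"
  have le': "l $ i \<bullet> b \<le> u $ i \<bullet> b" if "b \<in> Basis" for i b
    using le[of "axis i b"] that by (simp add: inner_axis axis_in_Basis_iff)
  have "vec_lambda -` box l u \<inter> space (PiM UNIV (\<lambda>_. lborel)) = (PiE UNIV (\<lambda>i. box (l $ i) (u $ i)) :: ('n \<Rightarrow> complex) set)"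
  proof -
    show ?thesis by (auto simp: mem_box Basis_vec_def inner_axis space_PiM PiE_def Pi_iff)
  qed
  then have "emeasure (distr (PiM UNIV (\<lambda>_::'n. lborel)) borel vec_lambda) (box l u) = emeasure (PiM UNIV (\<lambda>_::'n. lborel)) (PiE UNIV (\<lambda>i. box (l $ i) (u $ i)))"
    by (simp add: emeasure_distr)
  also have "\<dots> = (\<Prod>i\<in>UNIV. emeasure lborel (box (l $ i) (u $ i)))"
    by (rule emeasure_PiM) auto
  also have "\<dots> = (\<Prod>i\<in>UNIV. ennreal (\<Prod>b\<in>Basis. (u $ i - l $ i) \<bullet> b))"
    using le' by (intro prod.cong refl emeasure_lborel_box) auto
  also have "\<dots> = ennreal (\<Prod>i\<in>UNIV. \<Prod>b\<in>Basis. (u $ i - l $ i) \<bullet> b)"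
    using le' by (intro prod_ennreal prod_nonneg) (auto simp: inner_diff_left)
  also have "(\<Prod>i\<in>UNIV. \<Prod>b\<in>Basis. (u $ i - l $ i) \<bullet> b) = (\<Prod>b\<in>Basis. (u - l) \<bullet> b)"
  proof -
    have "(\<Prod>b\<in>(Basis :: (complex^'n) set). (u - l) \<bullet> b) = (\<Prod>(i, b)\<in>UNIV \<times> Basis. (u $ i - l $ i) \<bullet> b)"
    proof (rule prod.reindex_bij_betw[of "\<lambda>(i, b). axis i b" "UNIV \<times> Basis" Basis "\<lambda>b. (u - l) \<bullet> b", symmetric, THEN trans])
      show "bij_betw (\<lambda>(i, b). axis i b) (UNIV \<times> (Basis :: complex set)) (Basis :: (complex^'n) set)"
        unfolding bij_betw_def
      proof
        show "inj_on (\<lambda>(i::'n, b). axis i b) (UNIV \<times> (Basis :: complex set))"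
          by (auto simp: inj_on_def axis_eq_axis)
        show "(\<lambda>(i::'n, b). axis i b) ` (UNIV \<times> (Basis :: complex set)) = Basis"
          by (auto simp: Basis_vec_def)
      qed
      show "(\<Prod>x\<in>UNIV \<times> Basis. (u - l) \<bullet> (case x of (i, b) \<Rightarrow> axis i b)) = (\<Prod>(i, b)\<in>UNIV \<times> Basis. (u $ i - l $ i) \<bullet> b)"
        by (rule prod.cong) (auto simp: inner_axis)
    qed
    then show ?thesis by (simp add: prod.cartesian_product)
  qed
  finally show "emeasure (distr (PiM UNIV (\<lambda>_::'n. lborel)) borel vec_lambda) (box l u) = ennreal (\<Prod>b\<in>Basis. (u - l) \<bullet> b)" .
qed simp

section \<open>Haar measure of the multiplicative group\<close>

text \<open>Haar measure of the multiplicative group of nonzero complex numbers.\<close>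

definition haar1 :: "complex measure" where
  "haar1 = density lborel (\<lambda>z. ennreal (1 / (cmod z)\<^sup>2))"

lemma sets_haar1 [simp, measurable_cong]: "sets haar1 = sets borel" and space_haar1 [simp]: "space haar1 = UNIV"
  by (simp_all add: haar1_def)

lemma sigma_finite_haar1: "sigma_finite_measure haar1"
  unfolding haar1_def by (rule sigma_finite_density_real[OF lborel.sigma_finite_measure_axioms]) measurable

interpretation haar: product_sigma_finite "\<lambda>_::'i. haar1"
  by (simp add: product_sigma_finite_def sigma_finite_haar1)

lemma nn_integral_haar1:
  "f \<in> borel_measurable borel \<Longrightarrow> (\<integral>\<^sup>+z. f z \<partial>haar1) = (\<integral>\<^sup>+z. ennreal (1 / (cmod z)\<^sup>2) * f z \<partial>lborel)"
  unfolding haar1_def by (rule nn_integral_density) auto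

lemma AE_haar1: "AE z in haar1. z \<noteq> 0"
  unfolding haar1_def by (subst AE_density) (auto intro: AE_mp[OF AE_lborel_singleton])

lemma haar1_invariant:
  assumes c: "c \<noteq> 0"
  shows "distr haar1 borel (\<lambda>z. c * z) = haar1"
proof (rule measure_eqI)
  fix A assume "A \<in> sets (distr haar1 borel (\<lambda>z. c * z))"
  then have [measurable]: "A \<in> sets borel" by simp
  let ?f = "\<lambda>z. ennreal (1 / (cmod z)\<^sup>2) * indicator A z"
  have "emeasure haar1 A = (\<integral>\<^sup>+z. indicator A z \<partial>haar1)" by simp
  also have "\<dots> = (\<integral>\<^sup>+z. ?f z \<partial>lborel)" by (rule nn_integral_haar1) measurable
  also have "\<dots> = ennreal ((cmod c)\<^sup>2) * (\<integral>\<^sup>+z. ?f (c * z) \<partial>lborel)"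
    by (rule nn_integral_complex_mult[OF _ c]) measurable
  also have "\<dots> = (\<integral>\<^sup>+z. ennreal ((cmod c)\<^sup>2) * ?f (c * z) \<partial>lborel)"
    by (rule nn_integral_cmult[symmetric]) measurable
  also have "\<dots> = (\<integral>\<^sup>+z. ennreal (1 / (cmod z)\<^sup>2) * indicator A (c * z) \<partial>lborel)"
  proof (rule nn_integral_cong)
    fix z
    have "ennreal ((cmod c)\<^sup>2) * ennreal (1 / (cmod (c * z))\<^sup>2) = ennreal (1 / (cmod z)\<^sup>2)"
      using c by (simp add: norm_mult power_mult_distrib flip: ennreal_mult)
    then show "ennreal ((cmod c)\<^sup>2) * ?f (c * z) = ennreal (1 / (cmod z)\<^sup>2) * indicator A (c * z)"
      by (simp only: mult.assoc[symmetric])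
  qed
  also have "\<dots> = (\<integral>\<^sup>+z. indicator A (c * z) \<partial>haar1)"
    by (rule nn_integral_haar1[symmetric]) measurable
  also have "\<dots> = (\<integral>\<^sup>+z. indicator A z \<partial>distr haar1 borel (\<lambda>z. c * z))"
    by (rule nn_integral_distr[symmetric]) auto
  also have "\<dots> = emeasure (distr haar1 borel (\<lambda>z. c * z)) A" by simp
  finally show "emeasure (distr haar1 borel (\<lambda>z. c * z)) A = emeasure haar1 A" by simp
qed simp

lemma haar1_annulus:
  assumes "1 < r"
  shows "emeasure haar1 {z. 1 / r < cmod z \<and> cmod z < r} < \<infinity>" "0 < emeasure haar1 {z. 1 / r < cmod z \<and> cmod z < r}"
proof -
  let ?A = "{z::complex. 1 / r < cmod z \<and> cmod z < r}"
  have r0: "0 < r" using assms by simp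
  have [measurable]: "?A \<in> sets borel" by measurable
  have eq: "emeasure haar1 ?A = (\<integral>\<^sup>+z. ennreal (1 / (cmod z)\<^sup>2) * indicator ?A z \<partial>lborel)"
    unfolding haar1_def by (rule emeasure_density) auto
  have "\<dots> \<le> (\<integral>\<^sup>+z. ennreal (r\<^sup>2) * indicator (ball 0 r) (z::complex) \<partial>lborel)"
  proof (rule nn_integral_mono)
    fix z :: complex
    have "1 / (cmod z)\<^sup>2 \<le> r\<^sup>2" if "1 / r < cmod z"
    proof -
      have "(1 / cmod z)\<^sup>2 \<le> r\<^sup>2"
        using that r0 by (intro power_mono) (auto simp: divide_simps mult.commute split: if_splits)
      then show ?thesis by (simp add: power_divide)
    qed
    then show "ennreal (1 / (cmod z)\<^sup>2) * indicator ?A z \<le> ennreal (r\<^sup>2) * indicator (ball 0 r) z"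
      by (auto simp: indicator_def ennreal_leI)
  qed
  also have "\<dots> = ennreal (r\<^sup>2) * ennreal (pi * r\<^sup>2)"
    using r0 by (subst nn_integral_cmult_indicator) (auto simp: emeasure_ball_complex)
  also have "\<dots> < \<infinity>" by (simp add: ennreal_mult_less_top)
  finally show "emeasure haar1 ?A < \<infinity>" by (simp add: eq)
  show "0 < emeasure haar1 ?A"
  proof -
    have r1: "1 / r < 1" using assms by simp
    have rr: "1 / r < r" using less_trans[OF r1 assms] .
    then have "?A = ball 0 r - cball 0 (1 / r)" by auto
    moreover have "emeasure lborel (ball 0 r - cball 0 (1 / r) :: complex set) = emeasure lborel (ball (0::complex) r) - emeasure lborel (cball (0::complex) (1 / r))"
    proof (rule emeasure_Diff)
      show "cball 0 (1 / r) \<subseteq> ball (0::complex) r" using rr by auto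
    qed (use r0 in \<open>simp_all add: emeasure_cball_complex\<close>)
    moreover have "\<dots> = ennreal (pi * (r\<^sup>2 - (1 / r)\<^sup>2))"
      using r0 by (simp add: emeasure_cball_complex emeasure_ball_complex ennreal_minus right_diff_distrib)
    ultimately have area: "emeasure lborel ?A = ennreal (pi * (r\<^sup>2 - (1 / r)\<^sup>2))" by simp
    have "(1 / r)\<^sup>2 < r\<^sup>2" using rr by (rule power_strict_mono) (use r0 in auto)
    then have "0 < ennreal (1 / r\<^sup>2) * emeasure lborel ?A"
      using r0 by (simp add: area ennreal_zero_less_mult_iff)
    also have "\<dots> = (\<integral>\<^sup>+z. ennreal (1 / r\<^sup>2) * indicator ?A z \<partial>lborel)"
      by (rule nn_integral_cmult_indicator[symmetric]) measurable
    also have "\<dots> \<le> (\<integral>\<^sup>+z. ennreal (1 / (cmod z)\<^sup>2) * indicator ?A z \<partial>lborel)"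
    proof (rule nn_integral_mono)
      fix z :: complex
      have "1 / r\<^sup>2 \<le> 1 / (cmod z)\<^sup>2" if "z \<in> ?A"
        using that r0 by (intro divide_left_mono power_mono mult_pos_pos zero_less_power) (auto intro: less_trans[of 0 "1/r"])
      then show "ennreal (1 / r\<^sup>2) * indicator ?A z \<le> ennreal (1 / (cmod z)\<^sup>2) * indicator ?A z"
        by (auto simp: indicator_def ennreal_leI)
    qed
    finally show ?thesis by (simp add: eq)
  qed
qed

lemma haar_invariant:
  fixes f :: "('i::finite \<Rightarrow> complex) \<Rightarrow> ennreal"
  assumes f [measurable]: "f \<in> borel_measurable (PiM UNIV (\<lambda>_. haar1))" and c: "\<And>j. c j \<noteq> 0"
  shows "(\<integral>\<^sup>+x. f (\<lambda>j. c j * x j) \<partial>PiM UNIV (\<lambda>_. haar1)) = (\<integral>\<^sup>+x. f x \<partial>PiM UNIV (\<lambda>_. haar1))"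
proof -
  let ?H = "PiM UNIV (\<lambda>_::'i. haar1)"
  let ?T = "\<lambda>x j. c j * x j"
  have T [measurable]: "?T \<in> ?H \<rightarrow>\<^sub>M ?H"
  proof (rule measurable_PiM_single')
    fix i :: 'i
    have "(\<lambda>x. c i * x i) \<in> borel_measurable ?H" by measurable
    then show "(\<lambda>x. c i * x i) \<in> ?H \<rightarrow>\<^sub>M haar1" by (simp cong: measurable_cong_sets)
  qed (auto simp: space_PiM)
  have "distr ?H ?H ?T = ?H"
  proof (rule haar.PiM_eqI)
    fix A :: "'i \<Rightarrow> complex set" assume "\<And>i. i \<in> UNIV \<Longrightarrow> A i \<in> sets haar1"
    then have A [measurable]: "\<And>i. A i \<in> sets borel" by simp
    have A': "(\<lambda>z. c i * z) -` A i \<in> sets borel" for i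
      using measurable_sets[of "\<lambda>z. c i * z" borel borel "A i"] A by simp
    have "emeasure (distr ?H ?H ?T) (PiE UNIV A) = emeasure ?H (?T -` PiE UNIV A \<inter> space ?H)"
      by (rule emeasure_distr) (use A in \<open>auto intro!: sets_PiM_I_finite\<close>)
    also have "?T -` PiE UNIV A \<inter> space ?H = PiE UNIV (\<lambda>i. (\<lambda>z. c i * z) -` A i)"
      by (auto simp: space_PiM PiE_def)
    also have "emeasure ?H (PiE UNIV (\<lambda>i. (\<lambda>z. c i * z) -` A i)) = (\<Prod>i\<in>UNIV. emeasure haar1 ((\<lambda>z. c i * z) -` A i))"
      by (rule haar.emeasure_PiM) (use A' in auto)
    also have "\<dots> = (\<Prod>i\<in>UNIV. emeasure haar1 (A i))"
    proof (rule prod.cong[OF refl])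
      fix i
      have "emeasure haar1 (A i) = emeasure (distr haar1 borel (\<lambda>z. c i * z)) (A i)"
        by (simp add: haar1_invariant[OF c])
      then show "emeasure haar1 ((\<lambda>z. c i * z) -` A i) = emeasure haar1 (A i)"
        by (simp add: emeasure_distr)
    qed
    finally show "emeasure (distr ?H ?H ?T) (PiE UNIV A) = (\<Prod>i\<in>UNIV. emeasure haar1 (A i))" .
  qed auto
  then have "(\<integral>\<^sup>+x. f x \<partial>?H) = (\<integral>\<^sup>+x. f x \<partial>distr ?H ?H ?T)" by simp
  also have "\<dots> = (\<integral>\<^sup>+x. f (?T x) \<partial>?H)" by (rule nn_integral_distr) auto
  finally show ?thesis by simp
qed

lemma AE_haar: "AE x in PiM UNIV (\<lambda>_::'i::finite. haar1). \<forall>j. x j \<noteq> 0"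
proof -
  have "AE x in PiM UNIV (\<lambda>_::'i. haar1). \<forall>j\<in>UNIV. x j \<noteq> 0"
    by (intro AE_finite_allI haar.AE_PiM_coordinate AE_haar1) auto
  then show ?thesis by simp
qed

section \<open>Monomial maps\<close>

text \<open>The identity \<open>BA\<close> makes \<open>A\<close> invertible over the rationals, with inverse \<open>B\<close> divided by \<open>e\<close> row by row. So the
  monomial map with exponents \<open>A\<close> is onto, and the monomials with exponents \<open>B\<close> invert it up to powers.\<close>

locale monomial_map =
  fixes A :: "'n::finite \<Rightarrow> 'n \<Rightarrow> nat" and B :: "'n \<Rightarrow> 'n \<Rightarrow> int" and e :: "'n \<Rightarrow> nat"
  assumes e_pos: "\<And>j. 0 < e j"
    and BA: "\<And>j i. (\<Sum>k\<in>UNIV. B j k * int (A k i)) = (if j = i then int (e j) else 0)"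
begin

lemma AB: "(\<Sum>j\<in>UNIV. real (A i j) * (real_of_int (B j k) / real (e j))) = (if i = k then 1 else 0)"
proof -
  define MB :: "real^'n^'n" where "MB = (\<chi> j k. real_of_int (B j k) / real (e j))"
  define MA :: "real^'n^'n" where "MA = (\<chi> i j. real (A i j))"
  have "MB ** MA = mat 1"
  proof -
    have "(\<Sum>k\<in>UNIV. real_of_int (B j k) / real (e j) * real (A k i)) = (if j = i then 1 else 0)" for j i
    proof -
      have "(\<Sum>k\<in>UNIV. real_of_int (B j k) / real (e j) * real (A k i)) = real_of_int (\<Sum>k\<in>UNIV. B j k * int (A k i)) / real (e j)"
        by (simp add: sum_divide_distrib)
      then show ?thesis using e_pos[of j] e_pos[of i] by (simp add: BA)
    qed
    then show ?thesis by (simp add: MB_def MA_def matrix_matrix_mult_def mat_def vec_eq_iff)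
  qed
  then have "MA ** MB = mat 1" by (simp add: matrix_left_right_inverse)
  then show ?thesis by (simp add: MB_def MA_def matrix_matrix_mult_def mat_def vec_eq_iff)
qed

definition \<Phi> :: "('n \<Rightarrow> complex) \<Rightarrow> 'n \<Rightarrow> complex" where
  "\<Phi> x i = (\<Prod>j\<in>UNIV. x j ^ A i j)"

lemma \<Phi>_mult: "\<Phi> (\<lambda>j. x j * y j) i = \<Phi> x i * \<Phi> y i"
  by (simp add: \<Phi>_def power_mult_distrib prod.distrib)

lemma \<Phi>_nonzero: "(\<And>j. x j \<noteq> 0) \<Longrightarrow> \<Phi> x i \<noteq> 0"
  by (simp add: \<Phi>_def)

lemma prod_powi_monomial:
  fixes x :: "'n \<Rightarrow> 'b::field"
  assumes x: "\<And>j. x j \<noteq> 0"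
  shows "(\<Prod>k\<in>UNIV. (\<Prod>i\<in>UNIV. x i ^ A k i) powi (\<beta> k)) = (\<Prod>i\<in>UNIV. x i powi (\<Sum>k\<in>UNIV. \<beta> k * int (A k i)))"
proof -
  have "(\<Prod>i\<in>UNIV. x i ^ A k i) powi (\<beta> k) = (\<Prod>i\<in>UNIV. x i powi (\<beta> k * int (A k i)))" for k
    by (simp add: power_int_prod_distrib power_int_mult mult.commute[of "\<beta> k"])
  then have "(\<Prod>k\<in>UNIV. (\<Prod>i\<in>UNIV. x i ^ A k i) powi (\<beta> k)) = (\<Prod>k\<in>UNIV. \<Prod>i\<in>UNIV. x i powi (\<beta> k * int (A k i)))"
    by simp
  also have "\<dots> = (\<Prod>i\<in>UNIV. \<Prod>k\<in>UNIV. x i powi (\<beta> k * int (A k i)))" by (rule prod.swap)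
  also have "\<dots> = (\<Prod>i\<in>UNIV. x i powi (\<Sum>k\<in>UNIV. \<beta> k * int (A k i)))"
    by (simp add: power_int_sum_exponent x)
  finally show ?thesis .
qed

lemma prod_powi_B:
  fixes x :: "'n \<Rightarrow> 'b::field"
  assumes x: "\<And>j. x j \<noteq> 0"
  shows "(\<Prod>k\<in>UNIV. (\<Prod>i\<in>UNIV. x i ^ A k i) powi (B j k)) = x j ^ e j"
proof -
  have "(\<Prod>i\<in>UNIV. x i powi (\<Sum>k\<in>UNIV. B j k * int (A k i))) = (\<Prod>i\<in>UNIV. if i = j then x j ^ e j else 1)"
    by (rule prod.cong) (auto simp: BA)
  then show ?thesis by (simp add: prod_powi_monomial[OF x])
qed

text \<open>Take logarithms and solve the linear system; any branch will do.\<close>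

lemma \<Phi>_surj:
  assumes z: "\<And>i. z i \<noteq> 0"
  shows "\<exists>x. (\<forall>j. x j \<noteq> 0) \<and> \<Phi> x = z"
proof -
  define x where "x j = exp (\<Sum>k\<in>UNIV. of_real (real_of_int (B j k) / real (e j)) * Ln (z k))" for j
  have "\<Phi> x i = z i" for i
  proof -
    have "\<Phi> x i = exp (\<Sum>j\<in>UNIV. of_nat (A i j) * (\<Sum>k\<in>UNIV. of_real (real_of_int (B j k) / real (e j)) * Ln (z k)))"
      by (simp add: \<Phi>_def x_def exp_sum exp_of_nat_mult)
    also have "(\<Sum>j\<in>UNIV. of_nat (A i j) * (\<Sum>k\<in>UNIV. of_real (real_of_int (B j k) / real (e j)) * Ln (z k)))
        = (\<Sum>k\<in>UNIV. (\<Sum>j\<in>UNIV. of_nat (A i j) * of_real (real_of_int (B j k) / real (e j))) * Ln (z k))"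
      unfolding sum_distrib_left sum_distrib_right mult.assoc by (rule sum.swap)
    also have "\<dots> = (\<Sum>k\<in>UNIV. (if i = k then 1 else 0) * Ln (z k))"
    proof (rule sum.cong[OF refl])
      fix k
      have "(\<Sum>j\<in>UNIV. of_nat (A i j) * of_real (real_of_int (B j k) / real (e j))) = complex_of_real (\<Sum>j\<in>UNIV. real (A i j) * (real_of_int (B j k) / real (e j)))"
        by simp
      then show "(\<Sum>j\<in>UNIV. of_nat (A i j) * of_real (real_of_int (B j k) / real (e j))) * Ln (z k) = (if i = k then 1 else 0) * Ln (z k)"
        by (simp only: AB) simp
    qed
    also have "\<dots> = Ln (z i)" by (simp add: if_distrib[of "\<lambda>c. c * _"] cong: if_cong)
    finally show ?thesis using z by simp
  qed
  then show ?thesis by (intro exI[of _ x]) (auto simp: x_def)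
qed

abbreviation haarN :: "('n \<Rightarrow> complex) measure" where "haarN \<equiv> PiM UNIV (\<lambda>_. haar1)"

lemma measurable_\<Phi> [measurable]: "\<Phi> \<in> haarN \<rightarrow>\<^sub>M haarN"
proof (rule measurable_PiM_single')
  fix i :: 'n
  have "(\<lambda>x. \<Phi> x i) \<in> borel_measurable haarN" unfolding \<Phi>_def by measurable
  then show "(\<lambda>x. \<Phi> x i) \<in> haarN \<rightarrow>\<^sub>M haar1" by (simp cong: measurable_cong_sets)
qed (auto simp: space_PiM)

text \<open>Both \<open>f \<mapsto> \<integral> f\<close> and \<open>f \<mapsto> \<integral> f \<circ> \<Phi>\<close> are invariant under multiplication, the second one because \<open>\<Phi>\<close> is a
  surjective homomorphism, so they are proportional. The proof is the usual one for the uniqueness of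
  Haar measure: compare both with the indicator \<open>g\<close> of a product \<open>Q\<close> of annuli by evaluating
  \<open>\<integral> \<integral> g(\<Phi>(s)) f(x \<Phi>(s))\<close> in both orders.\<close>

lemma haar_pushforward:
  "\<exists>c>0. \<forall>f\<in>borel_measurable haarN. (\<integral>\<^sup>+x. f x \<partial>haarN) = ennreal c * (\<integral>\<^sup>+s. f (\<Phi> s) \<partial>haarN)"
proof -
  define Q where "Q = {x :: 'n \<Rightarrow> complex. \<forall>j. 1 / 2 < cmod (x j) \<and> cmod (x j) < 2}"
  have Qeq: "Q = PiE UNIV (\<lambda>_. {z. 1 / 2 < cmod z \<and> cmod z < 2})" by (auto simp: Q_def)
  have annm: "{z::complex. a < cmod z \<and> cmod z < b} \<in> sets borel" for a b by measurable
  have Qm [measurable]: "Q \<in> sets haarN" unfolding Qeq by (rule sets_PiM_I_finite) (use annm in auto)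
  have Qe: "emeasure haarN Q = (\<Prod>j\<in>(UNIV::'n set). emeasure haar1 {z. 1 / 2 < cmod z \<and> cmod z < 2})"
    unfolding Qeq using haar.emeasure_PiM[of "UNIV :: 'n set" "\<lambda>_. {z. 1 / 2 < cmod z \<and> cmod z < 2}"] annm by simp
  have Q1: "emeasure haarN Q < \<infinity>" and Q2: "0 < emeasure haarN Q"
    using haar1_annulus[of 2] unfolding Qe
    by (auto simp: less_top ennreal_prod_eq_top zero_less_iff_neq_zero power_less_top_ennreal)
  interpret H: sigma_finite_measure haarN by (rule haar.sigma_finite) simp
  interpret P: pair_sigma_finite haarN haarN by unfold_locales
  define g where "g = (indicator Q :: ('n \<Rightarrow> complex) \<Rightarrow> ennreal)"
  have gm [measurable]: "g \<in> borel_measurable haarN" by (simp add: g_def)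
  define c2 where "c2 = (\<integral>\<^sup>+s. g (\<Phi> s) \<partial>haarN)"
  \<comment> \<open>the annuli are symmetric under inversion\<close>
  have c1: "(\<integral>\<^sup>+x. g (\<lambda>j. inverse (x j)) \<partial>haarN) = emeasure haarN Q"
  proof -
    have "g (\<lambda>j. inverse (x j)) = indicator Q x" for x
    proof -
      have "(1 / 2 < cmod (inverse z) \<and> cmod (inverse z) < 2) \<longleftrightarrow> (1 / 2 < cmod z \<and> cmod z < 2)" for z
      proof (cases "z = 0")
        case False
        then have "cmod (inverse z) = 1 / cmod z" by (simp add: norm_inverse inverse_eq_divide norm_divide)
        then show ?thesis using False by (simp only:) (auto simp: less_divide_eq divide_less_eq)
      qed simp
      then show ?thesis by (simp add: g_def Q_def indicator_def)
    qed
    then show ?thesis using Qm by simp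
  qed
  have mulm: "(\<lambda>(x, s) j. x j * \<Phi> s j) \<in> haarN \<Otimes>\<^sub>M haarN \<rightarrow>\<^sub>M haarN"
  proof (rule measurable_PiM_single')
    fix i :: 'n
    have "(\<lambda>w. fst w i * \<Phi> (snd w) i) \<in> borel_measurable (haarN \<Otimes>\<^sub>M haarN)"
      unfolding \<Phi>_def by measurable
    then show "(\<lambda>w. (case w of (x, s) \<Rightarrow> \<lambda>j. x j * \<Phi> s j) i) \<in> haarN \<Otimes>\<^sub>M haarN \<rightarrow>\<^sub>M haar1"
      by (simp add: split_beta cong: measurable_cong_sets)
  qed (auto simp: space_PiM)
  have divm: "(\<lambda>(x, s) j. \<Phi> s j * inverse (x j)) \<in> haarN \<Otimes>\<^sub>M haarN \<rightarrow>\<^sub>M haarN"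
  proof (rule measurable_PiM_single')
    fix i :: 'n
    have "(\<lambda>w. \<Phi> (snd w) i * inverse (fst w i)) \<in> borel_measurable (haarN \<Otimes>\<^sub>M haarN)"
      unfolding \<Phi>_def by measurable
    then show "(\<lambda>w. (case w of (x, s) \<Rightarrow> \<lambda>j. \<Phi> s j * inverse (x j)) i) \<in> haarN \<Otimes>\<^sub>M haarN \<rightarrow>\<^sub>M haar1"
      by (simp add: split_beta cong: measurable_cong_sets)
  qed (auto simp: space_PiM)
  have invm: "(\<lambda>x j. inverse (x j)) \<in> haarN \<rightarrow>\<^sub>M haarN"
  proof (rule measurable_PiM_single')
    fix i :: 'n
    have "(\<lambda>x. inverse (x i)) \<in> borel_measurable haarN" by measurable
    then show "(\<lambda>x. inverse (x i)) \<in> haarN \<rightarrow>\<^sub>M haar1" by (simp cong: measurable_cong_sets)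
  qed (auto simp: space_PiM)
  have key: "c2 * (\<integral>\<^sup>+x. f x \<partial>haarN) = emeasure haarN Q * (\<integral>\<^sup>+s. f (\<Phi> s) \<partial>haarN)"
    if f [measurable]: "f \<in> borel_measurable haarN" for f
  proof -
    have fm [measurable]: "(\<lambda>(x, s). f (\<lambda>j. x j * \<Phi> s j)) \<in> borel_measurable (haarN \<Otimes>\<^sub>M haarN)"
      using measurable_compose[OF mulm f] by (simp add: split_beta)
    have gdm [measurable]: "(\<lambda>(x, s). g (\<lambda>j. \<Phi> s j * inverse (x j))) \<in> borel_measurable (haarN \<Otimes>\<^sub>M haarN)"
      using measurable_compose[OF divm gm] by (simp add: split_beta)
    have gim [measurable]: "(\<lambda>x. g (\<lambda>j. inverse (x j))) \<in> borel_measurable haarN"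
      by (rule measurable_compose[OF invm gm])
    have gPm [measurable]: "(\<lambda>s. g (\<Phi> s)) \<in> borel_measurable haarN" "(\<lambda>s. f (\<Phi> s)) \<in> borel_measurable haarN"
      by (rule measurable_compose[OF measurable_\<Phi>], rule gm, rule measurable_compose[OF measurable_\<Phi>], rule f)
    have "c2 * (\<integral>\<^sup>+x. f x \<partial>haarN) = (\<integral>\<^sup>+s. g (\<Phi> s) * (\<integral>\<^sup>+x. f x \<partial>haarN) \<partial>haarN)"
      unfolding c2_def by (rule nn_integral_multc[symmetric]) measurable
    also have "\<dots> = (\<integral>\<^sup>+s. (\<integral>\<^sup>+x. g (\<Phi> s) * f (\<lambda>j. x j * \<Phi> s j) \<partial>haarN) \<partial>haarN)"
    proof (rule nn_integral_cong_AE, use AE_haar AE_space in eventually_elim)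
      fix s :: "'n \<Rightarrow> complex" assume s: "\<forall>j. s j \<noteq> 0" and ss: "s \<in> space haarN"
      have fs [measurable]: "(\<lambda>x. f (\<lambda>j. x j * \<Phi> s j)) \<in> borel_measurable haarN"
        using measurable_Pair1[OF fm ss] by simp
      have "(\<integral>\<^sup>+x. f (\<lambda>j. \<Phi> s j * x j) \<partial>haarN) = (\<integral>\<^sup>+x. f x \<partial>haarN)"
        by (rule haar_invariant[OF f \<Phi>_nonzero]) (use s in auto)
      then show "g (\<Phi> s) * (\<integral>\<^sup>+x. f x \<partial>haarN) = (\<integral>\<^sup>+x. g (\<Phi> s) * f (\<lambda>j. x j * \<Phi> s j) \<partial>haarN)"
        by (subst nn_integral_cmult) (auto simp: mult.commute)
    qed
    also have "\<dots> = (\<integral>\<^sup>+x. (\<integral>\<^sup>+s. g (\<Phi> s) * f (\<lambda>j. x j * \<Phi> s j) \<partial>haarN) \<partial>haarN)"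
      by (rule P.Fubini') measurable
    also have "\<dots> = (\<integral>\<^sup>+x. (\<integral>\<^sup>+s. g (\<lambda>j. \<Phi> s j * inverse (x j)) * f (\<Phi> s) \<partial>haarN) \<partial>haarN)"
    proof (rule nn_integral_cong_AE, use AE_haar AE_space in eventually_elim)
      fix x :: "'n \<Rightarrow> complex" assume x: "\<forall>j. x j \<noteq> 0" and xs: "x \<in> space haarN"
      obtain r where r: "\<And>j. r j \<noteq> 0" "\<Phi> r = (\<lambda>j. inverse (x j))"
        using \<Phi>_surj[of "\<lambda>j. inverse (x j)"] x by auto
      have fs [measurable]: "(\<lambda>s. f (\<lambda>j. x j * \<Phi> s j)) \<in> borel_measurable haarN"
        using measurable_Pair2[OF fm xs] by simp
      let ?h = "\<lambda>s. g (\<Phi> s) * f (\<lambda>j. x j * \<Phi> s j)"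
      have "(\<integral>\<^sup>+s. ?h (\<lambda>j. r j * s j) \<partial>haarN) = (\<integral>\<^sup>+s. ?h s \<partial>haarN)"
        by (rule haar_invariant[OF _ r(1)]) measurable
      moreover have "?h (\<lambda>j. r j * s j) = g (\<lambda>j. \<Phi> s j * inverse (x j)) * f (\<Phi> s)" for s
      proof -
        have "\<Phi> (\<lambda>j. r j * s j) = (\<lambda>j. \<Phi> s j * inverse (x j))"
          by (rule ext) (simp add: \<Phi>_mult r(2) mult.commute)
        moreover have "(\<lambda>j. x j * (\<Phi> s j * inverse (x j))) = \<Phi> s"
          using x by (intro ext) simp
        ultimately show ?thesis by (simp only:)
      qed
      ultimately show "(\<integral>\<^sup>+s. ?h s \<partial>haarN) = (\<integral>\<^sup>+s. g (\<lambda>j. \<Phi> s j * inverse (x j)) * f (\<Phi> s) \<partial>haarN)"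
        by simp
    qed
    also have "\<dots> = (\<integral>\<^sup>+s. (\<integral>\<^sup>+x. g (\<lambda>j. \<Phi> s j * inverse (x j)) * f (\<Phi> s) \<partial>haarN) \<partial>haarN)"
      by (rule P.Fubini'[symmetric]) measurable
    also have "\<dots> = (\<integral>\<^sup>+s. emeasure haarN Q * f (\<Phi> s) \<partial>haarN)"
    proof (rule nn_integral_cong_AE, use AE_haar AE_space in eventually_elim)
      fix s :: "'n \<Rightarrow> complex" assume s: "\<forall>j. s j \<noteq> 0" and ss: "s \<in> space haarN"
      have gs [measurable]: "(\<lambda>x. g (\<lambda>j. \<Phi> s j * inverse (x j))) \<in> borel_measurable haarN"
        using measurable_Pair1[OF gdm ss] by simp
      have "(\<integral>\<^sup>+x. g (\<lambda>j. inverse (inverse (\<Phi> s j) * x j)) \<partial>haarN) = (\<integral>\<^sup>+x. g (\<lambda>j. inverse (x j)) \<partial>haarN)"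
        by (rule haar_invariant[OF gim]) (use \<Phi>_nonzero s in auto)
      then have "(\<integral>\<^sup>+x. g (\<lambda>j. \<Phi> s j * inverse (x j)) \<partial>haarN) = emeasure haarN Q"
        using c1 by simp
      then show "(\<integral>\<^sup>+x. g (\<lambda>j. \<Phi> s j * inverse (x j)) * f (\<Phi> s) \<partial>haarN) = emeasure haarN Q * f (\<Phi> s)"
        by (subst nn_integral_multc) auto
    qed
    also have "\<dots> = emeasure haarN Q * (\<integral>\<^sup>+s. f (\<Phi> s) \<partial>haarN)"
      by (rule nn_integral_cmult) measurable
    finally show ?thesis .
  qed
  have c2pos: "c2 \<noteq> 0"
  proof
    assume "c2 = 0"
    then have "emeasure haarN Q * (\<integral>\<^sup>+s. 1 \<partial>haarN) = 0" using key[of "\<lambda>_. 1"] by simp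
    then have "(\<integral>\<^sup>+s. 1 \<partial>haarN) = 0" using Q2 by auto
    moreover have "emeasure haarN Q \<le> (\<integral>\<^sup>+s. 1 \<partial>haarN)" using emeasure_space[of haarN Q] by simp
    ultimately show False using Q2 by simp
  qed
  have c2fin: "c2 < \<infinity>"
  proof -
    \<comment> \<open>\<open>|s\<^sub>j|^e\<^sub>j\<close> is a product of powers of \<open>|\<Phi>(s)\<^sub>k|\<close>, so the preimage of \<open>Q\<close> lies in a product of larger annuli\<close>
    define S where "S = 1 + (\<Sum>j\<in>UNIV. \<Sum>k\<in>UNIV. nat \<bar>B j k\<bar>)"
    define r :: real where "r = 2 ^ S"
    have r1: "1 < r" unfolding r_def by (rule one_less_power) (auto simp: S_def)
    let ?R = "PiE UNIV (\<lambda>_::'n. {z::complex. 1 / r < cmod z \<and> cmod z < r})"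
    have sub: "s \<in> ?R" if s: "\<forall>j. s j \<noteq> 0" and Q: "\<Phi> s \<in> Q" for s
    proof -
      have "1 / r < cmod (s j) \<and> cmod (s j) < r" for j
      proof -
        have eq: "(\<Prod>k\<in>UNIV. cmod (\<Phi> s k) powi (B j k)) = cmod (s j) ^ e j"
          using prod_powi_B[of "\<lambda>j. cmod (s j)" j] s by (simp add: \<Phi>_def norm_power flip: prod_norm)
        have bd: "1 / 2 ^ nat \<bar>B j k\<bar> \<le> cmod (\<Phi> s k) powi (B j k) \<and> cmod (\<Phi> s k) powi (B j k) \<le> 2 ^ nat \<bar>B j k\<bar>" for k
        proof -
          define u where "u = cmod (\<Phi> s k)"
          have u: "1 / 2 < u" "u < 2" using Q by (auto simp: u_def Q_def)
          have iu: "1 / 2 < inverse u" "inverse u < 2" using u by (auto simp: field_simps)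
          have "1 / 2 ^ n \<le> v ^ n \<and> v ^ n \<le> 2 ^ n" if "1 / 2 < v" "v < 2" for v :: real and n
            using that power_mono[of "1/2" v n] power_mono[of v 2 n] by (simp add: power_divide)
          from this[OF u] this[OF iu] show ?thesis unfolding u_def[symmetric]
            by (cases "0 \<le> B j k") (auto simp: power_int_def)
        qed
        have le: "(\<Sum>k\<in>UNIV. nat \<bar>B j k\<bar>) < S"
        proof -
          have "(\<Sum>k\<in>UNIV. nat \<bar>B j k\<bar>) \<le> (\<Sum>j\<in>UNIV. \<Sum>k\<in>UNIV. nat \<bar>B j k\<bar>)"
            by (rule member_le_sum[of j UNIV "\<lambda>j. \<Sum>k\<in>UNIV. nat \<bar>B j k\<bar>"]) auto
          then show ?thesis by (simp add: S_def)
        qed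
        have "(\<Prod>k\<in>UNIV. cmod (\<Phi> s k) powi (B j k)) \<le> (\<Prod>k\<in>UNIV. 2 ^ nat \<bar>B j k\<bar>)"
          by (intro prod_mono) (use bd in \<open>auto intro: order_trans[rotated]\<close>)
        also have "\<dots> = (2::real) ^ (\<Sum>k\<in>UNIV. nat \<bar>B j k\<bar>)" by (simp add: power_sum)
        also have "\<dots> < r" unfolding r_def by (intro power_strict_increasing le) simp
        finally have up: "cmod (s j) ^ e j < r" by (simp only: eq)
        have "1 / r < 1 / 2 ^ (\<Sum>k\<in>UNIV. nat \<bar>B j k\<bar>)"
          unfolding r_def by (intro divide_strict_left_mono power_strict_increasing le) auto
        also have "\<dots> = (\<Prod>k\<in>UNIV. 1 / 2 ^ nat \<bar>B j k\<bar>)" by (simp add: power_sum prod_dividef)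
        also have "\<dots> \<le> (\<Prod>k\<in>UNIV. cmod (\<Phi> s k) powi (B j k))"
          by (intro prod_mono) (use bd in auto)
        finally have lo: "1 / r < cmod (s j) ^ e j" by (simp only: eq)
        have "cmod (s j) < r"
        proof (rule ccontr)
          assume "\<not> cmod (s j) < r"
          then have "r \<le> cmod (s j)" by simp
          moreover have "cmod (s j) ^ 1 \<le> cmod (s j) ^ e j"
            using e_pos[of j] \<open>r \<le> cmod (s j)\<close> r1 by (intro power_increasing) auto
          ultimately show False using up by simp
        qed
        moreover have "1 / r < cmod (s j)"
        proof (rule ccontr)
          assume "\<not> 1 / r < cmod (s j)"
          then have "cmod (s j) \<le> 1 / r" by simp
          moreover have "1 / r \<le> 1" using r1 by simp
          ultimately have "cmod (s j) ^ e j \<le> cmod (s j) ^ 1"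
            using e_pos[of j] by (intro power_decreasing) auto
          then show False using lo \<open>cmod (s j) \<le> 1 / r\<close> by simp
        qed
        ultimately show ?thesis by simp
      qed
      then show ?thesis by auto
    qed
    have Rm: "?R \<in> sets haarN" by (rule sets_PiM_I_finite) (use annm in auto)
    have "c2 \<le> (\<integral>\<^sup>+s. indicator ?R s \<partial>haarN)"
      unfolding c2_def by (rule nn_integral_mono_AE, use AE_haar in eventually_elim) (use sub in \<open>auto simp: g_def indicator_def\<close>)
    also have "\<dots> = emeasure haarN ?R" using Rm by simp
    also have "\<dots> = (\<Prod>j\<in>(UNIV::'n set). emeasure haar1 {z. 1 / r < cmod z \<and> cmod z < r})"
      using haar.emeasure_PiM[of "UNIV :: 'n set" "\<lambda>_. {z. 1 / r < cmod z \<and> cmod z < r}"] annm by simp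
    also have "\<dots> < \<infinity>" using haar1_annulus(1)[OF r1] by (simp add: power_less_top_ennreal)
    finally show ?thesis .
  qed
  obtain c2' where c2': "c2 = ennreal c2'" "0 < c2'"
    using c2fin c2pos by (cases c2) (auto simp: ennreal_eq_0_iff not_le)
  obtain q where q: "emeasure haarN Q = ennreal q" "0 < q"
    using Q1 Q2 by (cases "emeasure haarN Q") auto
  show ?thesis
  proof (intro exI[of _ "q / c2'"] conjI ballI)
    show "0 < q / c2'" using q c2' by simp
    fix f :: "('n \<Rightarrow> complex) \<Rightarrow> ennreal" assume f: "f \<in> borel_measurable haarN"
    have "ennreal (1 / c2') * (ennreal c2' * (\<integral>\<^sup>+x. f x \<partial>haarN)) = ennreal (1 / c2') * (ennreal q * (\<integral>\<^sup>+s. f (\<Phi> s) \<partial>haarN))"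
      using key[OF f] by (simp add: c2' q)
    moreover have "ennreal (1 / c2') * ennreal c2' = 1" "ennreal (1 / c2') * ennreal q = ennreal (q / c2')"
      using c2' q by (simp_all flip: ennreal_mult)
    ultimately show "(\<integral>\<^sup>+x. f x \<partial>haarN) = ennreal (q / c2') * (\<integral>\<^sup>+s. f (\<Phi> s) \<partial>haarN)"
      by (simp only: mult.assoc[symmetric] mult_1)
  qed
qed

definition \<kappa> :: "'n \<Rightarrow> nat" where "\<kappa> j = (\<Sum>i\<in>UNIV. A i j)"

abbreviation wpoly :: "('n \<Rightarrow> complex) measure" where "wpoly \<equiv> PiM UNIV (\<lambda>j. wdisc (\<kappa> j))"

lemma prod_norm_\<Phi>: "(\<Prod>i\<in>UNIV. (cmod (\<Phi> x i))\<^sup>2) = (\<Prod>j\<in>UNIV. cmod (x j) ^ (2 * \<kappa> j))"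
proof -
  have "(\<Prod>i\<in>UNIV. (cmod (\<Phi> x i))\<^sup>2) = (\<Prod>i\<in>UNIV. \<Prod>j\<in>UNIV. cmod (x j) ^ (2 * A i j))"
    by (simp add: \<Phi>_def norm_power prod_power_distrib mult.commute flip: prod_norm power_mult)
  also have "\<dots> = (\<Prod>j\<in>UNIV. \<Prod>i\<in>UNIV. cmod (x j) ^ (2 * A i j))" by (rule prod.swap)
  also have "\<dots> = (\<Prod>j\<in>UNIV. cmod (x j) ^ (2 * \<kappa> j))"
    by (simp add: \<kappa>_def sum_distrib_left flip: power_sum)
  finally show ?thesis .
qed

end

lemma lborel_density_haar1: "density haar1 (\<lambda>z. ennreal ((cmod z)\<^sup>2)) = lborel"
proof -
  have "density haar1 (\<lambda>z. ennreal ((cmod z)\<^sup>2)) = density lborel (\<lambda>z. ennreal (1 / (cmod z)\<^sup>2) * ennreal ((cmod z)\<^sup>2))"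
    unfolding haar1_def by (rule density_density_eq) auto
  also have "\<dots> = density lborel (\<lambda>z. 1)"
  proof (rule density_cong)
    show "AE z in lborel. ennreal (1 / (cmod z)\<^sup>2) * ennreal ((cmod z)\<^sup>2) = 1"
      using AE_lborel_singleton[of "0::complex"] by eventually_elim (simp flip: ennreal_mult)
  qed auto
  also have "\<dots> = lborel" by (rule density_1)
  finally show ?thesis .
qed

lemma wdisc_density_haar1:
  assumes "1 \<le> k"
  shows "density haar1 (\<lambda>z. indicator (ball 0 1) z * ennreal (cmod z ^ (2 * k))) = wdisc k"
proof -
  have "density haar1 (\<lambda>z. indicator (ball 0 1) z * ennreal (cmod z ^ (2 * k)))
      = density lborel (\<lambda>z. ennreal (1 / (cmod z)\<^sup>2) * (indicator (ball 0 1) z * ennreal (cmod z ^ (2 * k))))"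
    unfolding haar1_def by (rule density_density_eq) measurable
  also have "\<dots> = density lborel (\<lambda>z. indicator (ball 0 1) z * ennreal (cmod z ^ (2 * k - 2)))"
  proof (rule density_cong)
    show "AE z in lborel. ennreal (1 / (cmod z)\<^sup>2) * (indicator (ball 0 1) z * ennreal (cmod z ^ (2 * k)))
        = indicator (ball 0 1) z * ennreal (cmod z ^ (2 * k - 2))"
      using AE_lborel_singleton[of "0::complex"]
    proof eventually_elim
      fix z :: complex assume "z \<noteq> 0"
      moreover have "2 * k = 2 + (2 * k - 2)" using assms by simp
      then have "cmod z ^ (2 * k) = (cmod z)\<^sup>2 * cmod z ^ (2 * k - 2)" by (metis power_add)
      ultimately have "ennreal (1 / (cmod z)\<^sup>2) * ennreal (cmod z ^ (2 * k)) = ennreal (cmod z ^ (2 * k - 2))"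
        by (simp flip: ennreal_mult)
      then show "ennreal (1 / (cmod z)\<^sup>2) * (indicator (ball 0 1) z * ennreal (cmod z ^ (2 * k)))
          = indicator (ball 0 1) z * ennreal (cmod z ^ (2 * k - 2))"
        by (simp only: mult.left_commute)
    qed
  qed measurable
  also have "\<dots> = wdisc k"
    unfolding wdisc_def disc_def by (rule density_density_eq[symmetric]) measurable
  finally show ?thesis .
qed

interpretation wdiscs: product_sigma_finite "\<lambda>j::'i. wdisc (k j)"
  by (simp add: product_sigma_finite_def sigma_finite_wdisc)

context monomial_map
begin

lemma measurable_vec_\<Phi>: "(\<lambda>x. vec_lambda (\<Phi> x)) \<in> haarN \<rightarrow>\<^sub>M borel"
proof -
  have "vec_lambda \<in> haarN \<rightarrow>\<^sub>M borel"
    using measurable_vec_lambda_complex by (simp cong: measurable_cong_sets sets_PiM_cong)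
  then show ?thesis by (rule measurable_compose[OF measurable_\<Phi>])
qed

text \<open>Haar measure carries the coordinates outside: Lebesgue measure has density \<open>\<Prod> |z\<^sub>i|\<^sup>2\<close> with respect to it,
  which pulls back to \<open>\<Prod> |x\<^sub>j|^(2\<kappa>\<^sub>j)\<close>.\<close>

theorem pushforward:
  assumes \<kappa>: "\<And>j. 1 \<le> \<kappa> j" and \<Omega> [measurable]: "\<Omega> \<in> sets borel"
    and mem: "\<And>x. (\<And>j. x j \<noteq> 0) \<Longrightarrow> vec_lambda (\<Phi> x) \<in> \<Omega> \<longleftrightarrow> (\<forall>j. cmod (x j) < 1)"
  shows "\<exists>c>0. \<forall>g\<in>borel_measurable borel.
    (\<integral>\<^sup>+z. indicator \<Omega> z * g z \<partial>lborel) = ennreal c * (\<integral>\<^sup>+x. g (vec_lambda (\<Phi> x)) \<partial>wpoly)"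
proof -
  obtain c where c: "c > 0" "\<And>f. f \<in> borel_measurable haarN \<Longrightarrow> (\<integral>\<^sup>+x. f x \<partial>haarN) = ennreal c * (\<integral>\<^sup>+s. f (\<Phi> s) \<partial>haarN)"
    using haar_pushforward by blast
  have PL: "PiM UNIV (\<lambda>_::'n. lborel) = density haarN (\<lambda>x. \<Prod>i\<in>UNIV. ennreal ((cmod (x i))\<^sup>2))"
    using PiM_density[of "UNIV :: 'n set" "\<lambda>_. haar1" "\<lambda>_ z. ennreal ((cmod z)\<^sup>2)"]
    unfolding lborel_density_haar1
    by (simp add: haar.product_sigma_finite_axioms product_sigma_finite_def lborel.sigma_finite_measure_axioms)
  have PW: "wpoly = density haarN (\<lambda>x. \<Prod>i\<in>UNIV. indicator (ball 0 1) (x i) * ennreal (cmod (x i) ^ (2 * \<kappa> i)))"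
    using PiM_density[of "UNIV :: 'n set" "\<lambda>_. haar1" "\<lambda>i z. indicator (ball 0 1) z * ennreal (cmod z ^ (2 * \<kappa> i))"]
    unfolding wdisc_density_haar1[OF \<kappa>]
    by (simp add: haar.product_sigma_finite_axioms wdiscs.product_sigma_finite_axioms)
  have vm: "vec_lambda \<in> haarN \<rightarrow>\<^sub>M borel" and vmL: "vec_lambda \<in> PiM UNIV (\<lambda>_::'n. lborel :: complex measure) \<rightarrow>\<^sub>M borel"
    using measurable_vec_lambda_complex by (simp_all cong: measurable_cong_sets sets_PiM_cong)
  have "(\<integral>\<^sup>+z. indicator \<Omega> z * g z \<partial>lborel) = ennreal c * (\<integral>\<^sup>+x. g (vec_lambda (\<Phi> x)) \<partial>wpoly)"
    if g [measurable]: "g \<in> borel_measurable borel" for g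
  proof -
    have ig: "(\<lambda>z. indicator \<Omega> z * g z) \<in> borel_measurable borel" by measurable
    have vg [measurable]: "(\<lambda>x. indicator \<Omega> (vec_lambda x) * g (vec_lambda x)) \<in> borel_measurable haarN"
      by (rule measurable_compose[OF vm ig])
    have pm: "(\<lambda>x. \<Prod>i\<in>UNIV. ennreal ((cmod (x i))\<^sup>2)) \<in> borel_measurable haarN"
      by (intro borel_measurable_prod_ennreal) measurable
    have "(\<integral>\<^sup>+z. indicator \<Omega> z * g z \<partial>lborel) = (\<integral>\<^sup>+z. indicator \<Omega> z * g z \<partial>distr (PiM UNIV (\<lambda>_::'n. lborel)) borel vec_lambda)"
      by (simp only: lborel_vec_eq_distr[symmetric])
    also have "\<dots> = (\<integral>\<^sup>+x. indicator \<Omega> (vec_lambda x) * g (vec_lambda x) \<partial>PiM UNIV (\<lambda>_::'n. lborel))"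
      by (rule nn_integral_distr[OF vmL]) (use ig in simp)
    also have "\<dots> = (\<integral>\<^sup>+x. (\<Prod>i\<in>UNIV. ennreal ((cmod (x i))\<^sup>2)) * (indicator \<Omega> (vec_lambda x) * g (vec_lambda x)) \<partial>haarN)"
      unfolding PL by (rule nn_integral_density[OF pm vg])
    also have "\<dots> = ennreal c * (\<integral>\<^sup>+x. (\<Prod>i\<in>UNIV. ennreal ((cmod (\<Phi> x i))\<^sup>2)) * (indicator \<Omega> (vec_lambda (\<Phi> x)) * g (vec_lambda (\<Phi> x))) \<partial>haarN)"
      by (rule c(2)) (intro borel_measurable_times_ennreal pm vg)
    also have "(\<integral>\<^sup>+x. (\<Prod>i\<in>UNIV. ennreal ((cmod (\<Phi> x i))\<^sup>2)) * (indicator \<Omega> (vec_lambda (\<Phi> x)) * g (vec_lambda (\<Phi> x))) \<partial>haarN)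
       = (\<integral>\<^sup>+x. (\<Prod>i\<in>UNIV. indicator (ball 0 1) (x i) * ennreal (cmod (x i) ^ (2 * \<kappa> i))) * g (vec_lambda (\<Phi> x)) \<partial>haarN)"
    proof (rule nn_integral_cong_AE, use AE_haar in eventually_elim)
      fix x :: "'n \<Rightarrow> complex" assume x: "\<forall>j. x j \<noteq> 0"
      have "(\<Prod>i\<in>UNIV. ennreal ((cmod (\<Phi> x i))\<^sup>2)) = (\<Prod>i\<in>UNIV. ennreal (cmod (x i) ^ (2 * \<kappa> i)))"
        using prod_norm_\<Phi>[of x] by (simp add: prod_ennreal)
      moreover have "(\<Prod>i\<in>UNIV. indicator (ball 0 1) (x i)) = (indicator \<Omega> (vec_lambda (\<Phi> x)) :: ennreal)"
        using mem[of x] x by (auto simp: indicator_def prod_zero_iff)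
      ultimately show "(\<Prod>i\<in>UNIV. ennreal ((cmod (\<Phi> x i))\<^sup>2)) * (indicator \<Omega> (vec_lambda (\<Phi> x)) * g (vec_lambda (\<Phi> x)))
        = (\<Prod>i\<in>UNIV. indicator (ball 0 1) (x i) * ennreal (cmod (x i) ^ (2 * \<kappa> i))) * g (vec_lambda (\<Phi> x))"
        by (simp add: prod.distrib mult_ac)
    qed
    also have "\<dots> = (\<integral>\<^sup>+x. g (vec_lambda (\<Phi> x)) \<partial>wpoly)"
      unfolding PW
    proof (rule nn_integral_density[symmetric])
      show "(\<lambda>x. g (vec_lambda (\<Phi> x))) \<in> borel_measurable haarN"
        by (rule measurable_compose[OF measurable_vec_\<Phi> g])
      show "(\<lambda>x. \<Prod>i\<in>UNIV. indicator (ball 0 1) (x i) * ennreal (cmod (x i) ^ (2 * \<kappa> i))) \<in> borel_measurable haarN"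
        by (intro borel_measurable_prod_ennreal) measurable
    qed
    finally show ?thesis .
  qed
  then show ?thesis using c(1) by blast
qed

end

section \<open>Holomorphic functions of several variables\<close>

definition holo_at :: "(complex^'n \<Rightarrow> complex) \<Rightarrow> complex^'n \<Rightarrow> bool" where
  "holo_at f z \<longleftrightarrow> (\<exists>D. (f has_derivative D) (at z) \<and> (\<forall>c v. D (c *s v) = c * D v))"

lemma holo_at_const: "holo_at (\<lambda>_. c) z"
  unfolding holo_at_def by (rule exI[of _ "\<lambda>_. 0"]) auto

lemma holo_at_coordinate: "holo_at (\<lambda>z. z $ k) z"
  unfolding holo_at_def by (rule exI[of _ "\<lambda>h. h $ k"]) (auto intro!: derivative_eq_intros bounded_linear.has_derivative[OF bounded_linear_vec_nth])

lemma holo_at_add: assumes "holo_at f z" "holo_at g z" shows "holo_at (\<lambda>z. f z + g z) z"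
proof -
  obtain D E where "(f has_derivative D) (at z)" "\<forall>c v. D (c *s v) = c * D v"
    "(g has_derivative E) (at z)" "\<forall>c v. E (c *s v) = c * E v"
    using assms unfolding holo_at_def by blast
  then show ?thesis unfolding holo_at_def
    by (intro exI[of _ "\<lambda>h. D h + E h"]) (auto intro!: has_derivative_add simp: algebra_simps)
qed

lemma holo_at_mult: assumes "holo_at f z" "holo_at g z" shows "holo_at (\<lambda>z. f z * g z) z"
proof -
  obtain D E where "(f has_derivative D) (at z)" "\<forall>c v. D (c *s v) = c * D v"
    "(g has_derivative E) (at z)" "\<forall>c v. E (c *s v) = c * E v"
    using assms unfolding holo_at_def by blast
  then show ?thesis unfolding holo_at_def
    by (intro exI[of _ "\<lambda>h. f z * E h + D h * g z"] conjI, intro has_derivative_mult) (simp_all add: algebra_simps)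
qed

lemma holo_at_compose:
  assumes "holo_at f z" "(g has_field_derivative d) (at (f z))" shows "holo_at (\<lambda>z. g (f z)) z"
proof -
  obtain D where D: "(f has_derivative D) (at z)" "\<forall>c v. D (c *s v) = c * D v"
    using assms unfolding holo_at_def by blast
  have "((\<lambda>z. g (f z)) has_derivative (\<lambda>h. d * D h)) (at z)"
    using has_derivative_compose[OF D(1), of g "\<lambda>h. d * h"] assms(2) by (simp add: has_field_derivative_def)
  then show ?thesis unfolding holo_at_def using D(2) by (intro exI[of _ "\<lambda>h. d * D h"]) auto
qed

lemma holo_at_sum: "(\<And>i. i \<in> I \<Longrightarrow> holo_at (f i) z) \<Longrightarrow> holo_at (\<lambda>z. \<Sum>i\<in>I. f i z) z"
  by (induction I rule: infinite_finite_induct) (auto intro: holo_at_const holo_at_add)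

lemma holo_at_prod: "(\<And>i. i \<in> I \<Longrightarrow> holo_at (f i) z) \<Longrightarrow> holo_at (\<lambda>z. \<Prod>i\<in>I. f i z) z"
  by (induction I rule: infinite_finite_induct) (auto intro: holo_at_const holo_at_mult)

lemma holo_at_monomial:
  assumes "\<And>k. z $ k = 0 \<Longrightarrow> 0 \<le> \<beta> k"
  shows "holo_at (\<lambda>z. \<Prod>k\<in>UNIV. (z $ k) powi \<beta> k) (z :: complex^'n)"
proof (rule holo_at_prod)
  fix k
  have "((\<lambda>u. u powi \<beta> k) has_field_derivative (of_int (\<beta> k) * (z $ k) powi (\<beta> k - 1) * 1)) (at (z $ k))"
    by (rule DERIV_power_int) (use assms[of k] in \<open>auto intro!: derivative_eq_intros\<close>)
  then show "holo_at (\<lambda>z. (z $ k) powi \<beta> k) z" by (rule holo_at_compose[OF holo_at_coordinate])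
qed

lemma holo_at_continuous: "holo_at f z \<Longrightarrow> isCont f z"
  unfolding holo_at_def using has_derivative_continuous by blast

lemma holomorphic_several_iff: "holomorphic_several f \<Omega> \<longleftrightarrow> (\<forall>z\<in>\<Omega>. holo_at f z)"
  by (simp add: holomorphic_several_def holo_at_def)

lemma holo_at_transform:
  assumes "holo_at f z" "open S" "z \<in> S" "\<And>y. y \<in> S \<Longrightarrow> g y = f y"
  shows "holo_at g z"
proof -
  obtain D where D: "(f has_derivative D) (at z)" "\<forall>c v. D (c *s v) = c * D v"
    using assms unfolding holo_at_def by blast
  have "(g has_derivative D) (at z)"
    by (rule has_derivative_transform_within_open[OF D(1) assms(2,3)]) (simp add: assms(4))
  then show ?thesis using D unfolding holo_at_def by blast
qed

lemma holo_at_slice: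
  assumes f: "holo_at f (\<chi> k. g k t)" and g: "\<And>k. ((\<lambda>t. g k t) has_field_derivative d k) (at t)"
  shows "(\<lambda>t. f (\<chi> k. g k t)) field_differentiable (at t)"
proof -
  obtain D where D: "(f has_derivative D) (at (\<chi> k. g k t))" "\<forall>c v. D (c *s v) = c * D v"
    using f unfolding holo_at_def by blast
  have "((\<lambda>t. \<chi> k. g k t) has_derivative (\<lambda>h. h *s (\<chi> k. d k))) (at t)"
  proof (subst has_derivative_componentwise_within, intro ballI)
    fix b :: "complex^'a" assume "b \<in> Basis"
    then obtain i u where b: "b = axis i u" by (auto simp: Basis_vec_def)
    have "((\<lambda>t. g i t) has_derivative (\<lambda>h. d i * h)) (at t)" using g[of i] by (simp add: has_field_derivative_def)
    then have "((\<lambda>t. g i t \<bullet> u) has_derivative (\<lambda>h. (d i * h) \<bullet> u)) (at t)"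
      by (rule has_derivative_inner_left)
    then show "((\<lambda>t. (\<chi> k. g k t) \<bullet> b) has_derivative (\<lambda>h. (h *s (\<chi> k. d k)) \<bullet> b)) (at t)"
      by (simp add: b inner_axis mult.commute)
  qed
  from has_derivative_compose[OF this D(1)]
  have "((\<lambda>t. f (\<chi> k. g k t)) has_derivative (\<lambda>h. D (\<chi> k. d k) * h)) (at t)"
    using D(2) by (simp add: mult.commute)
  then show ?thesis unfolding field_differentiable_def has_field_derivative_def by blast
qed

section \<open>The disc kernel sorted by residue classes\<close>

text \<open>The sum of \<open>\<Sum>\<^sub>m (s + m e) u^m\<close>: with \<open>u = t^e\<close> and a factor \<open>t^(s - 1)\<close> it collects the terms of
  \<open>1 / (1 - t)\<^sup>2 = \<Sum>\<^sub>n n t^(n - 1)\<close> with \<open>n\<close> congruent to \<open>s\<close> modulo \<open>e\<close>.\<close>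

definition class_kernel :: "nat \<Rightarrow> nat \<Rightarrow> complex \<Rightarrow> complex" where
  "class_kernel s e u = (of_nat s + (of_nat e - of_nat s) * u) / (1 - u)\<^sup>2"

lemma sum_arith_geom1: "(1 - t)\<^sup>2 * (\<Sum>s = 1..e. of_nat s * t ^ (s - 1)) = 1 - (of_nat e + 1) * t ^ e + of_nat e * t ^ Suc e"
  for t :: complex
proof (induction e)
  case (Suc e)
  have "(1 - t)\<^sup>2 * (\<Sum>s = 1..Suc e. of_nat s * t ^ (s - 1)) = (1 - t)\<^sup>2 * (\<Sum>s = 1..e. of_nat s * t ^ (s - 1)) + (1 - t)\<^sup>2 * (of_nat (Suc e) * t ^ e)"
    by (simp add: distrib_left)
  then show ?case unfolding Suc.IH by (simp add: power2_eq_square algebra_simps)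
qed simp

lemma sum_geom1: "(1 - t) * (\<Sum>s = 1..e. t ^ (s - 1)) = 1 - t ^ e" for t :: complex
proof (induction e)
  case (Suc e)
  have "(1 - t) * (\<Sum>s = 1..Suc e. t ^ (s - 1)) = (1 - t) * (\<Sum>s = 1..e. t ^ (s - 1)) + (1 - t) * t ^ e"
    by (simp add: distrib_left)
  also have "\<dots> = (1 - t ^ e) + (1 - t) * t ^ e" by (simp only: Suc.IH)
  also have "\<dots> = 1 - t ^ Suc e" by (simp add: algebra_simps)
  finally show ?case .
qed simp

lemma sum_class_kernel:
  assumes t: "cmod t < 1" and e: "0 < e"
  shows "(\<Sum>s = 1..e. t ^ (s - 1) * class_kernel s e (t ^ e)) = 1 / (1 - t)\<^sup>2"
proof -
  have "cmod (t ^ e) < 1" using power_less_one_norm[OF t e] by (simp add: norm_power)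
  then have te: "1 - t ^ e \<noteq> 0" by auto
  have t1: "1 - t \<noteq> 0" using t by auto
  let ?S1 = "\<Sum>s = 1..e. of_nat s * t ^ (s - 1)" and ?S0 = "\<Sum>s = 1..e. t ^ (s - 1)"
  have "(\<Sum>s = 1..e. t ^ (s - 1) * (of_nat s + (of_nat e - of_nat s) * t ^ e))
      = ?S1 * (1 - t ^ e) + of_nat e * t ^ e * ?S0"
    by (simp add: sum_distrib_left sum_distrib_right algebra_simps flip: sum.distrib sum_subtractf)
  note h = this
  have "(1 - t)\<^sup>2 * (\<Sum>s = 1..e. t ^ (s - 1) * (of_nat s + (of_nat e - of_nat s) * t ^ e))
      = ((1 - t)\<^sup>2 * ?S1) * (1 - t ^ e) + of_nat e * t ^ e * (1 - t) * ((1 - t) * ?S0)"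
    by (simp only: h) (simp add: algebra_simps power2_eq_square)
  also have "\<dots> = (1 - t ^ e)\<^sup>2"
    unfolding sum_arith_geom1 sum_geom1 by (simp add: algebra_simps power2_eq_square)
  finally have "(\<Sum>s = 1..e. t ^ (s - 1) * (of_nat s + (of_nat e - of_nat s) * t ^ e)) = (1 - t ^ e)\<^sup>2 / (1 - t)\<^sup>2"
    using t1 by (simp add: field_simps)
  moreover have "(\<Sum>s = 1..e. t ^ (s - 1) * class_kernel s e (t ^ e))
      = (\<Sum>s = 1..e. t ^ (s - 1) * (of_nat s + (of_nat e - of_nat s) * t ^ e)) / (1 - t ^ e)\<^sup>2"
    by (simp add: class_kernel_def sum_divide_distrib)
  ultimately show ?thesis using te by simp
qed

lemma norm_class_kernel_le:
  assumes s: "s \<le> e" and u: "cmod u \<le> 1"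
  shows "cmod (class_kernel s e u) \<le> real e / (cmod (1 - u))\<^sup>2"
proof -
  have "cmod (of_nat s + (of_nat e - of_nat s) * u) \<le> cmod (of_nat s) + cmod ((of_nat e - of_nat s) * u)"
    by (rule norm_triangle_ineq)
  also have "\<dots> = real s + (real e - real s) * cmod u"
    using s by (simp add: norm_mult norm_of_nat flip: of_nat_diff)
  also have "\<dots> \<le> real s + (real e - real s) * 1" using u s by (intro add_left_mono mult_left_mono) auto
  finally show ?thesis by (simp add: class_kernel_def norm_divide norm_power divide_right_mono)
qed

lemma cnj_class_kernel: "cnj (class_kernel s e u) = class_kernel s e (cnj u)"
  by (simp add: class_kernel_def)

lemma class_kernel_differentiable:
  assumes "cmod u < 1" shows "\<exists>d. (class_kernel s e has_field_derivative d) (at u)"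
proof -
  have "1 - u \<noteq> 0" using assms by auto
  then have "class_kernel s e field_differentiable (at u)"
    unfolding class_kernel_def[abs_def] by (intro derivative_intros) auto
  then show ?thesis by (simp add: field_differentiable_def)
qed

lemma measurable_class_kernel [measurable]: "class_kernel s e \<in> borel_measurable borel"
  unfolding class_kernel_def[abs_def] by measurable

section \<open>A kernel on the monomial polyhedron\<close>

locale monomial_domain = monomial_map A B e
  for A :: "'n::finite \<Rightarrow> 'n \<Rightarrow> nat" and B :: "'n \<Rightarrow> 'n \<Rightarrow> int" and e :: "'n \<Rightarrow> nat" +
  fixes \<Omega> :: "(complex^'n) set"
  assumes \<Omega>_def: "\<Omega> = {z. \<forall>j. (\<forall>k. z $ k = 0 \<longrightarrow> 0 \<le> B j k) \<and> (\<Prod>k\<in>UNIV. cmod (z $ k) powi (B j k)) < 1}"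
    and open_\<Omega>: "open \<Omega>"
    and \<kappa>_pos: "\<And>j. 1 \<le> \<kappa> j"
begin

lemma borel_\<Omega> [measurable]: "\<Omega> \<in> sets borel" using open_\<Omega> by simp

lemma \<Phi>_mem_\<Omega>:
  assumes x: "\<And>j. x j \<noteq> 0"
  shows "vec_lambda (\<Phi> x) \<in> \<Omega> \<longleftrightarrow> (\<forall>j. cmod (x j) < 1)"
proof -
  have "(\<Prod>k\<in>UNIV. cmod (\<Phi> x k) powi (B j k)) = cmod (x j) ^ e j" for j
    using prod_powi_B[of "\<lambda>j. cmod (x j)" j] x by (simp add: \<Phi>_def norm_power flip: prod_norm)
  moreover have "cmod (x j) ^ e j < 1 \<longleftrightarrow> cmod (x j) < 1" for j
    using e_pos[of j] by (simp add: power_less_one_iff)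
  ultimately show ?thesis using \<Phi>_nonzero[OF x] by (simp add: \<Omega>_def)
qed

text \<open>The monomial with exponents \<open>\<rho>\<close> pulls back under \<open>\<Phi>\<close> to the monomial with exponents \<open>\<sigma> \<rho>\<close>.\<close>

definition \<sigma> :: "('n \<Rightarrow> int) \<Rightarrow> 'n \<Rightarrow> int" where "\<sigma> \<rho> j = (\<Sum>k\<in>UNIV. \<rho> k * int (A k j))"

lemma \<sigma>_inverse: "real_of_int (\<rho> m) = (\<Sum>j\<in>UNIV. real_of_int (\<sigma> \<rho> j) * (real_of_int (B j m) / real (e j)))"
proof -
  have "(\<Sum>j\<in>UNIV. real_of_int (\<sigma> \<rho> j) * (real_of_int (B j m) / real (e j)))
     = (\<Sum>j\<in>UNIV. \<Sum>k\<in>UNIV. real_of_int (\<rho> k) * (real (A k j) * (real_of_int (B j m) / real (e j))))"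
    by (simp only: \<sigma>_def of_int_sum of_int_mult of_int_of_nat_eq sum_distrib_right mult.assoc)
  also have "\<dots> = (\<Sum>k\<in>UNIV. real_of_int (\<rho> k) * (\<Sum>j\<in>UNIV. real (A k j) * (real_of_int (B j m) / real (e j))))"
    unfolding sum_distrib_left by (rule sum.swap)
  also have "\<dots> = real_of_int (\<rho> m)" by (simp only: AB) (simp add: if_distrib cong: if_cong)
  finally show ?thesis by simp
qed

text \<open>Multiplication by the monomials with exponents in the rows of \<open>B\<close> shifts \<open>\<sigma> \<rho> j\<close> by multiples of \<open>e j\<close>. This is the set
  of representatives modulo these shifts with values of \<open>\<sigma>\<close> between \<open>1\<close> and \<open>e j\<close>.\<close>

definition exps :: "('n \<Rightarrow> int) set" where "exps = {\<rho>. \<forall>j. 1 \<le> \<sigma> \<rho> j \<and> \<sigma> \<rho> j \<le> int (e j)}"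

definition snat :: "('n \<Rightarrow> int) \<Rightarrow> 'n \<Rightarrow> nat" where "snat \<rho> j = nat (\<sigma> \<rho> j)"

lemma snat:
  assumes "\<rho> \<in> exps"
  shows "int (snat \<rho> j) = \<sigma> \<rho> j" "snat \<rho> j \<in> {1..e j}"
proof -
  have "1 \<le> \<sigma> \<rho> j" "\<sigma> \<rho> j \<le> int (e j)" using assms by (auto simp: exps_def)
  then show "int (snat \<rho> j) = \<sigma> \<rho> j" "snat \<rho> j \<in> {1..e j}"
    by (simp_all add: snat_def nat_le_iff le_nat_iff)
qed

lemma inj_snat: "inj_on snat exps"
proof (rule inj_onI, rule ext)
  fix \<rho> \<rho>' m assume r: "\<rho> \<in> exps" "\<rho>' \<in> exps" "snat \<rho> = snat \<rho>'"
  then have "\<sigma> \<rho> j = \<sigma> \<rho>' j" for j using snat(1)[OF r(1), of j] snat(1)[OF r(2), of j] by simp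
  then have "real_of_int (\<rho> m) = (\<Sum>j\<in>UNIV. real_of_int (\<sigma> \<rho>' j) * (real_of_int (B j m) / real (e j)))"
    by (subst \<sigma>_inverse[of \<rho> m]) simp
  also have "\<dots> = real_of_int (\<rho>' m)" by (rule \<sigma>_inverse[symmetric])
  finally have "real_of_int (\<rho> m) = real_of_int (\<rho>' m)" .
  then show "\<rho> m = \<rho>' m" by simp
qed

lemma snat_image: "snat ` exps \<subseteq> PiE UNIV (\<lambda>j. {1..e j})"
  using snat(2) by auto

lemma finite_exps: "finite exps"
  by (rule finite_imageD[OF finite_subset[OF snat_image] inj_snat]) (intro finite_PiE, auto)

text \<open>If \<open>z\<^sub>k = 0\<close> occurs in the polyhedron, then column \<open>k\<close> of \<open>B\<close> is nonnegative, and \<open>\<rho> k\<close> is a combination of its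
  entries with positive coefficients, so \<open>mon \<rho>\<close> is holomorphic there.\<close>

lemma exps_pos:
  assumes \<rho>: "\<rho> \<in> exps" and z: "z \<in> \<Omega>" "z $ k = 0"
  shows "0 \<le> \<rho> k - 1"
proof -
  have B: "0 \<le> B j k" for j using z by (auto simp: \<Omega>_def)
  obtain j where j: "B j k \<noteq> 0"
    using AB[of k k] by (metis (mono_tags, lifting) div_0 mult_zero_right of_int_0 sum.neutral zero_neq_one)
  have pos: "1 \<le> real_of_int (\<sigma> \<rho> j)" for j using \<rho> by (simp add: exps_def)
  have "0 < (\<Sum>j\<in>UNIV. real_of_int (\<sigma> \<rho> j) * (real_of_int (B j k) / real (e j)))"
  proof (rule sum_pos2[of _ j])
    show "0 < real_of_int (\<sigma> \<rho> j) * (real_of_int (B j k) / real (e j))"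
      using pos[of j] B[of j] j e_pos[of j] by (intro mult_pos_pos divide_pos_pos) auto
    show "0 \<le> real_of_int (\<sigma> \<rho> i) * (real_of_int (B i k) / real (e i))" for i
      using pos[of i] B[of i] by (intro mult_nonneg_nonneg divide_nonneg_nonneg) auto
  qed auto
  then have "0 < real_of_int (\<rho> k)" by (simp only: \<sigma>_inverse[symmetric])
  then show ?thesis by simp
qed

text \<open>With the exponents shifted by one, the pullback times the Jacobian is the monomial with exponents \<open>\<sigma> \<rho> - 1\<close>.\<close>

definition mon :: "('n \<Rightarrow> int) \<Rightarrow> complex^'n \<Rightarrow> complex" where
  "mon \<rho> z = (\<Prod>k\<in>UNIV. (z $ k) powi (\<rho> k - 1))"

definition bmon :: "'n \<Rightarrow> complex^'n \<Rightarrow> complex" where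
  "bmon j z = (\<Prod>k\<in>UNIV. (z $ k) powi (B j k))"

lemma measurable_powi [measurable]: "(\<lambda>u::complex. u powi n) \<in> borel_measurable borel"
  unfolding power_int_def by (cases "0 \<le> n") simp_all

lemma measurable_mon [measurable]: "mon \<rho> \<in> borel_measurable borel"
  unfolding mon_def[abs_def] by (intro borel_measurable_prod measurable_compose[OF measurable_vec_nth_complex measurable_powi])

lemma measurable_bmon [measurable]: "bmon j \<in> borel_measurable borel"
  unfolding bmon_def[abs_def] by (intro borel_measurable_prod measurable_compose[OF measurable_vec_nth_complex measurable_powi])

lemma bmon_less: "z \<in> \<Omega> \<Longrightarrow> cmod (bmon j z) < 1"
  by (simp add: \<Omega>_def bmon_def norm_power_int flip: prod_norm)

lemma holo_at_mon: "\<rho> \<in> exps \<Longrightarrow> z \<in> \<Omega> \<Longrightarrow> holo_at (mon \<rho>) z"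
  unfolding mon_def[abs_def] by (rule holo_at_monomial) (rule exps_pos)

lemma holo_at_bmon: "z \<in> \<Omega> \<Longrightarrow> holo_at (bmon j) z"
  unfolding bmon_def[abs_def] by (rule holo_at_monomial) (auto simp: \<Omega>_def)

text \<open>The part of the Bergman kernel, up to a constant, with exponents in the class of \<open>\<rho>\<close>.\<close>

definition kernel_term :: "('n \<Rightarrow> int) \<Rightarrow> complex^'n \<Rightarrow> complex^'n \<Rightarrow> complex" where
  "kernel_term \<rho> z w = mon \<rho> z * cnj (mon \<rho> w) * (\<Prod>j\<in>UNIV. class_kernel (snat \<rho> j) (e j) (bmon j z * cnj (bmon j w)))"

definition kernel_sum :: "complex^'n \<Rightarrow> complex^'n \<Rightarrow> complex" where
  "kernel_sum z w = (\<Sum>\<rho>\<in>exps. kernel_term \<rho> z w)"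

lemma kernel_sum_hermitian: "kernel_sum z w = cnj (kernel_sum w z)"
  by (simp add: kernel_sum_def kernel_term_def cnj_class_kernel mult_ac)

lemma measurable_kernel_sum [measurable]: "case_prod kernel_sum \<in> borel_measurable (borel \<Otimes>\<^sub>M borel)"
proof -
  have [measurable]: "(\<lambda>x. class_kernel (snat \<rho> j) (e j) (bmon j (fst x) * cnj (bmon j (snd x)))) \<in> borel_measurable (borel \<Otimes>\<^sub>M borel)" for \<rho> j
    by measurable
  show ?thesis unfolding kernel_sum_def kernel_term_def split_beta
    by (intro borel_measurable_sum borel_measurable_times borel_measurable_prod) measurable
qed

lemma product_less_one: "cmod a < 1 \<Longrightarrow> cmod b < 1 \<Longrightarrow> cmod (a * cnj b) < 1"
proof -
  assume "cmod a < 1" "cmod b < 1"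
  then have "cmod a * cmod b < 1 * 1" by (intro mult_strict_mono) auto
  then show ?thesis by (simp add: norm_mult)
qed

lemma holo_at_kernel_sum: assumes z: "z \<in> \<Omega>" and w: "w \<in> \<Omega>" shows "holo_at (\<lambda>z. kernel_sum z w) z"
  unfolding kernel_sum_def kernel_term_def
proof (intro holo_at_sum holo_at_mult holo_at_prod holo_at_mon z holo_at_const)
  fix \<rho> j
  have "cmod (bmon j z * cnj (bmon j w)) < 1" by (rule product_less_one[OF bmon_less[OF z] bmon_less[OF w]])
  then obtain d where "(class_kernel (snat \<rho> j) (e j) has_field_derivative d) (at (bmon j z * cnj (bmon j w)))"
    using class_kernel_differentiable by blast
  then show "holo_at (\<lambda>z. class_kernel (snat \<rho> j) (e j) (bmon j z * cnj (bmon j w))) z"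
    by (rule holo_at_compose[OF holo_at_mult[OF holo_at_bmon[OF z] holo_at_const]])
qed

text \<open>As \<open>|bmon j z| \<le> r < 1\<close> and \<open>|bmon j w| < 1\<close>, the class kernels are bounded uniformly in \<open>w\<close>, which leaves a monomial in \<open>w\<close>.\<close>

lemma norm_kernel_term_le:
  assumes \<rho>: "\<rho> \<in> exps" and z: "z \<in> \<Omega>" and w: "w \<in> \<Omega>" and M: "cmod (mon \<rho> z) \<le> M" and r: "\<And>j. cmod (bmon j z) \<le> r" "r < 1"
  shows "cmod (kernel_term \<rho> z w) \<le> M * (\<Prod>j\<in>UNIV. real (e j) / (1 - r)\<^sup>2) * cmod (mon \<rho> w)"
proof -
  have M0: "0 \<le> M" using norm_ge_zero order_trans M by blast
  have "(\<Prod>j\<in>UNIV. cmod (class_kernel (snat \<rho> j) (e j) (bmon j z * cnj (bmon j w)))) \<le> (\<Prod>j\<in>UNIV. real (e j) / (1 - r)\<^sup>2)"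
  proof (rule prod_mono, intro conjI norm_ge_zero)
    fix j
    let ?u = "bmon j z * cnj (bmon j w)"
    have "cmod (bmon j z) * cmod (bmon j w) \<le> cmod (bmon j z)"
      using bmon_less[OF w, of j] by (simp add: mult_left_le)
    then have ur: "cmod ?u \<le> r" using r(1)[of j] by (simp add: norm_mult)
    have "1 - r \<le> cmod (1 - ?u)" using norm_triangle_ineq2[of 1 ?u] ur by simp
    then have "(1 - r)\<^sup>2 \<le> (cmod (1 - ?u))\<^sup>2" using r(2) by (intro power_mono) auto
    moreover have "0 < (1 - r)\<^sup>2" using r(2) by simp
    ultimately have "real (e j) / (cmod (1 - ?u))\<^sup>2 \<le> real (e j) / (1 - r)\<^sup>2"
      by (intro frac_le) auto
    moreover have "cmod (class_kernel (snat \<rho> j) (e j) ?u) \<le> real (e j) / (cmod (1 - ?u))\<^sup>2"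
      by (rule norm_class_kernel_le) (use snat(2)[OF \<rho>, of j] ur r(2) in auto)
    ultimately show "cmod (class_kernel (snat \<rho> j) (e j) ?u) \<le> real (e j) / (1 - r)\<^sup>2" by simp
  qed
  then have "cmod (mon \<rho> z) * cmod (mon \<rho> w) * (\<Prod>j\<in>UNIV. cmod (class_kernel (snat \<rho> j) (e j) (bmon j z * cnj (bmon j w))))
     \<le> M * cmod (mon \<rho> w) * (\<Prod>j\<in>UNIV. real (e j) / (1 - r)\<^sup>2)"
    using M M0 by (intro mult_mono mult_nonneg_nonneg prod_nonneg) auto
  then show ?thesis by (simp add: kernel_term_def norm_mult mult_ac flip: prod_norm)
qed

section \<open>Pulling the kernel back to the polydisc\<close>

text \<open>The Jacobian determinant of \<open>\<Phi>\<close> up to a constant.\<close>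

definition jac :: "('n \<Rightarrow> complex) \<Rightarrow> complex" where "jac x = (\<Prod>i\<in>UNIV. x i ^ (\<kappa> i - 1))"

definition \<psi> :: "nat \<Rightarrow> nat \<Rightarrow> complex \<Rightarrow> complex" where "\<psi> s d t = t ^ (s - 1) * class_kernel s d (t ^ d)"

lemma measurable_\<psi> [measurable]: "\<psi> s d \<in> borel_measurable borel"
  unfolding \<psi>_def[abs_def] by measurable

lemma jac_nonzero: "(\<And>i. x i \<noteq> 0) \<Longrightarrow> jac x \<noteq> 0" by (simp add: jac_def)

lemma bmon_\<Phi>: "(\<And>i. x i \<noteq> 0) \<Longrightarrow> bmon j (vec_lambda (\<Phi> x)) = x j ^ e j"
  using prod_powi_B[of x j] by (simp add: bmon_def \<Phi>_def)

lemma mon_\<Phi>: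
  assumes x: "\<And>i. x i \<noteq> 0" and \<rho>: "\<rho> \<in> exps"
  shows "mon \<rho> (vec_lambda (\<Phi> x)) * jac x = (\<Prod>i\<in>UNIV. x i ^ (snat \<rho> i - 1))"
proof -
  have "mon \<rho> (vec_lambda (\<Phi> x)) = (\<Prod>i\<in>UNIV. x i powi (\<Sum>k\<in>UNIV. (\<rho> k - 1) * int (A k i)))"
    using prod_powi_monomial[of x "\<lambda>k. \<rho> k - 1"] x by (simp add: mon_def \<Phi>_def)
  also have "\<dots> * jac x = (\<Prod>i\<in>UNIV. x i powi (\<Sum>k\<in>UNIV. (\<rho> k - 1) * int (A k i)) * x i ^ (\<kappa> i - 1))"
    by (simp add: jac_def prod.distrib)
  also have "\<dots> = (\<Prod>i\<in>UNIV. x i ^ (snat \<rho> i - 1))"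
  proof (rule prod.cong[OF refl])
    fix i
    have "(\<Sum>k\<in>UNIV. (\<rho> k - 1) * int (A k i)) = \<sigma> \<rho> i - int (\<kappa> i)"
      by (simp add: \<sigma>_def \<kappa>_def left_diff_distrib sum_subtractf)
    then have "(\<Sum>k\<in>UNIV. (\<rho> k - 1) * int (A k i)) + int (\<kappa> i - 1) = int (snat \<rho> i - 1)"
      using \<kappa>_pos[of i] snat[OF \<rho>, of i] by (simp add: of_nat_diff)
    moreover have "x i powi (\<Sum>k\<in>UNIV. (\<rho> k - 1) * int (A k i)) * x i ^ (\<kappa> i - 1)
        = x i powi ((\<Sum>k\<in>UNIV. (\<rho> k - 1) * int (A k i)) + int (\<kappa> i - 1))"
      using x[of i] by (simp add: power_int_add)
    ultimately show "x i powi (\<Sum>k\<in>UNIV. (\<rho> k - 1) * int (A k i)) * x i ^ (\<kappa> i - 1) = x i ^ (snat \<rho> i - 1)"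
      by (simp only: power_int_of_nat)
  qed
  finally show ?thesis .
qed

lemma kernel_term_\<Phi>:
  assumes x: "\<And>i. x i \<noteq> 0" and y: "\<And>i. y i \<noteq> 0" and \<rho>: "\<rho> \<in> exps"
  shows "kernel_term \<rho> (vec_lambda (\<Phi> x)) (vec_lambda (\<Phi> y)) * (jac x * cnj (jac y)) = (\<Prod>i\<in>UNIV. \<psi> (snat \<rho> i) (e i) (x i * cnj (y i)))"
proof -
  have "kernel_term \<rho> (vec_lambda (\<Phi> x)) (vec_lambda (\<Phi> y)) * (jac x * cnj (jac y))
    = (mon \<rho> (vec_lambda (\<Phi> x)) * jac x) * cnj (mon \<rho> (vec_lambda (\<Phi> y)) * jac y) * (\<Prod>i\<in>UNIV. class_kernel (snat \<rho> i) (e i) (x i ^ e i * cnj (y i ^ e i)))"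
    by (simp add: kernel_term_def bmon_\<Phi> x y mult_ac)
  also have "\<dots> = (\<Prod>i\<in>UNIV. \<psi> (snat \<rho> i) (e i) (x i * cnj (y i)))"
    unfolding mon_\<Phi>[OF x \<rho>] mon_\<Phi>[OF y \<rho>]
    by (simp add: \<psi>_def power_mult_distrib prod.distrib)
  finally show ?thesis .
qed

lemma norm_\<psi>_le:
  assumes s: "s \<in> {1..d}" and t: "cmod t < 1"
  shows "cmod (\<psi> s d t) \<le> real d / (cmod (1 - t ^ d))\<^sup>2"
proof -
  have d: "0 < d" using s by auto
  have "cmod (\<psi> s d t) \<le> 1 * cmod (class_kernel s d (t ^ d))"
    unfolding \<psi>_def norm_mult using t by (intro mult_right_mono) (auto simp: norm_power power_le_one)
  also have "\<dots> \<le> real d / (cmod (1 - t ^ d))\<^sup>2"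
    using norm_class_kernel_le[of s d "t ^ d"] s t by (auto simp: norm_power power_le_one)
  finally show ?thesis .
qed

text \<open>Times \<open>jac x cnj (jac y)\<close>, every term of the sum is a product of pieces of disc kernels, each of size at most
  \<open>e\<^sub>i / |1 - (x\<^sub>i cnj y\<^sub>i)^e\<^sub>i|\<^sup>2\<close>.\<close>

lemma kernel_sum_\<Phi>_le:
  assumes x: "\<And>i. x i \<noteq> 0" "\<And>i. cmod (x i) < 1" and y: "\<And>i. y i \<noteq> 0" "\<And>i. cmod (y i) < 1"
  shows "cmod (kernel_sum (vec_lambda (\<Phi> x)) (vec_lambda (\<Phi> y))) \<le>
     (real (card exps) * (\<Prod>i\<in>UNIV. real (e i))) * (\<Prod>i\<in>UNIV. sing (\<kappa> i) (x i) * sing (\<kappa> i) (y i) * disc_kernel (e i) (x i) (y i))"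
proof -
  let ?X = "vec_lambda (\<Phi> x)" and ?Y = "vec_lambda (\<Phi> y)"
  have Jp: "0 < cmod (jac x) * cmod (jac y)" using jac_nonzero[OF x(1)] jac_nonzero[OF y(1)] by simp
  have "cmod (kernel_sum ?X ?Y) * (cmod (jac x) * cmod (jac y)) = cmod (\<Sum>\<rho>\<in>exps. kernel_term \<rho> ?X ?Y * (jac x * cnj (jac y)))"
    by (simp add: kernel_sum_def norm_mult flip: sum_distrib_right)
  also have "\<dots> \<le> (\<Sum>\<rho>\<in>exps. cmod (\<Prod>i\<in>UNIV. \<psi> (snat \<rho> i) (e i) (x i * cnj (y i))))"
    by (rule order_trans[OF norm_sum]) (simp add: kernel_term_\<Phi>[OF x(1) y(1)])
  also have "\<dots> \<le> (\<Sum>\<rho>\<in>exps. (\<Prod>i\<in>UNIV. real (e i) * disc_kernel (e i) (x i) (y i)))"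
  proof (rule sum_mono)
    fix \<rho> assume \<rho>: "\<rho> \<in> exps"
    show "cmod (\<Prod>i\<in>UNIV. \<psi> (snat \<rho> i) (e i) (x i * cnj (y i))) \<le> (\<Prod>i\<in>UNIV. real (e i) * disc_kernel (e i) (x i) (y i))"
      unfolding prod_norm[symmetric]
    proof (rule prod_mono, intro conjI norm_ge_zero)
      fix i
      show "cmod (\<psi> (snat \<rho> i) (e i) (x i * cnj (y i))) \<le> real (e i) * disc_kernel (e i) (x i) (y i)"
        using norm_\<psi>_le[OF snat(2)[OF \<rho>, of i] product_less_one[OF x(2)[of i] y(2)[of i]]] x(2)[of i] y(2)[of i]
        by (simp add: disc_kernel_def)
    qed
  qed
  also have "\<dots> = (real (card exps) * (\<Prod>i\<in>UNIV. real (e i))) * (\<Prod>i\<in>UNIV. disc_kernel (e i) (x i) (y i))"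
    by (simp add: prod.distrib)
  finally have "cmod (kernel_sum ?X ?Y) \<le> (real (card exps) * (\<Prod>i\<in>UNIV. real (e i))) * (\<Prod>i\<in>UNIV. disc_kernel (e i) (x i) (y i)) / (cmod (jac x) * cmod (jac y))"
    using Jp by (simp add: pos_le_divide_eq)
  also have "\<dots> = (real (card exps) * (\<Prod>i\<in>UNIV. real (e i))) * ((1 / (cmod (jac x) * cmod (jac y))) * (\<Prod>i\<in>UNIV. disc_kernel (e i) (x i) (y i)))"
    by simp
  also have "1 / (cmod (jac x) * cmod (jac y)) = (\<Prod>i\<in>UNIV. sing (\<kappa> i) (x i) * sing (\<kappa> i) (y i))"
    using x(1) y(1) by (simp add: jac_def sing_def norm_power prod_dividef prod.distrib flip: prod_norm)
  also have "(\<Prod>i\<in>UNIV. sing (\<kappa> i) (x i) * sing (\<kappa> i) (y i)) * (\<Prod>i\<in>UNIV. disc_kernel (e i) (x i) (y i))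
     = (\<Prod>i\<in>UNIV. sing (\<kappa> i) (x i) * sing (\<kappa> i) (y i) * disc_kernel (e i) (x i) (y i))"
    by (simp add: prod.distrib)
  finally show ?thesis .
qed

end

section \<open>Lebesgue measure on a Borel set\<close>

text \<open>Product measures, and with them Fubini's theorem and kernels measurable in both variables, live on Borel
  sets. The completed measure \<open>lebesgue_on \<Omega>\<close> is compared with this one through Borel representatives.\<close>

definition lborel_on :: "'a::euclidean_space set \<Rightarrow> 'a measure" where
  "lborel_on \<Omega> = density lborel (indicator \<Omega>)"

lemma sets_lborel_on [simp, measurable_cong]: "sets (lborel_on \<Omega>) = sets borel" and space_lborel_on [simp]: "space (lborel_on \<Omega>) = UNIV"
  by (simp_all add: lborel_on_def)

context
  fixes \<Omega> :: "'a::euclidean_space set"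
  assumes \<Omega>: "\<Omega> \<in> sets borel"
begin

lemma borel_measurable_indicator_ennreal: "(indicator \<Omega> :: 'a \<Rightarrow> ennreal) \<in> borel_measurable borel"
  using \<Omega> by simp

lemma leb_\<Omega>: "\<Omega> \<inter> space lebesgue \<in> sets lebesgue"
  using \<Omega> by auto

lemma nn_integral_lborel_on:
  "f \<in> borel_measurable borel \<Longrightarrow> (\<integral>\<^sup>+z. f z \<partial>lborel_on \<Omega>) = (\<integral>\<^sup>+z. indicator \<Omega> z * f z \<partial>lborel)"
  unfolding lborel_on_def using borel_measurable_indicator_ennreal by (intro nn_integral_density) auto

lemma sigma_finite_lborel_on: "sigma_finite_measure (lborel_on \<Omega>)"
proof -
  have "(\<lambda>z. ennreal (indicator \<Omega> z)) = (indicator \<Omega> :: 'a \<Rightarrow> ennreal)"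
    by (auto simp: ennreal_indicator)
  then show ?thesis
    using sigma_finite_density_real[OF lborel.sigma_finite_measure_axioms, of "indicator \<Omega>"] \<Omega>
    by (simp add: lborel_on_def)
qed

lemma AE_lebesgue_on_iff: "(AE z in lebesgue_on \<Omega>. P z) \<longleftrightarrow> (AE z in lborel_on \<Omega>. P z)"
proof -
  have "(AE z in lborel_on \<Omega>. P z) \<longleftrightarrow> (AE z in lborel. z \<in> \<Omega> \<longrightarrow> P z)"
    unfolding lborel_on_def using borel_measurable_indicator_ennreal
    by (subst AE_density) (auto simp: indicator_def)
  then show ?thesis by (simp add: AE_restrict_space_iff[OF leb_\<Omega>] AE_completion_iff)
qed

lemma nn_integral_lebesgue_on:
  assumes "f \<in> borel_measurable borel"
  shows "(\<integral>\<^sup>+z. f z \<partial>lebesgue_on \<Omega>) = (\<integral>\<^sup>+z. f z \<partial>lborel_on \<Omega>)"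
  by (simp add: nn_integral_restrict_space[OF leb_\<Omega>] nn_integral_completion nn_integral_lborel_on[OF assms] mult.commute)

lemma borel_measurable_lebesgue_on: "f \<in> borel_measurable borel \<Longrightarrow> f \<in> borel_measurable (lebesgue_on \<Omega>)"
  by (intro measurable_restrict_space1 measurable_completion) simp

lemma integrable_lebesgue_on:
  fixes f :: "'a \<Rightarrow> complex"
  assumes [measurable]: "f \<in> borel_measurable borel"
  shows "integrable (lebesgue_on \<Omega>) f \<longleftrightarrow> integrable (lborel_on \<Omega>) f"
  unfolding integrable_iff_bounded
  by (simp add: nn_integral_lebesgue_on borel_measurable_lebesgue_on)

lemma integral_lebesgue_on_lborel_on:
  fixes f :: "'a \<Rightarrow> complex"
  assumes f [measurable]: "f \<in> borel_measurable borel"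
  shows "(\<integral>z. f z \<partial>lebesgue_on \<Omega>) = (\<integral>z. f z \<partial>lborel_on \<Omega>)"
proof -
  have [measurable]: "\<Omega> \<in> sets borel" by (rule \<Omega>)
  have "(\<integral>z. f z \<partial>lebesgue_on \<Omega>) = (\<integral>z. indicator \<Omega> z *\<^sub>R f z \<partial>lebesgue)"
    by (rule integral_restrict_space[OF leb_\<Omega>])
  also have "\<dots> = (\<integral>z. indicator \<Omega> z *\<^sub>R f z \<partial>lborel)"
    by (rule integral_completion) measurable
  also have "\<dots> = (\<integral>z. f z \<partial>density lborel (\<lambda>z. ennreal (indicator \<Omega> z)))"
    by (rule integral_density[symmetric]) auto
  also have "density lborel (\<lambda>z. ennreal (indicator \<Omega> z)) = lborel_on \<Omega>"
    by (simp add: lborel_on_def ennreal_indicator)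
  finally show ?thesis .
qed

lemma lebesgue_on_borel_representative:
  fixes f :: "'a \<Rightarrow> complex"
  assumes f: "f \<in> borel_measurable (lebesgue_on \<Omega>)"
  shows "\<exists>f'\<in>borel_measurable borel. AE z in lebesgue_on \<Omega>. f z = f' z"
proof -
  let ?g = "\<lambda>z. indicator \<Omega> z *\<^sub>R f z"
  have "?g \<in> borel_measurable lebesgue"
    using f by (simp add: borel_measurable_restrict_space_iff[OF leb_\<Omega>])
  then have "(\<lambda>z. Re (?g z)) \<in> borel_measurable lebesgue" "(\<lambda>z. Im (?g z)) \<in> borel_measurable lebesgue"
    by measurable
  note re = this(1) and im = this(2)
  obtain u where u: "u \<in> borel_measurable lborel" "AE z in lborel. Re (?g z) = u z"
    using completion_ex_borel_measurable_real[OF re] by blast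
  obtain v where v: "v \<in> borel_measurable lborel" "AE z in lborel. Im (?g z) = v z"
    using completion_ex_borel_measurable_real[OF im] by blast
  have "AE z in lborel. z \<in> \<Omega> \<longrightarrow> f z = Complex (u z) (v z)"
    using u(2) v(2) by eventually_elim (auto simp: complex_eq_iff)
  then have "AE z in lebesgue_on \<Omega>. f z = Complex (u z) (v z)"
    by (simp add: AE_restrict_space_iff[OF leb_\<Omega>] AE_completion_iff)
  moreover have "(\<lambda>z. Complex (u z) (v z)) \<in> borel_measurable borel"
    using u(1) v(1) by (intro measurable_Complex) simp_all
  ultimately show ?thesis by (intro bexI)
qed

end

section \<open>Integration on the monomial polyhedron\<close>

lemma polydisc_rotate:
  fixes \<gamma> :: "'i::finite \<Rightarrow> complex"
  assumes \<gamma>: "\<And>i. cmod (\<gamma> i) = 1"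
  shows "distr (polydisc UNIV) (polydisc UNIV) (\<lambda>x j. \<gamma> j * x j) = polydisc UNIV"
proof -
  let ?H = "polydisc (UNIV :: 'i set)"
  let ?T = "\<lambda>x j. \<gamma> j * x j"
  have T [measurable]: "?T \<in> ?H \<rightarrow>\<^sub>M ?H"
  proof (rule measurable_PiM_single')
    fix i :: 'i
    have "(\<lambda>x. \<gamma> i * x i) \<in> borel_measurable ?H" by measurable
    then show "(\<lambda>x. \<gamma> i * x i) \<in> ?H \<rightarrow>\<^sub>M disc" by (simp cong: measurable_cong_sets)
  qed (auto simp: space_PiM)
  show ?thesis
  proof (rule discs.PiM_eqI)
    fix A :: "'i \<Rightarrow> complex set" assume "\<And>i. i \<in> UNIV \<Longrightarrow> A i \<in> sets disc"
    then have A [measurable]: "\<And>i. A i \<in> sets borel" by simp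
    have A': "(\<lambda>z. \<gamma> i * z) -` A i \<in> sets borel" for i
      using measurable_sets[of "\<lambda>z. \<gamma> i * z" borel borel "A i"] A by simp
    have "emeasure (distr ?H ?H ?T) (PiE UNIV A) = emeasure ?H (?T -` PiE UNIV A \<inter> space ?H)"
      by (rule emeasure_distr) (use A in \<open>auto intro!: sets_PiM_I_finite\<close>)
    also have "?T -` PiE UNIV A \<inter> space ?H = PiE UNIV (\<lambda>i. (\<lambda>z. \<gamma> i * z) -` A i)"
      by (auto simp: space_PiM PiE_def)
    also have "emeasure ?H (PiE UNIV (\<lambda>i. (\<lambda>z. \<gamma> i * z) -` A i)) = (\<Prod>i\<in>UNIV. emeasure disc ((\<lambda>z. \<gamma> i * z) -` A i))"
      by (rule discs.emeasure_PiM) (use A' in auto)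
    also have "\<dots> = (\<Prod>i\<in>UNIV. emeasure disc (A i))"
    proof (rule prod.cong[OF refl])
      fix i
      have "emeasure disc (A i) = emeasure (distr disc borel (\<lambda>z. \<gamma> i * z)) (A i)"
        by (simp add: disc_rotate[OF \<gamma>])
      then show "emeasure disc ((\<lambda>z. \<gamma> i * z) -` A i) = emeasure disc (A i)"
        by (simp add: emeasure_distr)
    qed
    finally show "emeasure (distr ?H ?H ?T) (PiE UNIV A) = (\<Prod>i\<in>UNIV. emeasure disc (A i))" .
  qed auto
qed

context monomial_domain
begin

abbreviation M\<Omega> :: "(complex^'n) measure" where "M\<Omega> \<equiv> lborel_on \<Omega>"

abbreviation D :: "('n \<Rightarrow> complex) measure" where "D \<equiv> polydisc UNIV"

abbreviation v\<Phi> :: "('n \<Rightarrow> complex) \<Rightarrow> complex^'n" where "v\<Phi> x \<equiv> vec_lambda (\<Phi> x)"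

definition vol_const :: real where
  "vol_const = (SOME c. c > 0 \<and> (\<forall>g\<in>borel_measurable borel.
    (\<integral>\<^sup>+z. indicator \<Omega> z * g z \<partial>lborel) = ennreal c * (\<integral>\<^sup>+x. g (v\<Phi> x) \<partial>wpoly)))"

lemma vol_const: "vol_const > 0" "g \<in> borel_measurable borel \<Longrightarrow> (\<integral>\<^sup>+z. g z \<partial>M\<Omega>) = ennreal vol_const * (\<integral>\<^sup>+x. g (v\<Phi> x) \<partial>wpoly)"
proof -
  have "\<exists>c>0. \<forall>g\<in>borel_measurable borel.
    (\<integral>\<^sup>+z. indicator \<Omega> z * g z \<partial>lborel) = ennreal c * (\<integral>\<^sup>+x. g (v\<Phi> x) \<partial>wpoly)"
    by (rule pushforward[OF \<kappa>_pos borel_\<Omega> \<Phi>_mem_\<Omega>])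
  then have "vol_const > 0 \<and> (\<forall>g\<in>borel_measurable borel.
    (\<integral>\<^sup>+z. indicator \<Omega> z * g z \<partial>lborel) = ennreal vol_const * (\<integral>\<^sup>+x. g (v\<Phi> x) \<partial>wpoly))"
    unfolding vol_const_def by (rule someI_ex)
  then show "vol_const > 0" "g \<in> borel_measurable borel \<Longrightarrow> (\<integral>\<^sup>+z. g z \<partial>M\<Omega>) = ennreal vol_const * (\<integral>\<^sup>+x. g (v\<Phi> x) \<partial>wpoly)"
    by (auto simp: nn_integral_lborel_on[OF borel_\<Omega>])
qed

lemma measurable_v\<Phi> [measurable]: "v\<Phi> \<in> borel_measurable D"
  using measurable_vec_\<Phi> by (simp cong: measurable_cong_sets sets_PiM_cong)

lemma measurable_v\<Phi>_wpoly: "v\<Phi> \<in> borel_measurable wpoly"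
  using measurable_vec_\<Phi> by (simp cong: measurable_cong_sets sets_PiM_cong)

lemma measurable_jac [measurable]: "jac \<in> borel_measurable D"
  unfolding jac_def[abs_def] by (intro borel_measurable_prod) measurable

lemma wpoly_density: "wpoly = density D (\<lambda>x. ennreal ((cmod (jac x))\<^sup>2))"
proof -
  have "wpoly = density D (\<lambda>x. \<Prod>i\<in>UNIV. ennreal (cmod (x i) ^ (2 * \<kappa> i - 2)))"
    unfolding wdisc_def
    by (rule PiM_density) (auto simp: discs.product_sigma_finite_axioms wdiscs.product_sigma_finite_axioms[unfolded wdisc_def])
  moreover have "(\<Prod>i\<in>UNIV. ennreal (cmod (x i) ^ (2 * \<kappa> i - 2))) = ennreal ((cmod (jac x))\<^sup>2)" for x
  proof -
    have "2 * \<kappa> i - 2 = (\<kappa> i - 1) * 2" for i by simp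
    then have "(\<Prod>i\<in>UNIV. cmod (x i) ^ (2 * \<kappa> i - 2)) = (cmod (jac x))\<^sup>2"
      by (simp add: jac_def norm_power prod_power_distrib power_mult flip: prod_norm)
    then show ?thesis by (simp add: prod_ennreal)
  qed
  ultimately show ?thesis by simp
qed

lemma nn_integral_pull:
  assumes [measurable]: "g \<in> borel_measurable borel"
  shows "(\<integral>\<^sup>+z. g z \<partial>M\<Omega>) = ennreal vol_const * (\<integral>\<^sup>+x. ennreal ((cmod (jac x))\<^sup>2) * g (v\<Phi> x) \<partial>D)"
  unfolding vol_const(2)[OF assms] wpoly_density by (subst nn_integral_density) auto

lemma M\<Omega>_eq: "M\<Omega> = density (distr wpoly borel v\<Phi>) (\<lambda>_. ennreal vol_const)"
proof (rule measure_eqI)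
  fix E assume "E \<in> sets M\<Omega>"
  then have [measurable]: "E \<in> sets borel" by simp
  have "emeasure M\<Omega> E = (\<integral>\<^sup>+z. indicator E z \<partial>M\<Omega>)" by simp
  also have "\<dots> = ennreal vol_const * (\<integral>\<^sup>+x. indicator E (v\<Phi> x) \<partial>wpoly)" by (rule vol_const) measurable
  also have "(\<integral>\<^sup>+x. indicator E (v\<Phi> x) \<partial>wpoly) = (\<integral>\<^sup>+z. indicator E z \<partial>distr wpoly borel v\<Phi>)"
    by (rule nn_integral_distr[symmetric, OF measurable_v\<Phi>_wpoly]) simp
  also have "ennreal vol_const * \<dots> = (\<integral>\<^sup>+z. ennreal vol_const * indicator E z \<partial>distr wpoly borel v\<Phi>)"
    by (rule nn_integral_cmult[symmetric]) simp
  also have "\<dots> = emeasure (density (distr wpoly borel v\<Phi>) (\<lambda>_. ennreal vol_const)) E"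
    by (subst emeasure_density) auto
  finally show "emeasure M\<Omega> E = emeasure (density (distr wpoly borel v\<Phi>) (\<lambda>_. ennreal vol_const)) E" .
qed simp

lemma integral_pull:
  fixes f :: "complex^'n \<Rightarrow> complex"
  assumes f [measurable]: "f \<in> borel_measurable borel"
  shows "(\<integral>z. f z \<partial>M\<Omega>) = vol_const *\<^sub>R (\<integral>x. (cmod (jac x))\<^sup>2 *\<^sub>R f (v\<Phi> x) \<partial>D)"
proof -
  have "(\<integral>z. f z \<partial>M\<Omega>) = (\<integral>z. vol_const *\<^sub>R f z \<partial>distr wpoly borel v\<Phi>)"
    unfolding M\<Omega>_eq by (rule integral_density) (use vol_const(1) in auto)
  also have "\<dots> = vol_const *\<^sub>R (\<integral>z. f z \<partial>distr wpoly borel v\<Phi>)" by (rule integral_scaleR_right)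
  also have "(\<integral>z. f z \<partial>distr wpoly borel v\<Phi>) = (\<integral>x. f (v\<Phi> x) \<partial>wpoly)"
    by (rule integral_distr[OF measurable_v\<Phi>_wpoly]) simp
  also have "\<dots> = (\<integral>x. (cmod (jac x))\<^sup>2 *\<^sub>R f (v\<Phi> x) \<partial>D)"
    unfolding wpoly_density by (rule integral_density) auto
  finally show ?thesis .
qed

lemma AE_D: "AE x in D. (\<forall>i. x i \<noteq> 0) \<and> (\<forall>i. cmod (x i) < 1)"
  using AE_polydisc[of "UNIV :: 'n set"] by (auto elim: eventually_mono)

lemma AE_push:
  assumes P [measurable]: "Measurable.pred borel P" and ae: "AE x in D. P (v\<Phi> x)"
  shows "AE z in M\<Omega>. P z"
proof -
  let ?N = "{z. \<not> P z}"
  have N: "?N \<in> sets borel" by measurable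
  have "emeasure M\<Omega> ?N = (\<integral>\<^sup>+z. indicator ?N z \<partial>M\<Omega>)" using N by simp
  also have "\<dots> = ennreal vol_const * (\<integral>\<^sup>+x. ennreal ((cmod (jac x))\<^sup>2) * indicator ?N (v\<Phi> x) \<partial>D)"
    by (rule nn_integral_pull) (use N in simp)
  also have "(\<integral>\<^sup>+x. ennreal ((cmod (jac x))\<^sup>2) * indicator ?N (v\<Phi> x) \<partial>D) = (\<integral>\<^sup>+x. 0 \<partial>D)"
    by (rule nn_integral_cong_AE, use ae in eventually_elim) (simp add: indicator_def)
  finally show ?thesis using N by (intro AE_I[of _ _ ?N]) auto
qed

text \<open>Times the Jacobian, the pullback is a monomial with nonnegative exponents, hence bounded.\<close>

lemma mon_L2:
  assumes \<rho>: "\<rho> \<in> exps"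
  shows "(\<integral>\<^sup>+z. ennreal ((cmod (mon \<rho> z))\<^sup>2) \<partial>M\<Omega>) < \<infinity>"
proof -
  have "(\<integral>\<^sup>+z. ennreal ((cmod (mon \<rho> z))\<^sup>2) \<partial>M\<Omega>) = ennreal vol_const * (\<integral>\<^sup>+x. ennreal ((cmod (jac x))\<^sup>2) * ennreal ((cmod (mon \<rho> (v\<Phi> x)))\<^sup>2) \<partial>D)"
    by (rule nn_integral_pull) measurable
  also have "\<dots> \<le> ennreal vol_const * (\<integral>\<^sup>+x. 1 \<partial>D)"
  proof (intro mult_left_mono nn_integral_mono_AE)
    show "AE x in D. ennreal ((cmod (jac x))\<^sup>2) * ennreal ((cmod (mon \<rho> (v\<Phi> x)))\<^sup>2) \<le> 1"
      using AE_D
    proof eventually_elim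
      fix x :: "'n \<Rightarrow> complex" assume x: "(\<forall>i. x i \<noteq> 0) \<and> (\<forall>i. cmod (x i) < 1)"
      have "cmod (mon \<rho> (v\<Phi> x) * jac x) = (\<Prod>i\<in>UNIV. cmod (x i) ^ (snat \<rho> i - 1))"
        using x by (simp add: mon_\<Phi>[OF _ \<rho>] norm_power flip: prod_norm)
      also have "\<dots> \<le> (\<Prod>i\<in>(UNIV::'n set). 1)"
        using x by (intro prod_mono conjI power_le_one zero_le_power norm_ge_zero less_imp_le) auto
      finally have "(cmod (mon \<rho> (v\<Phi> x) * jac x))\<^sup>2 \<le> 1" by (simp add: power_le_one)
      then have "ennreal ((cmod (jac x))\<^sup>2 * (cmod (mon \<rho> (v\<Phi> x)))\<^sup>2) \<le> 1"
        by (simp add: norm_mult power_mult_distrib mult.commute)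
      then show "ennreal ((cmod (jac x))\<^sup>2) * ennreal ((cmod (mon \<rho> (v\<Phi> x)))\<^sup>2) \<le> 1"
        by (simp add: ennreal_mult)
    qed
  qed simp
  also have "\<dots> < \<infinity>"
    using finite_measure.emeasure_finite[OF finite_measure_polydisc[of "UNIV :: 'n set"], of "space D"]
    by (simp add: ennreal_mult_less_top top.not_eq_extremum)
  finally show ?thesis .
qed

lemma L2_product_integrable:
  fixes f g :: "complex^'n \<Rightarrow> complex"
  assumes [measurable]: "f \<in> borel_measurable borel" "g \<in> borel_measurable borel"
    and "(\<integral>\<^sup>+z. ennreal ((cmod (f z))\<^sup>2) \<partial>M\<Omega>) < \<infinity>" "(\<integral>\<^sup>+z. ennreal ((cmod (g z))\<^sup>2) \<partial>M\<Omega>) < \<infinity>"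
  shows "integrable M\<Omega> (\<lambda>z. cmod (f z) * cmod (g z))"
  unfolding integrable_iff_bounded
proof
  have "(\<integral>\<^sup>+z. ennreal (norm (cmod (f z) * cmod (g z))) \<partial>M\<Omega>) \<le> (\<integral>\<^sup>+z. ennreal ((cmod (f z))\<^sup>2) + ennreal ((cmod (g z))\<^sup>2) \<partial>M\<Omega>)"
  proof (rule nn_integral_mono)
    fix z
    have "cmod (f z) * cmod (g z) \<le> (cmod (f z))\<^sup>2 + (cmod (g z))\<^sup>2"
      using sum_squares_bound[of "cmod (f z)" "cmod (g z)"] mult_nonneg_nonneg[OF norm_ge_zero norm_ge_zero, of "f z" "g z"] by linarith
    then show "ennreal (norm (cmod (f z) * cmod (g z))) \<le> ennreal ((cmod (f z))\<^sup>2) + ennreal ((cmod (g z))\<^sup>2)"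
      by (simp add: ennreal_leI flip: ennreal_plus)
  qed
  also have "\<dots> = (\<integral>\<^sup>+z. ennreal ((cmod (f z))\<^sup>2) \<partial>M\<Omega>) + (\<integral>\<^sup>+z. ennreal ((cmod (g z))\<^sup>2) \<partial>M\<Omega>)"
    by (rule nn_integral_add) measurable
  also have "\<dots> < \<infinity>" using assms(3,4) by simp
  finally show "(\<integral>\<^sup>+z. ennreal (norm (cmod (f z) * cmod (g z))) \<partial>M\<Omega>) < \<infinity>" .
qed measurable

section \<open>Residue classes that do not descend\<close>

definition \<psi>prod :: "('n \<Rightarrow> nat) \<Rightarrow> ('n \<Rightarrow> complex) \<Rightarrow> ('n \<Rightarrow> complex) \<Rightarrow> complex" where
  "\<psi>prod s x y = (\<Prod>i\<in>UNIV. \<psi> (s i) (e i) (x i * cnj (y i)))"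

lemma integrable_\<psi>prod:
  assumes F: "integrable D F" and s: "s \<in> PiE UNIV (\<lambda>i. {1..e i})" and x: "\<And>i. cmod (x i) < 1"
  shows "integrable D (\<lambda>y. F y * \<psi>prod s x y)"
proof (rule Bochner_Integration.integrable_bound)
  have [measurable]: "F \<in> borel_measurable D" using F by simp
  let ?C = "\<Prod>i\<in>UNIV. real (e i) / (1 - cmod (x i))\<^sup>2"
  show "integrable D (\<lambda>y. ?C * cmod (F y))" using F by auto
  have "\<psi>prod s x \<in> borel_measurable D"
    unfolding \<psi>prod_def[abs_def] by (intro borel_measurable_prod measurable_compose[OF _ measurable_\<psi>]) measurable
  then show "(\<lambda>y. F y * \<psi>prod s x y) \<in> borel_measurable D" by measurable
  show "AE y in D. norm (F y * \<psi>prod s x y) \<le> norm (?C * cmod (F y))"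
    using AE_D
  proof eventually_elim
    fix y :: "'n \<Rightarrow> complex" assume y: "(\<forall>i. y i \<noteq> 0) \<and> (\<forall>i. cmod (y i) < 1)"
    have "cmod (\<psi>prod s x y) = (\<Prod>i\<in>UNIV. cmod (\<psi> (s i) (e i) (x i * cnj (y i))))"
      by (simp add: \<psi>prod_def flip: prod_norm)
    also have "\<dots> \<le> ?C"
    proof (rule prod_mono, intro conjI norm_ge_zero)
      fix i
      let ?t = "x i * cnj (y i)"
      have t1: "cmod ?t < 1" using product_less_one[OF x[of i], of "y i"] y by simp
      have "cmod (x i) * cmod (y i) \<le> cmod (x i)" using y by (simp add: mult_left_le less_imp_le)
      then have tx: "cmod ?t \<le> cmod (x i)" by (simp add: norm_mult)
      have "cmod (?t ^ e i) \<le> cmod ?t"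
        using power_decreasing[of 1 "e i" "cmod ?t"] e_pos[of i] t1 by (simp add: norm_power)
      then have "1 - cmod (x i) \<le> cmod (1 - ?t ^ e i)"
        using norm_triangle_ineq2[of 1 "?t ^ e i"] tx by simp
      then have "(1 - cmod (x i))\<^sup>2 \<le> (cmod (1 - ?t ^ e i))\<^sup>2" using x[of i] by (intro power_mono) auto
      moreover have "0 < (1 - cmod (x i))\<^sup>2" using x[of i] by simp
      ultimately have "real (e i) / (cmod (1 - ?t ^ e i))\<^sup>2 \<le> real (e i) / (1 - cmod (x i))\<^sup>2"
        by (intro frac_le) auto
      moreover have "cmod (\<psi> (s i) (e i) ?t) \<le> real (e i) / (cmod (1 - ?t ^ e i))\<^sup>2"
        by (rule norm_\<psi>_le[OF _ t1]) (use s in auto)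
      ultimately show "cmod (\<psi> (s i) (e i) ?t) \<le> real (e i) / (1 - cmod (x i))\<^sup>2" by simp
    qed
    finally have "cmod (F y) * cmod (\<psi>prod s x y) \<le> cmod (F y) * ?C" by (intro mult_left_mono) auto
    also have "\<dots> \<le> norm (?C * cmod (F y))"
      unfolding real_norm_def by (subst mult.commute) (rule abs_ge_self)
    finally show "norm (F y * \<psi>prod s x y) \<le> norm (?C * cmod (F y))" by (simp add: norm_mult)
  qed
qed

lemma polydisc_kernel_eq:
  assumes x: "\<And>i. cmod (x i) < 1" and y: "\<And>i. cmod (y i) < 1"
  shows "polydisc_kernel UNIV x y = (\<Sum>s\<in>PiE UNIV (\<lambda>i. {1..e i}). \<psi>prod s x y)"
proof -
  have "polydisc_kernel UNIV x y = (\<Prod>i\<in>UNIV. \<Sum>s\<in>{1..e i}. \<psi> s (e i) (x i * cnj (y i)))"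
    unfolding polydisc_kernel_def
    by (rule prod.cong) (use sum_class_kernel[OF product_less_one[OF x y] e_pos] in \<open>simp_all add: \<psi>_def\<close>)
  then show ?thesis unfolding \<psi>prod_def by (simp add: prod_sum_PiE)
qed

text \<open>If \<open>s\<close> is not of the form \<open>\<sigma> \<rho>\<close>, then the rational solution \<open>q\<close> of \<open>\<sigma> q = s\<close> has a nonintegral coordinate \<open>k\<close>. The
  rotation by the angles \<open>2 \<pi> B\<^sub>i\<^sub>k / e\<^sub>i\<close> preserves \<open>\<Phi>\<close> and multiplies the integrand by the root of unity
  \<open>exp(-2 \<pi> i q\<^sub>k) \<noteq> 1\<close>; as it also preserves the measure, the integral vanishes.\<close>

lemma off_lattice_vanish:
  fixes f :: "complex^'n \<Rightarrow> complex"
  assumes f [measurable]: "f \<in> borel_measurable borel" and s: "s \<in> PiE UNIV (\<lambda>i. {1..e i})" "s \<notin> snat ` exps"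
  shows "(\<integral>y. f (v\<Phi> y) * jac y * \<psi>prod s x y \<partial>D) = 0"
proof -
  define q where "q k = (\<Sum>j\<in>UNIV. real (s j) * (real_of_int (B j k) / real (e j)))" for k
  have s1: "1 \<le> s i" "s i \<le> e i" for i using s(1) by (auto simp: PiE_iff)
  have "\<exists>k. q k \<notin> \<int>"
  proof (rule ccontr)
    assume "\<not> ?thesis"
    then have "\<forall>k. \<exists>m. q k = real_of_int m" by (auto simp: Ints_def)
    then obtain \<rho> where \<rho>: "\<And>k. q k = real_of_int (\<rho> k)" by metis
    have "\<sigma> \<rho> j = int (s j)" for j
    proof -
      have "real_of_int (\<sigma> \<rho> j) = (\<Sum>k\<in>UNIV. q k * real (A k j))" by (simp add: \<sigma>_def \<rho>)
      also have "\<dots> = (\<Sum>k\<in>UNIV. \<Sum>i\<in>UNIV. real (s i) / real (e i) * (real_of_int (B i k) * real (A k j)))"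
        unfolding q_def sum_distrib_right by (intro sum.cong refl) (simp add: field_simps)
      also have "\<dots> = (\<Sum>i\<in>UNIV. real (s i) / real (e i) * real_of_int (\<Sum>k\<in>UNIV. B i k * int (A k j)))"
        by (subst sum.swap) (simp add: sum_distrib_left)
      also have "\<dots> = (\<Sum>i\<in>UNIV. if i = j then real (s i) else 0)"
        by (rule sum.cong) (use e_pos in \<open>auto simp: BA\<close>)
      also have "\<dots> = real_of_int (int (s j))" by simp
      finally show ?thesis by (simp only: of_int_eq_iff)
    qed
    then have "\<rho> \<in> exps" "snat \<rho> = s" using s1 by (auto simp: exps_def snat_def fun_eq_iff)
    then show False using s(2) by auto
  qed
  then obtain k where k: "q k \<notin> \<int>" by blast
  define \<gamma> where "\<gamma> i = cis (2 * pi * (real_of_int (B i k) / real (e i)))" for i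
  have \<gamma>1: "cmod (\<gamma> i) = 1" for i by (simp add: \<gamma>_def)
  have \<gamma>0: "\<gamma> i \<noteq> 0" for i using \<gamma>1[of i] by auto
  have cnj\<gamma>: "\<gamma> i * cnj (\<gamma> i) = 1" for i using complex_norm_square[of "\<gamma> i"] \<gamma>1[of i] by simp
  have cis_int: "cis (2 * pi * real_of_int m) = 1" for m by (rule cis_multiple_2pi) simp
  have cis_pow: "(\<Prod>i\<in>UNIV. \<gamma> i ^ m i) = cis (2 * pi * (\<Sum>i\<in>UNIV. real (m i) * (real_of_int (B i k) / real (e i))))" for m
  proof -
    have "(\<Prod>i\<in>I. \<gamma> i ^ m i) = cis (2 * pi * (\<Sum>i\<in>I. real (m i) * (real_of_int (B i k) / real (e i))))" for I
      by (induction I rule: infinite_finite_induct)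
         (simp_all add: \<gamma>_def Complex.DeMoivre cis_mult distrib_left mult_ac)
    then show ?thesis .
  qed
  have \<Phi>\<gamma>: "\<Phi> \<gamma> m = 1" for m
  proof -
    have "\<Phi> \<gamma> m = cis (2 * pi * (if m = k then 1 else 0))" unfolding \<Phi>_def cis_pow AB ..
    then show ?thesis by simp
  qed
  have \<gamma>e: "\<gamma> i ^ e i = 1" for i
  proof -
    have "\<gamma> i ^ e i = cis (2 * pi * real_of_int (B i k))"
      using e_pos[of i] by (simp add: \<gamma>_def Complex.DeMoivre)
    then show ?thesis by (simp only: cis_int)
  qed
  define \<theta> where "\<theta> = cnj (\<Prod>i\<in>UNIV. \<gamma> i ^ s i)"
  have \<theta>1: "\<theta> \<noteq> 1"
  proof
    assume "\<theta> = 1"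
    then have "(\<Prod>i\<in>UNIV. \<gamma> i ^ s i) = 1" unfolding \<theta>_def by (simp only: complex_cnj_one_iff)
    then have "cis (2 * pi * q k) = 1" by (simp only: cis_pow q_def)
    then have "cos (2 * pi * q k) = 1" by (simp add: complex_eq_iff)
    then obtain n :: int where "2 * pi * q k = of_int n * 2 * pi" by (auto simp: cos_one_2pi_int)
    then have "q k = of_int n" by simp
    then show False using k by simp
  qed
  \<comment> \<open>the Jacobian is invariant up to \<open>\<Prod> cnj \<gamma>\<^sub>i\<close> because \<open>\<Prod> \<gamma>\<^sub>i^\<kappa>\<^sub>i = \<Prod>\<^sub>m \<Phi>(\<gamma>)\<^sub>m = 1\<close>\<close>
  have jac\<gamma>: "(\<Prod>i\<in>UNIV. \<gamma> i ^ (\<kappa> i - 1)) = cnj (\<Prod>i\<in>UNIV. \<gamma> i)"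
  proof -
    have "(\<Prod>i\<in>UNIV. \<gamma> i ^ \<kappa> i) = (\<Prod>i\<in>UNIV. \<Prod>m\<in>UNIV. \<gamma> i ^ A m i)" by (simp add: \<kappa>_def power_sum)
    also have "\<dots> = (\<Prod>m\<in>UNIV. \<Phi> \<gamma> m)" unfolding \<Phi>_def by (rule prod.swap)
    finally have k1: "(\<Prod>i\<in>UNIV. \<gamma> i ^ \<kappa> i) = 1" by (simp add: \<Phi>\<gamma>)
    have "\<gamma> i ^ (\<kappa> i - 1) = \<gamma> i ^ \<kappa> i * cnj (\<gamma> i)" for i
    proof -
      have "\<gamma> i ^ \<kappa> i = \<gamma> i ^ (\<kappa> i - 1) * \<gamma> i" using \<kappa>_pos[of i] by (cases "\<kappa> i") auto
      then show ?thesis by (simp add: mult.assoc cnj\<gamma>)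
    qed
    then show ?thesis by (simp add: prod.distrib k1)
  qed
  let ?G = "\<lambda>y. f (v\<Phi> y) * jac y * \<psi>prod s x y"
  have G\<gamma>: "?G (\<lambda>j. \<gamma> j * y j) = \<theta> * ?G y" for y
  proof -
    have 1: "\<Phi> (\<lambda>j. \<gamma> j * y j) = \<Phi> y" by (rule ext) (simp add: \<Phi>_mult \<Phi>\<gamma>)
    have 2: "jac (\<lambda>j. \<gamma> j * y j) = cnj (\<Prod>i\<in>UNIV. \<gamma> i) * jac y"
      by (simp only: jac_def power_mult_distrib prod.distrib jac\<gamma>)
    have "\<psi> (s i) (e i) (x i * cnj (\<gamma> i * y i)) = cnj (\<gamma> i) ^ (s i - 1) * \<psi> (s i) (e i) (x i * cnj (y i))" for i
    proof -
      have "x i * cnj (\<gamma> i * y i) = cnj (\<gamma> i) * (x i * cnj (y i))" by simp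
      moreover have "(cnj (\<gamma> i) * (x i * cnj (y i))) ^ e i = (x i * cnj (y i)) ^ e i"
        using arg_cong[OF \<gamma>e[of i], of cnj] by (simp add: power_mult_distrib)
      ultimately show ?thesis by (simp only: \<psi>_def) (simp add: power_mult_distrib)
    qed
    then have 3: "\<psi>prod s x (\<lambda>j. \<gamma> j * y j) = (\<Prod>i\<in>UNIV. cnj (\<gamma> i) ^ (s i - 1)) * \<psi>prod s x y"
      by (simp add: \<psi>prod_def prod.distrib)
    have "cnj (\<Prod>i\<in>UNIV. \<gamma> i) * (\<Prod>i\<in>UNIV. cnj (\<gamma> i) ^ (s i - 1)) = (\<Prod>i\<in>UNIV. cnj (\<gamma> i) * cnj (\<gamma> i) ^ (s i - 1))"
      by (simp add: prod.distrib)
    also have "\<dots> = \<theta>"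
    proof -
      have "cnj (\<gamma> i) * cnj (\<gamma> i) ^ (s i - 1) = cnj (\<gamma> i) ^ s i" for i using s1(1)[of i] by (cases "s i") auto
      then show ?thesis by (simp add: \<theta>_def)
    qed
    finally have 4: "cnj (\<Prod>i\<in>UNIV. \<gamma> i) * (\<Prod>i\<in>UNIV. cnj (\<gamma> i) ^ (s i - 1)) = \<theta>" .
    show ?thesis unfolding 1 2 3 4[symmetric] by (simp only: mult_ac)
  qed
  have "\<psi>prod s x \<in> borel_measurable D"
    unfolding \<psi>prod_def[abs_def] by (intro borel_measurable_prod measurable_compose[OF _ measurable_\<psi>]) measurable
  then have Gm [measurable]: "?G \<in> borel_measurable D" by measurable
  have T [measurable]: "(\<lambda>y j. \<gamma> j * y j) \<in> D \<rightarrow>\<^sub>M D"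
  proof (rule measurable_PiM_single')
    fix i :: 'n
    have "(\<lambda>x. \<gamma> i * x i) \<in> borel_measurable D" by measurable
    then show "(\<lambda>x. \<gamma> i * x i) \<in> D \<rightarrow>\<^sub>M disc" by (simp cong: measurable_cong_sets)
  qed (auto simp: space_PiM)
  have "(\<integral>y. ?G y \<partial>D) = (\<integral>y. ?G y \<partial>distr D D (\<lambda>y j. \<gamma> j * y j))" by (simp add: polydisc_rotate \<gamma>1)
  also have "\<dots> = (\<integral>y. ?G (\<lambda>j. \<gamma> j * y j) \<partial>D)" by (rule integral_distr[OF T Gm])
  also have "\<dots> = \<theta> * (\<integral>y. ?G y \<partial>D)" unfolding G\<gamma> by (rule integral_mult_right_zero)
  finally have "(1 - \<theta>) * (\<integral>y. ?G y \<partial>D) = 0" by (simp add: algebra_simps)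
  then show ?thesis using \<theta>1 by simp
qed

end

section \<open>The reproducing property\<close>

lemma AE_lborel_on_iff:
  "\<Omega> \<in> sets borel \<Longrightarrow> (AE z in lborel_on \<Omega>. P z) \<longleftrightarrow> (AE z in lborel. z \<in> \<Omega> \<longrightarrow> P z)"
  unfolding lborel_on_def by (subst AE_density) (auto simp: indicator_def)

lemma AE_lborel_on_mem: "\<Omega> \<in> sets borel \<Longrightarrow> AE z in lborel_on \<Omega>. z \<in> \<Omega>"
  by (simp add: AE_lborel_on_iff)

lemma continuous_eq_of_AE_eq:
  fixes h :: "'a::euclidean_space \<Rightarrow> complex"
  assumes op: "open \<Omega>" and h: "continuous_on \<Omega> h" and ae: "AE z in lborel_on \<Omega>. h z = 0" and w: "w \<in> \<Omega>"
  shows "h w = 0"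
proof -
  let ?N = "\<Omega> \<inter> h -` (- {0})"
  have o: "open ?N" by (rule continuous_open_preimage[OF h op open_Compl[OF closed_singleton]])
  have "AE z in lborel. z \<in> \<Omega> \<longrightarrow> h z = 0" using ae op by (simp add: AE_lborel_on_iff)
  then have "AE z in lborel. z \<notin> ?N" by eventually_elim auto
  then have "?N \<in> null_sets lborel" using o by (simp add: AE_iff_null_sets)
  then have "negligible ?N" by (simp add: negligible_iff_null_sets null_sets_completionI)
  then have "?N = {}" using open_not_negligible[OF o] by blast
  then show ?thesis using w by blast
qed

context monomial_domain
begin

lemma measurable_kernel_term: "(\<lambda>\<zeta>. kernel_term \<rho> w \<zeta>) \<in> borel_measurable borel"
  unfolding kernel_term_def
  by (intro borel_measurable_times borel_measurable_prod measurable_compose[OF _ measurable_class_kernel]) measurable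

lemma measurable_kernel_sum2 [measurable]: "kernel_sum w \<in> borel_measurable borel"
  unfolding kernel_sum_def[abs_def] by (intro borel_measurable_sum measurable_kernel_term)

lemma kernel_term_dominated:
  assumes K: "compact K" "K \<subseteq> \<Omega>" and \<rho>: "\<rho> \<in> exps"
  shows "\<exists>C\<ge>0. \<forall>z\<in>K. \<forall>\<zeta>\<in>\<Omega>. cmod (kernel_term \<rho> z \<zeta>) \<le> C * cmod (mon \<rho> \<zeta>)"
proof (cases "K = {}")
  case False
  have cont: "continuous_on K (\<lambda>z. cmod (mon \<rho> z))" "continuous_on K (\<lambda>z. cmod (bmon j z))" for j
    using K(2) \<rho>
    by (intro continuous_on_norm continuous_at_imp_continuous_on ballI holo_at_continuous holo_at_mon holo_at_bmon, auto)+
  obtain M where M: "\<And>z. z \<in> K \<Longrightarrow> cmod (mon \<rho> z) \<le> M"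
    using continuous_attains_sup[OF K(1) False cont(1)] by blast
  have "\<exists>r<1. \<forall>z\<in>K. cmod (bmon j z) \<le> r" for j
    using continuous_attains_sup[OF K(1) False cont(2)[of j]] bmon_less[of _ j] K(2) by blast
  then obtain r where r: "\<And>j. r j < 1" "\<And>j z. z \<in> K \<Longrightarrow> cmod (bmon j z) \<le> r j" by metis
  define s where "s = Max (range r)"
  have s: "s < 1" "r j \<le> s" for j unfolding s_def using r(1) by auto
  have M0: "0 \<le> M" using False M norm_ge_zero order_trans by blast
  show ?thesis
  proof (intro exI[of _ "M * (\<Prod>j\<in>UNIV. real (e j) / (1 - s)\<^sup>2)"] conjI ballI)
    show "0 \<le> M * (\<Prod>j\<in>UNIV. real (e j) / (1 - s)\<^sup>2)" using M0 by (intro mult_nonneg_nonneg prod_nonneg) auto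
    fix z \<zeta> assume z: "z \<in> K" and "\<zeta> \<in> \<Omega>"
    then show "cmod (kernel_term \<rho> z \<zeta>) \<le> M * (\<Prod>j\<in>UNIV. real (e j) / (1 - s)\<^sup>2) * cmod (mon \<rho> \<zeta>)"
      using r(2)[OF z] s K(2) by (intro norm_kernel_term_le[OF \<rho>] M s(1) order_trans[OF r(2)[OF z] s(2)]) auto
  qed
qed auto

text \<open>A square integrable majorant, uniform in the first variable on compact sets. It gives both the square
  integrability of the kernel in one variable and dominated convergence.\<close>

lemma kernel_sum_dominated:
  assumes K: "compact K" "K \<subseteq> \<Omega>"
  shows "\<exists>G. G \<in> borel_measurable borel \<and> (\<integral>\<^sup>+\<zeta>. ennreal ((cmod (G \<zeta>))\<^sup>2) \<partial>M\<Omega>) < \<infinity> \<and>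
    (\<forall>z\<in>K. \<forall>\<zeta>\<in>\<Omega>. cmod (kernel_sum z \<zeta>) \<le> cmod (G \<zeta> :: complex))"
proof -
  have "\<forall>\<rho>\<in>exps. \<exists>C. 0 \<le> C \<and> (\<forall>z\<in>K. \<forall>\<zeta>\<in>\<Omega>. cmod (kernel_term \<rho> z \<zeta>) \<le> C * cmod (mon \<rho> \<zeta>))"
    using kernel_term_dominated[OF K] by blast
  then obtain C where C: "\<And>\<rho>. \<rho> \<in> exps \<Longrightarrow> 0 \<le> C \<rho>"
    "\<And>\<rho> z \<zeta>. \<rho> \<in> exps \<Longrightarrow> z \<in> K \<Longrightarrow> \<zeta> \<in> \<Omega> \<Longrightarrow> cmod (kernel_term \<rho> z \<zeta>) \<le> C \<rho> * cmod (mon \<rho> \<zeta>)"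
    by metis
  define g where "g \<zeta> = (\<Sum>\<rho>\<in>exps. C \<rho> * cmod (mon \<rho> \<zeta>))" for \<zeta>
  have gm [measurable]: "g \<in> borel_measurable borel" unfolding g_def[abs_def] by measurable
  have g0: "0 \<le> g \<zeta>" for \<zeta> unfolding g_def using C(1) by (intro sum_nonneg mult_nonneg_nonneg) auto
  have "(\<integral>\<^sup>+\<zeta>. ennreal ((g \<zeta>)\<^sup>2) \<partial>M\<Omega>) \<le> (\<integral>\<^sup>+\<zeta>. (\<Sum>\<rho>\<in>exps. ennreal ((C \<rho>)\<^sup>2 * real (card exps)) * ennreal ((cmod (mon \<rho> \<zeta>))\<^sup>2)) \<partial>M\<Omega>)"
  proof (rule nn_integral_mono)
    fix \<zeta>
    have "(g \<zeta>)\<^sup>2 \<le> (\<Sum>\<rho>\<in>exps. (C \<rho> * cmod (mon \<rho> \<zeta>))\<^sup>2) * real (card exps)"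
      unfolding g_def by (rule sum_squared_le_sum_of_squares)
    also have "\<dots> = (\<Sum>\<rho>\<in>exps. ((C \<rho>)\<^sup>2 * real (card exps)) * (cmod (mon \<rho> \<zeta>))\<^sup>2)"
      unfolding sum_distrib_right by (rule sum.cong) (simp_all add: power_mult_distrib mult_ac)
    finally have "ennreal ((g \<zeta>)\<^sup>2) \<le> ennreal (\<Sum>\<rho>\<in>exps. ((C \<rho>)\<^sup>2 * real (card exps)) * (cmod (mon \<rho> \<zeta>))\<^sup>2)"
      by (rule ennreal_leI)
    then show "ennreal ((g \<zeta>)\<^sup>2) \<le> (\<Sum>\<rho>\<in>exps. ennreal ((C \<rho>)\<^sup>2 * real (card exps)) * ennreal ((cmod (mon \<rho> \<zeta>))\<^sup>2))"
      by (simp add: ennreal_mult flip: sum_ennreal)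
  qed
  also have "\<dots> = (\<Sum>\<rho>\<in>exps. (\<integral>\<^sup>+\<zeta>. ennreal ((C \<rho>)\<^sup>2 * real (card exps)) * ennreal ((cmod (mon \<rho> \<zeta>))\<^sup>2) \<partial>M\<Omega>))"
    by (rule nn_integral_sum) measurable
  also have "\<dots> = (\<Sum>\<rho>\<in>exps. ennreal ((C \<rho>)\<^sup>2 * real (card exps)) * (\<integral>\<^sup>+\<zeta>. ennreal ((cmod (mon \<rho> \<zeta>))\<^sup>2) \<partial>M\<Omega>))"
    by (intro sum.cong refl nn_integral_cmult) measurable
  also have "\<dots> < \<infinity>"
    using mon_L2 finite_exps by (auto simp: ennreal_mult_less_top)
  finally have "(\<integral>\<^sup>+\<zeta>. ennreal ((g \<zeta>)\<^sup>2) \<partial>M\<Omega>) < \<infinity>" .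
  moreover have "cmod (kernel_sum z \<zeta>) \<le> g \<zeta>" if "z \<in> K" "\<zeta> \<in> \<Omega>" for z \<zeta>
    unfolding kernel_sum_def g_def using C(2) that by (intro order_trans[OF norm_sum] sum_mono) auto
  ultimately show ?thesis
    by (intro exI[of _ "\<lambda>\<zeta>. complex_of_real (g \<zeta>)"] conjI) (auto simp: g0)
qed

lemma kernel_sum_L2:
  assumes w: "w \<in> \<Omega>"
  shows "(\<integral>\<^sup>+\<zeta>. ennreal ((cmod (kernel_sum w \<zeta>))\<^sup>2) \<partial>M\<Omega>) < \<infinity>"
proof -
  obtain G where G: "G \<in> borel_measurable borel" "(\<integral>\<^sup>+\<zeta>. ennreal ((cmod (G \<zeta>))\<^sup>2) \<partial>M\<Omega>) < \<infinity>"
    "\<And>\<zeta>. \<zeta> \<in> \<Omega> \<Longrightarrow> cmod (kernel_sum w \<zeta>) \<le> cmod (G \<zeta> :: complex)"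
    using kernel_sum_dominated[of "{w}"] w by auto
  have "(\<integral>\<^sup>+\<zeta>. ennreal ((cmod (kernel_sum w \<zeta>))\<^sup>2) \<partial>M\<Omega>) \<le> (\<integral>\<^sup>+\<zeta>. ennreal ((cmod (G \<zeta>))\<^sup>2) \<partial>M\<Omega>)"
    by (rule nn_integral_mono_AE, use AE_lborel_on_mem[OF borel_\<Omega>] in eventually_elim) (intro ennreal_leI power_mono G(3), auto)
  also note G(2)
  finally show ?thesis .
qed

lemma continuous_on_kernel_sum_integral:
  fixes f :: "complex^'n \<Rightarrow> complex"
  assumes f [measurable]: "f \<in> borel_measurable borel" and f2: "(\<integral>\<^sup>+z. ennreal ((cmod (f z))\<^sup>2) \<partial>M\<Omega>) < \<infinity>"
  shows "continuous_on \<Omega> (\<lambda>w. \<integral>\<zeta>. f \<zeta> * kernel_sum w \<zeta> \<partial>M\<Omega>)"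
proof (rule continuous_on_sequentiallyI)
  fix u a assume u: "\<forall>n. u n \<in> \<Omega>" and a: "a \<in> \<Omega>" and lim: "u \<longlonglongrightarrow> a"
  have "compact (insert a (range u))" by (rule compact_sequence_with_limit[OF lim])
  then obtain G where [measurable]: "G \<in> borel_measurable borel" and G: "(\<integral>\<^sup>+\<zeta>. ennreal ((cmod (G \<zeta>))\<^sup>2) \<partial>M\<Omega>) < \<infinity>"
    "\<And>z \<zeta>. z \<in> insert a (range u) \<Longrightarrow> \<zeta> \<in> \<Omega> \<Longrightarrow> cmod (kernel_sum z \<zeta>) \<le> cmod (G \<zeta> :: complex)"
    using kernel_sum_dominated[of "insert a (range u)"] u a by (metis image_subsetI insert_subset)
  show "(\<lambda>n. \<integral>\<zeta>. f \<zeta> * kernel_sum (u n) \<zeta> \<partial>M\<Omega>) \<longlonglongrightarrow> (\<integral>\<zeta>. f \<zeta> * kernel_sum a \<zeta> \<partial>M\<Omega>)"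
  proof (rule integral_dominated_convergence)
    show "integrable M\<Omega> (\<lambda>\<zeta>. cmod (f \<zeta>) * cmod (G \<zeta>))" by (rule L2_product_integrable[OF _ _ f2 G(1)]) measurable
    show "AE \<zeta> in M\<Omega>. (\<lambda>n. f \<zeta> * kernel_sum (u n) \<zeta>) \<longlonglongrightarrow> f \<zeta> * kernel_sum a \<zeta>"
      using AE_lborel_on_mem[OF borel_\<Omega>]
    proof eventually_elim
      fix \<zeta> assume "\<zeta> \<in> \<Omega>"
      then have "isCont (\<lambda>z. kernel_sum z \<zeta>) a" by (intro holo_at_continuous holo_at_kernel_sum a)
      then show "(\<lambda>n. f \<zeta> * kernel_sum (u n) \<zeta>) \<longlonglongrightarrow> f \<zeta> * kernel_sum a \<zeta>"
        by (intro tendsto_mult tendsto_const isCont_tendsto_compose[OF _ lim])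
    qed
    show "AE \<zeta> in M\<Omega>. norm (f \<zeta> * kernel_sum (u n) \<zeta>) \<le> cmod (f \<zeta>) * cmod (G \<zeta>)" for n
      using AE_lborel_on_mem[OF borel_\<Omega>]
      by eventually_elim (auto simp: norm_mult intro!: mult_left_mono G(2))
  qed measurable
qed

lemma integrable_mult_kernel_term:
  fixes f :: "complex^'n \<Rightarrow> complex"
  assumes f [measurable]: "f \<in> borel_measurable borel" and f2: "(\<integral>\<^sup>+z. ennreal ((cmod (f z))\<^sup>2) \<partial>M\<Omega>) < \<infinity>"
    and \<rho>: "\<rho> \<in> exps" and w: "w \<in> \<Omega>"
  shows "integrable M\<Omega> (\<lambda>\<zeta>. f \<zeta> * kernel_term \<rho> w \<zeta>)"
proof -
  obtain C where C: "0 \<le> C" "\<And>\<zeta>. \<zeta> \<in> \<Omega> \<Longrightarrow> cmod (kernel_term \<rho> w \<zeta>) \<le> C * cmod (mon \<rho> \<zeta>)"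
    using kernel_term_dominated[of "{w}", OF _ _ \<rho>] w by auto
  show ?thesis
  proof (rule Bochner_Integration.integrable_bound)
    show "integrable M\<Omega> (\<lambda>\<zeta>. C * (cmod (f \<zeta>) * cmod (mon \<rho> \<zeta>)))"
      by (intro integrable_mult_right L2_product_integrable[OF _ _ f2 mon_L2[OF \<rho>]]) measurable
    show "(\<lambda>\<zeta>. f \<zeta> * kernel_term \<rho> w \<zeta>) \<in> borel_measurable M\<Omega>" using measurable_kernel_term by simp
    show "AE \<zeta> in M\<Omega>. norm (f \<zeta> * kernel_term \<rho> w \<zeta>) \<le> norm (C * (cmod (f \<zeta>) * cmod (mon \<rho> \<zeta>)))"
      using AE_lborel_on_mem[OF borel_\<Omega>]
    proof eventually_elim
      fix \<zeta> assume "\<zeta> \<in> \<Omega>"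
      then have "cmod (f \<zeta>) * cmod (kernel_term \<rho> w \<zeta>) \<le> cmod (f \<zeta>) * (C * cmod (mon \<rho> \<zeta>))"
        by (intro mult_left_mono C) auto
      then show "norm (f \<zeta> * kernel_term \<rho> w \<zeta>) \<le> norm (C * (cmod (f \<zeta>) * cmod (mon \<rho> \<zeta>)))"
        using C(1) by (simp add: norm_mult mult_ac)
    qed
  qed
qed

lemma holomorphic_pullback_slice:
  fixes f :: "complex^'n \<Rightarrow> complex"
  assumes f: "\<And>z. z \<in> \<Omega> \<Longrightarrow> holo_at f z" and x: "x \<in> PiE UNIV (\<lambda>_. ball 0 1 - {0})"
  shows "(\<lambda>t. f (v\<Phi> (x(i := t))) * jac (x(i := t))) holomorphic_on ball 0 1 - {0}"
proof (rule holomorphic_on_mult)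
  have jac: "jac (x(i := t)) = t ^ (\<kappa> i - 1) * (\<Prod>j\<in>UNIV-{i}. x j ^ (\<kappa> j - 1))" for t
    unfolding jac_def by (subst prod.remove[of UNIV i]) auto
  show "(\<lambda>t. jac (x(i := t))) holomorphic_on ball 0 1 - {0}" unfolding jac by (intro holomorphic_intros)
  have \<Phi>: "\<Phi> (x(i := t)) k = t ^ A k i * (\<Prod>j\<in>UNIV-{i}. x j ^ A k j)" for t k
    unfolding \<Phi>_def by (subst prod.remove[of UNIV i]) auto
  show "(\<lambda>t. f (v\<Phi> (x(i := t)))) holomorphic_on ball 0 1 - {0}"
  proof (rule holomorphic_onI, rule field_differentiable_at_within)
    fix t :: complex assume t: "t \<in> ball 0 1 - {0}"
    have "v\<Phi> (x(i := t)) \<in> \<Omega>"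
      by (subst \<Phi>_mem_\<Omega>) (use t x in \<open>auto simp: PiE_iff\<close>)
    then have h: "holo_at f (\<chi> k. \<Phi> (x(i := t)) k)" by (rule f)
    have "\<exists>d. \<forall>k. ((\<lambda>t. \<Phi> (x(i := t)) k) has_field_derivative d k) (at t)"
    proof (intro choice allI)
      fix k
      have "(\<lambda>t. \<Phi> (x(i := t)) k) field_differentiable at t"
        unfolding \<Phi> by (intro derivative_intros)
      then show "\<exists>d. ((\<lambda>t. \<Phi> (x(i := t)) k) has_field_derivative d) (at t)"
        by (simp add: field_differentiable_def)
    qed
    then obtain d where "\<And>k. ((\<lambda>t. \<Phi> (x(i := t)) k) has_field_derivative d k) (at t)" by blast
    then show "(\<lambda>t. f (v\<Phi> (x(i := t)))) field_differentiable at t"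
      by (rule holo_at_slice[of f "\<lambda>k t. \<Phi> (x(i := t)) k", OF h])
  qed
qed

text \<open>Pull \<open>f\<close> back to \<open>F = (f \<circ> \<Phi>) jac\<close>, reproduce \<open>F\<close> by the polydisc kernel, split this kernel into residue
  classes and discard those that integrate to zero. The remaining classes are pullbacks of the terms
  of \<open>kernel_sum\<close>, up to the factor \<open>jac x cnj (jac y)\<close>, in which \<open>jac x\<close> cancels and \<open>cnj (jac y)\<close> completes the density of
  the measure.\<close>

lemma reproducing_AE:
  fixes f :: "complex^'n \<Rightarrow> complex"
  assumes f [measurable]: "f \<in> borel_measurable borel" and f2: "(\<integral>\<^sup>+z. ennreal ((cmod (f z))\<^sup>2) \<partial>M\<Omega>) < \<infinity>"
    and holo: "\<And>z. z \<in> \<Omega> \<Longrightarrow> holo_at f z"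
  shows "AE w in M\<Omega>. of_real (vol_const * pi ^ CARD('n)) * f w = (\<integral>\<zeta>. f \<zeta> * kernel_sum w \<zeta> \<partial>M\<Omega>)"
proof (rule AE_push)
  interpret sigma_finite_measure M\<Omega> by (rule sigma_finite_lborel_on[OF borel_\<Omega>])
  have "(\<lambda>(w, \<zeta>). f \<zeta> * kernel_sum w \<zeta>) \<in> borel_measurable (borel \<Otimes>\<^sub>M borel)" by measurable
  then have "(\<lambda>(w, \<zeta>). f \<zeta> * kernel_sum w \<zeta>) \<in> borel_measurable (borel \<Otimes>\<^sub>M M\<Omega>)"
    by (simp cong: measurable_cong_sets sets_pair_measure_cong)
  from borel_measurable_lebesgue_integral[OF this]
  have [measurable]: "(\<lambda>w. \<integral>\<zeta>. f \<zeta> * kernel_sum w \<zeta> \<partial>M\<Omega>) \<in> borel_measurable borel" .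
  show "Measurable.pred borel (\<lambda>w. of_real (vol_const * pi ^ CARD('n)) * f w = (\<integral>\<zeta>. f \<zeta> * kernel_sum w \<zeta> \<partial>M\<Omega>))" by measurable
  let ?F = "\<lambda>x. f (v\<Phi> x) * jac x"
  have Fm [measurable]: "?F \<in> borel_measurable D" by measurable
  have "(\<integral>\<^sup>+z. ennreal ((cmod (f z))\<^sup>2) \<partial>M\<Omega>) = ennreal vol_const * (\<integral>\<^sup>+x. ennreal ((cmod (jac x))\<^sup>2) * ennreal ((cmod (f (v\<Phi> x)))\<^sup>2) \<partial>D)"
    by (rule nn_integral_pull) measurable
  also have "(\<integral>\<^sup>+x. ennreal ((cmod (jac x))\<^sup>2) * ennreal ((cmod (f (v\<Phi> x)))\<^sup>2) \<partial>D) = (\<integral>\<^sup>+x. ennreal ((cmod (?F x))\<^sup>2) \<partial>D)"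
    by (intro nn_integral_cong) (simp add: norm_mult power_mult_distrib mult.commute flip: ennreal_mult)
  finally have F2: "(\<integral>\<^sup>+x. ennreal ((cmod (?F x))\<^sup>2) \<partial>D) < \<infinity>"
    using f2 vol_const(1) by (auto simp: ennreal_mult_less_top)
  have Fi: "integrable D ?F" by (rule integrable_of_square_integrable[OF finite_measure_polydisc Fm F2]) simp
  have "AE x in D. (\<integral>y. ?F y * polydisc_kernel UNIV x y \<partial>D) = of_real pi ^ CARD('n) * ?F x"
    by (rule polydisc_reproducing_AE[OF _ Fm F2 holomorphic_pullback_slice[OF holo]]) auto
  then show "AE x in D. of_real (vol_const * pi ^ CARD('n)) * f (v\<Phi> x) = (\<integral>\<zeta>. f \<zeta> * kernel_sum (v\<Phi> x) \<zeta> \<partial>M\<Omega>)"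
    using AE_D
  proof eventually_elim
    fix x assume rep: "(\<integral>y. ?F y * polydisc_kernel UNIV x y \<partial>D) = of_real pi ^ CARD('n) * ?F x"
      and x: "(\<forall>i. x i \<noteq> 0) \<and> (\<forall>i. cmod (x i) < 1)"
    let ?P = "PiE (UNIV :: 'n set) (\<lambda>i. {1..e i})"
    have finP: "finite ?P" by (intro finite_PiE) auto
    have x\<Omega>: "v\<Phi> x \<in> \<Omega>" using \<Phi>_mem_\<Omega> x by blast
    have \<psi>m: "\<psi>prod s x \<in> borel_measurable D" for s
      unfolding \<psi>prod_def[abs_def] by (intro borel_measurable_prod measurable_compose[OF _ measurable_\<psi>]) measurable
    have I\<rho>: "(\<integral>y. ?F y * \<psi>prod (snat \<rho>) x y \<partial>D) = jac x * (\<integral>y. (cmod (jac y))\<^sup>2 *\<^sub>R (f (v\<Phi> y) * kernel_term \<rho> (v\<Phi> x) (v\<Phi> y)) \<partial>D)"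
      if \<rho>: "\<rho> \<in> exps" for \<rho>
    proof -
      have km: "(\<lambda>y. kernel_term \<rho> (v\<Phi> x) (v\<Phi> y)) \<in> borel_measurable D"
        by (rule measurable_compose[OF measurable_v\<Phi> measurable_kernel_term])
      have "(\<integral>y. ?F y * \<psi>prod (snat \<rho>) x y \<partial>D) = (\<integral>y. jac x * ((cmod (jac y))\<^sup>2 *\<^sub>R (f (v\<Phi> y) * kernel_term \<rho> (v\<Phi> x) (v\<Phi> y))) \<partial>D)"
      proof (rule integral_cong_AE)
        show "AE y in D. ?F y * \<psi>prod (snat \<rho>) x y = jac x * ((cmod (jac y))\<^sup>2 *\<^sub>R (f (v\<Phi> y) * kernel_term \<rho> (v\<Phi> x) (v\<Phi> y)))"
          using AE_D
        proof eventually_elim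
          fix y :: "'n \<Rightarrow> complex" assume y: "(\<forall>i. y i \<noteq> 0) \<and> (\<forall>i. cmod (y i) < 1)"
          have k: "\<psi>prod (snat \<rho>) x y = kernel_term \<rho> (v\<Phi> x) (v\<Phi> y) * (jac x * cnj (jac y))"
            unfolding \<psi>prod_def by (rule kernel_term_\<Phi>[symmetric]) (use x y \<rho> in auto)
          have n: "of_real ((cmod (jac y))\<^sup>2) = jac y * cnj (jac y)" by (rule complex_norm_square)
          show "?F y * \<psi>prod (snat \<rho>) x y = jac x * ((cmod (jac y))\<^sup>2 *\<^sub>R (f (v\<Phi> y) * kernel_term \<rho> (v\<Phi> x) (v\<Phi> y)))"
            unfolding k scaleR_conv_of_real n by (simp only: mult_ac)
        qed
      qed (use km \<psi>m in measurable)
      also have "\<dots> = jac x * (\<integral>y. (cmod (jac y))\<^sup>2 *\<^sub>R (f (v\<Phi> y) * kernel_term \<rho> (v\<Phi> x) (v\<Phi> y)) \<partial>D)"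
        by (rule integral_mult_right_zero)
      finally show ?thesis .
    qed
    have "of_real pi ^ CARD('n) * ?F x = (\<integral>y. (\<Sum>s\<in>?P. ?F y * \<psi>prod s x y) \<partial>D)"
      unfolding rep[symmetric]
    proof (rule integral_cong_AE)
      have "polydisc_kernel UNIV x \<in> borel_measurable D"
        using measurable_Pair2[OF measurable_polydisc_kernel, of x UNIV] by (simp add: space_PiM)
      then show "(\<lambda>y. ?F y * polydisc_kernel UNIV x y) \<in> borel_measurable D" by measurable
      show "(\<lambda>y. \<Sum>s\<in>?P. ?F y * \<psi>prod s x y) \<in> borel_measurable D" using \<psi>m by measurable
      show "AE y in D. ?F y * polydisc_kernel UNIV x y = (\<Sum>s\<in>?P. ?F y * \<psi>prod s x y)"
        using AE_D by eventually_elim (use x in \<open>simp add: polydisc_kernel_eq sum_distrib_left\<close>)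
    qed
    also have "\<dots> = (\<Sum>s\<in>?P. (\<integral>y. ?F y * \<psi>prod s x y \<partial>D))"
      by (rule Bochner_Integration.integral_sum) (use integrable_\<psi>prod[OF Fi] x in auto)
    also have "\<dots> = (\<Sum>s\<in>snat ` exps. (\<integral>y. ?F y * \<psi>prod s x y \<partial>D))"
      by (rule sum.mono_neutral_right[OF finP snat_image]) (use off_lattice_vanish[OF f] in auto)
    also have "\<dots> = (\<Sum>\<rho>\<in>exps. (\<integral>y. ?F y * \<psi>prod (snat \<rho>) x y \<partial>D))"
      by (simp add: sum.reindex[OF inj_snat])
    also have "\<dots> = jac x * (\<Sum>\<rho>\<in>exps. (\<integral>y. (cmod (jac y))\<^sup>2 *\<^sub>R (f (v\<Phi> y) * kernel_term \<rho> (v\<Phi> x) (v\<Phi> y)) \<partial>D))"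
      by (simp add: I\<rho> sum_distrib_left)
    finally have main: "of_real pi ^ CARD('n) * f (v\<Phi> x) = (\<Sum>\<rho>\<in>exps. (\<integral>y. (cmod (jac y))\<^sup>2 *\<^sub>R (f (v\<Phi> y) * kernel_term \<rho> (v\<Phi> x) (v\<Phi> y)) \<partial>D))"
      using jac_nonzero[of x] x by simp
    have "(\<integral>\<zeta>. f \<zeta> * kernel_sum (v\<Phi> x) \<zeta> \<partial>M\<Omega>) = (\<Sum>\<rho>\<in>exps. (\<integral>\<zeta>. f \<zeta> * kernel_term \<rho> (v\<Phi> x) \<zeta> \<partial>M\<Omega>))"
      unfolding kernel_sum_def sum_distrib_left
      by (rule Bochner_Integration.integral_sum) (rule integrable_mult_kernel_term[OF f f2 _ x\<Omega>])
    also have "\<dots> = (\<Sum>\<rho>\<in>exps. vol_const *\<^sub>R (\<integral>y. (cmod (jac y))\<^sup>2 *\<^sub>R (f (v\<Phi> y) * kernel_term \<rho> (v\<Phi> x) (v\<Phi> y)) \<partial>D))"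
      by (intro sum.cong refl integral_pull borel_measurable_times f measurable_kernel_term)
    also have "\<dots> = of_real vol_const * (of_real pi ^ CARD('n) * f (v\<Phi> x))"
      unfolding main by (simp add: scaleR_conv_of_real sum_distrib_left)
    finally show "of_real (vol_const * pi ^ CARD('n)) * f (v\<Phi> x) = (\<integral>\<zeta>. f \<zeta> * kernel_sum (v\<Phi> x) \<zeta> \<partial>M\<Omega>)"
      by (simp add: mult.assoc)
  qed
qed

text \<open>Both sides are continuous in \<open>w\<close> and agree almost everywhere.\<close>

lemma reproducing:
  fixes f :: "complex^'n \<Rightarrow> complex"
  assumes f: "f \<in> borel_measurable borel" and f2: "(\<integral>\<^sup>+z. ennreal ((cmod (f z))\<^sup>2) \<partial>M\<Omega>) < \<infinity>"
    and holo: "\<And>z. z \<in> \<Omega> \<Longrightarrow> holo_at f z" and w: "w \<in> \<Omega>"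
  shows "of_real (vol_const * pi ^ CARD('n)) * f w = (\<integral>\<zeta>. f \<zeta> * kernel_sum w \<zeta> \<partial>M\<Omega>)"
proof -
  let ?h = "\<lambda>w. of_real (vol_const * pi ^ CARD('n)) * f w - (\<integral>\<zeta>. f \<zeta> * kernel_sum w \<zeta> \<partial>M\<Omega>)"
  have "continuous_on \<Omega> f" by (intro continuous_at_imp_continuous_on ballI holo_at_continuous holo)
  then have "continuous_on \<Omega> ?h"
    by (intro continuous_on_diff continuous_on_mult continuous_on_const continuous_on_kernel_sum_integral[OF f f2])
  moreover have "AE w in M\<Omega>. ?h w = 0"
    by (rule AE_mp[OF reproducing_AE[OF f f2 holo]]) (simp_all add: AE_I2)
  ultimately have "?h w = 0" by (rule continuous_eq_of_AE_eq[OF open_\<Omega> _ _ w])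
  then show ?thesis by simp
qed

section \<open>The Bergman kernel of the monomial polyhedron\<close>

definition bergman_ker :: "complex^'n \<Rightarrow> complex^'n \<Rightarrow> complex" where
  "bergman_ker z w = (if z \<in> \<Omega> \<and> w \<in> \<Omega> then kernel_sum z w / of_real (vol_const * pi ^ CARD('n)) else 0)"

lemma measurable_bergman_ker: "case_prod bergman_ker \<in> borel_measurable (borel \<Otimes>\<^sub>M borel)"
proof -
  have "(\<lambda>(z, w). if z \<in> \<Omega> \<and> w \<in> \<Omega> then kernel_sum z w / of_real (vol_const * pi ^ CARD('n)) else 0) \<in> borel_measurable (borel \<Otimes>\<^sub>M borel)"
    by measurable
  then show ?thesis by (simp add: bergman_ker_def[abs_def])
qed

lemma bergman_ker_hermitian: "bergman_ker z w = cnj (bergman_ker w z)"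
  using kernel_sum_hermitian[of z w] by (auto simp: bergman_ker_def)

lemma measurable_bergman_ker2: "bergman_ker w \<in> borel_measurable borel"
  unfolding bergman_ker_def[abs_def] by measurable

lemma measurable_bergman_ker1: "(\<lambda>z. bergman_ker z w) \<in> borel_measurable borel"
  unfolding bergman_ker_hermitian[of _ w] using measurable_bergman_ker2 by simp

lemma bergman_ker_in_bergman_space:
  assumes w: "w \<in> \<Omega>" shows "(\<lambda>z. bergman_ker z w) \<in> bergman_space \<Omega>"
  unfolding bergman_space_def Lp_space_def
proof (intro CollectI conjI)
  let ?c = "vol_const * pi ^ CARD('n)"
  note [measurable] = measurable_bergman_ker1
  show "(\<lambda>z. bergman_ker z w) \<in> borel_measurable (lebesgue_on \<Omega>)" by (rule borel_measurable_lebesgue_on[OF borel_\<Omega> measurable_bergman_ker1])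
  show "integrable (lebesgue_on \<Omega>) (\<lambda>z. cmod (bergman_ker z w) powr 2)"
    unfolding integrable_iff_bounded
  proof
    show "(\<lambda>z. cmod (bergman_ker z w) powr 2) \<in> borel_measurable (lebesgue_on \<Omega>)"
      by (rule borel_measurable_lebesgue_on[OF borel_\<Omega>]) measurable
    have "(\<integral>\<^sup>+z. ennreal (norm (cmod (bergman_ker z w) powr 2)) \<partial>lebesgue_on \<Omega>) = (\<integral>\<^sup>+z. ennreal (norm (cmod (bergman_ker z w) powr 2)) \<partial>M\<Omega>)"
      by (rule nn_integral_lebesgue_on[OF borel_\<Omega>]) measurable
    also have "\<dots> \<le> (\<integral>\<^sup>+z. ennreal (1 / ?c\<^sup>2) * ennreal ((cmod (kernel_sum w z))\<^sup>2) \<partial>M\<Omega>)"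
    proof (rule nn_integral_mono)
      fix z
      have "(cmod (bergman_ker z w))\<^sup>2 \<le> 1 / ?c\<^sup>2 * (cmod (kernel_sum w z))\<^sup>2"
        using kernel_sum_hermitian[of z w] by (simp add: bergman_ker_def norm_divide norm_mult norm_power power_divide power_mult_distrib)
      then show "ennreal (norm (cmod (bergman_ker z w) powr 2)) \<le> ennreal (1 / ?c\<^sup>2) * ennreal ((cmod (kernel_sum w z))\<^sup>2)"
        by (simp only: ennreal_mult[symmetric] zero_le_divide_1_iff zero_le_power2) (simp add: ennreal_leI)
    qed
    also have "\<dots> = ennreal (1 / ?c\<^sup>2) * (\<integral>\<^sup>+z. ennreal ((cmod (kernel_sum w z))\<^sup>2) \<partial>M\<Omega>)"
      by (rule nn_integral_cmult) measurable
    also have "\<dots> < \<infinity>" using kernel_sum_L2[OF w] by (simp add: ennreal_mult_less_top)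
    finally show "(\<integral>\<^sup>+z. ennreal (norm (cmod (bergman_ker z w) powr 2)) \<partial>lebesgue_on \<Omega>) < \<infinity>" .
  qed
  show "holomorphic_several (\<lambda>z. bergman_ker z w) \<Omega>"
    unfolding holomorphic_several_iff
  proof
    fix z assume z: "z \<in> \<Omega>"
    have "holo_at (\<lambda>z. kernel_sum z w * (1 / of_real ?c)) z" by (intro holo_at_mult holo_at_const holo_at_kernel_sum z w)
    then show "holo_at (\<lambda>z. bergman_ker z w) z"
      by (rule holo_at_transform[OF _ open_\<Omega> z]) (simp add: bergman_ker_def w)
  qed
qed

lemma bergman_ker_reproducing:
  assumes f: "f \<in> bergman_space \<Omega>" and w: "w \<in> \<Omega>"
  shows "f w = (\<integral>z. f z * cnj (bergman_ker z w) \<partial>lebesgue_on \<Omega>)"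
proof -
  let ?c = "complex_of_real (vol_const * pi ^ CARD('n))"
  have c: "?c \<noteq> 0" using vol_const(1) by simp
  \<comment> \<open>extended by zero, \<open>f\<close> is Borel measurable on the whole space\<close>
  define f' where "f' z = indicator \<Omega> z *\<^sub>R f z" for z
  have holo: "holo_at f z" if "z \<in> \<Omega>" for z using f that by (simp add: bergman_space_def holomorphic_several_iff)
  have int: "integrable (lebesgue_on \<Omega>) (\<lambda>z. cmod (f z) powr 2)" using f by (simp add: bergman_space_def Lp_space_def)
  have "continuous_on \<Omega> f" by (intro continuous_at_imp_continuous_on ballI holo_at_continuous holo)
  then have f'm [measurable]: "f' \<in> borel_measurable borel"
    unfolding f'_def[abs_def] by (rule borel_measurable_continuous_on_indicator[OF borel_\<Omega>])
  have holo': "holo_at f' z" if "z \<in> \<Omega>" for z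
    by (rule holo_at_transform[OF holo[OF that] open_\<Omega> that]) (simp add: f'_def)
  have "(\<integral>\<^sup>+z. ennreal ((cmod (f' z))\<^sup>2) \<partial>M\<Omega>) = (\<integral>\<^sup>+z. ennreal ((cmod (f' z))\<^sup>2) \<partial>lebesgue_on \<Omega>)"
    by (rule nn_integral_lebesgue_on[OF borel_\<Omega>, symmetric]) measurable
  also have "\<dots> = (\<integral>\<^sup>+z. ennreal (norm (cmod (f z) powr 2)) \<partial>lebesgue_on \<Omega>)"
    by (rule nn_integral_cong) (simp add: f'_def)
  also have "\<dots> < \<infinity>" using int unfolding integrable_iff_bounded by blast
  finally have f2: "(\<integral>\<^sup>+z. ennreal ((cmod (f' z))\<^sup>2) \<partial>M\<Omega>) < \<infinity>" .
  have m: "(\<lambda>z. f' z * cnj (bergman_ker z w)) \<in> borel_measurable borel" using measurable_bergman_ker1[of w] by measurable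
  have "(\<integral>z. f z * cnj (bergman_ker z w) \<partial>lebesgue_on \<Omega>) = (\<integral>z. f' z * cnj (bergman_ker z w) \<partial>lebesgue_on \<Omega>)"
    by (rule Bochner_Integration.integral_cong) (simp_all add: f'_def)
  also have "\<dots> = (\<integral>z. f' z * cnj (bergman_ker z w) \<partial>M\<Omega>)"
    by (rule integral_lebesgue_on_lborel_on[OF borel_\<Omega> m])
  also have "\<dots> = (\<integral>z. (f' z * kernel_sum w z) * (1 / ?c) \<partial>M\<Omega>)"
  proof (rule integral_cong_AE)
    show "(\<lambda>z. f' z * cnj (bergman_ker z w)) \<in> borel_measurable M\<Omega>" using m by simp
    show "AE z in M\<Omega>. f' z * cnj (bergman_ker z w) = (f' z * kernel_sum w z) * (1 / ?c)"
      using AE_lborel_on_mem[OF borel_\<Omega>]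
      by eventually_elim (use kernel_sum_hermitian[of w] w in \<open>simp add: bergman_ker_def\<close>)
  qed measurable
  also have "\<dots> = (\<integral>z. f' z * kernel_sum w z \<partial>M\<Omega>) * (1 / ?c)" by (rule integral_mult_left_zero)
  also have "(\<integral>z. f' z * kernel_sum w z \<partial>M\<Omega>) = ?c * f' w" by (rule reproducing[OF f'm f2 holo' w, symmetric])
  also have "?c * f' w * (1 / ?c) = f' w" using c by (metis mult.commute mult.right_neutral nonzero_mult_div_cancel_left times_divide_eq_right)
  finally show ?thesis using w by (simp add: f'_def)
qed

lemma is_bergman_kernel_bergman_ker: "is_bergman_kernel \<Omega> bergman_ker"
  unfolding is_bergman_kernel_def
  using bergman_ker_in_bergman_space bergman_ker_reproducing by (auto simp: bergman_ker_def)

end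

text \<open>Reproduce \<open>K(\<cdot>, w)\<close> by \<open>L\<close> and \<open>L(\<cdot>, z)\<close> by \<open>K\<close>: the two integrals are conjugate to each other.\<close>

lemma is_bergman_kernel_conjugate:
  assumes K: "is_bergman_kernel \<Omega> K" and L: "is_bergman_kernel \<Omega> L" and zw: "z \<in> \<Omega>" "w \<in> \<Omega>"
  shows "K z w = cnj (L w z)"
proof -
  have "f v = (\<integral>u. f u * cnj (M u v) \<partial>lebesgue_on \<Omega>)" if "is_bergman_kernel \<Omega> M" "f \<in> bergman_space \<Omega>" "v \<in> \<Omega>" for f M v
    using that unfolding is_bergman_kernel_def by (elim conjE) (drule (1) bspec)+
  note rep = this
  have mem: "(\<lambda>z. M z v) \<in> bergman_space \<Omega>" if "is_bergman_kernel \<Omega> M" "v \<in> \<Omega>" for M v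
    using that unfolding is_bergman_kernel_def by (elim conjE) (drule (1) bspec)
  have "K z w = (\<integral>u. K u w * cnj (L u z) \<partial>lebesgue_on \<Omega>)"
    by (rule rep[OF L mem[OF K zw(2)] zw(1)])
  moreover have "L w z = (\<integral>u. L u z * cnj (K u w) \<partial>lebesgue_on \<Omega>)"
    by (rule rep[OF K mem[OF L zw(1)] zw(2)])
  then have "cnj (L w z) = (\<integral>u. cnj (L u z * cnj (K u w)) \<partial>lebesgue_on \<Omega>)" by (simp add: Bochner_Integration.integral_cnj del: complex_cnj_mult)
  ultimately show ?thesis by (simp add: mult.commute)
qed

lemma bergman_kernel_eqI:
  assumes K: "is_bergman_kernel \<Omega> K" shows "bergman_kernel \<Omega> = K"
  unfolding bergman_kernel_def
proof (rule the_equality[of "is_bergman_kernel \<Omega>", OF K], intro ext)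
  fix L z w assume L: "is_bergman_kernel \<Omega> L"
  show "L z w = K z w"
  proof (cases "z \<in> \<Omega> \<and> w \<in> \<Omega>")
    case True
    then show ?thesis using is_bergman_kernel_conjugate[OF L K, of z w] is_bergman_kernel_conjugate[OF K K, of z w] by simp
  next
    case False
    then have "(z, w) \<notin> \<Omega> \<times> \<Omega>" by auto
    then show ?thesis using K L unfolding is_bergman_kernel_def by metis
  qed
qed

lemma (in monomial_domain) bergman_kernel_\<Omega>: "bergman_kernel \<Omega> = bergman_ker"
  by (rule bergman_kernel_eqI[OF is_bergman_kernel_bergman_ker])

section \<open>From positive operators to partial operators\<close>

context
  fixes \<Omega> :: "'a::euclidean_space set" and k :: "'a \<Rightarrow> 'a \<Rightarrow> complex" and kk :: "'a \<Rightarrow> 'a \<Rightarrow> ennreal"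
  assumes \<Omega>: "\<Omega> \<in> sets borel" and k: "case_prod k \<in> borel_measurable (borel \<Otimes>\<^sub>M borel)"
    and kk: "\<And>x y. kk x y = ennreal (cmod (k x y))"
begin

private lemma k' [measurable]: "case_prod k \<in> borel_measurable (lborel_on \<Omega> \<Otimes>\<^sub>M lborel_on \<Omega>)"
  using k by (simp cong: measurable_cong_sets sets_pair_measure_cong)

private lemma kx [measurable]: "k x \<in> borel_measurable borel"
  using measurable_Pair2[OF k, of x] by simp

private lemma kk' [measurable]: "case_prod kk \<in> borel_measurable (lborel_on \<Omega> \<Otimes>\<^sub>M lborel_on \<Omega>)"
proof -
  have "(\<lambda>z. ennreal (cmod (case_prod k z))) \<in> borel_measurable (lborel_on \<Omega> \<Otimes>\<^sub>M lborel_on \<Omega>)" by measurable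
  then show ?thesis by (simp add: kk split_beta')
qed

private abbreviation P :: "('a \<Rightarrow> complex) \<Rightarrow> 'a \<Rightarrow> ennreal" where
  "P f \<equiv> pos_op (lborel_on \<Omega>) kk (\<lambda>y. ennreal (cmod (f y)))"

text \<open>The operator only sees a Borel representative of its argument, and it is defined at \<open>x\<close> exactly where the
  positive operator with kernel \<open>|k|\<close> is finite. Hence bounds for the positive operator give
  existence almost everywhere and the norm estimate at once.\<close>

lemma kernel_operator_representative:
  assumes f: "f \<in> borel_measurable (lebesgue_on \<Omega>)" and f' [measurable]: "f' \<in> borel_measurable borel"
    and eq: "AE z in lebesgue_on \<Omega>. f z = f' z"
  shows "kernel_operator (lebesgue_on \<Omega>) k f x = (if P f' x < \<infinity> then Some (\<integral>y. k x y * f' y \<partial>lborel_on \<Omega>) else None)"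
proof -
  let ?L = "lebesgue_on \<Omega>"
  have m: "(\<lambda>y. k x y * f' y) \<in> borel_measurable borel" by measurable
  have m': "(\<lambda>y. k x y * f' y) \<in> borel_measurable ?L" by (rule borel_measurable_lebesgue_on[OF \<Omega> m])
  have "k x \<in> borel_measurable ?L" by (rule borel_measurable_lebesgue_on[OF \<Omega> kx])
  then have m2: "(\<lambda>y. k x y * f y) \<in> borel_measurable ?L" using f by (rule borel_measurable_times)
  have ae: "AE y in ?L. k x y * f y = k x y * f' y" using eq by eventually_elim simp
  have "integrable ?L (\<lambda>y. k x y * f y) \<longleftrightarrow> integrable ?L (\<lambda>y. k x y * f' y)"
    by (rule integrable_cong_AE[OF m2 m' ae])
  also have "\<dots> \<longleftrightarrow> integrable (lborel_on \<Omega>) (\<lambda>y. k x y * f' y)" by (rule integrable_lebesgue_on[OF \<Omega> m])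
  also have "\<dots> \<longleftrightarrow> P f' x < \<infinity>"
    unfolding integrable_iff_bounded using m by (simp add: norm_mult ennreal_mult pos_op_def kk)
  finally have "integrable ?L (\<lambda>y. k x y * f y) \<longleftrightarrow> P f' x < \<infinity>" .
  moreover have "(\<integral>y. k x y * f y \<partial>?L) = (\<integral>y. k x y * f' y \<partial>lborel_on \<Omega>)"
    using integral_cong_AE[OF m2 m' ae] integral_lebesgue_on_lborel_on[OF \<Omega> m] by simp
  ultimately show ?thesis by (simp add: kernel_operator_def)
qed

text \<open>The output of the operator, including the unspecified value that \<open>the None\<close> takes where the integral diverges.\<close>

private definition h :: "('a \<Rightarrow> complex) \<Rightarrow> 'a \<Rightarrow> complex" where
  "h f' x = (if P f' x < \<infinity> then (\<integral>y. k x y * f' y \<partial>lborel_on \<Omega>) else the None)"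

private lemma h:
  assumes "f \<in> borel_measurable (lebesgue_on \<Omega>)" "f' \<in> borel_measurable borel" "AE z in lebesgue_on \<Omega>. f z = f' z"
  shows "the (kernel_operator (lebesgue_on \<Omega>) k f x) = h f' x"
  unfolding kernel_operator_representative[OF assms] by (simp add: h_def)

private lemma P_measurable: "f' \<in> borel_measurable borel \<Longrightarrow> P f' \<in> borel_measurable borel"
  using pos_op_measurable[OF sigma_finite_lborel_on[OF \<Omega>] kk', of "\<lambda>y. ennreal (cmod (f' y))"]
  by simp

private lemma h_measurable:
  assumes [measurable]: "f' \<in> borel_measurable borel" shows "h f' \<in> borel_measurable borel"
proof -
  interpret sigma_finite_measure "lborel_on \<Omega>" by (rule sigma_finite_lborel_on[OF \<Omega>])
  note [measurable] = P_measurable[OF assms]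
  have "(\<lambda>(x, y). k x y * f' y) \<in> borel_measurable (lborel_on \<Omega> \<Otimes>\<^sub>M lborel_on \<Omega>)" by measurable
  from borel_measurable_lebesgue_integral[OF this]
  have [measurable]: "(\<lambda>x. \<integral>y. k x y * f' y \<partial>lborel_on \<Omega>) \<in> borel_measurable borel" by simp
  show ?thesis unfolding h_def[abs_def] by measurable
qed

private lemma h_le:
  assumes f': "f' \<in> borel_measurable borel" and fin: "P f' x < \<infinity>"
  shows "ennreal (cmod (h f' x)) \<le> P f' x"
proof -
  have "ennreal (cmod (\<integral>y. k x y * f' y \<partial>lborel_on \<Omega>)) \<le> (\<integral>\<^sup>+y. ennreal (norm (k x y * f' y)) \<partial>lborel_on \<Omega>)"
  proof (rule integral_norm_bound_ennreal)
    show "integrable (lborel_on \<Omega>) (\<lambda>y. k x y * f' y)"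
      unfolding integrable_iff_bounded using fin f' by (simp add: norm_mult ennreal_mult pos_op_def kk)
  qed
  also have "\<dots> = P f' x" by (simp add: norm_mult ennreal_mult pos_op_def kk)
  finally show ?thesis using fin by (simp add: h_def)
qed

private lemma Lp_representative:
  assumes f: "f \<in> Lp_space (lebesgue_on \<Omega>) p" and f' [measurable]: "f' \<in> borel_measurable borel"
    and eq: "AE z in lebesgue_on \<Omega>. f z = f' z"
  shows "(\<integral>\<^sup>+x. epow (ennreal (cmod (f' x))) p \<partial>lborel_on \<Omega>) = ennreal (\<integral>x. cmod (f x) powr p \<partial>lebesgue_on \<Omega>)"
proof -
  have m: "(\<lambda>x. ennreal (cmod (f' x) powr p)) \<in> borel_measurable borel" by measurable
  have "(\<integral>\<^sup>+x. epow (ennreal (cmod (f' x))) p \<partial>lborel_on \<Omega>) = (\<integral>\<^sup>+x. ennreal (cmod (f' x) powr p) \<partial>lborel_on \<Omega>)"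
    by (simp add: epow_ennreal)
  also have "\<dots> = (\<integral>\<^sup>+x. ennreal (cmod (f' x) powr p) \<partial>lebesgue_on \<Omega>)"
    by (rule nn_integral_lebesgue_on[OF \<Omega> m, symmetric])
  also have "\<dots> = (\<integral>\<^sup>+x. ennreal (cmod (f x) powr p) \<partial>lebesgue_on \<Omega>)"
    by (rule nn_integral_cong_AE, use eq in eventually_elim) simp
  also have "\<dots> = ennreal (\<integral>x. cmod (f x) powr p \<partial>lebesgue_on \<Omega>)"
    by (rule nn_integral_eq_integral) (use f in \<open>auto simp: Lp_space_def\<close>)
  finally show ?thesis .
qed

private lemma bounded_type:
  assumes p: "0 < p" and b: "pos_bounded_on G (lborel_on \<Omega>) kk p"
  shows "\<exists>C>0. \<forall>f f'. f \<in> Lp_space (lebesgue_on \<Omega>) p \<longrightarrow> f' \<in> borel_measurable borel \<longrightarrow>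
    (AE z in lebesgue_on \<Omega>. f z = f' z) \<longrightarrow> (\<lambda>y. ennreal (cmod (f' y))) \<in> G \<longrightarrow>
      (AE x in lebesgue_on \<Omega>. kernel_operator (lebesgue_on \<Omega>) k f x \<noteq> None) \<and>
      (\<lambda>x. the (kernel_operator (lebesgue_on \<Omega>) k f x)) \<in> Lp_space (lebesgue_on \<Omega>) p \<and>
      Lp_norm (lebesgue_on \<Omega>) p (\<lambda>x. the (kernel_operator (lebesgue_on \<Omega>) k f x)) \<le> C * Lp_norm (lebesgue_on \<Omega>) p f"
proof -
  let ?L = "lebesgue_on \<Omega>" and ?N = "lborel_on \<Omega>"
  obtain C where C: "C < \<infinity>" "\<And>g. g \<in> G \<Longrightarrow> g \<in> borel_measurable ?N \<Longrightarrow>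
      (\<integral>\<^sup>+x. epow (pos_op ?N kk g x) p \<partial>?N) \<le> C * (\<integral>\<^sup>+x. epow (g x) p \<partial>?N)"
    using b by (auto simp: pos_bounded_on_def)
  \<comment> \<open>one is added because the definitions ask for a positive constant\<close>
  define c where "c = enn2real C + 1"
  have c: "0 < c" "C \<le> ennreal c"
    using C(1) by (auto simp: c_def add_nonneg_pos ennreal_enn2real_if less_top intro!: order_trans[of C "ennreal (enn2real C)"] ennreal_leI)
  have "(AE x in ?L. kernel_operator ?L k f x \<noteq> None) \<and>
      (\<lambda>x. the (kernel_operator ?L k f x)) \<in> Lp_space ?L p \<and>
      Lp_norm ?L p (\<lambda>x. the (kernel_operator ?L k f x)) \<le> c powr (1 / p) * Lp_norm ?L p f"
    if f: "f \<in> Lp_space ?L p" and f' [measurable]: "f' \<in> borel_measurable borel" and eq: "AE z in ?L. f z = f' z"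
      and G: "(\<lambda>y. ennreal (cmod (f' y))) \<in> G" for f f'
  proof -
    let ?I = "\<integral>x. cmod (f x) powr p \<partial>?L"
    have I0: "0 \<le> ?I" by simp
    have fm: "f \<in> borel_measurable ?L" using f by (simp add: Lp_space_def)
    note rep = h[OF fm f' eq] and [measurable] = P_measurable[OF f'] h_measurable[OF f']
    have "(\<integral>\<^sup>+x. epow (P f' x) p \<partial>?N) \<le> C * (\<integral>\<^sup>+x. epow (ennreal (cmod (f' x))) p \<partial>?N)"
      by (rule C(2)[OF G]) simp
    also have "\<dots> \<le> ennreal c * ennreal ?I"
      unfolding Lp_representative[OF f f' eq] by (rule mult_right_mono[OF c(2)]) simp
    also have "\<dots> = ennreal (c * ?I)" using c(1) I0 by (simp add: ennreal_mult)
    finally have bd: "(\<integral>\<^sup>+x. epow (P f' x) p \<partial>?N) \<le> ennreal (c * ?I)" .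
    then have "(\<integral>\<^sup>+x. epow (P f' x) p \<partial>?N) \<noteq> \<infinity>" by (auto simp: top_unique)
    then have "AE x in ?N. epow (P f' x) p \<noteq> \<infinity>"
      by (intro nn_integral_PInf_AE) auto
    then have aeN: "AE x in ?N. P f' x < \<infinity>"
      by eventually_elim (metis epow_top(1) infinity_ennreal_def top.not_eq_extremum)
    have ae: "AE x in ?L. kernel_operator ?L k f x \<noteq> None"
      using aeN unfolding AE_lebesgue_on_iff[OF \<Omega>, symmetric]
      by eventually_elim (simp add: kernel_operator_representative[OF fm f' eq])
    have m: "(\<lambda>x. cmod (h f' x) powr p) \<in> borel_measurable borel" by measurable
    have "(\<integral>\<^sup>+x. ennreal (cmod (h f' x) powr p) \<partial>?L) = (\<integral>\<^sup>+x. ennreal (cmod (h f' x) powr p) \<partial>?N)"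
      by (rule nn_integral_lebesgue_on[OF \<Omega>]) measurable
    also have "\<dots> \<le> (\<integral>\<^sup>+x. epow (P f' x) p \<partial>?N)"
    proof (rule nn_integral_mono_AE, use aeN in eventually_elim)
      fix x assume "P f' x < \<infinity>"
      from epow_mono[OF h_le[OF f' this], of p] show "ennreal (cmod (h f' x) powr p) \<le> epow (P f' x) p"
        using p by (simp add: epow_ennreal)
    qed
    also note bd
    finally have hb: "(\<integral>\<^sup>+x. ennreal (cmod (h f' x) powr p) \<partial>?L) \<le> ennreal (c * ?I)" .
    have hi: "integrable ?L (\<lambda>x. cmod (h f' x) powr p)"
      unfolding integrable_iff_bounded using borel_measurable_lebesgue_on[OF \<Omega> m] hb
      by (auto intro: le_less_trans)
    have "ennreal (\<integral>x. cmod (h f' x) powr p \<partial>?L) \<le> ennreal (c * ?I)"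
      using hb by (subst nn_integral_eq_integral[OF hi, symmetric]) auto
    then have "(\<integral>x. cmod (h f' x) powr p \<partial>?L) \<le> c * ?I" using c(1) I0 by simp
    then have "(\<integral>x. cmod (h f' x) powr p \<partial>?L) powr (1 / p) \<le> (c * ?I) powr (1 / p)"
      using p by (intro powr_mono2) auto
    also have "\<dots> = c powr (1 / p) * ?I powr (1 / p)" using c(1) I0 by (simp add: powr_mult)
    finally show ?thesis
      using ae hi borel_measurable_lebesgue_on[OF \<Omega> h_measurable[OF f']] by (simp add: rep Lp_space_def Lp_norm_def)
  qed
  moreover have "0 < c powr (1 / p)" using c(1) by simp
  ultimately show ?thesis by (intro exI[of _ "c powr (1 / p)"]) blast
qed

lemma strong_type_kernel_operator:
  assumes p: "0 < p" and b: "pos_strong (lborel_on \<Omega>) kk p"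
  shows "strong_type (lebesgue_on \<Omega>) (kernel_operator (lebesgue_on \<Omega>) k) p"
proof -
  obtain C where C: "C > 0" "\<And>f f'. f \<in> Lp_space (lebesgue_on \<Omega>) p \<Longrightarrow> f' \<in> borel_measurable borel \<Longrightarrow>
    (AE z in lebesgue_on \<Omega>. f z = f' z) \<Longrightarrow>
      (AE x in lebesgue_on \<Omega>. kernel_operator (lebesgue_on \<Omega>) k f x \<noteq> None) \<and>
      (\<lambda>x. the (kernel_operator (lebesgue_on \<Omega>) k f x)) \<in> Lp_space (lebesgue_on \<Omega>) p \<and>
      Lp_norm (lebesgue_on \<Omega>) p (\<lambda>x. the (kernel_operator (lebesgue_on \<Omega>) k f x)) \<le> C * Lp_norm (lebesgue_on \<Omega>) p f"
    using bounded_type[OF p b] by blast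
  show ?thesis unfolding strong_type_def
  proof (intro exI[of _ C] conjI[OF C(1)] ballI)
    fix f assume f: "f \<in> Lp_space (lebesgue_on \<Omega>) p"
    then have "f \<in> borel_measurable (lebesgue_on \<Omega>)" by (simp add: Lp_space_def)
    then obtain f' where "f' \<in> borel_measurable borel" "AE z in lebesgue_on \<Omega>. f z = f' z"
      using lebesgue_on_borel_representative[OF \<Omega>] by blast
    from C(2)[OF f this] show "(AE x in lebesgue_on \<Omega>. kernel_operator (lebesgue_on \<Omega>) k f x \<noteq> None) \<and>
      (\<lambda>x. the (kernel_operator (lebesgue_on \<Omega>) k f x)) \<in> Lp_space (lebesgue_on \<Omega>) p \<and>
      Lp_norm (lebesgue_on \<Omega>) p (\<lambda>x. the (kernel_operator (lebesgue_on \<Omega>) k f x)) \<le> C * Lp_norm (lebesgue_on \<Omega>) p f" .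
  qed
qed

lemma restricted_type_kernel_operator:
  assumes p: "0 < p" and b: "pos_restricted (lborel_on \<Omega>) kk p"
  shows "restricted_type (lebesgue_on \<Omega>) (kernel_operator (lebesgue_on \<Omega>) k) p"
proof -
  obtain C where C: "C > 0" "\<And>f f'. f \<in> Lp_space (lebesgue_on \<Omega>) p \<Longrightarrow> f' \<in> borel_measurable borel \<Longrightarrow>
    (AE z in lebesgue_on \<Omega>. f z = f' z) \<Longrightarrow> (\<lambda>y. ennreal (cmod (f' y))) \<in> range indicator \<Longrightarrow>
      (AE x in lebesgue_on \<Omega>. kernel_operator (lebesgue_on \<Omega>) k f x \<noteq> None) \<and>
      (\<lambda>x. the (kernel_operator (lebesgue_on \<Omega>) k f x)) \<in> Lp_space (lebesgue_on \<Omega>) p \<and>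
      Lp_norm (lebesgue_on \<Omega>) p (\<lambda>x. the (kernel_operator (lebesgue_on \<Omega>) k f x)) \<le> C * Lp_norm (lebesgue_on \<Omega>) p f"
    using bounded_type[OF p b] by blast
  show ?thesis unfolding restricted_type_def
  proof (intro exI[of _ C] conjI[OF C(1)] ballI impI)
    fix E assume E: "E \<in> sets (lebesgue_on \<Omega>)" and fin: "emeasure (lebesgue_on \<Omega>) E < \<infinity>"
    have m: "(indicator E :: 'a \<Rightarrow> complex) \<in> borel_measurable (lebesgue_on \<Omega>)" using E by simp
    have "(\<lambda>x. cmod (indicator E x) powr p) = (indicator E :: 'a \<Rightarrow> real)"
      using p by (auto simp: indicator_def)
    then have f: "indicator E \<in> Lp_space (lebesgue_on \<Omega>) p"
      using E fin m by (simp add: Lp_space_def)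
    obtain f0 :: "'a \<Rightarrow> complex" where f0 [measurable]: "f0 \<in> borel_measurable borel" and eq: "AE z in lebesgue_on \<Omega>. indicator E z = f0 z"
      using lebesgue_on_borel_representative[OF \<Omega> m] by blast
    let ?E = "{z. f0 z = 1}"
    have E': "?E \<in> sets borel" by measurable
    have 1: "(indicator ?E :: 'a \<Rightarrow> complex) \<in> borel_measurable borel" by (rule borel_measurable_indicator[OF E'])
    have 2: "AE z in lebesgue_on \<Omega>. (indicator E z :: complex) = indicator ?E z"
      using eq by eventually_elim (metis (mono_tags, lifting) indicator_simps mem_Collect_eq)
    have 3: "(\<lambda>y. ennreal (cmod (indicator ?E y))) \<in> range indicator"
      by (rule range_eqI[of _ _ ?E]) (auto simp: indicator_def)
    from C(2)[OF f 1 2 3] show "(AE x in lebesgue_on \<Omega>. kernel_operator (lebesgue_on \<Omega>) k (indicator E) x \<noteq> None) \<and>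
      (\<lambda>x. the (kernel_operator (lebesgue_on \<Omega>) k (indicator E) x)) \<in> Lp_space (lebesgue_on \<Omega>) p \<and>
      Lp_norm (lebesgue_on \<Omega>) p (\<lambda>x. the (kernel_operator (lebesgue_on \<Omega>) k (indicator E) x)) \<le> C * Lp_norm (lebesgue_on \<Omega>) p (indicator E)" .
  qed
qed

lemma weak_type_kernel_operator:
  assumes p: "0 < p" and b: "pos_weak (lborel_on \<Omega>) kk p"
  shows "weak_type (lebesgue_on \<Omega>) (kernel_operator (lebesgue_on \<Omega>) k) p"
proof -
  let ?L = "lebesgue_on \<Omega>" and ?N = "lborel_on \<Omega>"
  obtain C where C: "C < \<infinity>" "\<And>g t. g \<in> borel_measurable ?N \<Longrightarrow> t > 0 \<Longrightarrow>
      ennreal (t powr p) * emeasure ?N {x\<in>space ?N. ennreal t < pos_op ?N kk g x} \<le> C * (\<integral>\<^sup>+x. epow (g x) p \<partial>?N)"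
    using b unfolding pos_weak_def by blast
  define c where "c = enn2real C + 1"
  have c: "0 < c" "C \<le> ennreal c"
    using C(1) by (auto simp: c_def add_nonneg_pos ennreal_enn2real_if less_top intro!: order_trans[of C "ennreal (enn2real C)"] ennreal_leI)
  show ?thesis unfolding weak_type_def
  proof (intro exI[of _ "c powr (1 / p)"] conjI ballI allI impI)
    show "0 < c powr (1 / p)" using c(1) by simp
    fix f assume f: "f \<in> Lp_space ?L p"
    then have fm: "f \<in> borel_measurable ?L" by (simp add: Lp_space_def)
    then obtain f' where f' [measurable]: "f' \<in> borel_measurable borel" and eq: "AE z in ?L. f z = f' z"
      using lebesgue_on_borel_representative[OF \<Omega>] by blast
    note rep = h[OF fm f' eq] and [measurable] = P_measurable[OF f'] h_measurable[OF f']
    let ?I = "\<integral>x. cmod (f x) powr p \<partial>?L"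
    have I0: "0 \<le> ?I" by simp
    have bd: "ennreal (t powr p) * emeasure ?N {x. ennreal t < P f' x} \<le> ennreal (c * ?I)" if t: "t > 0" for t
    proof -
      have "ennreal (t powr p) * emeasure ?N {x\<in>space ?N. ennreal t < P f' x} \<le> C * (\<integral>\<^sup>+x. epow (ennreal (cmod (f' x))) p \<partial>?N)"
        by (rule C(2)[OF _ t]) simp
      also have "\<dots> \<le> ennreal c * ennreal ?I"
        unfolding Lp_representative[OF f f' eq] by (rule mult_right_mono[OF c(2)]) simp
      also have "\<dots> = ennreal (c * ?I)" using c(1) I0 by (simp add: ennreal_mult)
      finally show ?thesis by simp
    qed
    have level: "\<exists>m\<ge>0. emeasure ?N {x. ennreal t < P f' x} = ennreal m \<and> m \<le> c * ?I / t powr p" if t: "t > 0" for t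
    proof -
      have tp: "0 < t powr p" using t by simp
      have "ennreal (t powr p) * emeasure ?N {x. ennreal t < P f' x} < \<infinity>" using bd[OF t] by (auto intro: le_less_trans)
      then have "emeasure ?N {x. ennreal t < P f' x} \<noteq> \<infinity>" using tp by (auto simp: ennreal_mult_eq_top_iff)
      then obtain m where m: "0 \<le> m" "emeasure ?N {x. ennreal t < P f' x} = ennreal m" by (cases "emeasure ?N {x. ennreal t < P f' x}") auto
      have "ennreal (t powr p * m) \<le> ennreal (c * ?I)" using bd[OF t] m by (simp add: ennreal_mult)
      then have "t powr p * m \<le> c * ?I" using c(1) I0 by simp
      then have "m \<le> c * ?I / t powr p" using tp by (simp add: pos_le_divide_eq mult.commute)
      then show ?thesis using m by blast
    qed
    \<comment> \<open>the level sets at height \<open>t\<close> have measure at most \<open>c I / t^p\<close>, so the set where the operator diverges is null\<close>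
    have "emeasure ?N {x. P f' x = \<infinity>} = 0"
    proof (rule ccontr)
      assume n0: "emeasure ?N {x. P f' x = \<infinity>} \<noteq> 0"
      have sub: "emeasure ?N {x. P f' x = \<infinity>} \<le> emeasure ?N {x. ennreal t < P f' x}" for t
        by (rule emeasure_mono) auto
      obtain m1 where m1: "emeasure ?N {x. ennreal 1 < P f' x} = ennreal m1" using level[of 1] by auto
      then have "emeasure ?N {x. P f' x = \<infinity>} \<noteq> \<infinity>" using sub[of 1] by (auto simp: top_unique)
      then obtain n where n: "emeasure ?N {x. P f' x = \<infinity>} = ennreal n" "0 < n"
        using n0 by (cases "emeasure ?N {x. P f' x = \<infinity>}") (auto simp: less_le)
      define t where "t = ((c * ?I + 1) / n) powr (1 / p)"
      have ci: "0 \<le> c * ?I" using c(1) I0 by simp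
      have q: "0 < (c * ?I + 1) / n" using n(2) ci by simp
      have "t powr p = ((c * ?I + 1) / n) powr 1" unfolding t_def powr_powr using p by simp
      also have "\<dots> = (c * ?I + 1) / n" using q by (intro powr_one less_imp_le)
      finally have t: "t > 0" "t powr p = (c * ?I + 1) / n" using q by (simp_all only: t_def powr_gt_zero)
      obtain m where m: "0 \<le> m" "emeasure ?N {x. ennreal t < P f' x} = ennreal m" "m \<le> c * ?I / t powr p"
        using level[OF t(1)] by blast
      have "n \<le> m" using sub[of t] n m by simp
      also note m(3)
      also have "c * ?I / t powr p = n * ((c * ?I) / (c * ?I + 1))" unfolding t(2) by simp
      also have "\<dots> < n * 1" using n(2) ci by (intro mult_strict_left_mono) auto
      finally show False by simp
    qed
    moreover have "{x. P f' x = \<infinity>} \<in> sets ?N" by measurable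
    ultimately have aeN: "AE x in ?N. P f' x < \<infinity>"
      by (intro AE_I[of _ _ "{x. P f' x = \<infinity>}"]) (auto simp: not_less top_unique)
    show "AE x in ?L. kernel_operator ?L k f x \<noteq> None"
      using aeN unfolding AE_lebesgue_on_iff[OF \<Omega>, symmetric]
      by eventually_elim (simp add: kernel_operator_representative[OF fm f' eq])
    show "(\<lambda>x. the (kernel_operator ?L k f x)) \<in> borel_measurable ?L"
      unfolding rep by (rule borel_measurable_lebesgue_on[OF \<Omega> h_measurable[OF f']])
    fix y :: real assume y: "0 < y"
    let ?S = "{x. y < cmod (h f' x)}"
    have S [measurable]: "?S \<in> sets borel" by measurable
    have "emeasure ?L {x\<in>space ?L. y < cmod (h f' x)} = (\<integral>\<^sup>+x. indicator ?S x \<partial>?L)"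
    proof -
      have "{x\<in>space ?L. y < cmod (h f' x)} = ?S \<inter> space ?L" by auto
      moreover have "?S \<inter> space ?L \<in> sets ?L" using S by (auto simp: sets_restrict_space)
      ultimately show ?thesis by (simp only: nn_integral_indicator')
    qed
    also have "\<dots> = (\<integral>\<^sup>+x. indicator ?S x \<partial>?N)" by (rule nn_integral_lebesgue_on[OF \<Omega>]) measurable
    also have "\<dots> = emeasure ?N ?S" by simp
    also have "\<dots> \<le> emeasure ?N {x. ennreal y < P f' x}"
    proof (rule emeasure_mono_AE)
      show "AE x in ?N. x \<in> ?S \<longrightarrow> x \<in> {x. ennreal y < P f' x}"
        using aeN
      proof eventually_elim
        fix x assume "P f' x < \<infinity>"
        from h_le[OF f' this] show "x \<in> ?S \<longrightarrow> x \<in> {x. ennreal y < P f' x}"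
          using y by (auto intro: less_le_trans[of _ "ennreal (cmod (h f' x))"] simp: ennreal_less_iff)
      qed
    qed measurable
    also have "\<dots> \<le> ennreal (c * ?I / y powr p)" using level[OF y] by (auto intro: ennreal_leI)
    also have "c * ?I / y powr p = (c powr (1 / p) * Lp_norm ?L p f / y) powr p"
      using c(1) I0 y p by (simp add: Lp_norm_def powr_mult powr_divide powr_powr)
    finally show "emeasure ?L {x\<in>space ?L. y < cmod (the (kernel_operator ?L k f x))}
      \<le> ennreal ((c powr (1 / p) * Lp_norm ?L p f / y) powr p)" unfolding rep .
  qed
qed

end

section \<open>Positive Bergman operators on the monomial polyhedron\<close>

text \<open>Both exponents are monotone in \<open>\<kappa>\<close>, so the admissible range for the smaller value \<open>a\<close> contains the closed range
  for the larger value \<open>b\<close> in its interior.\<close>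

lemma exponent_below:
  fixes a b :: real
  assumes "1 \<le> a" "a < b" shows "2 * a / (a + 1) < 2 * b / (b + 1)"
  using assms by (simp add: divide_simps algebra_simps)

lemma exponent_above:
  fixes a b p :: real
  assumes "1 \<le> a" "a < b" "p \<le> 2 * b / (b - 1)" shows "p * (a - 1) < 2 * a"
proof -
  have "p * (a - 1) \<le> (2 * b / (b - 1)) * (a - 1)" using assms by (intro mult_right_mono) auto
  also have "\<dots> < 2 * a"
  proof -
    have "2 * b * (a - 1) < 2 * a * (b - 1)" using assms by (simp add: algebra_simps)
    then show ?thesis using assms by (simp add: pos_divide_less_eq)
  qed
  finally show ?thesis .
qed

context monomial_domain
begin

definition abs_ker :: "complex^'n \<Rightarrow> complex^'n \<Rightarrow> ennreal" where "abs_ker z w = ennreal (cmod (bergman_ker z w))"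

abbreviation factor :: "'n \<Rightarrow> complex \<Rightarrow> complex \<Rightarrow> ennreal" where "factor i \<equiv> model_kernel (\<kappa> i) (e i)"

text \<open>One is added to make the constant positive without checking that \<open>exps\<close> is nonempty.\<close>

definition dom_const :: real where "dom_const = real (card exps) * (\<Prod>i\<in>UNIV. real (e i)) / (vol_const * pi ^ CARD('n)) + 1"

lemma dom_const_pos: "0 < dom_const"
  unfolding dom_const_def using vol_const(1) by (intro add_nonneg_pos divide_nonneg_pos mult_nonneg_nonneg prod_nonneg) auto

lemma AE_wpoly: "AE x in wpoly. \<forall>i. x i \<noteq> 0 \<and> cmod (x i) < 1"
proof -
  have "AE x in wpoly. x i \<noteq> 0 \<and> cmod (x i) < 1" for i
    by (rule wdiscs.AE_PiM_coordinate[OF finite _ AE_wdisc]) simp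
  then show ?thesis by (subst AE_all_countable) auto
qed

lemma abs_ker_le:
  assumes x: "\<forall>i. x i \<noteq> 0 \<and> cmod (x i) < 1" and y: "\<forall>i. y i \<noteq> 0 \<and> cmod (y i) < 1"
  shows "abs_ker (v\<Phi> x) (v\<Phi> y) \<le> ennreal dom_const * prod_kernel UNIV factor x y"
proof -
  let ?p = "\<Prod>i\<in>UNIV. sing (\<kappa> i) (x i) * sing (\<kappa> i) (y i) * disc_kernel (e i) (x i) (y i)"
  let ?c = "vol_const * pi ^ CARD('n)"
  have c: "0 < ?c" using vol_const(1) by simp
  have p0: "0 \<le> ?p" by (intro prod_nonneg ballI mult_nonneg_nonneg less_imp_le[OF sing_pos] disc_kernel_nonneg)
  have k: "cmod (kernel_sum (v\<Phi> x) (v\<Phi> y)) \<le> real (card exps) * (\<Prod>i\<in>UNIV. real (e i)) * ?p"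
    by (rule kernel_sum_\<Phi>_le) (use x y in auto)
  have "cmod (bergman_ker (v\<Phi> x) (v\<Phi> y)) \<le> cmod (kernel_sum (v\<Phi> x) (v\<Phi> y)) / ?c"
    using c vol_const(1) by (simp add: bergman_ker_def norm_divide norm_mult norm_power)
  also have "\<dots> \<le> real (card exps) * (\<Prod>i\<in>UNIV. real (e i)) * ?p / ?c"
    using k c by (intro divide_right_mono) auto
  also have "\<dots> = (real (card exps) * (\<Prod>i\<in>UNIV. real (e i)) / ?c) * ?p" by simp
  also have "\<dots> \<le> dom_const * ?p" unfolding dom_const_def using p0 by (intro mult_right_mono) auto
  finally have "abs_ker (v\<Phi> x) (v\<Phi> y) \<le> ennreal (dom_const * ?p)" unfolding abs_ker_def by (rule ennreal_leI)
  also have "\<dots> = ennreal dom_const * ennreal ?p" using dom_const_pos p0 by (intro ennreal_mult) auto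
  also have "ennreal ?p = prod_kernel UNIV factor x y"
    unfolding prod_kernel_def model_kernel_def
    by (intro prod_ennreal[symmetric] mult_nonneg_nonneg less_imp_le[OF sing_pos] disc_kernel_nonneg)
  finally show ?thesis .
qed

lemma abs_ker_dominated: "AE x in wpoly. AE y in wpoly. abs_ker (v\<Phi> x) (v\<Phi> y) \<le> ennreal dom_const * prod_kernel UNIV factor x y"
  by (rule eventually_mono[OF AE_wpoly], rule eventually_mono[OF AE_wpoly]) (rule abs_ker_le)

lemma measurable_abs_ker: "case_prod abs_ker \<in> borel_measurable (M\<Omega> \<Otimes>\<^sub>M M\<Omega>)"
proof -
  have "(\<lambda>w::complex. ennreal (cmod w)) \<in> borel_measurable borel" by measurable
  from measurable_compose[OF measurable_bergman_ker this]
  have "(\<lambda>z. ennreal (cmod (case_prod bergman_ker z))) \<in> borel_measurable (borel \<Otimes>\<^sub>M borel)" .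
  moreover have "(\<lambda>z. ennreal (cmod (case_prod bergman_ker z))) = case_prod abs_ker" by (auto simp: abs_ker_def fun_eq_iff)
  moreover have "sets (M\<Omega> \<Otimes>\<^sub>M M\<Omega>) = sets (borel \<Otimes>\<^sub>M borel)" by (intro sets_pair_measure_cong sets_lborel_on)
  ultimately show ?thesis by (simp only: measurable_cong_sets[of "M\<Omega> \<Otimes>\<^sub>M M\<Omega>" "borel \<Otimes>\<^sub>M borel" borel borel])
qed

lemma measurable_factor: "case_prod (prod_kernel UNIV factor) \<in> borel_measurable (wpoly \<Otimes>\<^sub>M wpoly)"
  by (rule wdiscs.measurable_prod_kernel) auto

lemma sigma_finite_wpoly: "sigma_finite_measure wpoly"
  by (rule wdiscs.sigma_finite) simp

lemma v\<Phi>_wpoly_M\<Omega>: "v\<Phi> \<in> wpoly \<rightarrow>\<^sub>M M\<Omega>"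
  using measurable_v\<Phi>_wpoly by (simp cong: measurable_cong_sets)

lemma nn_integral_M\<Omega>_wpoly:
  "f \<in> borel_measurable M\<Omega> \<Longrightarrow> (\<integral>\<^sup>+z. f z \<partial>M\<Omega>) = ennreal vol_const * (\<integral>\<^sup>+x. f (v\<Phi> x) \<partial>wpoly)"
  by (rule vol_const(2)) (simp only: measurable_cong_sets[OF sets_lborel_on refl])

lemma pos_bounded_on_abs_ker:
  assumes p: "0 \<le> p" and G: "\<And>g. g \<in> G \<Longrightarrow> (\<lambda>x. g (v\<Phi> x)) \<in> G'"
    and b: "pos_bounded_on G' wpoly (prod_kernel UNIV factor) p"
  shows "pos_bounded_on G M\<Omega> abs_ker p"
  by (rule pos_bounded_on_transfer[OF sigma_finite_lborel_on[OF borel_\<Omega>] sigma_finite_wpoly v\<Phi>_wpoly_M\<Omega>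
      nn_integral_M\<Omega>_wpoly abs_ker_dominated measurable_abs_ker measurable_factor p G b])

lemma pos_weak_abs_ker:
  assumes p: "0 \<le> p" and b: "pos_weak wpoly (prod_kernel UNIV factor) p"
  shows "pos_weak M\<Omega> abs_ker p"
  by (rule pos_weak_transfer[OF sigma_finite_lborel_on[OF borel_\<Omega>] sigma_finite_wpoly v\<Phi>_wpoly_M\<Omega>
      nn_integral_M\<Omega>_wpoly vol_const(1) dom_const_pos abs_ker_dominated measurable_abs_ker measurable_factor p b])

context
  fixes j0 :: 'n
  assumes j0: "2 \<le> \<kappa> j0" "\<And>j. j \<noteq> j0 \<Longrightarrow> \<kappa> j < \<kappa> j0"
begin

abbreviation ps :: real where "ps \<equiv> 2 * real (\<kappa> j0) / (real (\<kappa> j0) + 1)"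
abbreviation qs :: real where "qs \<equiv> 2 * real (\<kappa> j0) / (real (\<kappa> j0) - 1)"

lemma ps_pos: "0 < ps" and ps_less_qs: "ps < qs"
  using j0(1) by (auto simp: divide_simps)

text \<open>This is where it matters that the largest \<open>\<kappa>\<close> is attained only once: the endpoints are interior points
  of the admissible ranges of all other factors.\<close>

lemma other_factors_strong:
  assumes "ps \<le> p" "p \<le> qs"
  shows "pos_strong (PiM (UNIV - {j0}) (\<lambda>j. wdisc (\<kappa> j))) (prod_kernel (UNIV - {j0}) factor) p"
proof (rule wdiscs.pos_strong_PiM)
  show "0 \<le> p" using assms(1) ps_pos by linarith
  fix j assume "j \<in> UNIV - {j0}"
  then have j: "real (\<kappa> j) < real (\<kappa> j0)" using j0(2)[of j] by simp
  have 1: "1 \<le> real (\<kappa> j)" using \<kappa>_pos[of j] by simp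
  show "pos_strong (wdisc (\<kappa> j)) (factor j) p"
    by (rule model_kernel_strong[OF \<kappa>_pos e_pos less_le_trans[OF exponent_below[OF 1 j] assms(1)] exponent_above[OF 1 j assms(2)]])
qed auto

lemma UNIV_insert_j0: "insert j0 (UNIV - {j0}) = (UNIV :: 'n set)" by auto

lemma pos_bounded_on_wpoly:
  assumes "ps \<le> p" "p \<le> qs" and b: "pos_bounded_on G1 (wdisc (\<kappa> j0)) (factor j0) p"
    and G: "\<And>g x. g \<in> G \<Longrightarrow> (\<lambda>t. g (x(j0 := t))) \<in> G1"
  shows "pos_bounded_on G wpoly (prod_kernel UNIV factor) p"
proof -
  have "pos_bounded_on G (PiM (insert j0 (UNIV - {j0})) (\<lambda>j. wdisc (\<kappa> j))) (prod_kernel (insert j0 (UNIV - {j0})) factor) p"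
    by (rule wdiscs.pos_bounded_on_PiM_insert[OF _ _ _ _ b other_factors_strong[OF assms(1,2)] G])
       (use assms(1) ps_pos in auto)
  then show ?thesis by (simp only: UNIV_insert_j0)
qed

lemma pos_restricted_abs_ker: "pos_restricted M\<Omega> abs_ker ps"
proof (rule pos_bounded_on_abs_ker)
  show "0 \<le> ps" using ps_pos by simp
  show "pos_bounded_on (range indicator) wpoly (prod_kernel UNIV factor) ps"
  proof (rule pos_bounded_on_wpoly[OF order_refl less_imp_le[OF ps_less_qs] model_kernel_restricted[OF j0(1) e_pos]])
    fix g :: "('n \<Rightarrow> complex) \<Rightarrow> ennreal" and x assume "g \<in> range indicator"
    then obtain S where "g = indicator S" by blast
    then have "(\<lambda>t. g (x(j0 := t))) = indicator ((\<lambda>t. x(j0 := t)) -` S)" by (auto simp: indicator_def)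
    then show "(\<lambda>t. g (x(j0 := t))) \<in> range indicator" by simp
  qed
  fix g :: "complex^'n \<Rightarrow> ennreal" assume "g \<in> range indicator"
  then obtain S where "g = indicator S" by blast
  then have "(\<lambda>x. g (v\<Phi> x)) = indicator (v\<Phi> -` S)" by (auto simp: indicator_def)
  then show "(\<lambda>x. g (v\<Phi> x)) \<in> range indicator" by simp
qed

lemma pos_strong_abs_ker:
  assumes p: "ps < p" "p < qs" shows "pos_strong M\<Omega> abs_ker p"
proof (rule pos_bounded_on_abs_ker)
  show "0 \<le> p" using ps_pos p by linarith
  have "p * (real (\<kappa> j0) - 1) < 2 * real (\<kappa> j0)" using p(2) j0(1) by (simp add: pos_less_divide_eq)
  then have "pos_strong (wdisc (\<kappa> j0)) (factor j0) p"
    by (intro model_kernel_strong[OF \<kappa>_pos e_pos p(1)])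
  then show "pos_bounded_on UNIV wpoly (prod_kernel UNIV factor) p"
    by (rule pos_bounded_on_wpoly[OF less_imp_le[OF p(1)] less_imp_le[OF p(2)]]) simp
qed simp

lemma pos_weak_abs_ker_qs: "pos_weak M\<Omega> abs_ker qs"
proof (rule pos_weak_abs_ker)
  show q0: "0 \<le> qs" using ps_pos ps_less_qs by linarith
  have "pos_weak (PiM (insert j0 (UNIV - {j0})) (\<lambda>j. wdisc (\<kappa> j))) (prod_kernel (insert j0 (UNIV - {j0})) factor) qs"
    by (rule wdiscs.pos_weak_PiM_insert[OF _ _ _ q0 model_kernel_weak[OF j0(1) e_pos] other_factors_strong[OF less_imp_le[OF ps_less_qs] order_refl]]) auto
  then show "pos_weak wpoly (prod_kernel UNIV factor) qs" by (simp only: UNIV_insert_j0)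
qed

theorem bergman_operator_types:
  assumes T: "T \<in> {positive_bergman \<Omega>, bergman_projection \<Omega>}"
  shows "restricted_type (lebesgue_on \<Omega>) T ps" "ps < p \<Longrightarrow> p < qs \<Longrightarrow> strong_type (lebesgue_on \<Omega>) T p"
    "weak_type (lebesgue_on \<Omega>) T qs"
proof -
  define k where "k = (if T = bergman_projection \<Omega> then bergman_ker else (\<lambda>z w. complex_of_real (cmod (bergman_ker z w))))"
  have "(\<lambda>w. complex_of_real (cmod w)) \<in> borel_measurable borel" by measurable
  from measurable_compose[OF measurable_bergman_ker this]
  have "(\<lambda>z. complex_of_real (cmod (case_prod bergman_ker z))) \<in> borel_measurable (borel \<Otimes>\<^sub>M borel)" .
  moreover have "(\<lambda>z. complex_of_real (cmod (case_prod bergman_ker z))) = (\<lambda>(z, w). complex_of_real (cmod (bergman_ker z w)))"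
    by (auto simp: fun_eq_iff)
  ultimately have "(\<lambda>(z, w). complex_of_real (cmod (bergman_ker z w))) \<in> borel_measurable (borel \<Otimes>\<^sub>M borel)"
    by (simp only:)
  then have k: "case_prod k \<in> borel_measurable (borel \<Otimes>\<^sub>M borel)"
    using measurable_bergman_ker unfolding k_def by presburger
  have kk: "abs_ker x y = ennreal (cmod (k x y))" for x y by (simp add: k_def abs_ker_def)
  have Tk: "T = kernel_operator (lebesgue_on \<Omega>) k"
    using T unfolding k_def positive_bergman_def bergman_projection_def bergman_kernel_\<Omega> by (auto simp only: insert_iff if_True if_False split: if_split)
  have qs: "0 < qs" using ps_pos ps_less_qs by linarith
  show "restricted_type (lebesgue_on \<Omega>) T ps" unfolding Tk
    by (rule restricted_type_kernel_operator[OF borel_\<Omega> k kk ps_pos pos_restricted_abs_ker])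
  show "weak_type (lebesgue_on \<Omega>) T qs" unfolding Tk
    by (rule weak_type_kernel_operator[OF borel_\<Omega> k kk qs pos_weak_abs_ker_qs])
  assume p: "ps < p" "p < qs"
  show "strong_type (lebesgue_on \<Omega>) T p" unfolding Tk
    by (rule strong_type_kernel_operator[OF borel_\<Omega> k kk less_trans[OF ps_pos p(1)] pos_strong_abs_ker[OF p]])
qed

end

end

section \<open>The matrix of a monomial polyhedron\<close>

context
  fixes B :: "int^'n^'n"
  assumes poly: "is_monomial_polyhedron B" and det: "det B > 0"
begin

private abbreviation a :: "'n \<Rightarrow> 'n \<Rightarrow> int" where "a k j \<equiv> primitive_column B j $ k"

text \<open>The columns of the adjugate satisfy the same relation with \<open>det B\<close> on the diagonal; dividing column \<open>i\<close> by
  the gcd of its entries keeps the entries integral and the diagonal positive.\<close>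

lemma primitive_column_product:
  "\<exists>e::'n \<Rightarrow> nat. (\<forall>j. 0 < e j) \<and> (\<forall>j i. (\<Sum>k\<in>UNIV. B $ j $ k * a k i) = (if j = i then int (e j) else 0))"
proof -
  define g where "g j = Gcd (range (\<lambda>k. column j (adjugate B) $ k))" for j
  have ga: "a k j * g j = adjugate B $ k $ j" for k j
  proof -
    have "g j dvd column j (adjugate B) $ k" unfolding g_def by (rule Gcd_dvd) simp
    then have "column j (adjugate B) $ k div g j * g j = column j (adjugate B) $ k" by (rule dvd_div_mult_self)
    moreover have "a k j = column j (adjugate B) $ k div g j"
      by (simp only: primitive_column_def Let_def g_def vec_lambda_beta)
    ultimately show ?thesis by (simp add: column_def)
  qed
  have S: "(\<Sum>k\<in>UNIV. B $ j $ k * a k i) * g i = (if j = i then det B else 0)" for j i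
  proof -
    have "(\<Sum>k\<in>UNIV. B $ j $ k * a k i) * g i = (B ** adjugate B) $ j $ i"
      by (simp add: sum_distrib_right mult.assoc ga matrix_matrix_mult_def)
    then show ?thesis by (simp add: matrix_mult_adjugate mat_def)
  qed
  have g0: "g i \<noteq> 0" for i using S[of i i] det by auto
  have g1: "0 < g i" for i
  proof -
    have "0 \<le> g i" unfolding g_def by (metis Gcd_int_greater_eq_0)
    then show ?thesis using g0[of i] by simp
  qed
  have off: "(\<Sum>k\<in>UNIV. B $ j $ k * a k i) = 0" if "j \<noteq> i" for i j using S[of j i] g0[of i] that by simp
  have diag: "0 < (\<Sum>k\<in>UNIV. B $ j $ k * a k j)" for j
  proof -
    have "0 < (\<Sum>k\<in>UNIV. B $ j $ k * a k j) * g j" using S[of j j] det by simp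
    then show ?thesis using g1[of j] by (rule zero_less_mult_pos2)
  qed
  show ?thesis
    by (rule exI[of _ "\<lambda>j. nat (\<Sum>k\<in>UNIV. B $ j $ k * a k j)"]) (use off diag less_imp_le[OF diag] in auto)
qed

text \<open>A negative entry \<open>a k0 j0\<close> would make the polyhedron unbounded: its points \<open>\<Phi>(x)\<close> with \<open>x\<^sub>j\<^sub>0 = t \<rightarrow> 0\<close> and all other coordinates of
  \<open>x\<close> equal to \<open>1/2\<close> have a \<open>k0\<close>-th coordinate tending to infinity.\<close>

lemma primitive_column_nonneg: "0 \<le> a k0 j0"
proof (rule ccontr)
  assume neg: "\<not> 0 \<le> a k0 j0"
  obtain e :: "'n \<Rightarrow> nat" where e: "\<And>j. 0 < e j" "\<And>j i. (\<Sum>k\<in>UNIV. B $ j $ k * a k i) = (if j = i then int (e j) else 0)"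
    using primitive_column_product by blast
  define c :: real where "c = (\<Prod>j\<in>UNIV-{j0}. (1/2) powi a k0 j)"
  have c: "0 < c" unfolding c_def by (intro prod_pos) simp
  obtain M where M: "0 < M" "\<And>z. z \<in> monomial_set B \<Longrightarrow> norm z \<le> M"
    using poly unfolding is_monomial_polyhedron_def bounded_pos by blast
  define t where "t = min (1/2) (c / (M + 1))"
  have t: "0 < t" "t < 1" "t \<le> c / (M + 1)" using c M(1) by (auto simp: t_def)
  define x where "x = (\<lambda>j. 1/2)(j0 := t)"
  have x: "0 < x j" "x j < 1" for j using t by (auto simp: x_def)
  define z :: "complex^'n" where "z = (\<chi> k. of_real (\<Prod>j\<in>UNIV. x j powi a k j))"
  have zk: "cmod (z $ k) = (\<Prod>j\<in>UNIV. x j powi a k j)" for k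
  proof -
    have "0 \<le> (\<Prod>j\<in>UNIV. x j powi a k j)" using x(1) by (intro prod_nonneg ballI zero_le_power_int less_imp_le)
    then show ?thesis by (simp only: z_def vec_lambda_beta norm_of_real abs_of_nonneg)
  qed
  have "z \<in> monomial_set B"
    unfolding monomial_set_def
  proof (intro CollectI allI conjI impI)
    fix j k
    have "cmod (z $ k) \<noteq> 0" unfolding zk using x(1) by (simp add: less_imp_neq[symmetric])
    then show "z $ k = 0 \<Longrightarrow> 0 \<le> B $ j $ k" by simp
    have "(\<Prod>k\<in>UNIV. cmod (z $ k) powi (B $ j $ k)) = (\<Prod>k\<in>UNIV. \<Prod>i\<in>UNIV. x i powi (B $ j $ k * a k i))"
      unfolding zk by (simp add: power_int_prod_distrib power_int_mult mult.commute)
    also have "\<dots> = (\<Prod>i\<in>UNIV. \<Prod>k\<in>UNIV. x i powi (B $ j $ k * a k i))" by (rule prod.swap)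
    also have "\<dots> = (\<Prod>i\<in>UNIV. x i powi (if j = i then int (e j) else 0))"
    proof (rule prod.cong[OF refl])
      fix i
      have "(\<Prod>k\<in>I. x i powi (B $ j $ k * a k i)) = x i powi (\<Sum>k\<in>I. B $ j $ k * a k i)" if "finite I" for I
        using that by induction (use x(1)[of i] in \<open>auto simp: power_int_add\<close>)
      then show "(\<Prod>k\<in>UNIV. x i powi (B $ j $ k * a k i)) = x i powi (if j = i then int (e j) else 0)"
        by (simp add: e(2))
    qed
    also have "\<dots> = (\<Prod>i\<in>UNIV. if j = i then x i ^ e j else 1)" by (rule prod.cong) auto
    also have "\<dots> = x j ^ e j" by (simp add: prod.delta)
    also have "\<dots> < 1" using x[of j] e(1)[of j] by (simp add: power_less_one_iff)
    finally show "(\<Prod>k\<in>UNIV. cmod (z $ k) powi (B $ j $ k)) < 1" .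
  qed
  then have "cmod (z $ k0) \<le> M" using M(2) Finite_Cartesian_Product.norm_nth_le[of z k0] order_trans by blast
  moreover have "cmod (z $ k0) = t powi a k0 j0 * c"
    unfolding zk by (subst prod.remove[of UNIV j0]) (auto simp: x_def c_def)
  moreover have "M + 1 \<le> t powi a k0 j0 * c"
  proof -
    have "t powi (-1) \<le> t powi a k0 j0" using t(1,2) neg by (intro power_int_decreasing) auto
    then have "c / t \<le> t powi a k0 j0 * c" using c by (simp add: power_int_minus divide_inverse mult.commute)
    moreover have "M + 1 \<le> c / t" using t M(1) by (simp add: field_simps)
    ultimately show ?thesis by linarith
  qed
  ultimately show False by linarith
qed

lemma monomial_polyhedron_domain:
  "\<exists>e. monomial_domain (\<lambda>k j. nat (a k j)) (\<lambda>j k. B $ j $ k) e (monomial_set B)"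
proof -
  obtain e :: "'n \<Rightarrow> nat" where e: "\<And>j. 0 < e j" "\<And>j i. (\<Sum>k\<in>UNIV. B $ j $ k * a k i) = (if j = i then int (e j) else 0)"
    using primitive_column_product by blast
  interpret monomial_map "\<lambda>k j. nat (a k j)" "\<lambda>j k. B $ j $ k" e
  proof
    show "0 < e j" for j by (rule e(1))
    have "int (nat (a k i)) = a k i" for k i using primitive_column_nonneg[of i k] by simp
    then show "(\<Sum>k\<in>UNIV. B $ j $ k * int (nat (a k i))) = (if j = i then int (e j) else 0)" for j i
      by (simp only: e(2))
  qed
  have "monomial_domain (\<lambda>k j. nat (a k j)) (\<lambda>j k. B $ j $ k) e (monomial_set B)"
  proof
    show "open (monomial_set B)" using poly by (simp add: is_monomial_polyhedron_def)
    show "1 \<le> \<kappa> j" for j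
    proof (rule ccontr)
      assume "\<not> 1 \<le> \<kappa> j"
      then have "nat (a k j) = 0" for k by (simp add: \<kappa>_def not_le)
      then have "a k j = 0" for k using primitive_column_nonneg[of j k] nat_0_iff[of "a k j"] by (metis order_antisym)
      then show False using e(2)[of j j] e(1)[of j] by simp
    qed
  qed (simp add: monomial_set_def)
  then show ?thesis by blast
qed

end

theorem corollary1p3:
  fixes B :: "int^'n^'n"
  assumes "2 \<le> CARD('n)"
    and "is_monomial_polyhedron B"
    and "det B > 0"
    and "monomial_set B \<noteq> unit_polydisc"
    and "max_multiplicity B = 1"
  shows "\<forall>T \<in> {positive_bergman (monomial_set B), bergman_projection (monomial_set B)}.
           restricted_type (lebesgue_on (monomial_set B)) T (p_star B) \<and>
           (\<forall>p. p_star B < p \<and> p < q_star B \<longrightarrow>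
                strong_type (lebesgue_on (monomial_set B)) T p) \<and>
           weak_type (lebesgue_on (monomial_set B)) T (q_star B)"
proof -
  obtain e where "monomial_domain (\<lambda>k j. nat (primitive_column B j $ k)) (\<lambda>j k. B $ j $ k) e (monomial_set B)"
    using monomial_polyhedron_domain[OF assms(2,3)] by blast
  then interpret monomial_domain "\<lambda>k j. nat (primitive_column B j $ k)" "\<lambda>j k. B $ j $ k" e "monomial_set B" .
  have \<kappa>: "primitive_column_sum B j = int (\<kappa> j)" for j
    using primitive_column_nonneg[OF assms(2,3)] by (simp add: primitive_column_sum_def \<kappa>_def)
  define m where "m = Max (range (primitive_column_sum B))"
  obtain j0 where j0: "{j. primitive_column_sum B j = m} = {j0}"
    using assms(5) unfolding max_multiplicity_def m_def[symmetric] by (rule card_1_singletonE)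
  have "primitive_column_sum B j0 = m" using j0 by blast
  then have m: "m = int (\<kappa> j0)" using \<kappa>[of j0] by simp
  have other: "\<kappa> j < \<kappa> j0" if "j \<noteq> j0" for j
  proof -
    have "primitive_column_sum B j \<le> m" unfolding m_def by (rule Max_ge) auto
    moreover have "primitive_column_sum B j \<noteq> m" using j0 that by blast
    ultimately show ?thesis by (simp add: m \<kappa>)
  qed
  obtain j1 where "j1 \<noteq> j0"
  proof -
    have "(UNIV :: 'n set) \<noteq> {j0}" using assms(1) by (metis card.empty card_insert_disjoint empty_iff finite.emptyI numeral_le_one_iff One_nat_def semiring_norm(69))
    then show ?thesis using that by blast
  qed
  then have two: "2 \<le> \<kappa> j0" using other[of j1] \<kappa>_pos[of j1] by simp
  have "Max (range (\<lambda>j. 2 * real (\<kappa> j) / (real (\<kappa> j) + 1))) = 2 * real (\<kappa> j0) / (real (\<kappa> j0) + 1)"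
  proof (rule Max_eqI)
    fix y assume "y \<in> range (\<lambda>j. 2 * real (\<kappa> j) / (real (\<kappa> j) + 1))"
    then obtain j where y: "y = 2 * real (\<kappa> j) / (real (\<kappa> j) + 1)" by blast
    show "y \<le> 2 * real (\<kappa> j0) / (real (\<kappa> j0) + 1)"
    proof (cases "j = j0")
      case False
      then show ?thesis using exponent_below[of "real (\<kappa> j)" "real (\<kappa> j0)"] other[of j] \<kappa>_pos[of j] by (simp add: y)
    qed (simp add: y)
  qed auto
  then have p: "p_star B = 2 * real (\<kappa> j0) / (real (\<kappa> j0) + 1)" by (simp add: p_star_def \<kappa>)
  have q: "q_star B = 2 * real (\<kappa> j0) / (real (\<kappa> j0) - 1)"
  proof -
    have "2 * real (\<kappa> j0) / (real (\<kappa> j0) + 1) - 1 = (real (\<kappa> j0) - 1) / (real (\<kappa> j0) + 1)" by (simp add: field_simps)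
    then show ?thesis unfolding q_star_def hoelder_conjugate_def p by simp
  qed
  show ?thesis
    unfolding p q using bergman_operator_types[OF two other] by blast
qed

end
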